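(* Let $\mathcal C$ be a unital $A_\infty$-category and $\mathcal B\subset\mathcal C$ a full $A_\infty$-subcategory. Call a pair $(\mathcal D,e)$ of a unital $A_\infty$-category $\mathcal D$ and a unital $A_\infty$-functor $e:\mathcal C\to\mathcal D$ a quotient of $\mathcal C$ by $\mathcal B$ if (1) the composition $\mathcal B\hookrightarrow\mathcal C\xrightarrow{e}\mathcal D$ is contractible, and (2) for every unital $A_\infty$-category $\mathcal A$ the strict $A_\infty$-functor $A_\infty^u(\mathcal D,\mathcal A)\to A_\infty^u(\mathcal C,\mathcal A)_{\mathrm{mod}\,\mathcal B}$, $f\mapsto ef$, is an $A_\infty$-equivalence. Then the quotient is unique up to equivalence: for any two quotients $(\mathcal D,e:\mathcal C\to\mathcal D)$ and $(\mathcal D',e':\mathcal C\to\mathcal D')$ there exists an $A_\infty$-equivalence $\phi:\mathcal D\to\mathcal D'$ such that $e\phi$ is isomorphic to $e'$.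
   Context: Conventions. $k$ is a commutative associative unital ring; sets of objects and morphisms are small with respect to a fixed universe. Gradings are by $\mathbb Z$, differentials have degree $+1$. Maps are written on the right: $xf$ is the value of $f$ at $x$, and $fg$ means first $f$, then $g$; Koszul rule $(x\otimes y)(f\otimes g)=(-1)^{\deg y\,\deg f}xf\otimes yg$. A graded quiver $C$ is a set $\mathrm{Ob}\,C$ (possibly empty) with graded $k$-modules $C(X,Y)$ for $X,Y\in\mathrm{Ob}\,C$. $sC(X,Y)=C(X,Y)[1]$, i.e. $(sC)^d=C^{d+1}$; $s:C\to sC$ is the identity viewed as a map of degree $-1$. $T^nsC(X,Y)=\bigoplus_{X=X_0,X_1,\dots,X_n=Y}sC(X_0,X_1)\otimes\dots\otimes sC(X_{n-1},X_n)$, $T^0sC(X,X)=k$, $T^0sC(X,Y)=0$ for $X\ne Y$. An $A_\infty$-category is a graded quiver $C$ with maps $b_n:T^nsC(X,Y)\to sC(X,Y)$ of degree $1$, $n\ge1$, with $\sum_{r+n+t=m}(1^{\otimes r}\otimes b_n\otimes1^{\otimes t})b_{r+1+t}=0$ for all $m\ge1$. A full $A_\infty$-subcategory is given by a subset of objects with the same morphism modules and operations. An $A_\infty$-functor $f:A\to B$ is a map $X\mapsto Xf$ on objects with maps $f_n:T^nsA(X,Y)\to sB(Xf,Yf)$ of degree $0$, $n\ge1$, with $\sum_{i_1+\dots+i_l=m}(f_{i_1}\otimes\dots\otimes f_{i_l})b_l=\sum_{r+n+t=m}(1^{\otimes r}\otimes b_n\otimes1^{\otimes t})f_{r+1+t}$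 for all $m\ge1$; it is strict if $f_n=0$ for $n>1$. Composition: $(fg)_m=\sum_{i_1+\dots+i_l=m}(f_{i_1}\otimes\dots\otimes f_{i_l})g_l$. $A_\infty$-category $A_\infty(A,B)$: objects are $A_\infty$-functors $A\to B$. Elements of $sA_\infty(A,B)(f,g)$ of degree $d$ ($A_\infty$-transformations $r:f\to g$) are families $r=(r_n)_{n\ge0}$ of maps $r_n:T^nsA(X,Y)\to sB(Xf,Yg)$ of degree $d$ (one for each $X,Y$). For $r^i:f^{i-1}\to f^i$, $1\le i\le n$, let $[(r^1\otimes\dots\otimes r^n)\theta]_{m,l}:T^msA\to T^lsB$ be the sum of all tensor products $f^0_{\cdot}\otimes\dots\otimes f^0_{\cdot}\otimes r^1_{\cdot}\otimes f^1_{\cdot}\otimes\dots\otimes f^1_{\cdot}\otimes\dots\otimes r^n_{\cdot}\otimes f^n_{\cdot}\otimes\dots\otimes f^n_{\cdot}$ with $l$ factors and $m$ inputs in total (indices of $f$'s are $\ge1$, of $r$'s are $\ge0$). Operations: $[(r^1\otimes\dots\otimes r^n)B_n]_m=\sum_l[(r^1\otimes\dots\otimes r^n)\theta]_{m,l}b_l$ for $n\ge2$, and $[rB_1]_m=\sum_l[r\theta]_{m,l}b_l-(-1)^{\deg r}\sum_{a+p+c=m}(1^{\otimes a}\otimes b_p\otimes1^{\otimes c})r_{a+1+c}$. An $A_\infty$-category $C$ is unital if each object $X$ has a $b_1$-cycle ${}_X\mathbf i_0\in sC(X,X)$ of degree $-1$ such that $(1\otimes{}_Y\mathbf i_0)b_2$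 and $-({}_X\mathbf i_0\otimes1)b_2:sC(X,Y)\to sC(X,Y)$ are homotopic to the identity for all $X,Y$. Then $H^0C$ (same objects, morphisms $H^0(C(X,Y),sb_1s^{-1})$) is a category. An $A_\infty$-functor $f:A\to B$ between unital $A_\infty$-categories is unital if ${}_X\mathbf i^A_0f_1-{}_{Xf}\mathbf i^B_0\in\mathrm{Im}\,b_1$ for all $X$. $A_\infty^u(A,B)\subset A_\infty(A,B)$ is the full $A_\infty$-subcategory of unital $A_\infty$-functors (it is unital if $B$ is). Two unital $A_\infty$-functors $A\to B$ are isomorphic if they are isomorphic objects of $H^0A_\infty^u(A,B)$. A unital $A_\infty$-functor $f:A\to B$ is an $A_\infty$-equivalence if there is a unital $A_\infty$-functor $g:B\to A$ with $fg$ isomorphic to $\mathrm{id}_A$ and $gf$ isomorphic to $\mathrm{id}_B$. An $A_\infty$-functor $g:B\to A$ from a unital $A_\infty$-category $B$ is contractible if for all objects $X,Y$ of $B$ the chain map $g_1:sB(X,Y)\to sA(Xg,Yg)$ is null-homotopic. For a full $A_\infty$-subcategory $\mathcal B$ of a unital $A_\infty$-category $\mathcal C$, $A_\infty^u(\mathcal C,\mathcal A)_{\mathrm{mod}\,\mathcal B}$ is the full $A_\infty$-subcategory of $A_\infty^u(\mathcal C,\mathcal A)$ whose objects are unital $A_\infty$-functors $\mathcal C\to\mathcal A$ with contractible restriction to $\mathcal B$. The strict $A_\infty$-functor $f\mapsto ef$ acts on transformations by $r\mapsto er$, $(er)_m=\sum_{i_1+\dots+i_l=m}(e_{i_1}\otimes\dots\otimes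 e_{i_l})r_l$. *)

theory Defs
  imports "HOL-Algebra.Module"
begin

text \<open>
  Conventions. The ground ring is a commutative ring \<open>R\<close> in the sense of \<^locale>\<open>cring\<close>. Maps are
  written on the right of their arguments, so that the Koszul rule reads
  \<open>(x \<otimes> y)(f \<otimes> g) = (-1)\<^bsup>deg y deg f\<^esup> xf \<otimes> yg\<close>. The fixed universe is a pair of types
  \<open>'o\<close> (objects) and \<open>'m\<close> (morphisms).

  A \<open>k\<close>-linear map out of \<open>T\<^sup>n sC(X, Y)\<close> is encoded as a family of \<open>n\<close>-multilinear maps on
  homogeneous elements. A homogeneous decomposable tensor \<open>x\<^sub>1 \<otimes> \<dots> \<otimes> x\<^sub>n\<close>, with
  \<open>x\<^sub>i \<in> sC(X\<^sub>i\<^sub>-\<^sub>1, X\<^sub>i)\<close> of degree \<open>d\<^sub>i\<close>, is encoded as the starting object \<open>X\<^sub>0\<close> together with the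
  word \<open>[(X\<^sub>1, d\<^sub>1, x\<^sub>1), \<dots>, (X\<^sub>n, d\<^sub>n, x\<^sub>n)]\<close>. The empty word at \<open>X\<close> is the generator
  \<open>1\<close> of \<open>T\<^sup>0 sC(X, X) = k\<close>. Degrees in words are those of the suspension \<open>sC\<close>.
\<close>

type_synonym ('o, 'm) word = "('o \<times> int \<times> 'm) list"

record ('k, 'o, 'm) ainf_cat =
  Obj :: "'o set"
  Mor :: "'o \<Rightarrow> 'o \<Rightarrow> int \<Rightarrow> ('k, 'm) module"
  bop :: "'o \<Rightarrow> ('o, 'm) word \<Rightarrow> 'm"

record ('oa, 'ma, 'ob, 'mb) ainf_fun =
  fob :: "'oa \<Rightarrow> 'ob"
  fmp :: "'oa \<Rightarrow> ('oa, 'ma) word \<Rightarrow> 'mb"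

type_synonym ('oa, 'ma, 'mb) ainf_trans = "'oa \<Rightarrow> ('oa, 'ma) word \<Rightarrow> 'mb"

text \<open>\<open>sC(X, Y)\<^sup>d = C(X, Y)\<^bsup>d+1\<^esup>\<close>, the map \<open>s\<close> being the identity on elements.\<close>

definition sMor :: "('k, 'o, 'm) ainf_cat \<Rightarrow> 'o \<Rightarrow> 'o \<Rightarrow> int \<Rightarrow> ('k, 'm) module" where
  "sMor C X Y d = Mor C X Y (d + 1)"

fun wtgt :: "'o \<Rightarrow> ('o, 'm) word \<Rightarrow> 'o" where
  "wtgt X [] = X"
| "wtgt X ((Y, d, x) # w) = wtgt Y w"

fun wdeg :: "('o, 'm) word \<Rightarrow> int" where
  "wdeg [] = 0"
| "wdeg ((Y, d, x) # w) = d + wdeg w"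

fun is_word :: "('k, 'o, 'm) ainf_cat \<Rightarrow> 'o \<Rightarrow> ('o, 'm) word \<Rightarrow> bool" where
  "is_word C X [] \<longleftrightarrow> X \<in> Obj C"
| "is_word C X ((Y, d, x) # w) \<longleftrightarrow>
     X \<in> Obj C \<and> x \<in> carrier (sMor C X Y d) \<and> is_word C Y w"

definition ksign :: "('k, 'm) module \<Rightarrow> int \<Rightarrow> 'm \<Rightarrow> 'm" where
  "ksign M n x = (if even n then x else \<ominus>\<^bsub>M\<^esub> x)"

text \<open>Linear maps \<open>T\<^sup>n sA(X, Y) \<rightarrow> M(X, Y)\<close> of degree \<open>p\<close>, one for each pair \<open>X, Y\<close>.\<close>

definition tensor_map ::
  "'k ring \<Rightarrow> ('k, 'o, 'm) ainf_cat \<Rightarrow> ('o \<Rightarrow> 'o \<Rightarrow> int \<Rightarrow> ('k, 'n) module) \<Rightarrow> nat \<Rightarrow> int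
    \<Rightarrow> ('o \<Rightarrow> ('o, 'm) word \<Rightarrow> 'n) \<Rightarrow> bool" where
  "tensor_map R A M n p \<phi> \<longleftrightarrow>
     (\<forall>X w. is_word A X w \<and> length w = n \<longrightarrow> \<phi> X w \<in> carrier (M X (wtgt X w) (wdeg w + p))) \<and>
     (\<forall>X u Y d x y v.
        is_word A X (u @ (Y, d, x) # v) \<and> is_word A X (u @ (Y, d, y) # v) \<and>
        length u + 1 + length v = n \<longrightarrow>
        \<phi> X (u @ (Y, d, x \<oplus>\<^bsub>sMor A (wtgt X u) Y d\<^esub> y) # v)
          = \<phi> X (u @ (Y, d, x) # v)
              \<oplus>\<^bsub>M X (wtgt Y v) (wdeg u + d + wdeg v + p)\<^esub> \<phi> X (u @ (Y, d, y) # v)) \<and>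
     (\<forall>X u Y d x v. \<forall>a \<in> carrier R.
        is_word A X (u @ (Y, d, x) # v) \<and> length u + 1 + length v = n \<longrightarrow>
        \<phi> X (u @ (Y, d, a \<odot>\<^bsub>sMor A (wtgt X u) Y d\<^esub> x) # v)
          = a \<odot>\<^bsub>M X (wtgt Y v) (wdeg u + d + wdeg v + p)\<^esub> \<phi> X (u @ (Y, d, x) # v))"

text \<open>
  \<open>\<Sum>\<^bsub>r+n+t=m\<^esub> (1\<^bsup>\<otimes>r\<^esup> \<otimes> b\<^sub>n \<otimes> 1\<^bsup>\<otimes>t\<^esup>)\<phi>\<^bsub>r+1+t\<^esub>\<close> at a word of length \<open>m\<close>, with \<open>n \<ge> 1\<close>. Moving
  \<open>b\<^sub>n\<close>, of degree \<open>1\<close>, to the left past the last \<open>t\<close> factors gives the sign.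
\<close>

definition b_insert ::
  "('k, 'o, 'm) ainf_cat \<Rightarrow> 'o \<Rightarrow> ('o, 'm) word \<Rightarrow> nat \<Rightarrow> nat \<Rightarrow> ('o, 'm) word" where
  "b_insert A X w r n =
     (let u = take r w; v = take n (drop r w); t = drop (r + n) w; Y = wtgt X u
      in u @ (wtgt Y v, wdeg v + 1, bop A Y v) # t)"

definition b_then ::
  "('k, 'n) module \<Rightarrow> ('k, 'o, 'm) ainf_cat \<Rightarrow> ('o \<Rightarrow> ('o, 'm) word \<Rightarrow> 'n)
    \<Rightarrow> 'o \<Rightarrow> ('o, 'm) word \<Rightarrow> 'n" where
  "b_then M A \<phi> X w =
     finsum M (\<lambda>(r, n). ksign M (wdeg (drop (r + n) w)) (\<phi> X (b_insert A X w r n)))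
       {(r, n). 1 \<le> n \<and> r + n \<le> length w}"

definition ainf_category :: "'k ring \<Rightarrow> ('k, 'o, 'm) ainf_cat \<Rightarrow> bool" where
  "ainf_category R C \<longleftrightarrow>
     cring R \<and>
     (\<forall>X \<in> Obj C. \<forall>Y \<in> Obj C. \<forall>d. module R (Mor C X Y d)) \<and>
     (\<forall>n \<ge> 1. tensor_map R C (sMor C) n 1 (bop C)) \<and>
     (\<forall>X w. is_word C X w \<and> w \<noteq> [] \<longrightarrow>
        b_then (sMor C X (wtgt X w) (wdeg w + 2)) C (bop C) X w
          = \<zero>\<^bsub>sMor C X (wtgt X w) (wdeg w + 2)\<^esub>)"

definition full_sub :: "('k, 'o, 'm) ainf_cat \<Rightarrow> 'o set \<Rightarrow> ('k, 'o, 'm) ainf_cat" where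
  "full_sub C S = C\<lparr>Obj := S\<rparr>"


section \<open>Functors\<close>

text \<open>Decompositions of a word into consecutive nonempty pieces.\<close>

definition splits :: "('o, 'm) word \<Rightarrow> ('o, 'm) word list set" where
  "splits w = {ws. concat ws = w \<and> [] \<notin> set ws}"

text \<open>\<open>f\<^bsub>i\<^sub>1\<^esub> \<otimes> \<dots> \<otimes> f\<^bsub>i\<^sub>l\<^esub>\<close>; no signs occur since all \<open>f\<^sub>i\<close> have degree \<open>0\<close>.\<close>

fun fun_tensor ::
  "('oa, 'ma, 'ob, 'mb) ainf_fun \<Rightarrow> 'oa \<Rightarrow> ('oa, 'ma) word list \<Rightarrow> ('ob, 'mb) word" where
  "fun_tensor f X [] = []"
| "fun_tensor f X (u # us) =
     (fob f (wtgt X u), wdeg u, fmp f X u) # fun_tensor f (wtgt X u) us"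

text \<open>
  Functors and transformations are required to take the value \<^const>\<open>undefined\<close> outside their domain,
  so that they are determined by their mathematical data.
\<close>

definition ainf_functor ::
  "'k ring \<Rightarrow> ('k, 'oa, 'ma) ainf_cat \<Rightarrow> ('k, 'ob, 'mb) ainf_cat
    \<Rightarrow> ('oa, 'ma, 'ob, 'mb) ainf_fun \<Rightarrow> bool" where
  "ainf_functor R A B f \<longleftrightarrow>
     ainf_category R A \<and> ainf_category R B \<and>
     (\<forall>X \<in> Obj A. fob f X \<in> Obj B) \<and>
     (\<forall>n \<ge> 1. tensor_map R A (\<lambda>X Y. sMor B (fob f X) (fob f Y)) n 0 (fmp f)) \<and>
     (\<forall>X w. is_word A X w \<and> w \<noteq> [] \<longrightarrow>
        (let M = sMor B (fob f X) (fob f (wtgt X w)) (wdeg w + 1)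
         in (\<Oplus>\<^bsub>M\<^esub>ws \<in> splits w. bop B (fob f X) (fun_tensor f X ws)) = b_then M A (fmp f) X w)) \<and>
     (\<forall>X. X \<notin> Obj A \<longrightarrow> fob f X = undefined) \<and>
     (\<forall>X w. \<not> (is_word A X w \<and> w \<noteq> []) \<longrightarrow> fmp f X w = undefined)"

text \<open>
  The strict functor with identity first component. For \<open>A\<close> a full subcategory of \<open>B\<close> it is also the
  inclusion \<open>A \<rightarrow> B\<close>.
\<close>

definition id_fun :: "('k, 'o, 'm) ainf_cat \<Rightarrow> ('o, 'm, 'o, 'm) ainf_fun" where
  "id_fun A =
     \<lparr>fob = (\<lambda>X. if X \<in> Obj A then X else undefined),
      fmp = (\<lambda>X w. if is_word A X w \<and> w \<noteq> [] then
               (case w of [(Y, d, x)] \<Rightarrow> x | _ \<Rightarrow> \<zero>\<^bsub>sMor A X (wtgt X w) (wdeg w)\<^esub>)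
             else undefined)\<rparr>"

text \<open>The composite \<open>fg\<close> (first \<open>f\<close>, then \<open>g\<close>) of \<open>f : A \<rightarrow> B\<close> and \<open>g : B \<rightarrow> C\<close>.\<close>

definition comp_fun ::
  "('k, 'oa, 'ma) ainf_cat \<Rightarrow> ('k, 'oc, 'mc) ainf_cat \<Rightarrow> ('oa, 'ma, 'ob, 'mb) ainf_fun
    \<Rightarrow> ('ob, 'mb, 'oc, 'mc) ainf_fun \<Rightarrow> ('oa, 'ma, 'oc, 'mc) ainf_fun" where
  "comp_fun A C f g =
     \<lparr>fob = (\<lambda>X. if X \<in> Obj A then fob g (fob f X) else undefined),
      fmp = (\<lambda>X w. if is_word A X w \<and> w \<noteq> [] then
               (\<Oplus>\<^bsub>sMor C (fob g (fob f X)) (fob g (fob f (wtgt X w))) (wdeg w)\<^esub>ws \<in> splits w.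
                  fmp g (fob f X) (fun_tensor f X ws))
             else undefined)\<rparr>"


section \<open>The category of functors\<close>

definition trans_module ::
  "'k ring \<Rightarrow> ('k, 'oa, 'ma) ainf_cat \<Rightarrow> ('k, 'ob, 'mb) ainf_cat
    \<Rightarrow> ('oa, 'ma, 'ob, 'mb) ainf_fun \<Rightarrow> ('oa, 'ma, 'ob, 'mb) ainf_fun \<Rightarrow> int
    \<Rightarrow> ('k, ('oa, 'ma, 'mb) ainf_trans) module" where
  "trans_module R A B f g d =
     (let M = (\<lambda>X w. sMor B (fob f X) (fob g (wtgt X w)) (wdeg w + d))
      in \<lparr>carrier = {r.
            (\<forall>n. tensor_map R A (\<lambda>X Y. sMor B (fob f X) (fob g Y)) n d r) \<and>
            (\<forall>X w. \<not> is_word A X w \<longrightarrow> r X w = undefined)},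
          mult = undefined, one = undefined,
          zero = (\<lambda>X w. if is_word A X w then \<zero>\<^bsub>M X w\<^esub> else undefined),
          add = (\<lambda>r q X w. if is_word A X w then r X w \<oplus>\<^bsub>M X w\<^esub> q X w else undefined),
          smult = (\<lambda>a r X w. if is_word A X w then a \<odot>\<^bsub>M X w\<^esub> r X w else undefined)\<rparr>)"

text \<open>
  The summands of \<open>(r\<^sup>1 \<otimes> \<dots> \<otimes> r\<^sup>n)\<theta>\<close> at a word \<open>w\<close> are indexed by decompositions of \<open>w\<close> into pieces
  which are labelled \<^const>\<open>True\<close> if they are fed into one of the \<open>r\<^sup>i\<close> (these pieces may be empty)
  and \<^const>\<open>False\<close> if they are fed into one of the functors (these may not).
  The element \<open>r\<^sup>1 \<otimes> \<dots> \<otimes> r\<^sup>n\<close> is itself a word \<open>[(f\<^sup>1, deg r\<^sup>1, r\<^sup>1), \<dots>, (f\<^sup>n, deg r\<^sup>n, r\<^sup>n)]\<close>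
  starting at \<open>f\<^sup>0\<close>.
\<close>

definition theta_splits :: "nat \<Rightarrow> ('o, 'm) word \<Rightarrow> (bool \<times> ('o, 'm) word) list set" where
  "theta_splits n w =
     {ps. concat (map snd ps) = w \<and> (False, []) \<notin> set ps \<and> length (filter fst ps) = n}"

fun theta_tensor ::
  "('oa, 'ma, 'ob, 'mb) ainf_fun \<Rightarrow> 'oa
    \<Rightarrow> (('oa, 'ma, 'ob, 'mb) ainf_fun, ('oa, 'ma, 'mb) ainf_trans) word
    \<Rightarrow> (bool \<times> ('oa, 'ma) word) list \<Rightarrow> ('ob, 'mb) word" where
  "theta_tensor f X rs [] = []"
| "theta_tensor f X rs ((False, u) # ps) =
     (fob f (wtgt X u), wdeg u, fmp f X u) # theta_tensor f (wtgt X u) rs ps"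
| "theta_tensor f X ((g, d, r) # rs) ((True, u) # ps) =
     (fob g (wtgt X u), wdeg u + d, r X u) # theta_tensor g (wtgt X u) rs ps"
| "theta_tensor f X [] ((True, u) # ps) = undefined"

text \<open>Koszul sign exponent: each \<open>r\<^sup>i\<close> moves to the left past the inputs of all later factors.\<close>

fun theta_sign ::
  "('f, 'r) word \<Rightarrow> (bool \<times> ('oa, 'ma) word) list \<Rightarrow> int" where
  "theta_sign rs [] = 0"
| "theta_sign rs ((False, u) # ps) = theta_sign rs ps"
| "theta_sign ((g, d, r) # rs) ((True, u) # ps) =
     d * wdeg (concat (map snd ps)) + theta_sign rs ps"
| "theta_sign [] ((True, u) # ps) = undefined"

definition fun_cat ::
  "'k ring \<Rightarrow> ('k, 'oa, 'ma) ainf_cat \<Rightarrow> ('k, 'ob, 'mb) ainf_cat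
    \<Rightarrow> ('k, ('oa, 'ma, 'ob, 'mb) ainf_fun, ('oa, 'ma, 'mb) ainf_trans) ainf_cat" where
  "fun_cat R A B =
     \<lparr>Obj = {f. ainf_functor R A B f},
      Mor = (\<lambda>f g d. trans_module R A B f g (d - 1)),
      bop = (\<lambda>f rs X w.
        if is_word A X w then
          (let M = sMor B (fob f X) (fob (wtgt f rs) (wtgt X w)) (wdeg w + wdeg rs + 1);
               th = (\<Oplus>\<^bsub>M\<^esub>ps \<in> theta_splits (length rs) w.
                       ksign M (theta_sign rs ps) (bop B (fob f X) (theta_tensor f X rs ps)))
           in case rs of
                [(g, d, r)] \<Rightarrow> th \<ominus>\<^bsub>M\<^esub> ksign M d (b_then M A r X w)
              | _ \<Rightarrow> th)
        else undefined)\<rparr>"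


section \<open>Unital categories, functors and equivalences\<close>

text \<open>Graded modules are given by their homogeneous components.\<close>

definition graded_linear ::
  "'k ring \<Rightarrow> (int \<Rightarrow> ('k, 'm) module) \<Rightarrow> (int \<Rightarrow> ('k, 'n) module) \<Rightarrow> int
    \<Rightarrow> (int \<Rightarrow> 'm \<Rightarrow> 'n) \<Rightarrow> bool" where
  "graded_linear R M N p h \<longleftrightarrow>
     (\<forall>d. \<forall>x \<in> carrier (M d). h d x \<in> carrier (N (d + p))) \<and>
     (\<forall>d. \<forall>x \<in> carrier (M d). \<forall>y \<in> carrier (M d).
        h d (x \<oplus>\<^bsub>M d\<^esub> y) = h d x \<oplus>\<^bsub>N (d + p)\<^esub> h d y) \<and>
     (\<forall>d. \<forall>a \<in> carrier R. \<forall>x \<in> carrier (M d).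
        h d (a \<odot>\<^bsub>M d\<^esub> x) = a \<odot>\<^bsub>N (d + p)\<^esub> h d x)"

definition b1 :: "('k, 'o, 'm) ainf_cat \<Rightarrow> 'o \<Rightarrow> 'o \<Rightarrow> int \<Rightarrow> 'm \<Rightarrow> 'm" where
  "b1 C X Y d x = bop C X [(Y, d, x)]"

text \<open>For a chain map \<open>\<phi>\<close> from \<open>sA(X, Y)\<close> to \<open>sB(U, V)\<close>.\<close>

definition null_homotopic ::
  "'k ring \<Rightarrow> ('k, 'oa, 'ma) ainf_cat \<Rightarrow> 'oa \<Rightarrow> 'oa \<Rightarrow> ('k, 'ob, 'mb) ainf_cat \<Rightarrow> 'ob \<Rightarrow> 'ob
    \<Rightarrow> (int \<Rightarrow> 'ma \<Rightarrow> 'mb) \<Rightarrow> bool" where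
  "null_homotopic R A X Y B U V \<phi> \<longleftrightarrow>
     (\<exists>h. graded_linear R (sMor A X Y) (sMor B U V) (- 1) h \<and>
        (\<forall>d. \<forall>x \<in> carrier (sMor A X Y d).
           \<phi> d x = b1 B U V (d - 1) (h d x) \<oplus>\<^bsub>sMor B U V d\<^esub> h (d + 1) (b1 A X Y d x)))"

definition homotopic_to_id ::
  "'k ring \<Rightarrow> ('k, 'o, 'm) ainf_cat \<Rightarrow> 'o \<Rightarrow> 'o \<Rightarrow> (int \<Rightarrow> 'm \<Rightarrow> 'm) \<Rightarrow> bool" where
  "homotopic_to_id R C X Y \<phi> \<longleftrightarrow>
     null_homotopic R C X Y C X Y (\<lambda>d x. \<phi> d x \<ominus>\<^bsub>sMor C X Y d\<^esub> x)"

text \<open>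
  By the Koszul rule, \<open>x(i \<otimes> 1) = (-1)\<^bsup>deg x\<^esup> i \<otimes> x\<close> for \<open>i\<close> of degree \<open>-1\<close>, while
  \<open>x(1 \<otimes> i) = x \<otimes> i\<close>.
\<close>

definition is_unit_elt :: "'k ring \<Rightarrow> ('k, 'o, 'm) ainf_cat \<Rightarrow> 'o \<Rightarrow> 'm \<Rightarrow> bool" where
  "is_unit_elt R C X i \<longleftrightarrow>
     i \<in> carrier (sMor C X X (- 1)) \<and>
     b1 C X X (- 1) i = \<zero>\<^bsub>sMor C X X 0\<^esub> \<and>
     (\<forall>Y \<in> Obj C.
        homotopic_to_id R C Y X (\<lambda>d x. bop C Y [(X, d, x), (X, - 1, i)]) \<and>
        homotopic_to_id R C X Y
          (\<lambda>d x. \<ominus>\<^bsub>sMor C X Y d\<^esub> ksign (sMor C X Y d) d (bop C X [(X, - 1, i), (Y, d, x)])))"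

definition unital_category :: "'k ring \<Rightarrow> ('k, 'o, 'm) ainf_cat \<Rightarrow> bool" where
  "unital_category R C \<longleftrightarrow> ainf_category R C \<and> (\<forall>X \<in> Obj C. \<exists>i. is_unit_elt R C X i)"

text \<open>
  A chosen unit element. Any two unit elements of an object differ by a boundary, so nothing below
  depends on the choice.
\<close>

definition unit_elt :: "'k ring \<Rightarrow> ('k, 'o, 'm) ainf_cat \<Rightarrow> 'o \<Rightarrow> 'm" where
  "unit_elt R C X = (SOME i. is_unit_elt R C X i)"

text \<open>
  The category \<open>H\<^sup>0 C\<close>. Since \<open>s\<close> is the identity on elements, \<open>C(X, Y)\<^sup>0\<close> is \<open>sC(X, Y)\<^bsup>-1\<^esup>\<close>; in
  this degree composition is \<open>b\<^sub>2\<close> without a sign and identities are the classes of unit elements.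
\<close>

definition h0_class :: "('k, 'o, 'm) ainf_cat \<Rightarrow> 'o \<Rightarrow> 'o \<Rightarrow> 'm \<Rightarrow> 'm set" where
  "h0_class C X Y x =
     {x \<oplus>\<^bsub>sMor C X Y (- 1)\<^esub> b1 C X Y (- 2) z | z. z \<in> carrier (sMor C X Y (- 2))}"

definition h0_hom :: "('k, 'o, 'm) ainf_cat \<Rightarrow> 'o \<Rightarrow> 'o \<Rightarrow> 'm set set" where
  "h0_hom C X Y =
     h0_class C X Y ` {x \<in> carrier (sMor C X Y (- 1)). b1 C X Y (- 1) x = \<zero>\<^bsub>sMor C X Y 0\<^esub>}"

definition h0_comp ::
  "('k, 'o, 'm) ainf_cat \<Rightarrow> 'o \<Rightarrow> 'o \<Rightarrow> 'o \<Rightarrow> 'm set \<Rightarrow> 'm set \<Rightarrow> 'm set" where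
  "h0_comp C X Y Z p q =
     (\<Union>x \<in> p. \<Union>y \<in> q. h0_class C X Z (bop C X [(Y, - 1, x), (Z, - 1, y)]))"

definition h0_id :: "'k ring \<Rightarrow> ('k, 'o, 'm) ainf_cat \<Rightarrow> 'o \<Rightarrow> 'm set" where
  "h0_id R C X = h0_class C X X (unit_elt R C X)"

definition h0_isomorphic :: "'k ring \<Rightarrow> ('k, 'o, 'm) ainf_cat \<Rightarrow> 'o \<Rightarrow> 'o \<Rightarrow> bool" where
  "h0_isomorphic R C X Y \<longleftrightarrow>
     X \<in> Obj C \<and> Y \<in> Obj C \<and>
     (\<exists>p \<in> h0_hom C X Y. \<exists>q \<in> h0_hom C Y X.
        h0_comp C X Y X p q = h0_id R C X \<and> h0_comp C Y X Y q p = h0_id R C Y)"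

definition unital_functor ::
  "'k ring \<Rightarrow> ('k, 'oa, 'ma) ainf_cat \<Rightarrow> ('k, 'ob, 'mb) ainf_cat
    \<Rightarrow> ('oa, 'ma, 'ob, 'mb) ainf_fun \<Rightarrow> bool" where
  "unital_functor R A B f \<longleftrightarrow>
     unital_category R A \<and> unital_category R B \<and> ainf_functor R A B f \<and>
     (\<forall>X \<in> Obj A. \<exists>z \<in> carrier (sMor B (fob f X) (fob f X) (- 2)).
        fmp f X [(X, - 1, unit_elt R A X)]
            \<ominus>\<^bsub>sMor B (fob f X) (fob f X) (- 1)\<^esub> unit_elt R B (fob f X)
          = b1 B (fob f X) (fob f X) (- 2) z)"

definition ufun_cat ::
  "'k ring \<Rightarrow> ('k, 'oa, 'ma) ainf_cat \<Rightarrow> ('k, 'ob, 'mb) ainf_cat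
    \<Rightarrow> ('k, ('oa, 'ma, 'ob, 'mb) ainf_fun, ('oa, 'ma, 'mb) ainf_trans) ainf_cat" where
  "ufun_cat R A B = full_sub (fun_cat R A B) {f. unital_functor R A B f}"

definition isomorphic_functors ::
  "'k ring \<Rightarrow> ('k, 'oa, 'ma) ainf_cat \<Rightarrow> ('k, 'ob, 'mb) ainf_cat
    \<Rightarrow> ('oa, 'ma, 'ob, 'mb) ainf_fun \<Rightarrow> ('oa, 'ma, 'ob, 'mb) ainf_fun \<Rightarrow> bool" where
  "isomorphic_functors R A B f g \<longleftrightarrow> h0_isomorphic R (ufun_cat R A B) f g"

definition ainf_equivalence ::
  "'k ring \<Rightarrow> ('k, 'oa, 'ma) ainf_cat \<Rightarrow> ('k, 'ob, 'mb) ainf_cat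
    \<Rightarrow> ('oa, 'ma, 'ob, 'mb) ainf_fun \<Rightarrow> bool" where
  "ainf_equivalence R A B f \<longleftrightarrow>
     unital_functor R A B f \<and>
     (\<exists>g. unital_functor R B A g \<and>
        isomorphic_functors R A A (comp_fun A A f g) (id_fun A) \<and>
        isomorphic_functors R B B (comp_fun B B g f) (id_fun B))"


section \<open>Quotients\<close>

definition contractible_fun ::
  "'k ring \<Rightarrow> ('k, 'oa, 'ma) ainf_cat \<Rightarrow> ('k, 'ob, 'mb) ainf_cat
    \<Rightarrow> ('oa, 'ma, 'ob, 'mb) ainf_fun \<Rightarrow> bool" where
  "contractible_fun R B A g \<longleftrightarrow>
     unital_category R B \<and> ainf_functor R B A g \<and>
     (\<forall>X \<in> Obj B. \<forall>Y \<in> Obj B.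
        null_homotopic R B X Y A (fob g X) (fob g Y) (\<lambda>d x. fmp g X [(Y, d, x)]))"

definition restrict_fun ::
  "('k, 'oc, 'mc) ainf_cat \<Rightarrow> 'oc set \<Rightarrow> ('k, 'oa, 'ma) ainf_cat
    \<Rightarrow> ('oc, 'mc, 'oa, 'ma) ainf_fun \<Rightarrow> ('oc, 'mc, 'oa, 'ma) ainf_fun" where
  "restrict_fun C S A f = comp_fun (full_sub C S) A (id_fun (full_sub C S)) f"

definition ufun_cat_mod ::
  "'k ring \<Rightarrow> ('k, 'oc, 'mc) ainf_cat \<Rightarrow> 'oc set \<Rightarrow> ('k, 'oa, 'ma) ainf_cat
    \<Rightarrow> ('k, ('oc, 'mc, 'oa, 'ma) ainf_fun, ('oc, 'mc, 'ma) ainf_trans) ainf_cat" where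
  "ufun_cat_mod R C S A =
     full_sub (ufun_cat R C A)
       {f. unital_functor R C A f \<and> contractible_fun R (full_sub C S) A (restrict_fun C S A f)}"

text \<open>The action \<open>r \<mapsto> er\<close> on a transformation \<open>r : f \<rightarrow> g\<close> of degree \<open>d\<close>, for \<open>e : C \<rightarrow> D\<close>.\<close>

definition precomp_trans ::
  "('k, 'oc, 'mc) ainf_cat \<Rightarrow> ('k, 'oa, 'ma) ainf_cat \<Rightarrow> ('oc, 'mc, 'od, 'md) ainf_fun
    \<Rightarrow> ('od, 'md, 'oa, 'ma) ainf_fun \<Rightarrow> ('od, 'md, 'oa, 'ma) ainf_fun \<Rightarrow> int
    \<Rightarrow> ('od, 'md, 'ma) ainf_trans \<Rightarrow> ('oc, 'mc, 'ma) ainf_trans" where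
  "precomp_trans C A e f g d r =
     (\<lambda>X w. if is_word C X w then
        (\<Oplus>\<^bsub>sMor A (fob f (fob e X)) (fob g (fob e (wtgt X w))) (wdeg w + d)\<^esub>ws \<in> splits w.
           r (fob e X) (fun_tensor e X ws))
      else undefined)"

text \<open>The strict functor \<open>f \<mapsto> ef\<close> on unital functors \<open>D \<rightarrow> A\<close>.\<close>

definition precomp_fun ::
  "'k ring \<Rightarrow> ('k, 'oc, 'mc) ainf_cat \<Rightarrow> ('k, 'od, 'md) ainf_cat \<Rightarrow> ('k, 'oa, 'ma) ainf_cat
    \<Rightarrow> ('oc, 'mc, 'od, 'md) ainf_fun
    \<Rightarrow> (('od, 'md, 'oa, 'ma) ainf_fun, ('od, 'md, 'ma) ainf_trans,
        ('oc, 'mc, 'oa, 'ma) ainf_fun, ('oc, 'mc, 'ma) ainf_trans) ainf_fun" where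
  "precomp_fun R C D A e =
     \<lparr>fob = (\<lambda>f. if f \<in> Obj (ufun_cat R D A) then comp_fun C A e f else undefined),
      fmp = (\<lambda>f rs. if is_word (ufun_cat R D A) f rs \<and> rs \<noteq> [] then
               (case rs of
                  [(g, d, r)] \<Rightarrow> precomp_trans C A e f g d r
                | _ \<Rightarrow> \<zero>\<^bsub>sMor (ufun_cat R C A) (comp_fun C A e f) (comp_fun C A e (wtgt f rs)) (wdeg rs)\<^esub>)
             else undefined)\<rparr>"

text \<open>
  The quotient of \<open>C\<close> by its full subcategory with object set \<open>S\<close>; the test categories \<open>A\<close> range over
  the same universe as \<open>C\<close> and \<open>D\<close>.
\<close>

definition is_quotient ::
  "'k ring \<Rightarrow> ('k, 'o, 'm) ainf_cat \<Rightarrow> 'o set \<Rightarrow> ('k, 'o, 'm) ainf_cat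
    \<Rightarrow> ('o, 'm, 'o, 'm) ainf_fun \<Rightarrow> bool" where
  "is_quotient R C S D e \<longleftrightarrow>
     unital_category R D \<and> unital_functor R C D e \<and>
     contractible_fun R (full_sub C S) D (restrict_fun C S D e) \<and>
     (\<forall>A :: ('k, 'o, 'm) ainf_cat. unital_category R A \<longrightarrow>
        ainf_equivalence R (ufun_cat R D A) (ufun_cat_mod R C S A) (precomp_fun R C D A e))"

end

theory Submission
  imports Defs
begin

text \<open>
  By condition (2) for \<open>A = D'\<close>, the object \<open>e'\<close> is isomorphic to \<open>e\<phi>\<close> for some unital \<open>\<phi>\<close>, and
  symmetrically \<open>e\<close> is isomorphic to \<open>e'\<psi>\<close>. Then \<open>e\<phi>\<psi> \<cong> e'\<psi> \<cong> e\<close>, and since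
  \<open>f \<mapsto> ef\<close> is an equivalence it reflects isomorphisms, whence \<open>\<phi>\<psi> \<cong> id\<close>; likewise
  \<open>\<psi>\<phi> \<cong> id\<close>.

  The step \<open>e\<phi>\<psi> \<cong> e'\<psi>\<close> needs that composition with a unital functor preserves isomorphisms of
  functors, hence a hold on the unit elements of \<open>A\<^sub>\<infinity>(A, B)\<close>. They are characterised as the homotopy
  idempotents \<open>i\<close> whose components \<open>i\<^sub>0\<close> are unit elements of \<open>B\<close>: the filtration of transformations
  by word length shows that the multiplications by such an \<open>i\<close> are homotopic to automorphisms, and an
  invertible idempotent is the identity.
\<close>

section \<open>A universal group of values\<close>

text \<open>The homotopies that make multiplication by a unit of \<open>B\<close> close to the
  identity are given hom-complex by hom-complex and need not be natural, so they do not assemble to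
  A-infinity data: they control only the leading term with respect to word length. Moreover units of
  the category of functors must be constructed, not only recognised. Units of \<open>B\<close>
  chosen objectwise need not extend by zero to a cycle of \<open>B_1\<close>, so the higher
  components are built one word length at a time, together with a primitive of the idempotency
  defect.

  Signs and indices are controlled by duality. In place of tensors in \<open>TsB\<close> arbitrary
  multilinear functionals \<open>\<phi>\<close> on words are used: \<open>bh\<close> is a functional
  composed with the codifferential, \<open>cut\<close> with the comultiplication, \<open>th\<close>
  with \<open>\<theta>\<close>. The equations for transformations, composites and postcomposition
  then rest on three facts: \<open>\<theta>\<close> is a map of coalgebras (\<open>th_cut\<close>),
  it commutes with the codifferentials (\<open>th_bh\<close>), and it is compatible with composition
  (\<open>th_post\<close>).\<close>

text \<open>
  An element of this type is a choice of an element in every module. All the modules \<open>sC(X, Y)\<^sup>d\<close>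
  embed into it by extension by zero, so that identities between elements can be proved in a single
  abelian group, in which no carrier conditions arise.
\<close>

typedef ('k, 'm) allmod =
  "{F :: 'k ring \<times> ('k, 'm) module \<Rightarrow> 'm.
      \<forall>R M. F (R, M) \<in> (if module R M then carrier M else {undefined})}"
proof -
  have "(\<lambda>(R, M). if module R M then \<zero>\<^bsub>M\<^esub> else undefined) \<in>
      {F :: 'k ring \<times> ('k, 'm) module \<Rightarrow> 'm.
        \<forall>R M. F (R, M) \<in> (if module R M then carrier M else {undefined})}"
    by (auto intro: abelian_groupE(2) module.axioms(2))
  then show ?thesis by blast
qed

definition mk_allmod :: "('k ring \<Rightarrow> ('k, 'm) module \<Rightarrow> 'm) \<Rightarrow> ('k, 'm) allmod" where
  "mk_allmod F = Abs_allmod (\<lambda>(R, M). if module R M then F R M else undefined)"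

definition at_mod :: "('k, 'm) allmod \<Rightarrow> 'k ring \<Rightarrow> ('k, 'm) module \<Rightarrow> 'm" where
  "at_mod x R M = Rep_allmod x (R, M)"

lemma at_mod_closed [simp]: "module R M \<Longrightarrow> at_mod x R M \<in> carrier M"
  using Rep_allmod[of x] by (fastforce simp: at_mod_def split: if_splits)

text \<open>At a pair that is not a module every element takes the value \<open>undefined\<close>,
  so the components at genuine modules carry all the information.\<close>

lemma allmod_eqI: "(\<And>R M. module R M \<Longrightarrow> at_mod x R M = at_mod y R M) \<Longrightarrow> x = y"
proof -
  assume *: "\<And>R M. module R M \<Longrightarrow> at_mod x R M = at_mod y R M"
  have "Rep_allmod x (R, M) = Rep_allmod y (R, M)" for R M
  proof (cases "module R M")
    case False
    have "Rep_allmod z (R, M) = undefined" for z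
      using Rep_allmod[of z] False by (auto split: if_splits)
    then show ?thesis by simp
  qed (use * in \<open>simp add: at_mod_def\<close>)
  then show ?thesis by (simp add: Rep_allmod_inject[symmetric] fun_eq_iff)
qed

lemma at_mod_mk [simp]:
  assumes "\<And>R M. module R M \<Longrightarrow> F R M \<in> carrier M" "module R M"
  shows "at_mod (mk_allmod F) R M = F R M"
proof -
  have "(\<lambda>(R, M). if module R M then F R M else undefined) \<in>
      {F. \<forall>R M. F (R, M) \<in> (if module R M then carrier M else {undefined})}"
    using assms(1) by auto
  then show ?thesis using assms(2) by (simp add: at_mod_def mk_allmod_def Abs_allmod_inverse)
qed

instantiation allmod :: (type, type) ab_group_add
begin

definition "0 = mk_allmod (\<lambda>R M. \<zero>\<^bsub>M\<^esub>)"
definition "x + y = mk_allmod (\<lambda>R M. at_mod x R M \<oplus>\<^bsub>M\<^esub> at_mod y R M)"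
definition "- x = mk_allmod (\<lambda>R M. \<ominus>\<^bsub>M\<^esub> at_mod x R M)"
definition "(x :: ('a, 'b) allmod) - y = x + (- y)"

lemma ab_of_module: "module R M \<Longrightarrow> abelian_group M"
  by (rule module.axioms(2))

lemma at_mod_ops [simp]:
  assumes "module R M"
  shows "at_mod 0 R M = \<zero>\<^bsub>M\<^esub>"
    and "at_mod (x + y) R M = at_mod x R M \<oplus>\<^bsub>M\<^esub> at_mod y R M"
    and "at_mod (- x) R M = \<ominus>\<^bsub>M\<^esub> at_mod x R M"
proof -
  have "\<And>R M. module R M \<Longrightarrow> \<zero>\<^bsub>M\<^esub> \<in> carrier M"
    by (meson ab_of_module abelian_groupE(2))
  then show "at_mod 0 R M = \<zero>\<^bsub>M\<^esub>"
    unfolding zero_allmod_def using assms by (intro at_mod_mk[where F = "\<lambda>R M. \<zero>\<^bsub>M\<^esub>"])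
  have "\<And>R M. module R M \<Longrightarrow> at_mod x R M \<oplus>\<^bsub>M\<^esub> at_mod y R M \<in> carrier M"
    by (meson ab_of_module abelian_groupE(1) at_mod_closed)
  then show "at_mod (x + y) R M = at_mod x R M \<oplus>\<^bsub>M\<^esub> at_mod y R M"
    using assms by (simp add: plus_allmod_def)
  have "\<And>R M. module R M \<Longrightarrow> \<ominus>\<^bsub>M\<^esub> at_mod x R M \<in> carrier M"
    by (meson ab_of_module abelian_group.a_inv_closed at_mod_closed)
  then show "at_mod (- x) R M = \<ominus>\<^bsub>M\<^esub> at_mod x R M"
    using assms by (simp add: uminus_allmod_def)
qed

instance
proof
  fix x y z :: "('a, 'b) allmod"
  show "x + y + z = x + (y + z)"
    by (rule allmod_eqI) (simp add: abelian_groupE(3) ab_of_module)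
  show "x + y = y + x"
    by (rule allmod_eqI) (simp add: abelian_groupE(4) ab_of_module)
  show "0 + x = x"
    by (rule allmod_eqI) (simp add: abelian_groupE(5) ab_of_module)
  show "- x + x = 0"
    by (rule allmod_eqI) (simp add: abelian_group.l_neg ab_of_module)
  show "x - y = x + - y" by (simp add: minus_allmod_def)
qed

end

text \<open>Components over rings other than \<open>R\<close> are left alone, and so is everything
  if \<open>a\<close> lies outside \<open>R\<close>. This makes \<open>act\<close> additive in the
  vector without side conditions, at the price that it is not additive in the scalar.\<close>

definition act :: "'k ring \<Rightarrow> 'k \<Rightarrow> ('k, 'm) allmod \<Rightarrow> ('k, 'm) allmod" where
  "act R a x = mk_allmod (\<lambda>R' M. if R' = R \<and> a \<in> carrier R then a \<odot>\<^bsub>M\<^esub> at_mod x R' M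
     else at_mod x R' M)"

lemma at_mod_act [simp]:
  "module R' M \<Longrightarrow> at_mod (act R a x) R' M =
    (if R' = R \<and> a \<in> carrier R then a \<odot>\<^bsub>M\<^esub> at_mod x R' M else at_mod x R' M)"
  unfolding act_def by (subst at_mod_mk) (auto simp: module.smult_closed)

lemma act_add: "act R a (x + y) = act R a x + act R a y"
  by (rule allmod_eqI) (auto simp: module.smult_r_distr)

lemma act_zero [simp]: "act R a 0 = 0"
  using act_add[of R a 0 0] by simp

lemma act_minus: "act R a (- x) = - act R a x"
proof -
  have "act R a x + act R a (- x) = 0" by (simp flip: act_add)
  then show ?thesis by (rule minus_unique[symmetric])
qed

lemma act_one [simp]: "act R \<one>\<^bsub>R\<^esub> x = x"
  by (rule allmod_eqI) (auto simp: module.smult_one)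

lemma act_sum: "act R a (sum f I) = (\<Sum>i\<in>I. act R a (f i))"
  by (induction I rule: infinite_finite_induct) (auto simp: act_add)

text \<open>Extension by zero; elements outside the carrier go to zero, so the map is total.
  Hom-modules that happen to be equal as records share one component, which is harmless because
  \<open>emb_inject\<close> is applied within a single module.\<close>

definition emb :: "'k ring \<Rightarrow> ('k, 'm) module \<Rightarrow> 'm \<Rightarrow> ('k, 'm) allmod" where
  "emb R M x = mk_allmod (\<lambda>R' M'. if R' = R \<and> M' = M \<and> x \<in> carrier M then x else \<zero>\<^bsub>M'\<^esub>)"

lemma at_mod_emb:
  "module R' M' \<Longrightarrow> at_mod (emb R M x) R' M' =
    (if R' = R \<and> M' = M \<and> x \<in> carrier M then x else \<zero>\<^bsub>M'\<^esub>)"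
  unfolding emb_def
  by (intro at_mod_mk[where F = "\<lambda>R' M'. if R' = R \<and> M' = M \<and> x \<in> carrier M then x else \<zero>\<^bsub>M'\<^esub>"])
    (auto intro: abelian_groupE(2) ab_of_module)

lemma at_mod_emb_same: "module R M \<Longrightarrow> x \<in> carrier M \<Longrightarrow> at_mod (emb R M x) R M = x"
  by (simp only: at_mod_emb if_True simp_thms)

lemma at_mod_emb_other:
  "module R' M' \<Longrightarrow> \<not> (R' = R \<and> M' = M) \<Longrightarrow> at_mod (emb R M x) R' M' = \<zero>\<^bsub>M'\<^esub>"
  by (simp only: at_mod_emb, rule if_not_P, blast)

context
  fixes R :: "'k ring" and M :: "('k, 'm) module"
  assumes M: "module R M"
begin

interpretation M: module R M by (rule M)

text \<open>The way back: an identity between sums in the universal group becomes one in the module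
  as soon as both sides are known to lie in its carrier.\<close>

lemma emb_inject:
  assumes "x \<in> carrier M" "y \<in> carrier M"
  shows "emb R M x = emb R M y \<longleftrightarrow> x = y"
  using assms by (metis at_mod_emb_same[OF M])

lemma emb_eqI:
  assumes "x \<in> carrier M" "at_mod z R M = x"
    and "\<And>R' M'. module R' M' \<Longrightarrow> \<not> (R' = R \<and> M' = M) \<Longrightarrow> at_mod z R' M' = \<zero>\<^bsub>M'\<^esub>"
  shows "emb R M x = z"
proof (rule allmod_eqI)
  fix R' :: "'k ring" and M' :: "('k, 'm) module"
  assume M': "module R' M'"
  show "at_mod (emb R M x) R' M' = at_mod z R' M'"
  proof (cases "R' = R \<and> M' = M")
    case True
    then show ?thesis using at_mod_emb_same[OF M assms(1)] assms(2) by (simp only:)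
  next
    case False
    then show ?thesis using at_mod_emb_other[OF M' False] assms(3)[OF M' False] by (simp only:)
  qed
qed

lemma emb_zero: "emb R M \<zero>\<^bsub>M\<^esub> = 0"
  by (rule emb_eqI) (simp_all add: M)

lemma emb_add:
  assumes "x \<in> carrier M" "y \<in> carrier M"
  shows "emb R M (x \<oplus>\<^bsub>M\<^esub> y) = emb R M x + emb R M y"
proof (rule emb_eqI)
  fix R' :: "'k ring" and M' :: "('k, 'm) module"
  assume *: "module R' M'" "\<not> (R' = R \<and> M' = M)"
  show "at_mod (emb R M x + emb R M y) R' M' = \<zero>\<^bsub>M'\<^esub>"
    unfolding at_mod_ops[OF *(1)] at_mod_emb_other[OF *]
    by (intro abelian_groupE(5,2) ab_of_module[OF *(1)])
qed (simp_all add: M at_mod_emb_same assms)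

lemma emb_smult:
  assumes "a \<in> carrier R" "x \<in> carrier M"
  shows "emb R M (a \<odot>\<^bsub>M\<^esub> x) = act R a (emb R M x)"
proof (rule emb_eqI)
  fix R' :: "'k ring" and M' :: "('k, 'm) module"
  assume *: "module R' M'" "\<not> (R' = R \<and> M' = M)"
  have "a \<odot>\<^bsub>M'\<^esub> \<zero>\<^bsub>M'\<^esub> = \<zero>\<^bsub>M'\<^esub>" if "R' = R"
    using module.smult_r_null[OF *(1)] that assms(1) by (simp only:)
  then show "at_mod (act R a (emb R M x)) R' M' = \<zero>\<^bsub>M'\<^esub>"
    unfolding at_mod_act[OF *(1)] at_mod_emb_other[OF *] by (cases "R' = R \<and> a \<in> carrier R") simp_all
qed (simp_all add: M at_mod_emb_same assms)

lemma emb_minus: "x \<in> carrier M \<Longrightarrow> emb R M (\<ominus>\<^bsub>M\<^esub> x) = - emb R M x"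
  using emb_add[of x "\<ominus>\<^bsub>M\<^esub> x"] minus_unique[of "emb R M x" "emb R M (\<ominus>\<^bsub>M\<^esub> x)"]
  by (simp add: M.r_neg emb_zero)

lemma emb_diff:
  "x \<in> carrier M \<Longrightarrow> y \<in> carrier M \<Longrightarrow> emb R M (x \<ominus>\<^bsub>M\<^esub> y) = emb R M x - emb R M y"
  by (simp add: M.minus_eq emb_add emb_minus)

lemma emb_finsum:
  "g \<in> I \<rightarrow> carrier M \<Longrightarrow> emb R M (finsum M g I) = (\<Sum>i\<in>I. emb R M (g i))"
proof (induction I rule: infinite_finite_induct)
  case (insert i I)
  then have "g \<in> I \<rightarrow> carrier M" "g i \<in> carrier M" by auto
  with insert(1,2,3) show ?case by (simp add: M.finsum_closed emb_add)
qed (simp_all add: emb_zero M.finsum_infinite)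

end

section \<open>Koszul signs in the universal group\<close>

definition sg :: "int \<Rightarrow> 't \<Rightarrow> 't :: ab_group_add" where
  "sg n x = (if even n then x else - x)"

lemma sg_add: "sg n (x + y) = sg n x + sg n y"
  and sg_diff: "sg n (x - y) = sg n x - sg n y"
  and sg_minus: "sg n (- x) = - sg n x"
  and sg_zero [simp]: "sg n 0 = 0"
  and sg_0 [simp]: "sg 0 x = x"
  and sg_sg [simp]: "sg n (sg m x) = sg (n + m) x"
  by (auto simp: sg_def)

lemma sg_sum: "sg n (sum f I) = (\<Sum>i\<in>I. sg n (f i))"
  by (auto simp: sg_def sum_negf)

lemma sg_cong: "even (m - n) \<Longrightarrow> sg m x = sg n x"
  by (auto simp: sg_def)

lemma sg_opp: "odd (m - n) \<Longrightarrow> sg m x = - sg n x"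
  by (auto simp: sg_def)

lemma act_sg: "act R a (sg n x) = sg n (act R a x)"
  by (simp add: sg_def act_minus)

lemma emb_ksign:
  "module R M \<Longrightarrow> x \<in> carrier M \<Longrightarrow> emb R M (ksign M n x) = sg n (emb R M x)"
  by (auto simp: ksign_def sg_def emb_minus)

lemma ksign_closed:
  "module R M \<Longrightarrow> x \<in> carrier M \<Longrightarrow> ksign M n x \<in> carrier M"
  by (auto simp: ksign_def abelian_group.a_inv_closed ab_of_module)

section \<open>Sums over decompositions of words\<close>

text \<open>The sum of \<open>F u v\<close> over all cuts \<open>u @ v\<close> of the word, that is,
  \<open>F\<close> composed with the deconcatenation comultiplication; \<open>cut1\<close> keeps the
  cuts with nonempty first part. The recursion on the word replaces manipulations of index sets by
  induction.\<close>

fun cut :: "('a list \<Rightarrow> 'a list \<Rightarrow> 't :: ab_group_add) \<Rightarrow> 'a list \<Rightarrow> 't" where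
  "cut F [] = F [] []"
| "cut F (x # w) = F [] (x # w) + cut (\<lambda>u. F (x # u)) w"

fun cut1 :: "('a list \<Rightarrow> 'a list \<Rightarrow> 't :: ab_group_add) \<Rightarrow> 'a list \<Rightarrow> 't" where
  "cut1 F [] = 0"
| "cut1 F (x # w) = cut (\<lambda>u. F (x # u)) w"

lemma cut_cut1: "cut F w = F [] w + cut1 F w"
  by (cases w) auto

lemma cut_cong: "(\<And>u v. u @ v = w \<Longrightarrow> F u v = G u v) \<Longrightarrow> cut F w = cut G w"
proof (induction w arbitrary: F G)
  case (Cons x w)
  have "cut (\<lambda>u. F (x # u)) w = cut (\<lambda>u. G (x # u)) w"
    by (rule Cons.IH) (simp add: Cons.prems)
  then show ?case using Cons.prems by simp
qed simp

lemma cut1_cong: "(\<And>u v. u @ v = w \<Longrightarrow> u \<noteq> [] \<Longrightarrow> F u v = G u v) \<Longrightarrow> cut1 F w = cut1 G w"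
  by (cases w) (auto intro!: cut_cong)

lemma cut_add: "cut (\<lambda>u v. F u v + G u v) w = cut F w + cut G w"
  by (induction w arbitrary: F G) (auto simp: algebra_simps)

lemma cut_minus: "cut (\<lambda>u v. - F u v) w = - cut F w"
  by (induction w arbitrary: F) auto

lemma cut_0 [simp]: "cut (\<lambda>u v. 0) w = 0"
  by (induction w) auto

lemma cut_sg: "cut (\<lambda>u v. sg n (F u v)) w = sg n (cut F w)"
  by (auto simp: sg_def cut_minus)

lemma cut_act: "cut (\<lambda>u v. act R a (F u v)) w = act R a (cut F w)"
  by (induction w arbitrary: F) (auto simp: act_add)

lemma cut1_add: "cut1 (\<lambda>u v. F u v + G u v) w = cut1 F w + cut1 G w"
  by (cases w) (auto simp: cut_add)

lemma cut1_0 [simp]: "cut1 (\<lambda>u v. 0) w = 0"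
  by (cases w) auto

lemma cut1_sg: "cut1 (\<lambda>u v. sg n (F u v)) w = sg n (cut1 F w)"
  by (cases w) (auto simp: cut_sg)

lemma cut1_act: "cut1 (\<lambda>u v. act R a (F u v)) w = act R a (cut1 F w)"
  by (cases w) (auto simp: cut_act)

lemma cut1_cut: "cut1 F w = cut (\<lambda>u v. if u = [] then 0 else F u v) w"
  by (simp add: cut_cut1 cong: cut1_cong)

lemma cut_swap: "cut (\<lambda>u v. cut (\<lambda>p q. F u v p q) z) w = cut (\<lambda>p q. cut (\<lambda>u v. F u v p q) w) z"
  by (induction w arbitrary: F) (auto simp: cut_add)

text \<open>Coassociativity of deconcatenation: either order of cutting twice produces all
  decompositions into three consecutive parts.\<close>

lemma cut_assoc: "cut (\<lambda>u v. cut (\<lambda>p q. F p q v) u) w = cut (\<lambda>p v. cut (\<lambda>q r. F p q r) v) w"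
proof (induction w arbitrary: F)
  case (Cons x w)
  have "cut (\<lambda>u v. cut (\<lambda>p q. F p q v) u) (x # w) =
      F [] [] (x # w) + cut (\<lambda>u v. F [] (x # u) v + cut (\<lambda>p q. F (x # p) q v) u) w" by simp
  also have "\<dots> = cut (F [] ) (x # w) + cut (\<lambda>u v. cut (\<lambda>p q. F (x # p) q v) u) w"
    by (simp add: cut_add)
  also have "\<dots> = cut (F []) (x # w) + cut (\<lambda>p v. cut (\<lambda>q r. F (x # p) q r) v) w"
    by (subst Cons.IH) simp
  finally show ?case by simp
qed simp

lemma cut_assoc1: "cut (\<lambda>u v. cut1 (\<lambda>p q. F p q v) u) w = cut1 (\<lambda>p v. cut (\<lambda>q r. F p q r) v) w"
proof -
  have "cut (\<lambda>u v. cut (\<lambda>p q. if p = [] then 0 else F p q v) u) w =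
      cut (\<lambda>p v. cut (\<lambda>q r. if p = [] then 0 else F p q r) v) w"
    by (rule cut_assoc)
  also have "\<dots> = cut (\<lambda>p v. if p = [] then 0 else cut (\<lambda>q r. F p q r) v) w"
    by (rule cut_cong) auto
  finally show ?thesis by (simp add: cut1_cut)
qed

text \<open>The marked letter \<open>x\<close> lies either in the second part or in the first, which
  splits the sum in two. This is how linearity in one letter is passed on to
  \<open>cut\<close>.\<close>

lemma cut_append:
  "cut F (p @ x # q) = cut (\<lambda>p1 p2. F p1 (p2 @ x # q)) p + cut (\<lambda>q1. F (p @ x # q1)) q"
  by (induction p arbitrary: F) (auto simp: algebra_simps)

lemma finite_cuts: "finite {(u, v). u @ v = (w :: 'a list)}"
proof -
  have "{(u, v). u @ v = w} \<subseteq> (\<lambda>k. (take k w, drop k w)) ` {..length w}"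
  proof clarify
    fix u v :: "'a list"
    show "(u, v) \<in> (\<lambda>k. (take k (u @ v), drop k (u @ v))) ` {..length (u @ v)}"
      by (rule image_eqI[of _ _ "length u"]) auto
  qed
  then show ?thesis using finite_surj by blast
qed

lemma cut_set: "cut F w = (\<Sum>(u, v) \<in> {(u, v). u @ v = w}. F u v)"
proof (induction w arbitrary: F)
  case Nil
  have "{(u, v). u @ v = ([] :: 'a list)} = {([], [])}" by auto
  then show ?case by simp
next
  case (Cons x w)
  have *: "{(u, v). u @ v = x # w} = insert ([], x # w) ((\<lambda>(u, v). (x # u, v)) ` {(u, v). u @ v = w})"
    by (auto simp: Cons_eq_append_conv append_eq_Cons_conv image_iff)
  have "inj_on (\<lambda>(u, v). (x # u, v)) {(u, v). u @ v = w}" by (auto simp: inj_on_def)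
  then have "(\<Sum>(u, v) \<in> (\<lambda>(u, v). (x # u, v)) ` {(u, v). u @ v = w}. F u v) =
      (\<Sum>(u, v) \<in> {(u, v). u @ v = w}. F (x # u) v)"
    by (simp add: sum.reindex case_prod_unfold)
  then show ?case unfolding *
    by (subst sum.insert) (auto simp: Cons.IH finite_cuts)
qed

lemma cut1_set: "cut1 F w = (\<Sum>(u, v) \<in> {(u, v). u @ v = w \<and> u \<noteq> []}. F u v)"
proof -
  have "cut1 F w = (\<Sum>(u, v) \<in> {(u, v). u @ v = w}. if u = [] then 0 else F u v)"
    by (simp only: cut1_cut cut_set)
  also have "\<dots> = (\<Sum>(u, v) \<in> {(u, v). u @ v = w \<and> u \<noteq> []}. F u v)"
    by (rule sum.mono_neutral_cong_right) (auto simp: finite_cuts)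
  finally show ?thesis .
qed

text \<open>Links the recursive sums with the index pairs of \<open>b_then\<close>; the prefix
  length starts at 1 because operations take at least one input.\<close>

lemma cut1_sum: "cut1 F w = (\<Sum>n = 1..length w. F (take n w) (drop n w))"
proof -
  have "{(u, v). u @ v = w \<and> u \<noteq> []} = (\<lambda>n. (take n w, drop n w)) ` {1..length w}"
  proof (intro equalityI subsetI)
    fix p assume "p \<in> {(u, v). u @ v = w \<and> u \<noteq> []}"
    then obtain u v where "p = (u, v)" "u @ v = w" "u \<noteq> []" by auto
    then show "p \<in> (\<lambda>n. (take n w, drop n w)) ` {1..length w}"
      by (intro image_eqI[of _ _ "length u"]) (auto simp: Suc_le_eq)
  qed auto
  moreover have "inj_on (\<lambda>n. (take n w, drop n w)) {1..length w}"
  proof (rule inj_onI)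
    fix m n assume "m \<in> {1..length w}" "n \<in> {1..length w}"
      "(take m w, drop m w) = (take n w, drop n w)"
    then have "length (take m w) = length (take n w)" by simp
    then show "m = n" using \<open>m \<in> _\<close> \<open>n \<in> _\<close> by simp
  qed
  ultimately show ?thesis by (simp add: cut1_set sum.reindex)
qed

section \<open>Words and multilinear functionals\<close>

lemma wtgt_append [simp]: "wtgt X (u @ v) = wtgt (wtgt X u) v"
  by (induction u arbitrary: X) auto

lemma wdeg_append [simp]: "wdeg (u @ v) = wdeg u + wdeg v"
  by (induction u) auto

lemma is_word_src: "is_word A X w \<Longrightarrow> X \<in> Obj A"
  by (cases w) auto

lemma is_word_append: "is_word A X (u @ v) \<longleftrightarrow> is_word A X u \<and> is_word A (wtgt X u) v"
  by (induction u arbitrary: X) (auto dest: is_word_src)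

lemma is_word_tgt: "is_word A X w \<Longrightarrow> wtgt X w \<in> Obj A"
  using is_word_append[of A X w "[]"] by simp

text \<open>Only the module structures are retained, so that the notion applies to the category of
  functors before its A-infinity relations are known.\<close>

definition modular :: "'k ring \<Rightarrow> ('k, 'o, 'm) ainf_cat \<Rightarrow> bool" where
  "modular R A \<longleftrightarrow> cring R \<and> (\<forall>X \<in> Obj A. \<forall>Y \<in> Obj A. \<forall>d. module R (sMor A X Y d))"

lemma modularD: "modular R A \<Longrightarrow> X \<in> Obj A \<Longrightarrow> Y \<in> Obj A \<Longrightarrow> module R (sMor A X Y d)"
  by (auto simp: modular_def)

lemma modular_one: "modular R A \<Longrightarrow> \<one>\<^bsub>R\<^esub> \<in> carrier R"
  by (auto simp: modular_def intro: monoid.one_closed ring.is_monoid cring.axioms(1))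

lemma ainf_modular: "ainf_category R A \<Longrightarrow> modular R A"
  by (auto simp: ainf_category_def modular_def sMor_def)

text \<open>Linear maps out of the tensor coalgebra, with values in the universal group. The single
  condition on \<open>ax + y\<close> in one letter replaces additivity and homogeneity; the value at
  the empty word is unconstrained.\<close>

definition lin :: "'k ring \<Rightarrow> ('k, 'o, 'm) ainf_cat \<Rightarrow> 'o \<Rightarrow> (('o, 'm) word \<Rightarrow> ('k, 'n) allmod) \<Rightarrow> bool"
  where "lin R A X \<phi> \<longleftrightarrow> (\<forall>u Y d x y v. \<forall>a \<in> carrier R.
     is_word A X (u @ (Y, d, x) # v) \<longrightarrow> is_word A X (u @ (Y, d, y) # v) \<longrightarrow>
     \<phi> (u @ (Y, d, a \<odot>\<^bsub>sMor A (wtgt X u) Y d\<^esub> x \<oplus>\<^bsub>sMor A (wtgt X u) Y d\<^esub> y) # v)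
       = act R a (\<phi> (u @ (Y, d, x) # v)) + \<phi> (u @ (Y, d, y) # v))"

lemma linI:
  assumes "\<And>u Y d x y v a. a \<in> carrier R \<Longrightarrow>
     is_word A X (u @ (Y, d, x) # v) \<Longrightarrow> is_word A X (u @ (Y, d, y) # v) \<Longrightarrow>
     \<phi> (u @ (Y, d, a \<odot>\<^bsub>sMor A (wtgt X u) Y d\<^esub> x \<oplus>\<^bsub>sMor A (wtgt X u) Y d\<^esub> y) # v)
       = act R a (\<phi> (u @ (Y, d, x) # v)) + \<phi> (u @ (Y, d, y) # v)"
  shows "lin R A X \<phi>"
  using assms by (simp add: lin_def)

lemma linD:
  assumes "lin R A X \<phi>" "a \<in> carrier R"
     "is_word A X (u @ (Y, d, x) # v)" "is_word A X (u @ (Y, d, y) # v)"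
  shows "\<phi> (u @ (Y, d, a \<odot>\<^bsub>sMor A (wtgt X u) Y d\<^esub> x \<oplus>\<^bsub>sMor A (wtgt X u) Y d\<^esub> y) # v)
       = act R a (\<phi> (u @ (Y, d, x) # v)) + \<phi> (u @ (Y, d, y) # v)"
  using assms by (simp add: lin_def)

lemma word_comb:
  assumes "modular R A" "a \<in> carrier R"
    "is_word A X (u @ (Y, d, x) # v)" "is_word A X (u @ (Y, d, y) # v)"
  shows "is_word A X (u @ (Y, d, a \<odot>\<^bsub>sMor A (wtgt X u) Y d\<^esub> x \<oplus>\<^bsub>sMor A (wtgt X u) Y d\<^esub> y) # v)"
proof -
  have *: "is_word A X u" "wtgt X u \<in> Obj A" "x \<in> carrier (sMor A (wtgt X u) Y d)"
    "y \<in> carrier (sMor A (wtgt X u) Y d)" "is_word A Y v"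
    using assms(3,4) by (auto simp: is_word_append)
  interpret module R "sMor A (wtgt X u) Y d"
    using modularD[OF assms(1) *(2)] is_word_src[OF *(5)] .
  show ?thesis using * assms(2) by (simp add: is_word_append)
qed

lemma lin_shift:
  assumes "lin R A X \<phi>" "is_word A X u"
  shows "lin R A (wtgt X u) (\<lambda>v. \<phi> (u @ v))"
proof (rule linI)
  fix p Y d x y v a
  assume "a \<in> carrier R" "is_word A (wtgt X u) (p @ (Y, d, x) # v)"
    "is_word A (wtgt X u) (p @ (Y, d, y) # v)"
  with linD[OF assms(1), of a "u @ p" Y d x v y] assms(2)
  show "\<phi> (u @ p @ (Y, d, a \<odot>\<^bsub>sMor A (wtgt (wtgt X u) p) Y d\<^esub> x
      \<oplus>\<^bsub>sMor A (wtgt (wtgt X u) p) Y d\<^esub> y) # v) =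
    act R a (\<phi> (u @ p @ (Y, d, x) # v)) + \<phi> (u @ p @ (Y, d, y) # v)"
    by (simp add: is_word_append)
qed

lemma lin_tail:
  assumes "lin R A X \<phi>" "X \<in> Obj A" "x \<in> carrier (sMor A X Y d)"
  shows "lin R A Y (\<lambda>v. \<phi> ((Y, d, x) # v))"
proof (cases "Y \<in> Obj A")
  case True
  then show ?thesis using lin_shift[OF assms(1), of "[(Y, d, x)]"] assms by simp
next
  case False
  show ?thesis using False by (intro linI) (metis is_word_src)
qed

text \<open>Every word in the condition defining \<open>lin\<close> has a marked letter, and a
  combination of well-formed words is well-formed by \<open>word_comb\<close>; so agreement on
  nonempty well-formed words is enough.\<close>

lemma lin_cong:
  assumes "modular R A" "lin R A X \<phi>" "\<And>w. is_word A X w \<Longrightarrow> w \<noteq> [] \<Longrightarrow> \<phi> w = \<psi> w"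
  shows "lin R A X \<psi>"
proof (rule linI)
  fix u Y d x y v a
  assume *: "a \<in> carrier R" "is_word A X (u @ (Y, d, x) # v)" "is_word A X (u @ (Y, d, y) # v)"
  show "\<psi> (u @ (Y, d, a \<odot>\<^bsub>sMor A (wtgt X u) Y d\<^esub> x \<oplus>\<^bsub>sMor A (wtgt X u) Y d\<^esub> y) # v)
       = act R a (\<psi> (u @ (Y, d, x) # v)) + \<psi> (u @ (Y, d, y) # v)"
    using linD[OF assms(2) *] assms(3) * word_comb[OF assms(1) *] by simp
qed

lemma lin_0: "lin R A X (\<lambda>w. 0)"
  by (simp add: lin_def)

lemma lin_plus: "lin R A X \<phi> \<Longrightarrow> lin R A X \<psi> \<Longrightarrow> lin R A X (\<lambda>w. \<phi> w + \<psi> w)"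
  by (simp add: lin_def act_add)

lemma lin_minus: "lin R A X \<phi> \<Longrightarrow> lin R A X (\<lambda>w. - \<phi> w)"
  by (simp add: lin_def act_minus)

lemma lin_sg: "lin R A X \<phi> \<Longrightarrow> lin R A X (\<lambda>w. sg n (\<phi> w))"
  by (cases "even n") (simp_all add: sg_def lin_minus)

lemma lin_sgw: "lin R A X \<phi> \<Longrightarrow> lin R A X (\<lambda>w. sg (n + m * wdeg w) (\<phi> w))"
  by (simp add: lin_def act_sg sg_add)

context
  fixes R :: "'k ring" and A :: "('k, 'o, 'm) ainf_cat" and X :: 'o
    and \<phi> :: "('o, 'm) word \<Rightarrow> ('k, 'n) allmod"
  assumes m: "modular R A" and l: "lin R A X \<phi>" and X: "X \<in> Obj A"
begin

lemma lin_comb: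
  assumes "x \<in> carrier (sMor A X Y d)" "y \<in> carrier (sMor A X Y d)" "is_word A Y v" "a \<in> carrier R"
  shows "\<phi> ((Y, d, a \<odot>\<^bsub>sMor A X Y d\<^esub> x \<oplus>\<^bsub>sMor A X Y d\<^esub> y) # v) =
    act R a (\<phi> ((Y, d, x) # v)) + \<phi> ((Y, d, y) # v)"
  using linD[OF l, of a "[]" Y d x v y] assms X by simp

lemma lin_add:
  assumes "x \<in> carrier (sMor A X Y d)" "y \<in> carrier (sMor A X Y d)" "is_word A Y v"
  shows "\<phi> ((Y, d, x \<oplus>\<^bsub>sMor A X Y d\<^esub> y) # v) = \<phi> ((Y, d, x) # v) + \<phi> ((Y, d, y) # v)"
  using lin_comb[OF assms modular_one[OF m]] assms
    module.smult_one[OF modularD[OF m X is_word_src[OF assms(3)]]]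
  by simp

lemma lin_zero:
  assumes "is_word A Y v"
  shows "\<phi> ((Y, d, \<zero>\<^bsub>sMor A X Y d\<^esub>) # v) = 0"
proof -
  interpret module R "sMor A X Y d" using modularD[OF m X is_word_src[OF assms]] .
  show ?thesis using lin_add[of "\<zero>\<^bsub>sMor A X Y d\<^esub>" Y d "\<zero>\<^bsub>sMor A X Y d\<^esub>" v] assms by simp
qed

lemma lin_neg:
  assumes "x \<in> carrier (sMor A X Y d)" "is_word A Y v"
  shows "\<phi> ((Y, d, \<ominus>\<^bsub>sMor A X Y d\<^esub> x) # v) = - \<phi> ((Y, d, x) # v)"
proof -
  interpret module R "sMor A X Y d" using modularD[OF m X is_word_src[OF assms(2)]] .
  have "\<phi> ((Y, d, x) # v) + \<phi> ((Y, d, \<ominus>\<^bsub>sMor A X Y d\<^esub> x) # v) = 0"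
    using lin_add[of x Y d "\<ominus>\<^bsub>sMor A X Y d\<^esub> x" v] lin_zero[of Y v d] assms by (simp add: r_neg)
  then show ?thesis by (rule group_add_class.minus_unique[symmetric])
qed

lemma lin_diff:
  assumes "x \<in> carrier (sMor A X Y d)" "y \<in> carrier (sMor A X Y d)" "is_word A Y v"
  shows "\<phi> ((Y, d, x \<ominus>\<^bsub>sMor A X Y d\<^esub> y) # v) = \<phi> ((Y, d, x) # v) - \<phi> ((Y, d, y) # v)"
proof -
  interpret module R "sMor A X Y d" using modularD[OF m X is_word_src[OF assms(3)]] .
  show ?thesis using assms by (simp add: minus_eq lin_add lin_neg)
qed

lemma lin_ksign:
  assumes "x \<in> carrier (sMor A X Y d)" "is_word A Y v"
  shows "\<phi> ((Y, d, ksign (sMor A X Y d) n x) # v) = sg n (\<phi> ((Y, d, x) # v))"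
  using assms by (auto simp: ksign_def sg_def lin_neg)

lemma lin_finsum:
  assumes "is_word A Y v" "\<And>i. i \<in> I \<Longrightarrow> g i \<in> carrier (sMor A X Y d)"
  shows "\<phi> ((Y, d, finsum (sMor A X Y d) g I) # v) = (\<Sum>i\<in>I. \<phi> ((Y, d, g i) # v))"
proof -
  interpret module R "sMor A X Y d" using modularD[OF m X is_word_src[OF assms(1)]] .
  show ?thesis using assms(2)
  proof (induction I rule: infinite_finite_induct)
    case (insert i I)
    then have "g \<in> I \<rightarrow> carrier (sMor A X Y d)" "g i \<in> carrier (sMor A X Y d)" by auto
    then show ?case using insert assms(1) by (simp add: lin_add)
  qed (simp_all add: lin_zero[OF assms(1)] finsum_infinite)
qed

end

text \<open>Linearity in the two factors of a cut: the second hypothesis is stated for composable words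
  only, as \<open>F u v\<close> may depend on the common object.\<close>

lemma lin_cut:
  assumes "modular R A"
    and 1: "\<And>u. is_word A X u \<Longrightarrow> lin R A (wtgt X u) (F u)"
    and 2: "\<And>u Y d x y u' v a. a \<in> carrier R \<Longrightarrow> is_word A X (u @ (Y, d, x) # u' @ v) \<Longrightarrow>
       is_word A X (u @ (Y, d, y) # u' @ v) \<Longrightarrow>
       F (u @ (Y, d, a \<odot>\<^bsub>sMor A (wtgt X u) Y d\<^esub> x \<oplus>\<^bsub>sMor A (wtgt X u) Y d\<^esub> y) # u') v
         = act R a (F (u @ (Y, d, x) # u') v) + F (u @ (Y, d, y) # u') v"
  shows "lin R A X (cut F)"
proof (rule linI)
  fix u Y d x y v a
  assume *: "a \<in> carrier R" "is_word A X (u @ (Y, d, x) # v)" "is_word A X (u @ (Y, d, y) # v)"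
  let ?z = "a \<odot>\<^bsub>sMor A (wtgt X u) Y d\<^esub> x \<oplus>\<^bsub>sMor A (wtgt X u) Y d\<^esub> y"
  have "cut (\<lambda>p q. F p (q @ (Y, d, ?z) # v)) u =
     cut (\<lambda>p q. act R a (F p (q @ (Y, d, x) # v)) + F p (q @ (Y, d, y) # v)) u"
  proof (rule cut_cong)
    fix p q assume u: "p @ q = u"
    have "is_word A X p" "is_word A (wtgt X p) (q @ (Y, d, x) # v)" "is_word A (wtgt X p) (q @ (Y, d, y) # v)"
      using * u by (auto simp: is_word_append)
    from linD[OF 1 *(1), OF this] u
    show "F p (q @ (Y, d, ?z) # v) = act R a (F p (q @ (Y, d, x) # v)) + F p (q @ (Y, d, y) # v)"
      by auto
  qed
  moreover have "cut (\<lambda>p. F (u @ (Y, d, ?z) # p)) v =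
     cut (\<lambda>p q. act R a (F (u @ (Y, d, x) # p) q) + F (u @ (Y, d, y) # p) q) v"
    by (rule cut_cong, rule 2) (use * in auto)
  ultimately show "cut F (u @ (Y, d, ?z) # v) =
      act R a (cut F (u @ (Y, d, x) # v)) + cut F (u @ (Y, d, y) # v)"
    by (simp add: cut_append cut_add cut_act act_add algebra_simps)
qed

lemma lin_cut1:
  assumes "modular R A"
    and 1: "\<And>u. is_word A X u \<Longrightarrow> u \<noteq> [] \<Longrightarrow> lin R A (wtgt X u) (F u)"
    and 2: "\<And>u Y d x y u' v a. a \<in> carrier R \<Longrightarrow> is_word A X (u @ (Y, d, x) # u' @ v) \<Longrightarrow>
       is_word A X (u @ (Y, d, y) # u' @ v) \<Longrightarrow>
       F (u @ (Y, d, a \<odot>\<^bsub>sMor A (wtgt X u) Y d\<^esub> x \<oplus>\<^bsub>sMor A (wtgt X u) Y d\<^esub> y) # u') v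
         = act R a (F (u @ (Y, d, x) # u') v) + F (u @ (Y, d, y) # u') v"
  shows "lin R A X (cut1 F)"
proof -
  have "lin R A X (cut (\<lambda>u v. if u = [] then 0 else F u v))"
  proof (rule lin_cut[OF assms(1)])
    show "lin R A (wtgt X u) (\<lambda>v. if u = [] then 0 else F u v)" if "is_word A X u" for u
      using that 1 by (cases "u = []") (simp_all add: lin_0)
  qed (use 2 in simp)
  then show ?thesis by (simp add: cut1_cut[abs_def])
qed

section \<open>Insertion of the operations\<close>

text \<open>The functional \<open>\<phi>\<close> composed with the codifferential of the tensor
  coalgebra. It is \<open>b_then\<close> with values in the universal group, where terms whose
  typing is not yet known can be added freely.\<close>

definition bh :: "('k, 'o, 'm) ainf_cat \<Rightarrow> 'o \<Rightarrow> (('o, 'm) word \<Rightarrow> 't :: ab_group_add) \<Rightarrow> ('o, 'm) word \<Rightarrow> 't"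
  where "bh A X \<phi> w = (\<Sum>(r, n) \<in> {(r, n). 1 \<le> n \<and> r + n \<le> length w}.
     sg (wdeg (drop (r + n) w)) (\<phi> (b_insert A X w r n)))"

lemma finite_bh_index: "finite {(r, n). 1 \<le> n \<and> r + n \<le> (k :: nat)}"
  by (rule finite_subset[of _ "{..k} \<times> {..k}"]) auto

lemma bh_Nil [simp]: "bh A X \<phi> [] = 0"
  unfolding bh_def by (rule sum.neutral) auto

text \<open>The operation either swallows the first letter or acts behind it. Its sign counts only
  the letters to its right, so the second kind of term is the same sum for the shorter word, with no
  extra sign.\<close>

lemma bh_cut1_Cons:
  "bh A X \<phi> ((Y, d, x) # w) =
     cut1 (\<lambda>u v. sg (wdeg v) (\<phi> ((wtgt X u, wdeg u + 1, bop A X u) # v))) ((Y, d, x) # w) +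
     bh A Y (\<lambda>v. \<phi> ((Y, d, x) # v)) w"
proof -
  let ?w = "(Y, d, x) # w"
  let ?g = "\<lambda>(r, n). sg (wdeg (drop (r + n) ?w)) (\<phi> (b_insert A X ?w r n))"
  have split: "{(r, n). 1 \<le> n \<and> r + n \<le> length ?w} =
      Pair 0 ` {1..length ?w} \<union> (\<lambda>(r, n). (Suc r, n)) ` {(r, n). 1 \<le> n \<and> r + n \<le> length w}"
    (is "?I = ?P \<union> ?Q")
  proof (intro equalityI subsetI)
    fix p assume "p \<in> ?I"
    then obtain r n where p: "p = (r, n)" "1 \<le> n" "r + n \<le> length ?w" by auto
    show "p \<in> ?P \<union> ?Q"
    proof (cases r)
      case (Suc r')
      then show ?thesis using p by (intro UnI2 image_eqI[of _ _ "(r', n)"]) auto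
    qed (use p in auto)
  qed auto
  have "bh A X \<phi> ?w = sum ?g ?P + sum ?g ?Q"
    unfolding bh_def split
    by (rule sum.union_disjoint) (auto intro!: finite_imageI simp: finite_bh_index[simplified])
  also have "sum ?g ?P = cut1 (\<lambda>u v. sg (wdeg v) (\<phi> ((wtgt X u, wdeg u + 1, bop A X u) # v))) ?w"
    unfolding cut1_sum by (subst sum.reindex) (auto simp: inj_on_def b_insert_def Let_def)
  also have "sum ?g ?Q = bh A Y (\<lambda>v. \<phi> ((Y, d, x) # v)) w"
    unfolding bh_def
    by (subst sum.reindex) (auto simp: inj_on_def b_insert_def Let_def intro!: sum.cong)
  finally show ?thesis .
qed

lemma bh_add: "bh A X (\<lambda>w. \<phi> w + \<psi> w) w = bh A X \<phi> w + bh A X \<psi> w"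
  by (simp add: bh_def sg_add case_prod_unfold sum.distrib)

lemma bh_minus: "bh A X (\<lambda>w. - \<phi> w) w = - bh A X \<phi> w"
  by (simp add: bh_def sg_minus case_prod_unfold sum_negf)

lemma bh_diff: "bh A X (\<lambda>w. \<phi> w - \<psi> w) w = bh A X \<phi> w - bh A X \<psi> w"
  by (simp add: bh_def sg_diff case_prod_unfold sum_subtractf)

lemma bh_0 [simp]: "bh A X (\<lambda>w. 0) w = 0"
  by (simp add: bh_def case_prod_unfold)

lemma bh_sg: "bh A X (\<lambda>w. sg n (\<phi> w)) w = sg n (bh A X \<phi> w)"
  by (auto simp: sg_def bh_minus)

lemma bh_act: "bh A X (\<lambda>w. act R a (\<phi> w)) w = act R a (bh A X \<phi> w)"
  by (simp add: bh_def act_sum act_sg case_prod_unfold)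

lemma b_insert_facts:
  assumes "1 \<le> n" "r + n \<le> length w"
  shows "b_insert A X w r n \<noteq> []" "wtgt X (b_insert A X w r n) = wtgt X w"
    "wdeg (b_insert A X w r n) = wdeg w + 1" "length (b_insert A X w r n) \<le> length w"
proof -
  let ?u = "take r w" and ?v = "take n (drop r w)" and ?t = "drop (r + n) w"
  have w: "w = ?u @ ?v @ ?t" by (metis append_take_drop_id drop_drop add.commute)
  have "wtgt X w = wtgt X (?u @ ?v @ ?t)" "wdeg w = wdeg (?u @ ?v @ ?t)" by (metis w)+
  then show "b_insert A X w r n \<noteq> []" "wtgt X (b_insert A X w r n) = wtgt X w"
    "wdeg (b_insert A X w r n) = wdeg w + 1" "length (b_insert A X w r n) \<le> length w"
    using assms by (simp_all add: b_insert_def Let_def)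
qed

text \<open>The one consequence of the axioms needed for insertions to stay well-formed. It is
  separated out because for the category of functors it is known before the A-infinity
  relations.\<close>

definition bclosed :: "('k, 'o, 'm) ainf_cat \<Rightarrow> bool" where
  "bclosed A \<longleftrightarrow> (\<forall>X w. is_word A X w \<longrightarrow> w \<noteq> [] \<longrightarrow>
     bop A X w \<in> carrier (sMor A X (wtgt X w) (wdeg w + 1)))"

lemma b_insert_word:
  assumes "bclosed A" "is_word A X w" "1 \<le> n" "r + n \<le> length w"
  shows "is_word A X (b_insert A X w r n)"
proof -
  let ?u = "take r w" and ?v = "take n (drop r w)" and ?t = "drop (r + n) w"
  have w: "w = ?u @ ?v @ ?t" by (metis append_take_drop_id drop_drop add.commute)
  have *: "is_word A X (?u @ ?v @ ?t)" using assms(2) by (metis w)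
  have "?v \<noteq> []" using assms by auto
  then have "bop A (wtgt X ?u) ?v \<in> carrier (sMor A (wtgt X ?u) (wtgt (wtgt X ?u) ?v) (wdeg ?v + 1))"
    using * assms(1) unfolding bclosed_def is_word_append by blast
  then show ?thesis using * by (auto simp: is_word_append b_insert_def Let_def dest: is_word_tgt)
qed

lemma bh_cong:
  assumes "\<And>w'. w' \<noteq> [] \<Longrightarrow> wtgt X w' = wtgt X w \<Longrightarrow> wdeg w' = wdeg w + 1 \<Longrightarrow>
     length w' \<le> length w \<Longrightarrow> \<phi> w' = \<psi> w'"
  shows "bh A X \<phi> w = bh A X \<psi> w"
  unfolding bh_def by (rule sum.cong) (auto simp: assms b_insert_facts)

lemma bh_cong_word:
  assumes "bclosed A" "is_word A X w"
    "\<And>w'. is_word A X w' \<Longrightarrow> w' \<noteq> [] \<Longrightarrow> wtgt X w' = wtgt X w \<Longrightarrow> wdeg w' = wdeg w + 1 \<Longrightarrow>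
     length w' \<le> length w \<Longrightarrow> \<phi> w' = \<psi> w'"
  shows "bh A X \<phi> w = bh A X \<psi> w"
  unfolding bh_def by (rule sum.cong) (auto simp: assms b_insert_facts b_insert_word)

text \<open>The codifferential is a coderivation: the letter produced by an operation is never cut,
  so each operation acts wholly in the first or wholly in the second part, and acting in the first
  costs the sign of passing the second.\<close>

lemma bh_cut:
  "bh A X (cut F) w =
     cut (\<lambda>u v. sg (wdeg v) (bh A X (\<lambda>u. F u v) u) + bh A (wtgt X u) (F u) v) w"
proof (induction w arbitrary: X F)
  case (Cons p w)
  obtain Y d x where p: "p = (Y, d, x)" by (cases p)
  let ?b = "\<lambda>u. (wtgt X u, wdeg u + 1, bop A X u)"
  have "bh A X (cut F) (p # w) =
      cut1 (\<lambda>u v. sg (wdeg v) (F [] (?b u # v) + cut (\<lambda>q. F (?b u # q)) v)) (p # w) +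
      bh A Y (\<lambda>v. F [] (p # v) + cut (\<lambda>q. F (p # q)) v) w"
    by (simp add: p bh_cut1_Cons)
  also have "\<dots> = bh A X (F []) (p # w) +
      (cut1 (\<lambda>u v. sg (wdeg v) (cut (\<lambda>q. F (?b u # q)) v)) (p # w) + bh A Y (cut (\<lambda>q. F (p # q))) w)"
    by (simp only: p bh_cut1_Cons sg_add cut1_add bh_add ac_simps)
  also have "cut1 (\<lambda>u v. sg (wdeg v) (cut (\<lambda>q. F (?b u # q)) v)) (p # w) =
      cut1 (\<lambda>u v. cut (\<lambda>q r. sg (wdeg r) (sg (wdeg q) (F (?b u # q) r))) v) (p # w)"
    by (rule cut1_cong, subst cut_sg[symmetric], rule cut_cong) (auto simp: add.commute)
  also have "\<dots> = cut (\<lambda>u v. cut1 (\<lambda>q r. sg (wdeg v) (sg (wdeg r) (F (?b q # r) v))) u) (p # w)"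
    by (rule cut_assoc1[symmetric])
  also have "\<dots> = cut (\<lambda>u v. sg (wdeg v) (cut1 (\<lambda>q r. sg (wdeg r) (F (?b q # r) v)) (p # u))) w"
    by (simp only: cut.simps cut1.simps cut1_sg cut_sg add_0 sg_zero)
  also have "bh A Y (cut (\<lambda>q. F (p # q))) w = cut (\<lambda>u v. sg (wdeg v) (bh A Y (\<lambda>u. F (p # u) v) u)
      + bh A (wtgt X (p # u)) (F (p # u)) v) w"
    by (subst Cons.IH) (simp add: p)
  also have "cut (\<lambda>u v. sg (wdeg v) (cut1 (\<lambda>q r. sg (wdeg r) (F (?b q # r) v)) (p # u))) w + \<dots> =
      cut (\<lambda>u v. sg (wdeg v) (bh A X (\<lambda>u. F u v) (p # u)) + bh A (wtgt X (p # u)) (F (p # u)) v) w"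
    unfolding cut_add[symmetric]
    by (rule cut_cong) (simp only: p bh_cut1_Cons sg_add ac_simps)
  finally show ?case by simp
qed simp

lemma bh_cut1:
  "bh A X (cut1 F) w =
     cut1 (\<lambda>u v. sg (wdeg v) (bh A X (\<lambda>u. F u v) u) + bh A (wtgt X u) (F u) v) w"
proof -
  have *: "bh A X (\<lambda>u. if u = [] then 0 else F u v) u = bh A X (\<lambda>u. F u v) u" for u v
    by (rule bh_cong) auto
  have "bh A X (cut1 F) w = bh A X (cut (\<lambda>u v. if u = [] then 0 else F u v)) w"
    by (simp add: cut1_cut[abs_def])
  also have "\<dots> = cut (\<lambda>u v. sg (wdeg v) (bh A X (\<lambda>u. F u v) u) +
      bh A (wtgt X u) (\<lambda>v. if u = [] then 0 else F u v) v) w"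
    by (simp add: bh_cut *)
  also have "\<dots> = cut1 (\<lambda>u v. sg (wdeg v) (bh A X (\<lambda>u. F u v) u) + bh A (wtgt X u) (F u) v) w"
    unfolding cut1_cut by (rule cut_cong) auto
  finally show ?thesis .
qed

text \<open>Only the operation that consumes the whole word leaves a single letter; all other
  insertions produce words on which \<open>\<phi>\<close> vanishes.\<close>

lemma bh_singleton_support:
  assumes "w \<noteq> []" "\<And>w'. length w' > 1 \<Longrightarrow> \<phi> w' = 0"
  shows "bh A X \<phi> w = \<phi> [(wtgt X w, wdeg w + 1, bop A X w)]"
proof -
  let ?I = "{(r, n). 1 \<le> n \<and> r + n \<le> length w}"
  have "bh A X \<phi> w = (\<Sum>(r, n) \<in> {(0, length w)}. sg (wdeg (drop (r + n) w)) (\<phi> (b_insert A X w r n)))"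
    unfolding bh_def
  proof (rule sum.mono_neutral_right)
    show "\<forall>i \<in> ?I - {(0, length w)}. (case i of (r, n) \<Rightarrow>
        sg (wdeg (drop (r + n) w)) (\<phi> (b_insert A X w r n))) = 0"
    proof
      fix i assume "i \<in> ?I - {(0, length w)}"
      obtain r n where "i = (r, n)" by (cases i)
      then have i: "i = (r, n)" "1 \<le> n" "r + n \<le> length w" "r \<noteq> 0 \<or> n \<noteq> length w"
        using \<open>i \<in> _\<close> by auto
      then have "length (b_insert A X w r n) > 1"
        by (auto simp: b_insert_def Let_def)
      then show "(case i of (r, n) \<Rightarrow> sg (wdeg (drop (r + n) w)) (\<phi> (b_insert A X w r n))) = 0"
        using i assms(2) by simp
    qed
    show "finite ?I" by (rule finite_bh_index)
    show "{(0, length w)} \<subseteq> ?I" using assms(1) by (simp add: Suc_le_eq)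
  qed
  then show ?thesis by (simp add: b_insert_def)
qed

section \<open>The sums over decompositions defining functors and their transformations\<close>

text \<open>The functional \<open>\<phi>\<close> composed with
  \<open>(r\<^sup>1 \<otimes> \<dots> \<otimes> r\<^sup>n)\<theta>\<close>. For the empty word
  \<open>rs\<close> it is composition with the coalgebra map that the functor \<open>f\<close>
  induces.\<close>

definition th ::
  "('oa, 'ma, 'ob, 'mb) ainf_fun
    \<Rightarrow> (('oa, 'ma, 'ob, 'mb) ainf_fun, ('oa, 'ma, 'mb) ainf_trans) word
    \<Rightarrow> 'oa \<Rightarrow> (('ob, 'mb) word \<Rightarrow> 't :: ab_group_add) \<Rightarrow> ('oa, 'ma) word \<Rightarrow> 't" where
  "th f rs X \<phi> w = (\<Sum>ps \<in> theta_splits (length rs) w.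
     sg (theta_sign rs ps) (\<phi> (theta_tensor f X rs ps)))"

definition fletter ::
  "('oa, 'ma, 'ob, 'mb) ainf_fun \<Rightarrow> 'oa \<Rightarrow> ('oa, 'ma) word \<Rightarrow> 'ob \<times> int \<times> 'mb" where
  "fletter f X u = (fob f (wtgt X u), wdeg u, fmp f X u)"

definition rletter ::
  "('oa, 'ma, 'ob, 'mb) ainf_fun \<Rightarrow> int \<Rightarrow> ('oa, 'ma, 'mb) ainf_trans \<Rightarrow> 'oa \<Rightarrow> ('oa, 'ma) word
    \<Rightarrow> 'ob \<times> int \<times> 'mb" where
  "rletter g d r X u = (fob g (wtgt X u), wdeg u + d, r X u)"

lemma theta_splits_rec:
  "theta_splits n w = (if n = 0 \<and> w = [] then {[]} else {}) \<union>
     (\<Union>(u, v) \<in> {(u, v). u @ v = w \<and> u \<noteq> []}. Cons (False, u) ` theta_splits n v) \<union>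
     (case n of 0 \<Rightarrow> {} | Suc m \<Rightarrow>
        (\<Union>(u, v) \<in> {(u, v). u @ v = w}. Cons (True, u) ` theta_splits m v))"
  (is "_ = ?R")
proof (intro equalityI subsetI)
  fix ps assume ps: "ps \<in> theta_splits n w"
  show "ps \<in> ?R"
  proof (cases ps)
    case (Cons p qs)
    obtain b u where p: "p = (b, u)" by (cases p)
    show ?thesis
    proof (cases b)
      case True
      with ps Cons p obtain m where "n = Suc m" "qs \<in> theta_splits m (concat (map snd qs))"
        "w = u @ concat (map snd qs)"
        by (cases n) (auto simp: theta_splits_def)
      then have "ps \<in> (\<Union>(u, v) \<in> {(u, v). u @ v = w}. Cons (True, u) ` theta_splits m v)" "n = Suc m"
        using Cons p True by auto
      then show ?thesis by simp
    next
      case False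
      with ps Cons p have "qs \<in> theta_splits n (concat (map snd qs))" "u \<noteq> []"
        "w = u @ concat (map snd qs)"
        by (auto simp: theta_splits_def)
      then show ?thesis using Cons p False by auto
    qed
  qed (use ps in \<open>auto simp: theta_splits_def\<close>)
qed (auto simp: theta_splits_def split: nat.splits if_splits)

lemma finite_theta_splits: "finite (theta_splits n w)"
proof (induction "n + length w" arbitrary: n w rule: less_induct)
  case less
  have "finite (\<Union>(u, v) \<in> {(u, v). u @ v = w \<and> u \<noteq> []}. Cons (False, u) ` theta_splits n v)"
    by (intro finite_UN_I finite_subset[OF _ finite_cuts[of w]]) (auto intro!: finite_imageI less)
  moreover have "finite (case n of 0 \<Rightarrow> {} | Suc m \<Rightarrow>
        (\<Union>(u, v) \<in> {(u, v). u @ v = w}. Cons (True, u) ` theta_splits m v))"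
  proof (cases n)
    case (Suc m)
    have "finite (\<Union>(u, v) \<in> {(u, v). u @ v = w}. Cons (True, u) ` theta_splits m v)"
      by (intro finite_UN_I finite_cuts) (auto intro!: finite_imageI less simp: Suc)
    then show ?thesis by (simp add: Suc)
  qed simp
  ultimately show ?case by (subst theta_splits_rec) simp
qed

lemma sum_Cons_image:
  assumes "finite K" "\<And>u v. (u, v) \<in> K \<Longrightarrow> u @ v = w"
  shows "(\<Sum>ps \<in> (\<Union>(u, v) \<in> K. Cons (b, u) ` theta_splits n v). g ps) =
    (\<Sum>(u, v) \<in> K. \<Sum>ps \<in> theta_splits n v. g ((b, u) # ps))"
proof -
  have "(\<Sum>ps \<in> (\<Union>(u, v) \<in> K. Cons (b, u) ` theta_splits n v). g ps) =
      (\<Sum>(u, v) \<in> K. \<Sum>ps \<in> Cons (b, u) ` theta_splits n v. g ps)"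
  proof (subst sum.UNION_disjoint)
    show "\<forall>i\<in>K. \<forall>j\<in>K. i \<noteq> j \<longrightarrow>
      (case i of (u, v) \<Rightarrow> Cons (b, u) ` theta_splits n v) \<inter>
      (case j of (u, v) \<Rightarrow> Cons (b, u) ` theta_splits n v) = {}"
      by (auto simp: theta_splits_def)
  qed (auto simp: assms finite_theta_splits case_prod_unfold)
  also have "\<dots> = (\<Sum>(u, v) \<in> K. \<Sum>ps \<in> theta_splits n v. g ((b, u) # ps))"
    by (rule sum.cong[OF refl]) (simp add: sum.reindex case_prod_unfold)
  finally show ?thesis .
qed

text \<open>Expansion by the first piece: a functor piece is nonempty, hence \<open>cut1\<close>,
  while a transformation piece may be empty, hence \<open>cut\<close>. A transformation in the first
  piece has to pass all remaining inputs, whence the sign with \<open>d * wdeg v\<close>.\<close>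

lemma th_rec:
  "th f rs X \<phi> w =
     (if w = [] \<and> rs = [] then \<phi> [] else 0) +
     cut1 (\<lambda>u v. th f rs (wtgt X u) (\<lambda>z. \<phi> (fletter f X u # z)) v) w +
     (case rs of [] \<Rightarrow> 0 | (g, d, r) # rs' \<Rightarrow>
        cut (\<lambda>u v. sg (d * wdeg v) (th g rs' (wtgt X u) (\<lambda>z. \<phi> (rletter g d r X u # z)) v)) w)"
proof -
  let ?g = "\<lambda>ps. sg (theta_sign rs ps) (\<phi> (theta_tensor f X rs ps))"
  let ?n = "length rs"
  let ?P = "if ?n = 0 \<and> w = [] then {[]} else {}"
  let ?Q = "\<Union>(u, v) \<in> {(u, v). u @ v = w \<and> u \<noteq> []}. Cons (False, u) ` theta_splits ?n v"
  let ?S = "case ?n of 0 \<Rightarrow> {} | Suc m \<Rightarrow>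
        (\<Union>(u, v) \<in> {(u, v). u @ v = w}. Cons (True, u) ` theta_splits m v)"
  have fin: "finite (?P \<union> ?Q \<union> ?S)"
    using finite_theta_splits[of ?n w] by (subst (asm) theta_splits_rec)
  have "sum ?g (theta_splits ?n w) = sum ?g (?P \<union> ?Q \<union> ?S)" by (subst theta_splits_rec) simp
  also have "\<dots> = sum ?g (?P \<union> ?Q) + sum ?g ?S"
    using fin by (intro sum.union_disjoint) (auto split: nat.splits)
  also have "sum ?g (?P \<union> ?Q) = sum ?g ?P + sum ?g ?Q"
    using fin by (intro sum.union_disjoint) auto
  also have "sum ?g ?P = (if w = [] \<and> rs = [] then \<phi> [] else 0)" by simp
  also have "sum ?g ?Q = cut1 (\<lambda>u v. th f rs (wtgt X u) (\<lambda>z. \<phi> (fletter f X u # z)) v) w"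
    unfolding cut1_set
    by (subst sum_Cons_image[where w = w])
      (auto simp: th_def fletter_def intro: finite_subset[OF _ finite_cuts[of w]] intro!: sum.cong)
  also have "sum ?g ?S = (case rs of [] \<Rightarrow> 0 | (g, d, r) # rs' \<Rightarrow>
        cut (\<lambda>u v. sg (d * wdeg v) (th g rs' (wtgt X u) (\<lambda>z. \<phi> (rletter g d r X u # z)) v)) w)"
  proof (cases rs)
    case (Cons p rs')
    obtain g d r where p: "p = (g, d, r)" by (cases p)
    show ?thesis unfolding Cons p
      by (simp add: cut_set, subst sum_Cons_image[where w = w])
        (auto simp: finite_cuts th_def rletter_def theta_splits_def sg_sum intro!: sum.cong)
  qed simp
  finally show ?thesis by (simp only: th_def[of f rs X \<phi> w])
qed

lemma theta_tensor_nonempty: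
  assumes "ps \<in> theta_splits (length rs) w" "rs \<noteq> [] \<or> w \<noteq> []"
  shows "theta_tensor f X rs ps \<noteq> []"
proof -
  obtain b u qs where ps: "ps = (b, u) # qs"
    using assms by (cases ps) (auto simp: theta_splits_def)
  then show ?thesis using assms(1) by (cases b; cases rs) (auto simp: theta_splits_def)
qed

lemma th_cong_nonempty:
  assumes "rs \<noteq> [] \<or> w \<noteq> []" "\<And>z. z \<noteq> [] \<Longrightarrow> \<phi> z = \<psi> z"
  shows "th f rs X \<phi> w = th f rs X \<psi> w"
  unfolding th_def using assms by (intro sum.cong refl) (simp add: theta_tensor_nonempty)

lemma th_Nil_Nil [simp]: "th f [] X \<phi> [] = \<phi> []"
  by (subst th_rec) simp

lemma th_add: "th f rs X (\<lambda>z. \<phi> z + \<psi> z) w = th f rs X \<phi> w + th f rs X \<psi> w"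
  by (simp add: th_def sg_add sum.distrib)

lemma th_add_fun:
  "th f rs X (\<lambda>z. \<phi> z + \<psi> z) = (\<lambda>w. th f rs X \<phi> w + th f rs X \<psi> w)"
  by (rule ext) (rule th_add)

lemma th_minus: "th f rs X (\<lambda>z. - \<phi> z) w = - th f rs X \<phi> w"
  by (simp add: th_def sg_minus sum_negf)

lemma th_0 [simp]: "th f rs X (\<lambda>z. 0) w = 0"
  by (simp add: th_def)

lemma th_sg: "th f rs X (\<lambda>z. sg n (\<phi> z)) w = sg n (th f rs X \<phi> w)"
  by (auto simp: sg_def th_minus)

lemma th_act: "th f rs X (\<lambda>z. act R a (\<phi> z)) w = act R a (th f rs X \<phi> w)"
  by (simp add: th_def act_sum act_sg)

text \<open>\<open>\<theta>\<close> is a map of coalgebras: cutting the output means cutting the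
  inputs and the list of transformations simultaneously, and the transformations of the first part
  pass the inputs of the second. The induction runs over both lengths together, because the
  expansion by the first piece shortens one or both.\<close>

lemma th_cut:
  fixes f :: "('oa, 'ma, 'ob, 'mb) ainf_fun" and w :: "('oa, 'ma) word"
    and rs :: "(('oa, 'ma, 'ob, 'mb) ainf_fun, ('oa, 'ma, 'mb) ainf_trans) word"
  shows "th f rs X (cut G) w =
     cut (\<lambda>rs1 rs2. cut (\<lambda>u v. sg (wdeg rs1 * wdeg v)
       (th f rs1 X (\<lambda>z1. th (wtgt f rs1) rs2 (wtgt X u) (G z1) v) u)) w) rs"
proof (induction "length rs + length w" arbitrary: f rs X G w rule: less_induct)
  case less
  let ?E = "\<lambda>rs1 rs2 u v. th f rs1 X (\<lambda>z1. th (wtgt f rs1) rs2 (wtgt X u) (G z1) v) u"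
  let ?i = "\<lambda>rs1 u. if u = [] \<and> rs1 = [] then (1 :: nat) else 0"
  \<comment> \<open>\<open>A\<close>, \<open>B\<close> and \<open>C\<close> are the three summands
    of \<open>th_rec\<close> for the first factor: nothing in it, a functor piece in front, a
    transformation piece in front.\<close>
  define A where "A rs1 rs2 u v = (if u = [] \<and> rs1 = [] then th (wtgt f rs1) rs2 (wtgt X u) (G []) v else 0)"
    for rs1 rs2 :: "(('oa, 'ma, 'ob, 'mb) ainf_fun, ('oa, 'ma, 'mb) ainf_trans) word"
      and u v :: "('oa, 'ma) word"
  define B where "B rs1 rs2 u v = cut1 (\<lambda>p q. th f rs1 (wtgt X p)
     (\<lambda>z1. th (wtgt f rs1) rs2 (wtgt X u) (G (fletter f X p # z1)) v) q) u" for rs1 rs2 u v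
  define C where "C rs1 rs2 u v = (case rs1 of [] \<Rightarrow> 0 | (g, d, r) # rs' \<Rightarrow>
      cut (\<lambda>p q. sg (d * wdeg q) (th g rs' (wtgt X p)
     (\<lambda>z1. th (wtgt f rs1) rs2 (wtgt X u) (G (rletter g d r X p # z1)) v) q)) u)" for rs1 rs2 u v
  have E: "?E rs1 rs2 u v = A rs1 rs2 u v + B rs1 rs2 u v + C rs1 rs2 u v" for rs1 rs2 u v
    by (subst th_rec) (simp add: A_def B_def C_def)
  have A: "cut (\<lambda>rs1 rs2. cut (\<lambda>u v. sg (wdeg rs1 * wdeg v) (A rs1 rs2 u v)) w) rs = th f rs X (G []) w"
  proof -
    have "cut (\<lambda>u v. sg (wdeg rs1 * wdeg v) (A rs1 rs2 u v)) w =
        (if rs1 = [] then th f rs2 X (G []) w else 0)" for rs1 rs2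
    proof -
      have "cut1 (\<lambda>u v. sg (wdeg rs1 * wdeg v) (A rs1 rs2 u v)) w = cut1 (\<lambda>u v. 0) w"
        by (rule cut1_cong) (simp add: A_def)
      then show ?thesis by (simp add: cut_cut1 A_def)
    qed
    then have "cut (\<lambda>rs1 rs2. cut (\<lambda>u v. sg (wdeg rs1 * wdeg v) (A rs1 rs2 u v)) w) rs =
      th f rs X (G []) w + cut1 (\<lambda>rs1 rs2. if rs1 = [] then th f rs2 X (G []) w else 0) rs"
      by (simp add: cut_cut1)
    also have "cut1 (\<lambda>rs1 rs2. if rs1 = [] then th f rs2 X (G []) w else 0) rs = cut1 (\<lambda>u v. 0) rs"
      by (rule cut1_cong) simp
    finally show ?thesis by simp
  qed
  have B: "cut (\<lambda>rs1 rs2. cut (\<lambda>u v. sg (wdeg rs1 * wdeg v) (B rs1 rs2 u v)) w) rs =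
      cut1 (\<lambda>u v. th f rs (wtgt X u) (cut (\<lambda>z1. G (fletter f X u # z1))) v) w"
  proof -
    have "cut (\<lambda>rs1 rs2. cut (\<lambda>u v. sg (wdeg rs1 * wdeg v) (B rs1 rs2 u v)) w) rs =
        cut (\<lambda>rs1 rs2. cut1 (\<lambda>p v'. cut (\<lambda>q v. sg (wdeg rs1 * wdeg v) (th f rs1 (wtgt X p)
     (\<lambda>z1. th (wtgt f rs1) rs2 (wtgt X (p @ q)) (G (fletter f X p # z1)) v) q)) v') w) rs"
    proof (rule cut_cong)
      fix rs1 rs2
      let ?F = "\<lambda>p q v. sg (wdeg rs1 * wdeg v) (th f rs1 (wtgt X p)
           (\<lambda>z1. th (wtgt f rs1) rs2 (wtgt X (p @ q)) (G (fletter f X p # z1)) v) q)"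
      have "cut (\<lambda>u v. sg (wdeg rs1 * wdeg v) (B rs1 rs2 u v)) w = cut (\<lambda>u v. cut1 (\<lambda>p q. ?F p q v) u) w"
        unfolding B_def by (rule cut_cong, subst cut1_sg[symmetric], rule cut1_cong) auto
      then show "cut (\<lambda>u v. sg (wdeg rs1 * wdeg v) (B rs1 rs2 u v)) w = cut1 (\<lambda>p v'. cut (\<lambda>q v. ?F p q v) v') w"
        by (simp only: cut_assoc1)
    qed
    also have "\<dots> = cut1 (\<lambda>p v'. cut (\<lambda>rs1 rs2. cut (\<lambda>q v. sg (wdeg rs1 * wdeg v) (th f rs1 (wtgt X p)
     (\<lambda>z1. th (wtgt f rs1) rs2 (wtgt X (p @ q)) (G (fletter f X p # z1)) v) q)) v') rs) w"
      unfolding cut1_cut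
      by (subst cut_swap, rule cut_cong) simp
    also have "\<dots> = cut1 (\<lambda>u v. th f rs (wtgt X u) (cut (\<lambda>z1. G (fletter f X u # z1))) v) w"
      by (rule cut1_cong, subst less) auto
    finally show ?thesis .
  qed
  have C: "cut (\<lambda>rs1 rs2. cut (\<lambda>u v. sg (wdeg rs1 * wdeg v) (C rs1 rs2 u v)) w) rs =
     (case rs of [] \<Rightarrow> 0 | (g, d, r) # rs' \<Rightarrow> cut (\<lambda>u v. sg (d * wdeg v)
       (th g rs' (wtgt X u) (cut (\<lambda>z1. G (rletter g d r X u # z1))) v)) w)"
  proof (cases rs)
    case (Cons p rs')
    obtain g d r where p: "p = (g, d, r)" by (cases p)
    let ?F = "\<lambda>rs1 rs2 p q v. sg (d * wdeg (q @ v)) (sg (wdeg rs1 * wdeg v) (th g rs1 (wtgt X p)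
           (\<lambda>z1. th (wtgt g rs1) rs2 (wtgt X (p @ q)) (G (rletter g d r X p # z1)) v) q))"
    have "cut (\<lambda>rs1 rs2. cut (\<lambda>u v. sg (wdeg rs1 * wdeg v) (C rs1 rs2 u v)) w) rs =
        cut (\<lambda>rs1 rs2. cut (\<lambda>u v. sg (wdeg ((g, d, r) # rs1) * wdeg v) (C ((g, d, r) # rs1) rs2 u v)) w) rs'"
      by (simp add: Cons p C_def)
    also have "\<dots> = cut (\<lambda>rs1 rs2. cut (\<lambda>u v. cut (\<lambda>p q. ?F rs1 rs2 p q v) u) w) rs'"
      unfolding C_def list.case prod.case
      by (intro cut_cong, subst cut_sg[symmetric], rule cut_cong)
        (auto simp: algebra_simps intro!: sg_cong)
    also have "\<dots> = cut (\<lambda>rs1 rs2. cut (\<lambda>p v'. cut (\<lambda>q v. ?F rs1 rs2 p q v) v') w) rs'"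
      by (simp only: cut_assoc)
    also have "\<dots> = cut (\<lambda>p v'. cut (\<lambda>rs1 rs2. cut (\<lambda>q v. ?F rs1 rs2 p q v) v') rs') w"
      by (rule cut_swap)
    also have "\<dots> = cut (\<lambda>u v. sg (d * wdeg v)
       (th g rs' (wtgt X u) (cut (\<lambda>z1. G (rletter g d r X u # z1))) v)) w"
    proof (rule cut_cong)
      fix u v' assume "u @ v' = w"
      have "cut (\<lambda>rs1 rs2. cut (\<lambda>q v. ?F rs1 rs2 u q v) v') rs' = sg (d * wdeg v')
        (cut (\<lambda>rs1 rs2. cut (\<lambda>q v. (sg (wdeg rs1 * wdeg v) (th g rs1 (wtgt X u)
           (\<lambda>z1. th (wtgt g rs1) rs2 (wtgt X (u @ q)) (G (rletter g d r X u # z1)) v) q))) v') rs')"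
        by (subst cut_sg[symmetric], rule cut_cong, subst cut_sg[symmetric], rule cut_cong) auto
      also have "\<dots> = sg (d * wdeg v')
       (th g rs' (wtgt X u) (cut (\<lambda>z1. G (rletter g d r X u # z1))) v')"
        by (subst less) (use \<open>u @ v' = w\<close> Cons p in auto)
      finally show "cut (\<lambda>rs1 rs2. cut (\<lambda>q v. ?F rs1 rs2 u q v) v') rs' = sg (d * wdeg v')
       (th g rs' (wtgt X u) (cut (\<lambda>z1. G (rletter g d r X u # z1))) v')" .
    qed
    finally show ?thesis by (simp add: Cons p)
  qed (simp add: C_def)
  have "th f rs X (cut G) w = th f rs X (G []) w +
      cut1 (\<lambda>u v. th f rs (wtgt X u) (cut (\<lambda>z1. G (fletter f X u # z1))) v) w +
      (case rs of [] \<Rightarrow> 0 | (g, d, r) # rs' \<Rightarrow> cut (\<lambda>u v. sg (d * wdeg v)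
       (th g rs' (wtgt X u) (cut (\<lambda>z1. G (rletter g d r X u # z1))) v)) w)"
    by (subst th_rec, subst (2) th_rec)
      (simp add: th_add_fun cut1_add cut_add sg_add split: list.splits)
  then show ?case
    by (simp add: E sg_add cut_add A B C)
qed

text \<open>The first part of the output is empty exactly when it receives neither inputs nor
  transformations, so only that pair has to be left out.\<close>

lemma th_cut1:
  "th f rs X (cut1 G) w =
     cut (\<lambda>rs1 rs2. cut (\<lambda>u v. if rs1 = [] \<and> u = [] then 0 else sg (wdeg rs1 * wdeg v)
       (th f rs1 X (\<lambda>z1. th (wtgt f rs1) rs2 (wtgt X u) (G z1) v) u)) w) rs"
  unfolding cut1_cut[abs_def] th_cut
proof (intro cut_cong)
  fix rs1 rs2 u v
  let ?H = "\<lambda>z1 v. if z1 = [] then 0 else G z1 v"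
  have "th f rs1 X (\<lambda>z1. th (wtgt f rs1) rs2 (wtgt X u) (?H z1) v) u =
    (if rs1 = [] \<and> u = [] then 0 else th f rs1 X (\<lambda>z1. th (wtgt f rs1) rs2 (wtgt X u) (G z1) v) u)"
  proof (cases "rs1 = [] \<and> u = []")
    case False
    then have *: "rs1 \<noteq> [] \<or> u \<noteq> []" by simp
    have "th f rs1 X (\<lambda>z1. th (wtgt f rs1) rs2 (wtgt X u) (?H z1) v) u =
        th f rs1 X (\<lambda>z1. th (wtgt f rs1) rs2 (wtgt X u) (G z1) v) u"
      by (rule th_cong_nonempty[OF *]) simp
    then show ?thesis unfolding if_not_P[OF False] .
  qed simp
  then show "sg (wdeg rs1 * wdeg v) (th f rs1 X (\<lambda>z1. th (wtgt f rs1) rs2 (wtgt X u) (?H z1) v) u) =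
    (if rs1 = [] \<and> u = [] then 0
     else sg (wdeg rs1 * wdeg v) (th f rs1 X (\<lambda>z1. th (wtgt f rs1) rs2 (wtgt X u) (G z1) v) u))"
    by simp
qed

section \<open>Typing and linearity\<close>

lemma act_act:
  "cring R \<Longrightarrow> a \<in> carrier R \<Longrightarrow> b \<in> carrier R \<Longrightarrow> act R a (act R b x) = act R (a \<otimes>\<^bsub>R\<^esub> b) x"
proof (rule allmod_eqI)
  fix R' :: "'a ring" and M :: "('a, 'b) module"
  assume *: "cring R" "a \<in> carrier R" "b \<in> carrier R" and M: "module R' M"
  have ab: "a \<otimes>\<^bsub>R\<^esub> b \<in> carrier R" using * by (rule cring.cring_simprules(5))
  show "at_mod (act R a (act R b x)) R' M = at_mod (act R (a \<otimes>\<^bsub>R\<^esub> b) x) R' M"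
  proof (cases "R' = R")
    case True
    then have MR: "module R M" using M by (simp only:)
    show ?thesis
      unfolding True at_mod_act[OF MR]
      by (simp only: *(2,3) ab simp_thms if_True module.smult_assoc1[OF MR *(2,3) at_mod_closed[OF MR]])
  next
    case False
    show ?thesis by (simp only: at_mod_act[OF M] False simp_thms if_False)
  qed
qed

lemma act_commute:
  "cring R \<Longrightarrow> a \<in> carrier R \<Longrightarrow> b \<in> carrier R \<Longrightarrow> act R a (act R b x) = act R b (act R a x)"
  by (simp only: act_act cring.cring_simprules(14)[of R b a])

lemma lin_act:
  assumes "modular R A" "a \<in> carrier R" "lin R A X \<phi>"
  shows "lin R A X (\<lambda>w. act R a (\<phi> w))"
proof (rule linI)
  fix u Y d x y v b
  assume *: "b \<in> carrier R" "is_word A X (u @ (Y, d, x) # v)" "is_word A X (u @ (Y, d, y) # v)"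
  have R: "cring R" using assms(1) by (simp add: modular_def)
  then show "act R a (\<phi> (u @ (Y, d, b \<odot>\<^bsub>sMor A (wtgt X u) Y d\<^esub> x \<oplus>\<^bsub>sMor A (wtgt X u) Y d\<^esub> y) # v)) =
     act R b (act R a (\<phi> (u @ (Y, d, x) # v))) + act R a (\<phi> (u @ (Y, d, y) # v))"
    using linD[OF assms(3) *] act_commute[OF R assms(2) *(1)] by (simp add: act_add)
qed

definition ev ::
  "'k ring \<Rightarrow> ('o \<Rightarrow> 'o \<Rightarrow> int \<Rightarrow> ('k, 'n) module) \<Rightarrow> int \<Rightarrow> ('o \<Rightarrow> ('o, 'm) word \<Rightarrow> 'n)
    \<Rightarrow> 'o \<Rightarrow> ('o, 'm) word \<Rightarrow> ('k, 'n) allmod" where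
  "ev R M p \<phi> X w = emb R (M X (wtgt X w) (wdeg w + p)) (\<phi> X w)"

text \<open>The conditions of \<open>tensor_map\<close> for all lengths from \<open>n\<close> on,
  bundled into one. The second clause puts no bound on the length: the notion is used for
  \<open>n\<close> at most 1, where any word with a letter is long enough.\<close>

definition tlin ::
  "'k ring \<Rightarrow> ('k, 'o, 'm) ainf_cat \<Rightarrow> ('o \<Rightarrow> 'o \<Rightarrow> int \<Rightarrow> ('k, 'n) module) \<Rightarrow> nat \<Rightarrow> int
    \<Rightarrow> ('o \<Rightarrow> ('o, 'm) word \<Rightarrow> 'n) \<Rightarrow> bool" where
  "tlin R A M n p \<phi> \<longleftrightarrow>
     (\<forall>X w. is_word A X w \<longrightarrow> n \<le> length w \<longrightarrow> \<phi> X w \<in> carrier (M X (wtgt X w) (wdeg w + p))) \<and>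
     (\<forall>X u Y d x y v. \<forall>a \<in> carrier R.
        is_word A X (u @ (Y, d, x) # v) \<longrightarrow> is_word A X (u @ (Y, d, y) # v) \<longrightarrow>
        \<phi> X (u @ (Y, d, a \<odot>\<^bsub>sMor A (wtgt X u) Y d\<^esub> x \<oplus>\<^bsub>sMor A (wtgt X u) Y d\<^esub> y) # v) =
          a \<odot>\<^bsub>M X (wtgt Y v) (wdeg u + (d + wdeg v) + p)\<^esub> \<phi> X (u @ (Y, d, x) # v)
            \<oplus>\<^bsub>M X (wtgt Y v) (wdeg u + (d + wdeg v) + p)\<^esub> \<phi> X (u @ (Y, d, y) # v))"

definition modfam :: "'k ring \<Rightarrow> ('k, 'o, 'm) ainf_cat \<Rightarrow> ('o \<Rightarrow> 'o \<Rightarrow> int \<Rightarrow> ('k, 'n) module) \<Rightarrow> bool"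
  where "modfam R A M \<longleftrightarrow> (\<forall>X \<in> Obj A. \<forall>Y \<in> Obj A. \<forall>d. module R (M X Y d))"

lemma tlin_closed:
  "tlin R A M n p \<phi> \<Longrightarrow> is_word A X w \<Longrightarrow> n \<le> length w \<Longrightarrow>
     \<phi> X w \<in> carrier (M X (wtgt X w) (wdeg w + p))"
  by (simp add: tlin_def)

lemma tlin_comb:
  "tlin R A M n p \<phi> \<Longrightarrow> a \<in> carrier R \<Longrightarrow> is_word A X (u @ (Y, d, x) # v) \<Longrightarrow>
     is_word A X (u @ (Y, d, y) # v) \<Longrightarrow>
     \<phi> X (u @ (Y, d, a \<odot>\<^bsub>sMor A (wtgt X u) Y d\<^esub> x \<oplus>\<^bsub>sMor A (wtgt X u) Y d\<^esub> y) # v) =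
       a \<odot>\<^bsub>M X (wtgt Y v) (wdeg u + (d + wdeg v) + p)\<^esub> \<phi> X (u @ (Y, d, x) # v)
         \<oplus>\<^bsub>M X (wtgt Y v) (wdeg u + (d + wdeg v) + p)\<^esub> \<phi> X (u @ (Y, d, y) # v)"
  by (simp add: tlin_def)

text \<open>Once closure is known, \<open>emb_inject\<close> makes the equation in the module
  equivalent to its image in the universal group. A word with a marked letter has length at least 1,
  which is why \<open>n \<le> 1\<close> suffices for closure.\<close>

lemma tlin_iff_lin:
  assumes A: "modular R A" and M: "modfam R A M" and n: "n \<le> 1"
  shows "tlin R A M n p \<phi> \<longleftrightarrow>
    (\<forall>X w. is_word A X w \<longrightarrow> n \<le> length w \<longrightarrow> \<phi> X w \<in> carrier (M X (wtgt X w) (wdeg w + p))) \<and>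
    (\<forall>X. lin R A X (ev R M p \<phi> X))"
proof -
  have "(\<phi> X (u @ (Y, d, a \<odot>\<^bsub>sMor A (wtgt X u) Y d\<^esub> x \<oplus>\<^bsub>sMor A (wtgt X u) Y d\<^esub> y) # v) =
       a \<odot>\<^bsub>M X (wtgt Y v) (wdeg u + (d + wdeg v) + p)\<^esub> \<phi> X (u @ (Y, d, x) # v)
         \<oplus>\<^bsub>M X (wtgt Y v) (wdeg u + (d + wdeg v) + p)\<^esub> \<phi> X (u @ (Y, d, y) # v)) =
     (ev R M p \<phi> X (u @ (Y, d, a \<odot>\<^bsub>sMor A (wtgt X u) Y d\<^esub> x \<oplus>\<^bsub>sMor A (wtgt X u) Y d\<^esub> y) # v)
       = act R a (ev R M p \<phi> X (u @ (Y, d, x) # v)) + ev R M p \<phi> X (u @ (Y, d, y) # v))"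
    if cl: "\<And>X w. is_word A X w \<Longrightarrow> n \<le> length w \<Longrightarrow> \<phi> X w \<in> carrier (M X (wtgt X w) (wdeg w + p))"
      and *: "a \<in> carrier R" "is_word A X (u @ (Y, d, x) # v)" "is_word A X (u @ (Y, d, y) # v)"
    for X u Y d x y v a
  proof -
    let ?N = "M X (wtgt Y v) (wdeg u + (d + wdeg v) + p)"
    let ?z = "a \<odot>\<^bsub>sMor A (wtgt X u) Y d\<^esub> x \<oplus>\<^bsub>sMor A (wtgt X u) Y d\<^esub> y"
    have N: "module R ?N"
      using M is_word_src[OF *(2)] is_word_tgt[OF *(2)] by (simp add: modfam_def)
    interpret N: module R ?N by (rule N)
    have cl': "\<phi> X (u @ (Y, d, x) # v) \<in> carrier ?N" "\<phi> X (u @ (Y, d, y) # v) \<in> carrier ?N"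
      "\<phi> X (u @ (Y, d, ?z) # v) \<in> carrier ?N"
      using cl[OF *(2)] cl[OF *(3)] cl[OF word_comb[OF A *]] n by simp_all
    have "emb R ?N (a \<odot>\<^bsub>?N\<^esub> \<phi> X (u @ (Y, d, x) # v) \<oplus>\<^bsub>?N\<^esub> \<phi> X (u @ (Y, d, y) # v)) =
        act R a (emb R ?N (\<phi> X (u @ (Y, d, x) # v))) + emb R ?N (\<phi> X (u @ (Y, d, y) # v))"
      using cl' * by (simp add: emb_add[OF N] emb_smult[OF N])
    moreover have "a \<odot>\<^bsub>?N\<^esub> \<phi> X (u @ (Y, d, x) # v) \<oplus>\<^bsub>?N\<^esub> \<phi> X (u @ (Y, d, y) # v) \<in> carrier ?N"
      using cl' * by simp
    note emb_inject[OF N cl'(3) this]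
    ultimately show ?thesis by (simp add: ev_def)
  qed
  note eq = this
  show ?thesis
  proof
    assume t: "tlin R A M n p \<phi>"
    note cl = tlin_closed[OF t]
    have "lin R A X (ev R M p \<phi> X)" for X
    proof (rule linI)
      fix u Y d x y v a
      assume *: "a \<in> carrier R" "is_word A X (u @ (Y, d, x) # v)" "is_word A X (u @ (Y, d, y) # v)"
      show "ev R M p \<phi> X (u @ (Y, d, a \<odot>\<^bsub>sMor A (wtgt X u) Y d\<^esub> x \<oplus>\<^bsub>sMor A (wtgt X u) Y d\<^esub> y) # v)
         = act R a (ev R M p \<phi> X (u @ (Y, d, x) # v)) + ev R M p \<phi> X (u @ (Y, d, y) # v)"
        by (rule iffD1[OF eq[OF cl *] tlin_comb[OF t *]])
    qed
    then show "(\<forall>X w. is_word A X w \<longrightarrow> n \<le> length w \<longrightarrow> \<phi> X w \<in> carrier (M X (wtgt X w) (wdeg w + p))) \<and>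
      (\<forall>X. lin R A X (ev R M p \<phi> X))"
      using cl by simp
  next
    assume r: "(\<forall>X w. is_word A X w \<longrightarrow> n \<le> length w \<longrightarrow> \<phi> X w \<in> carrier (M X (wtgt X w) (wdeg w + p))) \<and>
      (\<forall>X. lin R A X (ev R M p \<phi> X))"
    then have cl: "\<And>X w. is_word A X w \<Longrightarrow> n \<le> length w \<Longrightarrow> \<phi> X w \<in> carrier (M X (wtgt X w) (wdeg w + p))"
      and l: "\<And>X. lin R A X (ev R M p \<phi> X)" by simp_all
    show "tlin R A M n p \<phi>"
      unfolding tlin_def
    proof (intro conjI allI ballI impI)
      fix X u Y d x y v a
      assume *: "a \<in> carrier R" "is_word A X (u @ (Y, d, x) # v)" "is_word A X (u @ (Y, d, y) # v)"
      show "\<phi> X (u @ (Y, d, a \<odot>\<^bsub>sMor A (wtgt X u) Y d\<^esub> x \<oplus>\<^bsub>sMor A (wtgt X u) Y d\<^esub> y) # v) =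
         a \<odot>\<^bsub>M X (wtgt Y v) (wdeg u + (d + wdeg v) + p)\<^esub> \<phi> X (u @ (Y, d, x) # v)
           \<oplus>\<^bsub>M X (wtgt Y v) (wdeg u + (d + wdeg v) + p)\<^esub> \<phi> X (u @ (Y, d, y) # v)"
        by (rule iffD2[OF eq[OF cl *] linD[OF l[of X] *]])
    qed (rule cl)
  qed
qed

lemma tlin_iff_tensor_map:
  assumes A: "modular R A" and M: "modfam R A M" and n: "n \<le> 1"
  shows "tlin R A M n p \<phi> \<longleftrightarrow> (\<forall>k\<ge>n. tensor_map R A M k p \<phi>)"
proof
  assume t: "tlin R A M n p \<phi>"
  show "\<forall>k\<ge>n. tensor_map R A M k p \<phi>"
  proof (intro allI impI)
    fix k assume "n \<le> k"
    have comb: "\<phi> X (u @ (Y, d, x \<oplus>\<^bsub>sMor A (wtgt X u) Y d\<^esub> y) # v) =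
          \<phi> X (u @ (Y, d, x) # v) \<oplus>\<^bsub>M X (wtgt Y v) (wdeg u + d + wdeg v + p)\<^esub> \<phi> X (u @ (Y, d, y) # v)"
      and scal: "\<And>a. a \<in> carrier R \<Longrightarrow> \<phi> X (u @ (Y, d, a \<odot>\<^bsub>sMor A (wtgt X u) Y d\<^esub> x) # v) =
          a \<odot>\<^bsub>M X (wtgt Y v) (wdeg u + d + wdeg v + p)\<^esub> \<phi> X (u @ (Y, d, x) # v)"
      if *: "is_word A X (u @ (Y, d, x) # v)" "is_word A X (u @ (Y, d, y) # v)"
      for X u Y d x y v
    proof -
      let ?S = "sMor A (wtgt X u) Y d" and ?N = "M X (wtgt Y v) (wdeg u + d + wdeg v + p)"
      have **: "wtgt X u \<in> Obj A" "Y \<in> Obj A" "x \<in> carrier ?S" "y \<in> carrier ?S"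
        "is_word A X u" "is_word A Y v"
        using * by (auto simp: is_word_append dest: is_word_src)
      interpret S: module R ?S using modularD[OF A] ** by simp
      have N: "module R ?N"
        using M is_word_src[OF *(1)] is_word_tgt[OF *(1)] by (simp add: modfam_def)
      interpret N: module R ?N by (rule N)
      have cl: "\<phi> X (u @ (Y, d, z) # v) \<in> carrier ?N" if "z \<in> carrier ?S" for z
        using tlin_closed[OF t, of X "u @ (Y, d, z) # v"] n ** that
        by (simp add: is_word_append ac_simps)
      have 1: "\<phi> X (u @ (Y, d, a \<odot>\<^bsub>?S\<^esub> x' \<oplus>\<^bsub>?S\<^esub> y') # v) =
          a \<odot>\<^bsub>?N\<^esub> \<phi> X (u @ (Y, d, x') # v) \<oplus>\<^bsub>?N\<^esub> \<phi> X (u @ (Y, d, y') # v)"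
        if "a \<in> carrier R" "x' \<in> carrier ?S" "y' \<in> carrier ?S" for a x' y'
        using tlin_comb[OF t that(1), of X u Y d x' v y'] ** that
        by (simp add: is_word_append add.assoc)
      show "\<phi> X (u @ (Y, d, x \<oplus>\<^bsub>?S\<^esub> y) # v) = \<phi> X (u @ (Y, d, x) # v) \<oplus>\<^bsub>?N\<^esub> \<phi> X (u @ (Y, d, y) # v)"
        using 1[OF modular_one[OF A] **(3,4)] ** cl by (simp add: S.smult_one N.smult_one)
      \<comment> \<open>Homogeneity is the combination with zero as second summand, so the vanishing
        of \<open>\<phi>\<close> at a zero letter comes out of additivity beforehand.\<close>
      have "\<phi> X (u @ (Y, d, \<zero>\<^bsub>?S\<^esub>) # v) = \<phi> X (u @ (Y, d, \<zero>\<^bsub>?S\<^esub>) # v) \<oplus>\<^bsub>?N\<^esub> \<phi> X (u @ (Y, d, \<zero>\<^bsub>?S\<^esub>) # v)"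
        using 1[OF modular_one[OF A], of "\<zero>\<^bsub>?S\<^esub>" "\<zero>\<^bsub>?S\<^esub>"] cl[of "\<zero>\<^bsub>?S\<^esub>"]
        by (simp add: S.smult_one N.smult_one)
      then have 0: "\<phi> X (u @ (Y, d, \<zero>\<^bsub>?S\<^esub>) # v) = \<zero>\<^bsub>?N\<^esub>"
        using cl[of "\<zero>\<^bsub>?S\<^esub>"] by (metis N.add.l_cancel_one N.zero_closed S.zero_closed)
      show "\<phi> X (u @ (Y, d, a \<odot>\<^bsub>?S\<^esub> x) # v) = a \<odot>\<^bsub>?N\<^esub> \<phi> X (u @ (Y, d, x) # v)"
        if "a \<in> carrier R" for a
        using 1[OF that **(3), of "\<zero>\<^bsub>?S\<^esub>"] 0 that ** cl by simp
    qed
    show "tensor_map R A M k p \<phi>"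
      unfolding tensor_map_def using tlin_closed[OF t] \<open>n \<le> k\<close> comb scal by blast
  qed
next
  assume t: "\<forall>k\<ge>n. tensor_map R A M k p \<phi>"
  have cl: "\<phi> X w \<in> carrier (M X (wtgt X w) (wdeg w + p))" if "is_word A X w" "n \<le> length w" for X w
    using t[rule_format, OF that(2)] that by (simp add: tensor_map_def)
  have "\<phi> X (u @ (Y, d, a \<odot>\<^bsub>sMor A (wtgt X u) Y d\<^esub> x \<oplus>\<^bsub>sMor A (wtgt X u) Y d\<^esub> y) # v) =
          a \<odot>\<^bsub>M X (wtgt Y v) (wdeg u + (d + wdeg v) + p)\<^esub> \<phi> X (u @ (Y, d, x) # v)
            \<oplus>\<^bsub>M X (wtgt Y v) (wdeg u + (d + wdeg v) + p)\<^esub> \<phi> X (u @ (Y, d, y) # v)"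
    if *: "a \<in> carrier R" "is_word A X (u @ (Y, d, x) # v)" "is_word A X (u @ (Y, d, y) # v)"
    for X u Y d x y v a
  proof -
    let ?S = "sMor A (wtgt X u) Y d"
    have **: "wtgt X u \<in> Obj A" "Y \<in> Obj A" "x \<in> carrier ?S" "y \<in> carrier ?S"
      "is_word A X u" "is_word A Y v"
      using * by (auto simp: is_word_append dest: is_word_src)
    interpret S: module R ?S using modularD[OF A] ** by simp
    have ax: "is_word A X (u @ (Y, d, a \<odot>\<^bsub>?S\<^esub> x) # v)"
      using ** * by (simp add: is_word_append)
    have "n \<le> length u + 1 + length v" using n by simp
    then have T: "tensor_map R A M (length u + 1 + length v) p \<phi>" using t by blast
    show ?thesis
      using T[unfolded tensor_map_def, THEN conjunct2, THEN conjunct1, rule_format, of X u Y d "a \<odot>\<^bsub>?S\<^esub> x" v y]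
        T[unfolded tensor_map_def, THEN conjunct2, THEN conjunct2, rule_format, of a X u Y d x v] ax *
      by (simp add: add.assoc)
  qed
  then show "tlin R A M n p \<phi>" unfolding tlin_def using cl by blast
qed

lemma modfam_sMor: "ainf_category R A \<Longrightarrow> modfam R A (sMor A)"
  using ainf_modular[of R A] by (simp add: modfam_def modular_def)

lemma modfam_pull:
  "ainf_category R B \<Longrightarrow> (\<And>X. X \<in> Obj A \<Longrightarrow> p X \<in> Obj B) \<Longrightarrow> (\<And>X. X \<in> Obj A \<Longrightarrow> q X \<in> Obj B) \<Longrightarrow>
    modfam R A (\<lambda>X Y. sMor B (p X) (q Y))"
  using ainf_modular[of R B] by (simp add: modfam_def modular_def)

lemma ainf_tlin: "ainf_category R A \<Longrightarrow> tlin R A (sMor A) 1 1 (bop A)"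
  by (simp add: tlin_iff_tensor_map modfam_sMor ainf_modular) (simp add: ainf_category_def)

lemma ainf_bclosed: "ainf_category R A \<Longrightarrow> bclosed A"
  unfolding bclosed_def
  by (intro allI impI tlin_closed[OF ainf_tlin]) (simp_all add: Suc_le_eq)

definition bv :: "'k ring \<Rightarrow> ('k, 'o, 'm) ainf_cat \<Rightarrow> 'o \<Rightarrow> ('o, 'm) word \<Rightarrow> ('k, 'm) allmod" where
  "bv R A = ev R (sMor A) 1 (bop A)"

lemma lin_bv: "ainf_category R A \<Longrightarrow> lin R A X (bv R A X)"
  unfolding bv_def
  using tlin_iff_lin[OF ainf_modular modfam_sMor, of R A 1 1 "bop A"] ainf_tlin[of R A] by simp

lemma emb_b_then:
  assumes "bclosed A" "is_word A X w" "module R (N (wtgt X w) (wdeg w + 1))"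
    and "\<And>w'. is_word A X w' \<Longrightarrow> w' \<noteq> [] \<Longrightarrow> \<phi> X w' \<in> carrier (N (wtgt X w') (wdeg w'))"
    and "N' = N (wtgt X w) (wdeg w + 1)"
  shows "b_then N' A \<phi> X w \<in> carrier N'"
    and "emb R N' (b_then N' A \<phi> X w) = bh A X (\<lambda>w'. emb R (N (wtgt X w') (wdeg w')) (\<phi> X w')) w"
proof -
  interpret N: module R N' using assms(3,5) by simp
  have N: "module R N'" by (rule N.module_axioms)
  let ?g = "\<lambda>(r, n). ksign N' (wdeg (drop (r + n) w)) (\<phi> X (b_insert A X w r n))"
  have cl: "\<phi> X (b_insert A X w r n) \<in> carrier N'" if "1 \<le> n" "r + n \<le> length w" for r n
    using assms(4)[OF b_insert_word[OF assms(1,2) that] b_insert_facts(1)[OF that]]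
    by (simp add: b_insert_facts[OF that] assms(5))
  then have g: "?g \<in> {(r, n). 1 \<le> n \<and> r + n \<le> length w} \<rightarrow> carrier N'"
    by (auto intro: ksign_closed[OF N])
  then show "b_then N' A \<phi> X w \<in> carrier N'" unfolding b_then_def by (rule N.finsum_closed)
  show "emb R N' (b_then N' A \<phi> X w) = bh A X (\<lambda>w'. emb R (N (wtgt X w') (wdeg w')) (\<phi> X w')) w"
    unfolding b_then_def bh_def emb_finsum[OF N g]
  proof (rule sum.cong[OF refl], clarify)
    fix r n assume rn: "1 \<le> n" "r + n \<le> length w"
    show "emb R N' (ksign N' (wdeg (drop (r + n) w)) (\<phi> X (b_insert A X w r n))) =
        sg (wdeg (drop (r + n) w)) (emb R (N (wtgt X (b_insert A X w r n)) (wdeg (b_insert A X w r n)))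
          (\<phi> X (b_insert A X w r n)))"
      by (simp only: emb_ksign[OF N cl[OF rn]] b_insert_facts[OF rn] flip: assms(5))
  qed
qed

text \<open>The A-infinity relations in functional form: the operations, read as the functional
  \<open>bv\<close>, vanish after the codifferential.\<close>

lemma bh_bv:
  assumes A: "ainf_category R A" and w: "is_word A X w"
  shows "bh A X (bv R A X) w = 0"
proof (cases "w = []")
  case False
  let ?N = "\<lambda>Y d. sMor A X Y (d + 1)"
  have 2: "wdeg w + 2 = wdeg w + 1 + 1" by simp
  have "module R (sMor A X (wtgt X w) (wdeg w + 2))"
    using modularD[OF ainf_modular[OF A]] is_word_src[OF w] is_word_tgt[OF w] by simp
  moreover have "emb R (sMor A X (wtgt X w) (wdeg w + 2))
      (b_then (sMor A X (wtgt X w) (wdeg w + 2)) A (bop A) X w) = bh A X (bv R A X) w"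
    unfolding bv_def ev_def using ainf_bclosed[OF A] calculation
    unfolding 2 by (intro emb_b_then(2)[where N = ?N]) (simp_all add: w bclosed_def)
  moreover have "b_then (sMor A X (wtgt X w) (wdeg w + 2)) A (bop A) X w =
      \<zero>\<^bsub>sMor A X (wtgt X w) (wdeg w + 2)\<^esub>"
    using A w False by (simp add: ainf_category_def)
  ultimately show ?thesis by (simp add: emb_zero)
qed simp

text \<open>The relations are used here inside the first letter of a longer word: the zero letter is
  written as the sum of the relation, and linearity of \<open>\<phi>\<close> takes the sum out of
  the letter.\<close>

lemma lin_bop_cut:
  assumes A: "ainf_category R A" and X: "is_word A X u" "u \<noteq> []" and v: "is_word A (wtgt X u) v"
    and l: "lin R A X \<phi>"
  shows "bh A X (\<lambda>u'. \<phi> ((wtgt X u', wdeg u' + 1, bop A X u') # v)) u = 0"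
proof -
  let ?N = "\<lambda>Y d. sMor A X Y (d + 1)"
  let ?M = "sMor A X (wtgt X u) (wdeg u + 2)"
  have M: "module R ?M"
    using modularD[OF ainf_modular[OF A]] is_word_src[OF X(1)] is_word_tgt[OF X(1)] by simp
  let ?g = "\<lambda>(r, n). ksign ?M (wdeg (drop (r + n) u)) (bop A X (b_insert A X u r n))"
  have cl: "bop A X (b_insert A X u r n) \<in> carrier ?M" if "1 \<le> n" "r + n \<le> length u" for r n
    using ainf_bclosed[OF A] b_insert_word[OF ainf_bclosed[OF A] X(1) that] b_insert_facts[OF that]
    unfolding bclosed_def by (metis (no_types, lifting) add.assoc one_add_one)
  have z: "\<zero>\<^bsub>?M\<^esub> = b_then ?M A (bop A) X u"
    using A X by (simp add: ainf_category_def)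
  have "0 = \<phi> ((wtgt X u, wdeg u + 2, \<zero>\<^bsub>?M\<^esub>) # v)"
    using lin_zero[OF ainf_modular[OF A] l is_word_src[OF X(1)] v] by simp
  also have "\<dots> = (\<Sum>(r, n) \<in> {(r, n). 1 \<le> n \<and> r + n \<le> length u}. \<phi> ((wtgt X u, wdeg u + 2, 
      ksign ?M (wdeg (drop (r + n) u)) (bop A X (b_insert A X u r n))) # v))"
    unfolding z b_then_def
    by (subst lin_finsum[OF ainf_modular[OF A] l is_word_src[OF X(1)] v])
      (auto simp: ksign_closed[OF M] cl intro!: sum.cong)
  also have "\<dots> = bh A X (\<lambda>u'. \<phi> ((wtgt X u', wdeg u' + 1, bop A X u') # v)) u"
    unfolding bh_def
    by (rule sum.cong[OF refl])
      (auto simp: lin_ksign[OF ainf_modular[OF A] l is_word_src[OF X(1)] cl v] b_insert_facts add.commute[of 2])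
  finally show ?thesis by simp
qed

text \<open>The codifferential squares to zero on all linear functionals, not only on
  \<open>bv\<close>. Two operations are either nested, and then the A-infinity relations apply, or
  side by side, and then the two orders cancel because an operation has odd degree.\<close>

lemma bh_bh:
  assumes A: "ainf_category R A" and "is_word A X w" "lin R A X \<phi>"
  shows "bh A X (bh A X \<phi>) w = 0"
  using assms(2,3)
proof (induction w arbitrary: X \<phi>)
  case (Cons p w)
  obtain Y d x where p: "p = (Y, d, x)" by (cases p)
  let ?b = "\<lambda>u. (wtgt X u, wdeg u + 1, bop A X u)"
  \<comment> \<open>The part of \<open>bh\<close> in which the operation swallows the first
    letter.\<close>
  define \<kappa> where "\<kappa> = cut1 (\<lambda>u v. sg (wdeg v) (\<phi> (?b u # v)))"
  have px: "X \<in> Obj A" "x \<in> carrier (sMor A X Y d)" "is_word A Y w" using Cons.prems p by auto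
  have bh: "bh A X \<phi> (q # v) = \<kappa> (q # v) + bh A (fst q) (\<lambda>v. \<phi> (q # v)) v" for q v
    by (cases q) (simp add: bh_cut1_Cons \<kappa>_def)
  have "bh A X (bh A X \<phi>) (p # w) =
      cut1 (\<lambda>u v. sg (wdeg v) (\<kappa> (?b u # v) + bh A (wtgt X u) (\<lambda>v. \<phi> (?b u # v)) v)) (p # w) +
      bh A Y (\<lambda>v. \<kappa> (p # v) + bh A Y (\<lambda>v. \<phi> (p # v)) v) w"
    by (simp only: p bh_cut1_Cons[of A X "bh A X \<phi>"] bh fst_conv)
  also have "\<dots> = bh A X \<kappa> (p # w) + cut1 (\<lambda>u v. sg (wdeg v) (bh A (wtgt X u) (\<lambda>v. \<phi> (?b u # v)) v)) (p # w)
      + bh A Y (bh A Y (\<lambda>v. \<phi> (p # v))) w"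
    unfolding p bh_cut1_Cons[of A X \<kappa>] by (simp only: sg_add cut1_add bh_add ac_simps)
  also have "bh A Y (bh A Y (\<lambda>v. \<phi> (p # v))) w = 0"
    by (rule Cons.IH[OF px(3)]) (use lin_tail[OF Cons.prems(2) px(1,2)] p in simp)
  also have "bh A X \<kappa> (p # w) = cut1 (\<lambda>u v. - sg (wdeg v) (bh A (wtgt X u) (\<lambda>v. \<phi> (?b u # v)) v)) (p # w)"
    unfolding \<kappa>_def bh_cut1
  proof (rule cut1_cong)
    fix u v assume uv: "u @ v = p # w" "u \<noteq> []"
    have w: "is_word A X u" "is_word A (wtgt X u) v"
      using Cons.prems(1) uv(1)[symmetric] by (simp_all add: is_word_append)
    have "bh A X (\<lambda>u. sg (wdeg v) (\<phi> (?b u # v))) u = 0"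
      using lin_bop_cut[OF A w(1) uv(2) w(2) Cons.prems(2)] by (simp add: bh_sg)
    \<comment> \<open>An insertion in the tail raises its degree by one and so flips the sign; this
      is the cancellation of operations placed side by side.\<close>
    moreover have "bh A (wtgt X u) (\<lambda>v'. sg (wdeg v') (\<phi> (?b u # v'))) v =
        bh A (wtgt X u) (\<lambda>v'. - sg (wdeg v) (\<phi> (?b u # v'))) v"
      by (rule bh_cong) (simp add: sg_def)
    ultimately show "sg (wdeg v) (bh A X (\<lambda>u. sg (wdeg v) (\<phi> (?b u # v))) u) +
         bh A (wtgt X u) (\<lambda>v'. sg (wdeg v') (\<phi> (?b u # v'))) v =
         - sg (wdeg v) (bh A (wtgt X u) (\<lambda>v. \<phi> (?b u # v)) v)"
      by (simp add: bh_minus bh_sg)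
  qed
  finally show ?case by (simp add: cut1_add[symmetric] del: cut1.simps)
qed simp

section \<open>Functors and transformations\<close>

lemma functor_cats: "ainf_functor R A B f \<Longrightarrow> ainf_category R A \<and> ainf_category R B"
  by (simp add: ainf_functor_def)

lemma functor_ob: "ainf_functor R A B f \<Longrightarrow> X \<in> Obj A \<Longrightarrow> fob f X \<in> Obj B"
  by (simp add: ainf_functor_def)

lemma functor_modfam: "ainf_functor R A B f \<Longrightarrow> ainf_functor R A B g \<Longrightarrow>
    modfam R A (\<lambda>X Y. sMor B (fob f X) (fob g Y))"
  by (intro modfam_pull) (auto simp: ainf_functor_def)

lemma functor_tlin:
  assumes "ainf_functor R A B f"
  shows "tlin R A (\<lambda>X Y. sMor B (fob f X) (fob f Y)) 1 0 (fmp f)"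
  unfolding tlin_iff_tensor_map[OF ainf_modular functor_modfam, OF conjunct1[OF functor_cats, OF assms] assms assms order_refl]
  using assms by (simp add: ainf_functor_def)

lemma functor_closed:
  "ainf_functor R A B f \<Longrightarrow> is_word A X w \<Longrightarrow> w \<noteq> [] \<Longrightarrow>
     fmp f X w \<in> carrier (sMor B (fob f X) (fob f (wtgt X w)) (wdeg w))"
  using tlin_closed[OF functor_tlin, of R A B f X w] by (simp add: Suc_le_eq)

definition fv ::
  "'k ring \<Rightarrow> ('k, 'ob, 'mb) ainf_cat \<Rightarrow> ('oa, 'ma, 'ob, 'mb) ainf_fun
    \<Rightarrow> 'oa \<Rightarrow> ('oa, 'ma) word \<Rightarrow> ('k, 'mb) allmod" where
  "fv R B f = ev R (\<lambda>X Y. sMor B (fob f X) (fob f Y)) 0 (fmp f)"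

definition rv ::
  "'k ring \<Rightarrow> ('k, 'ob, 'mb) ainf_cat \<Rightarrow> ('oa, 'ma, 'ob, 'mb) ainf_fun \<Rightarrow> ('oa, 'ma, 'ob, 'mb) ainf_fun
    \<Rightarrow> int \<Rightarrow> ('oa, 'ma, 'mb) ainf_trans \<Rightarrow> 'oa \<Rightarrow> ('oa, 'ma) word \<Rightarrow> ('k, 'mb) allmod" where
  "rv R B f g d r = ev R (\<lambda>X Y. sMor B (fob f X) (fob g Y)) d r"

lemma fv_eq: "fv R B f X w = emb R (sMor B (fob f X) (fob f (wtgt X w)) (wdeg w)) (fmp f X w)"
  by (simp add: fv_def ev_def)

lemma rv_eq: "rv R B f g d r X w =
    emb R (sMor B (fob f X) (fob g (wtgt X w)) (wdeg w + d)) (r X w)"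
  by (simp add: rv_def ev_def)

lemma bv_eq: "bv R B X w = emb R (sMor B X (wtgt X w) (wdeg w + 1)) (bop B X w)"
  by (simp add: bv_def ev_def)

lemma lin_fv: "ainf_functor R A B f \<Longrightarrow> lin R A X (fv R B f X)"
  unfolding fv_def
  using tlin_iff_lin[OF ainf_modular functor_modfam, of R A B f f 1 0 "fmp f"]
    functor_tlin[of R A B f] functor_cats[of R A B f] by simp

lemma trans_carrier_iff:
  assumes "ainf_functor R A B f" "ainf_functor R A B g"
  shows "r \<in> carrier (trans_module R A B f g d) \<longleftrightarrow>
    (\<forall>X w. is_word A X w \<longrightarrow> r X w \<in> carrier (sMor B (fob f X) (fob g (wtgt X w)) (wdeg w + d))) \<and>
    (\<forall>X. lin R A X (rv R B f g d r X)) \<and> (\<forall>X w. \<not> is_word A X w \<longrightarrow> r X w = undefined)"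
proof -
  have A: "modular R A" using assms by (simp add: ainf_modular functor_cats)
  note m = functor_modfam[OF assms]
  show ?thesis
    using tlin_iff_lin[OF A m, of 0 d r] tlin_iff_tensor_map[OF A m, of 0 d r]
    by (simp add: trans_module_def Let_def rv_def)
qed

lemma trans_closed:
  assumes "ainf_functor R A B f" "ainf_functor R A B g" "r \<in> carrier (trans_module R A B f g d)"
    "is_word A X w"
  shows "r X w \<in> carrier (sMor B (fob f X) (fob g (wtgt X w)) (wdeg w + d))"
  using assms by (simp add: trans_carrier_iff)

lemma lin_rv:
  assumes "ainf_functor R A B f" "ainf_functor R A B g" "r \<in> carrier (trans_module R A B f g d)"
  shows "lin R A X (rv R B f g d r X)"
  using assms by (simp add: trans_carrier_iff)

text \<open>The values at well-formed words decide, since transformations are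
  \<open>undefined\<close> elsewhere; at each word \<open>emb_inject\<close> is applied in the
  hom-module concerned.\<close>

lemma trans_ext:
  assumes "ainf_functor R A B f" "ainf_functor R A B g"
    "r \<in> carrier (trans_module R A B f g d)" "q \<in> carrier (trans_module R A B f g d)"
    "\<And>X w. is_word A X w \<Longrightarrow> rv R B f g d r X w = rv R B f g d q X w"
  shows "r = q"
proof (intro ext)
  fix X w
  show "r X w = q X w"
  proof (cases "is_word A X w")
    case True
    have "module R (sMor B (fob f X) (fob g (wtgt X w)) (wdeg w + d))"
      using functor_modfam[OF assms(1,2)] is_word_src[OF True] is_word_tgt[OF True]
      by (simp add: modfam_def)
    then show ?thesis
      using assms(5)[OF True] trans_closed[OF assms(1-3) True] trans_closed[OF assms(1,2,4) True]
      by (simp add: rv_eq emb_inject)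
  qed (use assms(1-4) in \<open>simp add: trans_carrier_iff\<close>)
qed

lemma trans_zero: "\<zero>\<^bsub>trans_module R A B f g d\<^esub> = (\<lambda>X w. if is_word A X w
      then \<zero>\<^bsub>sMor B (fob f X) (fob g (wtgt X w)) (wdeg w + d)\<^esub> else undefined)"
  and trans_add: "r \<oplus>\<^bsub>trans_module R A B f g d\<^esub> q = (\<lambda>X w. if is_word A X w
      then r X w \<oplus>\<^bsub>sMor B (fob f X) (fob g (wtgt X w)) (wdeg w + d)\<^esub> q X w else undefined)"
  and trans_smult: "a \<odot>\<^bsub>trans_module R A B f g d\<^esub> r = (\<lambda>X w. if is_word A X w
      then a \<odot>\<^bsub>sMor B (fob f X) (fob g (wtgt X w)) (wdeg w + d)\<^esub> r X w else undefined)"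
  by (simp_all add: trans_module_def Let_def)

context
  fixes R :: "'k ring" and A :: "('k, 'oa, 'ma) ainf_cat" and B :: "('k, 'ob, 'mb) ainf_cat"
    and f g :: "('oa, 'ma, 'ob, 'mb) ainf_fun" and d :: int
  assumes f: "ainf_functor R A B f" and g: "ainf_functor R A B g"
begin

private abbreviation "T \<equiv> trans_module R A B f g d"
private abbreviation "M X w \<equiv> sMor B (fob f X) (fob g (wtgt X w)) (wdeg w + d)"

lemma trans_fibre_module: "is_word A X w \<Longrightarrow> module R (M X w)"
  using functor_modfam[OF f g] is_word_src[of A X w] is_word_tgt[of A X w]
  by (simp add: modfam_def)

lemma rv_zero: "is_word A X w \<Longrightarrow> rv R B f g d \<zero>\<^bsub>T\<^esub> X w = 0"
  by (simp add: rv_eq trans_zero emb_zero trans_fibre_module)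

lemma rv_add:
  "r \<in> carrier T \<Longrightarrow> q \<in> carrier T \<Longrightarrow> is_word A X w \<Longrightarrow>
    rv R B f g d (r \<oplus>\<^bsub>T\<^esub> q) X w = rv R B f g d r X w + rv R B f g d q X w"
  by (simp add: rv_eq trans_add emb_add trans_fibre_module trans_closed[OF f g])

lemma rv_smult:
  "r \<in> carrier T \<Longrightarrow> a \<in> carrier R \<Longrightarrow> is_word A X w \<Longrightarrow>
    rv R B f g d (a \<odot>\<^bsub>T\<^esub> r) X w = act R a (rv R B f g d r X w)"
  by (simp add: rv_eq trans_smult emb_smult trans_fibre_module trans_closed[OF f g])

lemma trans_zero_closed: "\<zero>\<^bsub>T\<^esub> \<in> carrier T"
proof -
  have A: "modular R A" using f by (simp add: ainf_modular functor_cats)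
  have "lin R A X (rv R B f g d \<zero>\<^bsub>T\<^esub> X)" for X
    by (rule lin_cong[OF A lin_0]) (simp add: rv_zero)
  then show ?thesis
    using abelian_groupE(2)[OF ab_of_module[OF trans_fibre_module]]
    by (auto simp: trans_carrier_iff[OF f g] trans_zero)
qed

lemma trans_add_closed:
  assumes "r \<in> carrier T" "q \<in> carrier T"
  shows "r \<oplus>\<^bsub>T\<^esub> q \<in> carrier T"
proof -
  have A: "modular R A" using f by (simp add: ainf_modular functor_cats)
  have "lin R A X (rv R B f g d (r \<oplus>\<^bsub>T\<^esub> q) X)" for X
    by (rule lin_cong[OF A lin_plus[OF lin_rv[OF f g assms(1)] lin_rv[OF f g assms(2)]]])
      (simp add: rv_add assms)
  then show ?thesis
    using trans_fibre_module trans_closed[OF f g assms(1)] trans_closed[OF f g assms(2)]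
    by (auto simp: trans_carrier_iff[OF f g] trans_add intro!: abelian_groupE(1) ab_of_module)
qed

lemma trans_smult_closed:
  assumes "r \<in> carrier T" "a \<in> carrier R"
  shows "a \<odot>\<^bsub>T\<^esub> r \<in> carrier T"
proof -
  have A: "modular R A" using f by (simp add: ainf_modular functor_cats)
  have "lin R A X (rv R B f g d (a \<odot>\<^bsub>T\<^esub> r) X)" for X
    by (rule lin_cong[OF A lin_act[OF A assms(2) lin_rv[OF f g assms(1)]]]) (simp add: rv_smult assms)
  then show ?thesis
    using module.smult_closed[OF trans_fibre_module assms(2) trans_closed[OF f g assms(1)]]
    by (auto simp: trans_carrier_iff[OF f g] trans_smult)
qed

lemma trans_module_module: "module R T"
proof (rule moduleI)
  have A: "modular R A" using f by (simp add: ainf_modular functor_cats)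
  then show R: "cring R" by (simp add: modular_def)
  note cl = trans_add_closed trans_smult_closed trans_zero_closed
  note rvs = rv_add rv_smult rv_zero
  show "abelian_group T"
  proof (rule abelian_groupI)
    fix r assume r: "r \<in> carrier T"
    let ?q = "\<lambda>X w. if is_word A X w then \<ominus>\<^bsub>M X w\<^esub> r X w else undefined"
    have q: "rv R B f g d ?q X w = - rv R B f g d r X w" if "is_word A X w" for X w
      using that by (simp add: rv_eq emb_minus trans_fibre_module trans_closed[OF f g r])
    have "lin R A X (rv R B f g d ?q X)" for X
      by (rule lin_cong[OF A lin_minus[OF lin_rv[OF f g r]]]) (simp add: q)
    then have qc: "?q \<in> carrier T"
      using trans_fibre_module trans_closed[OF f g r]
      by (auto simp: trans_carrier_iff[OF f g] intro!: abelian_group.a_inv_closed ab_of_module)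
    have "?q \<oplus>\<^bsub>T\<^esub> r = \<zero>\<^bsub>T\<^esub>"
      by (rule trans_ext[OF f g, of _ d]) (simp_all add: cl qc r rvs q)
    then show "\<exists>q\<in>carrier T. q \<oplus>\<^bsub>T\<^esub> r = \<zero>\<^bsub>T\<^esub>" using qc by blast
  qed (auto intro!: trans_ext[OF f g, of _ d] simp: cl rvs algebra_simps)
  interpret R: cring R by (rule R)
  \<comment> \<open>Because \<open>act\<close> is not additive in the scalar, this axiom is checked
    directly in the hom-modules, while the others are read off in the universal group.\<close>
  show "(a \<oplus>\<^bsub>R\<^esub> b) \<odot>\<^bsub>T\<^esub> r = a \<odot>\<^bsub>T\<^esub> r \<oplus>\<^bsub>T\<^esub> b \<odot>\<^bsub>T\<^esub> r"
    if "a \<in> carrier R" "b \<in> carrier R" "r \<in> carrier T" for a b r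
  proof (intro ext)
    fix X w
    show "((a \<oplus>\<^bsub>R\<^esub> b) \<odot>\<^bsub>T\<^esub> r) X w = (a \<odot>\<^bsub>T\<^esub> r \<oplus>\<^bsub>T\<^esub> b \<odot>\<^bsub>T\<^esub> r) X w"
      using that module.smult_l_distr[OF trans_fibre_module that(1,2) trans_closed[OF f g that(3)]]
      by (simp add: trans_smult trans_add)
  qed
  show "a \<otimes>\<^bsub>R\<^esub> b \<odot>\<^bsub>T\<^esub> r = a \<odot>\<^bsub>T\<^esub> (b \<odot>\<^bsub>T\<^esub> r)"
    if "a \<in> carrier R" "b \<in> carrier R" "r \<in> carrier T" for a b r
    by (rule trans_ext[OF f g, of _ d]) (simp_all add: cl rvs that act_act[OF R])
  show "\<one>\<^bsub>R\<^esub> \<odot>\<^bsub>T\<^esub> r = r" if "r \<in> carrier T" for r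
    by (rule trans_ext[OF f g, of _ d]) (simp_all add: cl rvs that)
  show "a \<odot>\<^bsub>T\<^esub> (r \<oplus>\<^bsub>T\<^esub> q) = a \<odot>\<^bsub>T\<^esub> r \<oplus>\<^bsub>T\<^esub> a \<odot>\<^bsub>T\<^esub> q"
    if "a \<in> carrier R" "r \<in> carrier T" "q \<in> carrier T" for a r q
    by (rule trans_ext[OF f g, of _ d]) (simp_all add: cl rvs that act_add)
qed (rule trans_smult_closed)

lemma rv_minus: "r \<in> carrier T \<Longrightarrow> is_word A X w \<Longrightarrow> rv R B f g d (\<ominus>\<^bsub>T\<^esub> r) X w = - rv R B f g d r X w"
proof -
  interpret T: module R T by (rule trans_module_module)
  assume "r \<in> carrier T" "is_word A X w"
  then have "rv R B f g d r X w + rv R B f g d (\<ominus>\<^bsub>T\<^esub> r) X w = 0"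
    by (simp flip: rv_add add: T.r_neg rv_zero)
  then show ?thesis by (rule group_add_class.minus_unique[symmetric])
qed

lemma rv_diff: "r \<in> carrier T \<Longrightarrow> q \<in> carrier T \<Longrightarrow> is_word A X w \<Longrightarrow>
    rv R B f g d (r \<ominus>\<^bsub>T\<^esub> q) X w = rv R B f g d r X w - rv R B f g d q X w"
proof -
  interpret T: module R T by (rule trans_module_module)
  assume "r \<in> carrier T" "q \<in> carrier T" "is_word A X w"
  then show ?thesis by (simp add: T.minus_eq rv_add rv_minus)
qed

lemma rv_ksign: "r \<in> carrier T \<Longrightarrow> is_word A X w \<Longrightarrow>
    rv R B f g d (ksign T n r) X w = sg n (rv R B f g d r X w)"
  by (auto simp: ksign_def sg_def rv_minus)

lemma rv_finsum:
  assumes "\<And>i. i \<in> I \<Longrightarrow> q i \<in> carrier T" "is_word A X w"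
  shows "rv R B f g d (finsum T q I) X w = (\<Sum>i\<in>I. rv R B f g d (q i) X w)"
proof -
  interpret T: module R T by (rule trans_module_module)
  show ?thesis using assms(1)
  proof (induction I rule: infinite_finite_induct)
    case (insert i I)
    then have "q \<in> I \<rightarrow> carrier T" "q i \<in> carrier T" by auto
    then show ?case using insert assms(2) by (simp add: rv_add)
  qed (simp_all add: rv_zero assms(2) T.finsum_infinite)
qed

end

section \<open>The category of functors\<close>

lemma fun_cat_sMor [simp]: "sMor (fun_cat R A B) f g d = trans_module R A B f g d"
  by (simp add: fun_cat_def sMor_def)

lemma fun_cat_Obj [simp]: "f \<in> Obj (fun_cat R A B) \<longleftrightarrow> ainf_functor R A B f"
  by (simp add: fun_cat_def)

lemma fun_cat_modular: "ainf_category R A \<Longrightarrow> modular R (fun_cat R A B)"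
  by (simp add: modular_def trans_module_module) (simp add: ainf_category_def)

section \<open>Typing of \<open>\<theta>\<close> and its linearity in inputs and
  transformations\<close>

lemma theta_tensor_word:
  assumes "is_word (fun_cat R A B) f rs" "is_word A X w" "ps \<in> theta_splits (length rs) w"
  shows "is_word B (fob f X) (theta_tensor f X rs ps) \<and>
    wtgt (fob f X) (theta_tensor f X rs ps) = fob (wtgt f rs) (wtgt X w) \<and>
    wdeg (theta_tensor f X rs ps) = wdeg w + wdeg rs"
  using assms
proof (induction ps arbitrary: f X rs w)
  case Nil
  then have "rs = []" "w = []" by (auto simp: theta_splits_def)
  then show ?case using Nil by (simp add: functor_ob)
next
  case (Cons p ps)
  obtain b u where p: "p = (b, u)" by (cases p)
  define v where "v = concat (map snd ps)"
  have w: "w = u @ v" using Cons.prems(3) by (simp add: theta_splits_def p v_def)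
  have wu: "is_word A X u" "is_word A (wtgt X u) v" using Cons.prems(2) w by (simp_all add: is_word_append)
  have f: "ainf_functor R A B f" using is_word_src[OF Cons.prems(1)] by simp
  show ?case
  proof (cases b)
    case True
    then obtain g d r rs' where rs: "rs = (g, d, r) # rs'"
      using Cons.prems(3) p by (cases rs) (auto simp: theta_splits_def)
    have "ps \<in> theta_splits (length rs') v"
      using Cons.prems(3) p True rs by (auto simp: theta_splits_def v_def)
    moreover have "is_word (fun_cat R A B) g rs'" "r \<in> carrier (trans_module R A B f g d)"
      using Cons.prems(1) rs by simp_all
    moreover have "ainf_functor R A B g" using is_word_src[OF calculation(2)] by simp
    ultimately show ?thesis
      using Cons.IH[of g rs' "wtgt X u" v] wu p True rs w f
      by (simp add: trans_closed[OF f] functor_ob is_word_src)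
  next
    case False
    then have "ps \<in> theta_splits (length rs) v" "u \<noteq> []"
      using Cons.prems(3) p by (auto simp: theta_splits_def v_def)
    then show ?thesis
      using Cons.IH[of f rs "wtgt X u" v] Cons.prems(1) wu p False w f
      by (simp add: functor_closed[OF f] functor_ob is_word_src)
  qed
qed

text \<open>Functionals matter only on words that \<open>\<theta>\<close> can produce: well-formed,
  with prescribed target and degree, nonempty unless everything is empty. In particular a sign
  depending on the degree of the output may be replaced by a constant.\<close>

lemma th_cong_word:
  assumes "is_word (fun_cat R A B) f rs" "is_word A X w"
    "\<And>z. is_word B (fob f X) z \<Longrightarrow> wtgt (fob f X) z = fob (wtgt f rs) (wtgt X w) \<Longrightarrow>
      wdeg z = wdeg w + wdeg rs \<Longrightarrow> (rs \<noteq> [] \<or> w \<noteq> [] \<Longrightarrow> z \<noteq> []) \<Longrightarrow> \<phi> z = \<psi> z"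
  shows "th f rs X \<phi> w = th f rs X \<psi> w"
  unfolding th_def
proof (rule sum.cong[OF refl])
  fix ps assume ps: "ps \<in> theta_splits (length rs) w"
  note * = theta_tensor_word[OF assms(1,2) ps]
  have "\<phi> (theta_tensor f X rs ps) = \<psi> (theta_tensor f X rs ps)"
    using * by (intro assms(3) theta_tensor_nonempty[OF ps]) auto
  then show "sg (theta_sign rs ps) (\<phi> (theta_tensor f X rs ps)) =
    sg (theta_sign rs ps) (\<psi> (theta_tensor f X rs ps))" by simp
qed

text \<open>Truncation allows linearity to be proved by induction on the length of words.\<close>

lemma lin_trunc: "lin R A X \<phi> \<Longrightarrow> lin R A X (\<lambda>w. if length w \<le> n then \<phi> w else 0)"
  by (simp add: lin_def)

lemma lin_of_trunc: "(\<And>n. lin R A X (\<lambda>w. if length w \<le> n then \<phi> w else 0)) \<Longrightarrow> lin R A X \<phi>"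
proof (rule linI)
  fix u Y d x y v a
  assume l: "\<And>n. lin R A X (\<lambda>w. if length w \<le> n then \<phi> w else 0)"
    and *: "a \<in> carrier R" "is_word A X (u @ (Y, d, x) # v)" "is_word A X (u @ (Y, d, y) # v)"
  show "\<phi> (u @ (Y, d, a \<odot>\<^bsub>sMor A (wtgt X u) Y d\<^esub> x \<oplus>\<^bsub>sMor A (wtgt X u) Y d\<^esub> y) # v)
       = act R a (\<phi> (u @ (Y, d, x) # v)) + \<phi> (u @ (Y, d, y) # v)"
    using linD[OF l * , of "length u + Suc (length v)"] by simp
qed

lemma th_head_comb:
  assumes B: "ainf_category R B" and rs: "is_word (fun_cat R A B) g rs" and v: "is_word A Y v"
    and l: "lin R B X' \<phi>" and X': "X' \<in> Obj B"
    and "x \<in> carrier (sMor B X' (fob g Y) d)" "y \<in> carrier (sMor B X' (fob g Y) d)" "a \<in> carrier R"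
  shows "th g rs Y (\<lambda>z. \<phi> ((fob g Y, d, a \<odot>\<^bsub>sMor B X' (fob g Y) d\<^esub> x \<oplus>\<^bsub>sMor B X' (fob g Y) d\<^esub> y) # z)) v =
    act R a (th g rs Y (\<lambda>z. \<phi> ((fob g Y, d, x) # z)) v) + th g rs Y (\<lambda>z. \<phi> ((fob g Y, d, y) # z)) v"
  unfolding th_act[symmetric] th_add[symmetric]
  by (rule th_cong_word[OF rs v]) (simp add: lin_comb[OF ainf_modular[OF B] l X'] assms)

text \<open>Two nested inductions follow the expansion by the first piece. A transformation piece
  shortens \<open>rs\<close>, but its remaining inputs may be the whole word, so full linearity is
  needed there; a functor piece keeps \<open>rs\<close> and shortens the word, which the truncation
  handles.\<close>

lemma lin_th:
  fixes A :: "('k, 'oa, 'ma) ainf_cat"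
  assumes "is_word (fun_cat R A B) f rs" "lin R B (fob f X) \<phi>" "X \<in> Obj A"
  shows "lin R A X (th f rs X \<phi>)"
  using assms
proof (induction rs arbitrary: f X \<phi> rule: measure_induct_rule[where f = length])
  case (less rs)
  note IHrs = less.IH
  have "lin R A X (\<lambda>w. if length w \<le> n then th f rs X \<phi> w else 0)" for n
    using less.prems
  proof (induction n arbitrary: X \<phi>)
    case 0
    then show ?case by (simp add: lin_def)
  next
    case (Suc n)
    note wf = Suc.prems(1) and l = Suc.prems(2) and X = Suc.prems(3)
    have f: "ainf_functor R A B f" using is_word_src[OF wf] by simp
    have A: "modular R A" and B: "ainf_category R B" using f by (simp_all add: ainf_modular functor_cats)
    have fX: "fob f X \<in> Obj B" using f X by (rule functor_ob)
    \<comment> \<open>Functor pieces are nonempty, so on words of length at most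
      \<open>Suc n\<close> the cut-off at \<open>n\<close> removes nothing; it brings the summand
      into the range of the inner hypothesis.\<close>
    define F where "F u v = (if length v \<le> n then th f rs (wtgt X u) (\<lambda>z. \<phi> (fletter f X u # z)) v else 0)"
      for u v :: "('oa, 'ma) word"
    have 1: "lin R A X (cut1 F)"
    proof (rule lin_cut1[OF A])
      fix u assume u: "is_word A X u" "u \<noteq> []"
      have "lin R B (fob f (wtgt X u)) (\<lambda>z. \<phi> (fletter f X u # z))"
        unfolding fletter_def by (rule lin_tail[OF l fX]) (rule functor_closed[OF f u])
      then show "lin R A (wtgt X u) (F u)"
        unfolding F_def by (intro Suc.IH wf) (use u in \<open>simp add: is_word_tgt\<close>)+
    next
      fix u :: "('oa, 'ma) word" and Y d x y u' v a
      let ?z = "a \<odot>\<^bsub>sMor A (wtgt X u) Y d\<^esub> x \<oplus>\<^bsub>sMor A (wtgt X u) Y d\<^esub> y"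
      assume *: "a \<in> carrier R" "is_word A X (u @ (Y, d, x) # u' @ v)" "is_word A X (u @ (Y, d, y) # u' @ v)"
      then have w: "is_word A X (u @ (Y, d, x) # u')" "is_word A X (u @ (Y, d, y) # u')" "is_word A (wtgt Y u') v"
        by (auto simp: is_word_append dest: is_word_tgt)
      have cl: "fmp f X (u @ (Y, d, x) # u') \<in> carrier (sMor B (fob f X) (fob f (wtgt Y u')) (wdeg u + (d + wdeg u')))"
        "fmp f X (u @ (Y, d, y) # u') \<in> carrier (sMor B (fob f X) (fob f (wtgt Y u')) (wdeg u + (d + wdeg u')))"
        using functor_closed[OF f w(1)] functor_closed[OF f w(2)] by simp_all
      show "F (u @ (Y, d, ?z) # u') v = act R a (F (u @ (Y, d, x) # u') v) + F (u @ (Y, d, y) # u') v"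
        using th_head_comb[OF B wf w(3) l fX cl *(1)] tlin_comb[OF functor_tlin[OF f] *(1) w(1,2)]
        by (simp add: F_def fletter_def)
    qed
    have 2: "lin R A X (\<lambda>w. case rs of [] \<Rightarrow> 0 | (g, d, r) # rs' \<Rightarrow>
        cut (\<lambda>u v. sg (d * wdeg v) (th g rs' (wtgt X u) (\<lambda>z. \<phi> (rletter g d r X u # z)) v)) w)"
    proof (cases rs)
      case (Cons p rs')
      obtain g D r where p: "p = (g, D, r)" by (cases p)
      have r: "r \<in> carrier (trans_module R A B f g D)" and wg: "is_word (fun_cat R A B) g rs'"
        using wf Cons p by simp_all
      have g: "ainf_functor R A B g" using is_word_src[OF wg] by simp
      have rt: "tlin R A (\<lambda>X Y. sMor B (fob f X) (fob g Y)) 0 D r"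
        using tlin_iff_tensor_map[OF A functor_modfam[OF f g], of 0 D r] r
        by (simp add: trans_module_def Let_def)
      define G where "G u v = sg (0 + D * wdeg v) (th g rs' (wtgt X u) (\<lambda>z. \<phi> (rletter g D r X u # z)) v)"
        for u v :: "('oa, 'ma) word"
      have "lin R A X (cut G)"
      proof (rule lin_cut[OF A])
        fix u assume u: "is_word A X u"
        have "lin R B (fob g (wtgt X u)) (\<lambda>z. \<phi> (rletter g D r X u # z))"
          unfolding rletter_def by (rule lin_tail[OF l fX]) (rule trans_closed[OF f g r u])
        then show "lin R A (wtgt X u) (G u)"
          unfolding G_def by (intro lin_sgw IHrs wg) (use u Cons in \<open>simp_all add: is_word_tgt\<close>)
      next
        fix u :: "('oa, 'ma) word" and Y d x y u' v a
        let ?z = "a \<odot>\<^bsub>sMor A (wtgt X u) Y d\<^esub> x \<oplus>\<^bsub>sMor A (wtgt X u) Y d\<^esub> y"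
        assume *: "a \<in> carrier R" "is_word A X (u @ (Y, d, x) # u' @ v)" "is_word A X (u @ (Y, d, y) # u' @ v)"
        then have w: "is_word A X (u @ (Y, d, x) # u')" "is_word A X (u @ (Y, d, y) # u')" "is_word A (wtgt Y u') v"
          by (auto simp: is_word_append dest: is_word_tgt)
        have cl: "r X (u @ (Y, d, x) # u') \<in> carrier (sMor B (fob f X) (fob g (wtgt Y u')) (wdeg u + (d + wdeg u') + D))"
          "r X (u @ (Y, d, y) # u') \<in> carrier (sMor B (fob f X) (fob g (wtgt Y u')) (wdeg u + (d + wdeg u') + D))"
          using trans_closed[OF f g r w(1)] trans_closed[OF f g r w(2)] by simp_all
        show "G (u @ (Y, d, ?z) # u') v = act R a (G (u @ (Y, d, x) # u') v) + G (u @ (Y, d, y) # u') v"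
          using th_head_comb[OF B wg w(3) l fX cl *(1)] tlin_comb[OF rt *(1) w(1,2)]
          by (simp add: G_def rletter_def act_sg sg_add)
      qed
      then show ?thesis by (simp add: Cons p G_def[abs_def])
    qed (simp add: lin_0)
    have eq: "th f rs X \<phi> w = cut1 F w + (case rs of [] \<Rightarrow> 0 | (g, d, r) # rs' \<Rightarrow>
        cut (\<lambda>u v. sg (d * wdeg v) (th g rs' (wtgt X u) (\<lambda>z. \<phi> (rletter g d r X u # z)) v)) w)"
      if "w \<noteq> []" "length w \<le> Suc n" for w
    proof -
      have "cut1 (\<lambda>u v. th f rs (wtgt X u) (\<lambda>z. \<phi> (fletter f X u # z)) v) w = cut1 F w"
      proof (rule cut1_cong)
        fix u v assume "u @ v = w" "u \<noteq> []"
        then have "length v \<le> n" using that by (cases u) auto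
        then show "th f rs (wtgt X u) (\<lambda>z. \<phi> (fletter f X u # z)) v = F u v" by (simp add: F_def)
      qed
      then show ?thesis using that by (subst th_rec) simp
    qed
    show ?case
      by (rule lin_cong[OF A lin_trunc[OF lin_plus[OF 1 2], of "Suc n"]]) (simp add: eq)
  qed
  then show ?case by (rule lin_of_trunc)
qed

text \<open>Makes the operations of the category of functors multilinear. Expanding by the first
  piece shortens the inputs or the part \<open>rs1\<close> before the marked transformation, until
  that transformation itself heads the list and \<open>th_head_comb\<close> applies.\<close>

lemma th_rs_lin:
  assumes "ainf_category R A" "ainf_category R B" "is_word A X w" "lin R B (fob f X) \<phi>" "ainf_functor R A B f"
  shows "lin R (fun_cat R A B) f (\<lambda>rs. th f rs X \<phi> w)"
proof (rule linI)
  fix rs1 h D x y rs2 a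
  let ?W = "fun_cat R A B"
  assume "a \<in> carrier R" "is_word ?W f (rs1 @ (h, D, x) # rs2)" "is_word ?W f (rs1 @ (h, D, y) # rs2)"
  then show "th f (rs1 @ (h, D, a \<odot>\<^bsub>sMor ?W (wtgt f rs1) h D\<^esub> x \<oplus>\<^bsub>sMor ?W (wtgt f rs1) h D\<^esub> y) # rs2) X \<phi> w =
    act R a (th f (rs1 @ (h, D, x) # rs2) X \<phi> w) + th f (rs1 @ (h, D, y) # rs2) X \<phi> w"
    using assms(3-5)
  proof (induction "length rs1 + length w" arbitrary: rs1 f X \<phi> w rule: less_induct)
    case less
    let ?z = "a \<odot>\<^bsub>sMor ?W (wtgt f rs1) h D\<^esub> x \<oplus>\<^bsub>sMor ?W (wtgt f rs1) h D\<^esub> y"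
    note a = less.prems(1) and wx = less.prems(2) and wy = less.prems(3) and w = less.prems(4)
      and l = less.prems(5) and f = less.prems(6)
    have fX: "fob f X \<in> Obj B" using f is_word_src[OF w] by (rule functor_ob)
    have wz: "is_word ?W f (rs1 @ (h, D, ?z) # rs2)"
      by (rule word_comb[OF fun_cat_modular[OF assms(1)] a wx wy])
    let ?P = "\<lambda>x. cut1 (\<lambda>u v. th f (rs1 @ (h, D, x) # rs2) (wtgt X u) (\<lambda>z. \<phi> (fletter f X u # z)) v) w"
    have 1: "?P ?z = act R a (?P x) + ?P y"
      unfolding cut1_act[symmetric] cut1_add[symmetric]
    proof (rule cut1_cong)
      fix u v assume uv: "u @ v = w" "u \<noteq> []"
      then have u: "is_word A X u" "is_word A (wtgt X u) v" using w by (auto simp: is_word_append)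
      have "lin R B (fob f (wtgt X u)) (\<lambda>z. \<phi> (fletter f X u # z))"
        unfolding fletter_def by (rule lin_tail[OF l fX]) (rule functor_closed[OF f u(1) uv(2)])
      then show "th f (rs1 @ (h, D, ?z) # rs2) (wtgt X u) (\<lambda>z. \<phi> (fletter f X u # z)) v =
         act R a (th f (rs1 @ (h, D, x) # rs2) (wtgt X u) (\<lambda>z. \<phi> (fletter f X u # z)) v) +
         th f (rs1 @ (h, D, y) # rs2) (wtgt X u) (\<lambda>z. \<phi> (fletter f X u # z)) v"
        using uv by (intro less.hyps a wx wy u f) auto
    qed
    show ?case
    proof (cases rs1)
      case Nil
      have x: "x \<in> carrier (trans_module R A B f h D)" "y \<in> carrier (trans_module R A B f h D)"
        and wh: "is_word ?W h rs2" using wx wy Nil by simp_all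
      have h: "ainf_functor R A B h" using is_word_src[OF wh] by simp
      let ?Q = "\<lambda>x. cut (\<lambda>u v. sg (D * wdeg v) (th h rs2 (wtgt X u) (\<lambda>z. \<phi> (rletter h D x X u # z)) v)) w"
      have "?Q ?z = act R a (?Q x) + ?Q y"
        unfolding cut_act[symmetric] cut_add[symmetric] act_sg sg_add[symmetric]
      proof (rule cut_cong, rule arg_cong[where f = "sg _"])
        fix u v assume uv: "u @ v = w"
        then have u: "is_word A X u" "is_word A (wtgt X u) v" using w by (auto simp: is_word_append)
        show "th h rs2 (wtgt X u) (\<lambda>z. \<phi> (rletter h D ?z X u # z)) v =
         act R a (th h rs2 (wtgt X u) (\<lambda>z. \<phi> (rletter h D x X u # z)) v) +
         th h rs2 (wtgt X u) (\<lambda>z. \<phi> (rletter h D y X u # z)) v"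
          using th_head_comb[OF assms(2) wh u(2) l fX trans_closed[OF f h x(1) u(1)] trans_closed[OF f h x(2) u(1)] a]
          by (simp add: rletter_def Nil trans_add trans_smult u)
      qed
      then show ?thesis
        using 1 by (subst (1 2 3) th_rec) (simp add: Nil act_add)
    next
      case (Cons p rs1')
      obtain g d r where p: "p = (g, d, r)" by (cases p)
      have r: "r \<in> carrier (trans_module R A B f g d)" and wg: "is_word ?W g (rs1' @ (h, D, x) # rs2)"
         "is_word ?W g (rs1' @ (h, D, y) # rs2)"
        using wx wy Cons p by simp_all
      have g: "ainf_functor R A B g" using is_word_src[OF wg(1)] by simp
      let ?Q = "\<lambda>x. cut (\<lambda>u v. sg (d * wdeg v) (th g (rs1' @ (h, D, x) # rs2) (wtgt X u) (\<lambda>z. \<phi> (rletter g d r X u # z)) v)) w"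
      have "?Q ?z = act R a (?Q x) + ?Q y"
        unfolding cut_act[symmetric] cut_add[symmetric] act_sg sg_add[symmetric]
      proof (rule cut_cong, rule arg_cong[where f = "sg _"])
        fix u v assume uv: "u @ v = w"
        then have u: "is_word A X u" "is_word A (wtgt X u) v" using w by (auto simp: is_word_append)
        have "lin R B (fob g (wtgt X u)) (\<lambda>z. \<phi> (rletter g d r X u # z))"
          unfolding rletter_def by (rule lin_tail[OF l fX]) (rule trans_closed[OF f g r u(1)])
        then show "th g (rs1' @ (h, D, ?z) # rs2) (wtgt X u) (\<lambda>z. \<phi> (rletter g d r X u # z)) v =
         act R a (th g (rs1' @ (h, D, x) # rs2) (wtgt X u) (\<lambda>z. \<phi> (rletter g d r X u # z)) v) +
         th g (rs1' @ (h, D, y) # rs2) (wtgt X u) (\<lambda>z. \<phi> (rletter g d r X u # z)) v"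
          using less.hyps[of rs1' v g "wtgt X u" "\<lambda>z. \<phi> (rletter g d r X u # z)"] uv Cons p a wg u g
          by auto
      qed
      then show ?thesis
        using 1 by (subst (1 2 3) th_rec) (simp add: Cons p act_add)
    qed
  qed
qed

section \<open>Words without transformations: functors as maps of coalgebras\<close>

lemma theta_splits_0: "theta_splits 0 w = map (Pair False) ` splits w"
proof (intro equalityI subsetI)
  fix ps assume ps: "ps \<in> theta_splits 0 w"
  then have "\<forall>p \<in> set ps. p = (False, snd p)"
    by (auto simp: theta_splits_def filter_empty_conv)
  then have "ps = map (Pair False) (map snd ps)" by (simp add: map_idI)
  moreover have "map snd ps \<in> splits w"
    using ps \<open>\<forall>p \<in> set ps. p = (False, snd p)\<close> by (auto simp: splits_def theta_splits_def)
  ultimately show "ps \<in> map (Pair False) ` splits w" by blast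
qed (auto simp: theta_splits_def splits_def filter_empty_conv comp_def)

lemma theta_tensor_functor: "theta_tensor f X [] (map (Pair False) ws) = fun_tensor f X ws"
  by (induction ws arbitrary: X) auto

lemma theta_sign_functor: "theta_sign [] (map (Pair False) ws) = 0"
  by (induction ws) auto

lemma inj_map_False: "inj_on (map (Pair False)) S"
  by (rule inj_onI) (metis inj_def inj_map_eq_map prod.inject)

lemma sum_splits: "(\<Sum>ws \<in> splits w. h (fun_tensor f X ws)) = th f [] X h w"
  unfolding th_def list.size theta_splits_0
  by (subst sum.reindex[OF inj_map_False]) (simp add: theta_tensor_functor theta_sign_functor)

text \<open>Only the typing of \<open>f\<close> is assumed, not the functor equations, so that the
  result is available while these equations are still being proved for composites and for
  postcomposition.\<close>

lemma fun_tensor_word_closed: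
  assumes ob: "\<And>X. X \<in> Obj A \<Longrightarrow> fob f X \<in> Obj B"
    and mp: "\<And>X w. is_word A X w \<Longrightarrow> w \<noteq> [] \<Longrightarrow>
      fmp f X w \<in> carrier (sMor B (fob f X) (fob f (wtgt X w)) (wdeg w))"
    and "is_word A X w" "ws \<in> splits w"
  shows "is_word B (fob f X) (fun_tensor f X ws) \<and>
    wtgt (fob f X) (fun_tensor f X ws) = fob f (wtgt X w) \<and>
    wdeg (fun_tensor f X ws) = wdeg w \<and> (w \<noteq> [] \<longrightarrow> fun_tensor f X ws \<noteq> [])"
  using assms(3,4)
proof (induction ws arbitrary: X w)
  case (Cons u ws)
  have w: "w = u @ concat ws" "u \<noteq> []" "ws \<in> splits (concat ws)"
    using Cons.prems(2) by (auto simp: splits_def)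
  then have wu: "is_word A X u" "is_word A (wtgt X u) (concat ws)"
    using Cons.prems(1) by (simp_all add: is_word_append)
  show ?case using Cons.IH[OF wu(2) w(3)] w(1,2) wu by (simp add: ob mp is_word_src)
qed (auto simp: splits_def ob)

lemma fun_tensor_word:
  assumes "ainf_functor R A B f" "is_word A X w" "ws \<in> splits w"
  shows "is_word B (fob f X) (fun_tensor f X ws) \<and>
    wtgt (fob f X) (fun_tensor f X ws) = fob f (wtgt X w) \<and>
    wdeg (fun_tensor f X ws) = wdeg w \<and> (w \<noteq> [] \<longrightarrow> fun_tensor f X ws \<noteq> [])"
  by (rule fun_tensor_word_closed[OF functor_ob[OF assms(1)] functor_closed[OF assms(1)] assms(2,3)])

lemma th_swap:
  "th f rs X (\<lambda>z1. th g qs Y (\<lambda>z2. \<Phi> z1 z2) v) u = th g qs Y (\<lambda>z2. th f rs X (\<lambda>z1. \<Phi> z1 z2) u) v"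
  unfolding th_def sg_sum by (subst sum.swap) (simp add: add.commute)

lemma bh_th_swap:
  "bh A X (\<lambda>u'. th g qs Y (\<lambda>z2. \<Phi> u' z2) v) u = th g qs Y (\<lambda>z2. bh A X (\<lambda>u'. \<Phi> u' z2) u) v"
  unfolding th_def bh_def sg_sum case_prod_unfold by (subst sum.swap) (simp add: add.commute)

lemma bh_cut_swap: "bh A X (\<lambda>z. cut (\<lambda>u v. F u v z) w) rs = cut (\<lambda>u v. bh A X (F u v) rs) w"
  by (induction w arbitrary: F) (simp_all add: bh_add)

lemma bh_cut1_swap: "bh A X (\<lambda>z. cut1 (\<lambda>u v. F u v z) w) rs = cut1 (\<lambda>u v. bh A X (F u v) rs) w"
  by (cases w) (simp_all add: bh_cut_swap)

text \<open>A sum standing inside a letter is moved outside by linearity of \<open>\<phi>\<close>.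
  In this way equations in \<open>A\<close> and \<open>B\<close> are applied under an arbitrary
  functional; the next two lemmas do the same for sums over labelled and over plain
  decompositions.\<close>

lemma lin_b_then:
  assumes A: "ainf_category R A" and B: "ainf_category R B" and u: "is_word A X u"
    and l: "lin R B X' \<phi>" and X': "X' \<in> Obj B" and z: "is_word B Z z"
    and cl: "\<And>u'. is_word A X u' \<Longrightarrow> u' \<noteq> [] \<Longrightarrow> wtgt X u' = wtgt X u \<Longrightarrow> wdeg u' = wdeg u + 1 \<Longrightarrow>
      \<psi> X u' \<in> carrier (sMor B X' Z D)"
  shows "b_then (sMor B X' Z D) A \<psi> X u \<in> carrier (sMor B X' Z D)" (is ?cl)
    and "\<phi> ((Z, D, b_then (sMor B X' Z D) A \<psi> X u) # z) = bh A X (\<lambda>u'. \<phi> ((Z, D, \<psi> X u') # z)) u" (is ?eq)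
proof -
  have m: "modular R B" using B by (rule ainf_modular)
  have N: "module R (sMor B X' Z D)" by (rule modularD[OF m X' is_word_src[OF z]])
  interpret N: module R "sMor B X' Z D" by (rule N)
  have c: "\<psi> X (b_insert A X u r n) \<in> carrier (sMor B X' Z D)" if "1 \<le> n" "r + n \<le> length u" for r n
    by (intro cl b_insert_word[OF ainf_bclosed[OF A] u] b_insert_facts that)
  then show ?cl unfolding b_then_def
    by (intro N.finsum_closed) (auto intro: ksign_closed[OF N])
  show ?eq unfolding b_then_def bh_def
    by (subst lin_finsum[OF m l X' z])
      (auto intro!: sum.cong ksign_closed[OF N] c simp: lin_ksign[OF m l X' c z])
qed

lemma lin_th_sum:
  assumes C: "ainf_category R C" and rs: "is_word (fun_cat R A B) f rs" and u: "is_word A X u"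
    and l: "lin R C X' \<phi>" and X': "X' \<in> Obj C" and z: "is_word C Z z"
    and cl: "\<And>y. is_word B (fob f X) y \<Longrightarrow> wtgt (fob f X) y = fob (wtgt f rs) (wtgt X u) \<Longrightarrow>
      wdeg y = wdeg u + wdeg rs \<Longrightarrow> (rs \<noteq> [] \<or> u \<noteq> [] \<Longrightarrow> y \<noteq> []) \<Longrightarrow> \<Phi> y \<in> carrier (sMor C X' Z D)"
  shows "finsum (sMor C X' Z D) (\<lambda>ps. ksign (sMor C X' Z D) (theta_sign rs ps)
      (\<Phi> (theta_tensor f X rs ps))) (theta_splits (length rs) u) \<in> carrier (sMor C X' Z D)" (is ?cl)
    and "\<phi> ((Z, D, finsum (sMor C X' Z D) (\<lambda>ps. ksign (sMor C X' Z D) (theta_sign rs ps)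
      (\<Phi> (theta_tensor f X rs ps))) (theta_splits (length rs) u)) # z) =
      th f rs X (\<lambda>y. \<phi> ((Z, D, \<Phi> y) # z)) u" (is ?eq)
proof -
  have m: "modular R C" using C by (rule ainf_modular)
  have N: "module R (sMor C X' Z D)" by (rule modularD[OF m X' is_word_src[OF z]])
  interpret N: module R "sMor C X' Z D" by (rule N)
  have c: "\<Phi> (theta_tensor f X rs ps) \<in> carrier (sMor C X' Z D)"
    if "ps \<in> theta_splits (length rs) u" for ps
    using theta_tensor_word[OF rs u that] by (intro cl theta_tensor_nonempty[OF that]) auto
  then show ?cl by (intro N.finsum_closed) (auto intro: ksign_closed[OF N])
  show ?eq unfolding th_def
    by (subst lin_finsum[OF m l X' z]) (auto intro!: sum.cong ksign_closed[OF N] c simp: lin_ksign[OF m l X' c z])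
qed

lemma lin_splits_sum:
  assumes C: "ainf_category R C" and f: "ainf_functor R A B f" and u: "is_word A X u"
    and l: "lin R C X' \<phi>" and X': "X' \<in> Obj C" and z: "is_word C Z z"
    and cl: "\<And>y. is_word B (fob f X) y \<Longrightarrow> wtgt (fob f X) y = fob f (wtgt X u) \<Longrightarrow>
      wdeg y = wdeg u \<Longrightarrow> (u \<noteq> [] \<Longrightarrow> y \<noteq> []) \<Longrightarrow> \<Phi> y \<in> carrier (sMor C X' Z D)"
  shows "finsum (sMor C X' Z D) (\<lambda>ws. \<Phi> (fun_tensor f X ws)) (splits u) \<in> carrier (sMor C X' Z D)"
    and "\<phi> ((Z, D, finsum (sMor C X' Z D) (\<lambda>ws. \<Phi> (fun_tensor f X ws)) (splits u)) # z) =
      th f [] X (\<lambda>y. \<phi> ((Z, D, \<Phi> y) # z)) u"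
proof -
  have m: "modular R C" using C by (rule ainf_modular)
  interpret N: module R "sMor C X' Z D" by (rule modularD[OF m X' is_word_src[OF z]])
  have c: "\<Phi> (fun_tensor f X ws) \<in> carrier (sMor C X' Z D)" if "ws \<in> splits u" for ws
    using fun_tensor_word[OF f u that] by (intro cl) auto
  then show "finsum (sMor C X' Z D) (\<lambda>ws. \<Phi> (fun_tensor f X ws)) (splits u) \<in> carrier (sMor C X' Z D)"
    by (intro N.finsum_closed) auto
  show "\<phi> ((Z, D, finsum (sMor C X' Z D) (\<lambda>ws. \<Phi> (fun_tensor f X ws)) (splits u)) # z) =
      th f [] X (\<lambda>y. \<phi> ((Z, D, \<Phi> y) # z)) u"
    by (subst lin_finsum[OF m l X' z c]) (simp_all only: sum_splits[of "\<lambda>y. \<phi> ((Z, D, \<Phi> y) # z)"])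
qed

text \<open>The functor equation inside the first letter of a word with arbitrary tail
  \<open>z\<close>: both sides are one and the same element of the hom-module, written as two sums,
  and \<open>\<phi>\<close> is linear in that letter.\<close>

lemma lin_functor_eq:
  assumes f: "ainf_functor R A B f" and u: "is_word A X u" "u \<noteq> []"
    and l: "lin R B (fob f X) \<phi>" and z: "is_word B (fob f (wtgt X u)) z"
  shows "th f [] X (\<lambda>y. \<phi> ((wtgt (fob f X) y, wdeg y + 1, bop B (fob f X) y) # z)) u =
    bh A X (\<lambda>u'. \<phi> (fletter f X u' # z)) u"
proof -
  let ?Z = "fob f (wtgt X u)" and ?D = "wdeg u + 1"
  let ?M = "sMor B (fob f X) ?Z ?D"
  have A: "ainf_category R A" and B: "ainf_category R B" using f by (simp_all add: functor_cats)
  have X: "X \<in> Obj A" using is_word_src[OF u(1)] .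
  have rs: "is_word (fun_cat R A B) f []" using f by simp
  have "th f [] X (\<lambda>y. \<phi> ((wtgt (fob f X) y, wdeg y + 1, bop B (fob f X) y) # z)) u =
      th f [] X (\<lambda>y. \<phi> ((?Z, ?D, bop B (fob f X) y) # z)) u"
    by (rule th_cong_word[OF rs u(1)]) simp
  also have "\<dots> = \<phi> ((?Z, ?D, finsum ?M (\<lambda>ws. bop B (fob f X) (fun_tensor f X ws)) (splits u)) # z)"
  proof (rule lin_splits_sum(2)[OF B f u(1) l functor_ob[OF f X] z, symmetric])
    fix y assume "is_word B (fob f X) y" "wtgt (fob f X) y = fob f (wtgt X u)" "wdeg y = wdeg u"
      "u \<noteq> [] \<Longrightarrow> y \<noteq> []"
    then show "bop B (fob f X) y \<in> carrier ?M"
      using ainf_bclosed[OF B] u(2) unfolding bclosed_def by metis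
  qed
  also have "finsum ?M (\<lambda>ws. bop B (fob f X) (fun_tensor f X ws)) (splits u) = b_then ?M A (fmp f) X u"
    using f u by (simp add: ainf_functor_def Let_def)
  also have "\<phi> ((?Z, ?D, \<dots>) # z) = bh A X (\<lambda>u'. \<phi> ((?Z, ?D, fmp f X u') # z)) u"
  proof (rule lin_b_then(2)[OF A B u(1) l functor_ob[OF f X] z])
    fix u' assume "is_word A X u'" "u' \<noteq> []" "wtgt X u' = wtgt X u" "wdeg u' = wdeg u + 1"
    then show "fmp f X u' \<in> carrier ?M" using functor_closed[OF f] by metis
  qed
  also have "\<dots> = bh A X (\<lambda>u'. \<phi> (fletter f X u' # z)) u"
    by (rule bh_cong) (simp add: fletter_def)
  finally show ?thesis .
qed

text \<open>Singles out words of length one. It carries the summand peculiar to \<open>B_1\<close>,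
  in which an operation of \<open>A\<close> precedes the transformation; the operations with more
  inputs have no such term.\<close>

definition sing :: "(('f \<times> int \<times> 'r) list) \<Rightarrow> ('f \<Rightarrow> int \<Rightarrow> 'r \<Rightarrow> 't :: zero) \<Rightarrow> 't" where
  "sing rs \<Psi> = (case rs of [(g, d, r)] \<Rightarrow> \<Psi> g d r | _ \<Rightarrow> 0)"

lemma sing_simps [simp]:
  "sing [] \<Psi> = 0" "sing [(g, d, r)] \<Psi> = \<Psi> g d r" "sing (p # q # rs) \<Psi> = 0"
  by (auto simp: sing_def split: prod.splits)

lemma cut1_sing:
  fixes rs :: "('f \<times> int \<times> 'r) list"
  shows "cut1 (\<lambda>rs1 rs2. sing rs1 (\<lambda>g d r. \<Psi> g d r rs2)) rs =
    (case rs of [] \<Rightarrow> 0 | (g, d, r) # rs' \<Rightarrow> \<Psi> g d r rs')"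
proof (cases rs)
  case (Cons p rs')
  obtain g d r where p: "p = (g, d, r)" by (cases p)
  have "cut1 (\<lambda>rs1 rs2. sing (p # rs1) (\<lambda>g d r. \<Psi> g d r rs2)) rs' = cut1 (\<lambda>_ _. 0) rs'"
  proof (rule cut1_cong)
    fix u v :: "('f \<times> int \<times> 'r) list" assume "u \<noteq> []"
    then show "sing (p # u) (\<lambda>g d r. \<Psi> g d r v) = 0" by (cases u) auto
  qed
  then show ?thesis by (simp add: Cons p cut_cut1)
qed simp

text \<open>The operations of the category of functors as a first letter under a functional: the sum
  over decompositions and, for a single transformation, the correction by \<open>b_then\<close> are
  both taken out of the letter by linearity.\<close>

lemma fun_cat_bop:
  fixes B :: "('k, 'ob, 'mb) ainf_cat" and \<phi> :: "('ob, 'mb) word \<Rightarrow> ('k, 'n) allmod"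
  assumes f: "is_word (fun_cat R A B) f rs" and rs: "rs \<noteq> []" and u: "is_word A X u"
  shows "bop (fun_cat R A B) f rs X u \<in>
      carrier (sMor B (fob f X) (fob (wtgt f rs) (wtgt X u)) (wdeg u + (wdeg rs + 1)))"
    and "lin R B (fob f X) \<phi> \<Longrightarrow> is_word B (fob (wtgt f rs) (wtgt X u)) z \<Longrightarrow>
      \<phi> (rletter (wtgt f rs) (wdeg rs + 1) (bop (fun_cat R A B) f rs) X u # z) =
      th f rs X (\<lambda>y. \<phi> ((wtgt (fob f X) y, wdeg y + 1, bop B (fob f X) y) # z)) u -
      sing rs (\<lambda>g d r. sg d (bh A X (\<lambda>u'. \<phi> (rletter g d r X u' # z)) u))"
proof -
  let ?Z = "fob (wtgt f rs) (wtgt X u)" and ?D = "wdeg u + (wdeg rs + 1)" and ?X = "fob f X"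
  let ?M = "sMor B ?X ?Z ?D"
  have ff: "ainf_functor R A B f" using is_word_src[OF f] by simp
  have A: "ainf_category R A" and B: "ainf_category R B" using ff by (simp_all add: functor_cats)
  have X: "X \<in> Obj A" using is_word_src[OF u] .
  have fX: "?X \<in> Obj B" using ff X by (rule functor_ob)
  have m: "modular R B" using B by (rule ainf_modular)
  have Z: "?Z \<in> Obj B" using is_word_tgt[OF f] is_word_tgt[OF u] by (simp add: functor_ob)
  interpret M: module R ?M by (rule modularD[OF m fX Z])
  have M: "module R ?M" by (rule M.module_axioms)
  define t where "t = finsum ?M (\<lambda>ps. ksign ?M (theta_sign rs ps)
      (bop B ?X (theta_tensor f X rs ps))) (theta_splits (length rs) u)"
  have c: "bop B ?X y \<in> carrier ?M" if "is_word B ?X y" "wtgt ?X y = ?Z" "wdeg y = wdeg u + wdeg rs"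
    "rs \<noteq> [] \<or> u \<noteq> [] \<Longrightarrow> y \<noteq> []" for y
    using ainf_bclosed[OF B] that rs unfolding bclosed_def by (metis add.assoc)
  have tc: "t \<in> carrier ?M"
    unfolding t_def by (rule lin_th_sum(1)[OF B f u lin_0 fX, where z = "[]"]) (use Z c in auto)
  have tl: "\<phi> ((?Z, ?D, t) # z) = th f rs X (\<lambda>y. \<phi> ((wtgt ?X y, wdeg y + 1, bop B ?X y) # z)) u"
    if l: "lin R B ?X \<phi>" and z: "is_word B ?Z z" for \<phi> :: "('ob, 'mb) word \<Rightarrow> ('k, 'n) allmod" and z
  proof -
    have "\<phi> ((?Z, ?D, t) # z) = th f rs X (\<lambda>y. \<phi> ((?Z, ?D, bop B ?X y) # z)) u"
      unfolding t_def by (rule lin_th_sum(2)[OF B f u l fX z c])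
    also have "\<dots> = th f rs X (\<lambda>y. \<phi> ((wtgt ?X y, wdeg y + 1, bop B ?X y) # z)) u"
      by (rule th_cong_word[OF f u]) (simp add: add.assoc)
    finally show ?thesis .
  qed
  have D: "wdeg u + wdeg rs + 1 = ?D" by simp
  have *: "bop (fun_cat R A B) f rs X u \<in> carrier ?M \<and>
     (\<forall>\<phi> :: ('ob, 'mb) word \<Rightarrow> ('k, 'n) allmod. \<forall>z. lin R B ?X \<phi> \<longrightarrow> is_word B ?Z z \<longrightarrow>
       \<phi> ((?Z, ?D, bop (fun_cat R A B) f rs X u) # z) = \<phi> ((?Z, ?D, t) # z) -
      sing rs (\<lambda>g d r. sg d (bh A X (\<lambda>u'. \<phi> (rletter g d r X u' # z)) u)))"
  proof (cases "\<exists>g d r. rs = [(g, d, r)]")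
    case True
    then obtain g d r where r: "rs = [(g, d, r)]" by blast
    have g: "ainf_functor R A B g" and rc: "r \<in> carrier (trans_module R A B f g d)"
      using f r by simp_all
    let ?b = "b_then ?M A r X u"
    have bop: "bop (fun_cat R A B) f rs X u = t \<ominus>\<^bsub>?M\<^esub> ksign ?M d ?b"
      using u by (simp add: fun_cat_def r t_def Let_def ac_simps)
    have cr: "r X u' \<in> carrier ?M" if "is_word A X u'" "wtgt X u' = wtgt X u" "wdeg u' = wdeg u + 1" for u'
      using trans_closed[OF ff g rc that(1)] that(2,3) by (simp add: r ac_simps)
    have bc: "?b \<in> carrier ?M"
      by (rule lin_b_then(1)[OF A B u lin_0 fX, where z = "[]"]) (use cr Z in auto)
    have "\<phi> ((?Z, ?D, bop (fun_cat R A B) f rs X u) # z) = \<phi> ((?Z, ?D, t) # z) -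
      sing rs (\<lambda>g d r. sg d (bh A X (\<lambda>u'. \<phi> (rletter g d r X u' # z)) u))"
      if l: "lin R B ?X \<phi>" and z: "is_word B ?Z z" for \<phi> :: "('ob, 'mb) word \<Rightarrow> ('k, 'n) allmod" and z
    proof -
      have "\<phi> ((?Z, ?D, ?b) # z) = bh A X (\<lambda>u'. \<phi> ((?Z, ?D, r X u') # z)) u"
        by (rule lin_b_then(2)[OF A B u l fX z]) (use cr in auto)
      also have "\<dots> = bh A X (\<lambda>u'. \<phi> (rletter g d r X u' # z)) u"
        by (rule bh_cong) (simp add: rletter_def r ac_simps)
      finally show ?thesis
        unfolding bop lin_diff[OF m l fX tc ksign_closed[OF M bc] z] lin_ksign[OF m l fX bc z]
        by (simp add: r)
    qed
    then show ?thesis using tc ksign_closed[OF M bc] by (simp add: bop)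
  next
    case False
    obtain g1 d1 r1 g2 d2 r2 rs' where r: "rs = (g1, d1, r1) # (g2, d2, r2) # rs'"
      using rs False by (metis list.exhaust prod_cases3)
    have "bop (fun_cat R A B) f rs X u = t"
      using u by (simp add: fun_cat_def r t_def Let_def ac_simps)
    then show ?thesis using tc by (simp add: r)
  qed
  then show "bop (fun_cat R A B) f rs X u \<in> carrier ?M" by blast
  show "\<phi> (rletter (wtgt f rs) (wdeg rs + 1) (bop (fun_cat R A B) f rs) X u # z) =
      th f rs X (\<lambda>y. \<phi> ((wtgt ?X y, wdeg y + 1, bop B ?X y) # z)) u -
      sing rs (\<lambda>g d r. sg d (bh A X (\<lambda>u'. \<phi> (rletter g d r X u' # z)) u))"
    if "lin R B ?X \<phi>" "is_word B ?Z z"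
    using *[THEN conjunct2, rule_format, OF that] tl[OF that] by (simp add: rletter_def)
qed

text \<open>Presents the parts before, inside and after the operation as an iterated cut, so that
  the linearity rules for cuts reach a marked letter in any of the three.\<close>

lemma bh_as_cut:
  "bh A X \<phi> w = cut (\<lambda>u0. cut1 (\<lambda>u v. sg (wdeg v)
     (\<phi> (u0 @ (wtgt (wtgt X u0) u, wdeg u + 1, bop A (wtgt X u0) u) # v)))) w"
proof (induction w arbitrary: X \<phi>)
  case (Cons p w)
  obtain Y d x where p: "p = (Y, d, x)" by (cases p)
  show ?case unfolding p bh_cut1_Cons cut.simps Cons.IH by simp
qed simp

lemma lin_bh:
  assumes A: "ainf_category R A" and l: "lin R A X \<phi>"
  shows "lin R A X (bh A X \<phi>)"
proof -
  have m: "modular R A" using A by (rule ainf_modular)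
  let ?F = "\<lambda>u0 u v. sg (wdeg v) (\<phi> (u0 @ (wtgt (wtgt X u0) u, wdeg u + 1, bop A (wtgt X u0) u) # v))"
  have bl: "is_word A X (u0 @ (wtgt (wtgt X u0) u, wdeg u + 1, bop A (wtgt X u0) u) # v)"
    if "is_word A X (u0 @ u @ v)" "u \<noteq> []" for u0 u v
    using that ainf_bclosed[OF A] by (auto simp: is_word_append bclosed_def is_word_tgt)
  have "lin R A X (cut (\<lambda>u0. cut1 (?F u0)))"
  proof (rule lin_cut[OF m])
    fix u0 assume u0: "is_word A X u0"
    show "lin R A (wtgt X u0) (cut1 (?F u0))"
    proof (rule lin_cut1[OF m])
      fix u assume u: "is_word A (wtgt X u0) u" "u \<noteq> []"
      have "is_word A X (u0 @ [(wtgt (wtgt X u0) u, wdeg u + 1, bop A (wtgt X u0) u)])"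
        using bl[of u0 u "[]"] u u0 by (simp add: is_word_append is_word_tgt)
      from lin_sgw[OF lin_shift[OF l this], of 0 1]
      show "lin R A (wtgt (wtgt X u0) u) (?F u0 u)" by simp
    next
      fix u Y d x y u' v a
      assume *: "a \<in> carrier R" "is_word A (wtgt X u0) (u @ (Y, d, x) # u' @ v)"
        "is_word A (wtgt X u0) (u @ (Y, d, y) # u' @ v)"
      then have w: "is_word A (wtgt X u0) (u @ (Y, d, x) # u')" "is_word A (wtgt X u0) (u @ (Y, d, y) # u')"
        "is_word A (wtgt Y u') v"
        by (auto simp: is_word_append dest: is_word_tgt)
      have b: "is_word A X (u0 @ (wtgt Y u', wdeg u + (d + wdeg u') + 1, bop A (wtgt X u0) (u @ (Y, d, x) # u')) # v)"
        "is_word A X (u0 @ (wtgt Y u', wdeg u + (d + wdeg u') + 1, bop A (wtgt X u0) (u @ (Y, d, y) # u')) # v)"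
        using bl[of u0 "u @ (Y, d, x) # u'" v] bl[of u0 "u @ (Y, d, y) # u'" v] * u0
        by (simp_all add: is_word_append)
      show "?F u0 (u @ (Y, d, a \<odot>\<^bsub>sMor A (wtgt (wtgt X u0) u) Y d\<^esub> x \<oplus>\<^bsub>sMor A (wtgt (wtgt X u0) u) Y d\<^esub> y) # u') v =
        act R a (?F u0 (u @ (Y, d, x) # u') v) + ?F u0 (u @ (Y, d, y) # u') v"
        using tlin_comb[OF ainf_tlin[OF A] *(1) w(1,2)] linD[OF l *(1) b] by (simp add: act_sg sg_add)
    qed
  next
    fix u Y d x y u' v0 a
    assume *: "a \<in> carrier R" "is_word A X (u @ (Y, d, x) # u' @ v0)" "is_word A X (u @ (Y, d, y) # u' @ v0)"
    show "cut1 (?F (u @ (Y, d, a \<odot>\<^bsub>sMor A (wtgt X u) Y d\<^esub> x \<oplus>\<^bsub>sMor A (wtgt X u) Y d\<^esub> y) # u')) v0 =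
      act R a (cut1 (?F (u @ (Y, d, x) # u')) v0) + cut1 (?F (u @ (Y, d, y) # u')) v0"
      unfolding cut1_act[symmetric] cut1_add[symmetric]
    proof (rule cut1_cong)
      fix p v assume p: "p @ v = v0" "p \<noteq> []"
      have "is_word A X (u @ (Y, d, t) # u' @ (wtgt (wtgt Y u') p, wdeg p + 1, bop A (wtgt Y u') p) # v)"
        if "is_word A X (u @ (Y, d, t) # u' @ v0)" for t
        using bl[of "u @ (Y, d, t) # u'" p v] that p by simp
      from linD[OF l *(1) this[OF *(2)] this[OF *(3)]]
      show "?F (u @ (Y, d, a \<odot>\<^bsub>sMor A (wtgt X u) Y d\<^esub> x \<oplus>\<^bsub>sMor A (wtgt X u) Y d\<^esub> y) # u') p v =
        act R a (?F (u @ (Y, d, x) # u') p v) + ?F (u @ (Y, d, y) # u') p v"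
        by (simp add: act_sg sg_add)
    qed
  qed
  then show ?thesis by (simp add: bh_as_cut[abs_def])
qed

text \<open>Reduces identities between elements to identities between linear functionals.\<close>

definition emb_word :: "'k ring \<Rightarrow> ('k, 'o, 'm) ainf_cat \<Rightarrow> 'o \<Rightarrow> ('o, 'm) word \<Rightarrow> ('k, 'm) allmod" where
  "emb_word R B X = (\<lambda>z. case z of [(Z, D, x)] \<Rightarrow> emb R (sMor B X Z D) x | _ \<Rightarrow> 0)"

lemma emb_word_single [simp]: "emb_word R B X [(Z, D, x)] = emb R (sMor B X Z D) x"
  by (simp add: emb_word_def)

lemma lin_emb_word:
  assumes mB: "modular R B" and X: "X \<in> Obj B"
  shows "lin R B X (emb_word R B X)"
proof (rule linI)
  fix u Y d x y v a
  assume *: "a \<in> carrier R" "is_word B X (u @ (Y, d, x) # v)"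
    "is_word B X (u @ (Y, d, y) # v)"
  show "emb_word R B X (u @ (Y, d, a \<odot>\<^bsub>sMor B (wtgt X u) Y d\<^esub> x \<oplus>\<^bsub>sMor B (wtgt X u) Y d\<^esub> y) # v)
     = act R a (emb_word R B X (u @ (Y, d, x) # v)) + emb_word R B X (u @ (Y, d, y) # v)"
  proof (cases "u = [] \<and> v = []")
    case True
    have N: "module R (sMor B X Y d)"
      using modularD[OF mB X] * True by simp
    then show ?thesis using True *
      by (simp add: emb_add[OF N] emb_smult[OF N] module.smult_closed[OF N])
  next
    case False
    have "emb_word R B X (u @ (Y, d, t) # v) = 0" for t
      using False unfolding emb_word_def by (cases u; cases v; cases "tl u") (auto split: list.splits)
    then show ?thesis by simp
  qed
qed

text \<open>The previous letter formula with empty tail, tested on the functional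
  \<open>emb_word\<close>, which reads off a one-letter word.\<close>

lemma rv_bop:
  assumes f: "is_word (fun_cat R A B) f rs" and rs: "rs \<noteq> []" and w: "is_word A X w"
    and B: "ainf_category R B"
  shows "rv R B f (wtgt f rs) (wdeg rs + 1) (bop (fun_cat R A B) f rs) X w =
      th f rs X (bv R B (fob f X)) w - sing rs (\<lambda>g d r. sg d (bh A X (rv R B f g d r X) w))"
proof -
  have ff: "ainf_functor R A B f" and g: "ainf_functor R A B (wtgt f rs)"
    using is_word_src[OF f] is_word_tgt[OF f] by simp_all
  have fX: "fob f X \<in> Obj B" using functor_ob[OF ff is_word_src[OF w]] .
  have "is_word B (fob (wtgt f rs) (wtgt X w)) []"
    using is_word_tgt[OF w] g by (simp add: functor_ob)
  from fun_cat_bop(2)[OF f rs w lin_emb_word[OF ainf_modular[OF B] fX] this]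
  show ?thesis
    by (simp add: rletter_def rv_eq[abs_def] bv_eq[abs_def])
qed

lemma fun_cat_bop_carrier:
  assumes f: "is_word (fun_cat R A B) f rs" and rs: "rs \<noteq> []"
    and A: "ainf_category R A" and B: "ainf_category R B"
  shows "bop (fun_cat R A B) f rs \<in> carrier (trans_module R A B f (wtgt f rs) (wdeg rs + 1))"
proof -
  let ?b = "bop (fun_cat R A B) f rs" and ?g = "wtgt f rs"
  have ff: "ainf_functor R A B f" and g: "ainf_functor R A B ?g"
    using is_word_src[OF f] is_word_tgt[OF f] by simp_all
  have mA: "modular R A" and mB: "modular R B" using A B by (simp_all add: ainf_modular)
  have cl: "?b X w \<in> carrier (sMor B (fob f X) (fob ?g (wtgt X w)) (wdeg w + (wdeg rs + 1)))"
    if "is_word A X w" for X w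
    by (rule fun_cat_bop(1)[OF f rs that])
  have undef: "?b X w = undefined" if "\<not> is_word A X w" for X w
    using that by (simp add: fun_cat_def)
  have lin: "lin R A X (rv R B f ?g (wdeg rs + 1) ?b X)" for X
  proof (cases "X \<in> Obj A")
    case True
    have fX: "fob f X \<in> Obj B" using ff True by (rule functor_ob)
    note eq = rv_bop[OF f rs _ B]
    have "lin R A X (\<lambda>w. th f rs X (bv R B (fob f X)) w -
        sing rs (\<lambda>g d r. sg d (bh A X (rv R B f g d r X) w)))"
    proof -
      have 1: "lin R A X (th f rs X (bv R B (fob f X)))" by (rule lin_th[OF f lin_bv[OF B] True])
      have 2: "lin R A X (\<lambda>w. - sing rs (\<lambda>g d r. sg d (bh A X (rv R B f g d r X) w)))"
      proof (cases "\<exists>g d r. rs = [(g, d, r)]")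
        case True
        then obtain g d r where r: "rs = [(g, d, r)]" by blast
        then have g: "ainf_functor R A B g" and rc: "r \<in> carrier (trans_module R A B f g d)"
          using f by simp_all
        show ?thesis unfolding r sing_simps
          by (intro lin_minus lin_sg lin_bh[OF A] lin_rv[OF ff g rc])
      next
        case False
        then have "sing rs (\<lambda>g d r. sg d (bh A X (rv R B f g d r X) w)) = 0" for w
          by (auto simp: sing_def split: list.splits)
        then show ?thesis by (simp add: lin_0)
      qed
      show ?thesis using lin_plus[OF 1 2] by simp
    qed
    then show ?thesis by (rule lin_cong[OF mA]) (simp add: eq)
  next
    case False
    then show ?thesis by (intro linI) (metis is_word_src)
  qed
  show ?thesis unfolding trans_carrier_iff[OF ff g] using cl lin undef by simp
qed

lemma fun_cat_bclosed:
  "ainf_category R A \<Longrightarrow> ainf_category R B \<Longrightarrow> bclosed (fun_cat R A B)"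
  by (simp add: bclosed_def fun_cat_bop_carrier)

text \<open>The map \<open>\<theta>\<close> intertwines the codifferentials of source and target.\<close>

theorem th_bh:
  assumes A: "ainf_category R A" and B: "ainf_category R B"
    and "is_word (fun_cat R A B) f rs" "is_word A X w" "lin R B (fob f X) \<phi>"
  shows "th f rs X (bh B (fob f X) \<phi>) w =
    bh (fun_cat R A B) f (\<lambda>rs'. th f rs' X \<phi> w) rs + sg (wdeg rs) (bh A X (th f rs X \<phi>) w)"
  using assms(3-)
proof (induction "length rs + length w" arbitrary: f rs X \<phi> w rule: less_induct)
  case less
  let ?W = "fun_cat R A B"
  note rs = less.prems(1) and w = less.prems(2) and l = less.prems(3)
  have f: "ainf_functor R A B f" using is_word_src[OF rs] by simp
  have X: "X \<in> Obj A" using is_word_src[OF w] .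
  have fX: "fob f X \<in> Obj B" using f X by (rule functor_ob)
  let ?X = "fob f X"
  let ?bl = "\<lambda>z. (wtgt ?X z, wdeg z + 1, bop B ?X z)"
  let ?pF = "\<lambda>u z. \<phi> (fletter f X u # z)" and ?pR = "\<lambda>g d r u z. \<phi> (rletter g d r X u # z)"
  \<comment> \<open>\<open>T1\<close> to \<open>T4\<close> are the terms in which the operation of
    \<open>B\<close> acts behind the first output letter. That letter comes from \<open>f\<close> in
    \<open>T1\<close> and \<open>T2\<close>, from the first transformation in \<open>T3\<close> and
    \<open>T4\<close>; the induction hypothesis trades the operation for one on transformations or
    one on inputs.\<close>
  define T1 where "T1 = cut1 (\<lambda>u v. bh ?W f (\<lambda>rs'. th f rs' (wtgt X u) (?pF u) v) rs) w"
  define T2 where "T2 = cut1 (\<lambda>u v. sg (wdeg rs) (bh A (wtgt X u) (th f rs (wtgt X u) (?pF u)) v)) w"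
  define T3 where "T3 = (case rs of [] \<Rightarrow> 0 | (g, d, r) # rs' \<Rightarrow>
     cut (\<lambda>u v. sg (d * wdeg v) (bh ?W g (\<lambda>rs''. th g rs'' (wtgt X u) (?pR g d r u) v) rs')) w)"
  define T4 where "T4 = (case rs of [] \<Rightarrow> 0 | (g, d, r) # rs' \<Rightarrow>
     cut (\<lambda>u v. sg (d * wdeg v + wdeg rs') (bh A (wtgt X u) (th g rs' (wtgt X u) (?pR g d r u)) v)) w)"
  \<comment> \<open>In \<open>K1\<close> to \<open>K3\<close> the operation of \<open>B\<close>
    swallows the first output letter. If it meets only functor letters, the functor equation gives
    \<open>K1\<close>; otherwise it forms an operation on an initial part of \<open>rs\<close>,
    giving \<open>K2\<close>, and \<open>K3\<close> undoes the extra summand of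
    \<open>B_1\<close>.\<close>
  define K1 where "K1 = cut1 (\<lambda>u v. sg (wdeg v + wdeg rs)
     (bh A X (\<lambda>u'. th f rs (wtgt X u') (?pF u') v) u)) w"
  define K2 where "K2 = cut1 (\<lambda>rs1 rs2. cut (\<lambda>u v. sg ((wdeg rs1 + 1) * wdeg v + wdeg rs2)
     (th (wtgt f rs1) rs2 (wtgt X u) (?pR (wtgt f rs1) (wdeg rs1 + 1) (bop ?W f rs1) u) v)) w) rs"
  define K3 where "K3 = (case rs of [] \<Rightarrow> 0 | (g, d, r) # rs' \<Rightarrow>
     cut (\<lambda>u v. sg ((d + 1) * wdeg v + wdeg rs' + d)
       (bh A X (\<lambda>u'. th g rs' (wtgt X u') (?pR g d r u') v) u)) w)"
  define \<kappa> where "\<kappa> = cut1 (\<lambda>z1 z2. sg (wdeg z2) (\<phi> (?bl z1 # z2)))"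
  define rest where "rest = (\<lambda>z. case z of [] \<Rightarrow> 0 | p # z \<Rightarrow> bh B (fst p) (\<lambda>z. \<phi> (p # z)) z)"
  have letters:
    "\<And>u. is_word A X u \<Longrightarrow> u \<noteq> [] \<Longrightarrow> lin R B (fob f (wtgt X u)) (?pF u)"
    "\<And>g d r rs' u. rs = (g, d, r) # rs' \<Longrightarrow> is_word A X u \<Longrightarrow> lin R B (fob g (wtgt X u)) (?pR g d r u)"
    unfolding fletter_def rletter_def
    by (rule lin_tail[OF l fX], rule functor_closed[OF f], assumption+)
      (rule lin_tail[OF l fX], rule trans_closed[OF f], use rs in \<open>auto dest: is_word_src\<close>)
  have "th f rs X (bh B ?X \<phi>) w = th f rs X (\<lambda>z. \<kappa> z + rest z) w"
  proof (rule arg_cong[where f = "\<lambda>\<psi>. th f rs X \<psi> w"], rule ext)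
    fix z show "bh B ?X \<phi> z = \<kappa> z + rest z"
      by (cases z) (auto simp: \<kappa>_def rest_def bh_cut1_Cons simp del: cut1.simps(2))
  qed
  then have LHS: "th f rs X (bh B ?X \<phi>) w = th f rs X \<kappa> w + th f rs X rest w"
    by (simp only: th_add)
  have rest: "th f rs X rest w = T1 + T2 + (T3 + T4)"
  proof -
    have "cut1 (\<lambda>u v. th f rs (wtgt X u) (\<lambda>z. rest (fletter f X u # z)) v) w = T1 + T2"
      unfolding T1_def T2_def cut1_add[symmetric]
    proof (rule cut1_cong)
      fix u v assume uv: "u @ v = w" "u \<noteq> []"
      then have wu: "is_word A X u" "is_word A (wtgt X u) v" using w by (auto simp: is_word_append)
      have "length rs + length v < length rs + length w" using uv by auto
      from less.hyps[OF this rs wu(2) letters(1)[OF wu(1) uv(2)]]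
      show "th f rs (wtgt X u) (\<lambda>z. rest (fletter f X u # z)) v =
         bh ?W f (\<lambda>rs'. th f rs' (wtgt X u) (?pF u) v) rs +
         sg (wdeg rs) (bh A (wtgt X u) (th f rs (wtgt X u) (?pF u)) v)"
        by (simp add: rest_def fletter_def)
    qed
    moreover have "(case rs of [] \<Rightarrow> 0 | (g, d, r) # rs' \<Rightarrow> cut (\<lambda>u v. sg (d * wdeg v)
        (th g rs' (wtgt X u) (\<lambda>z. rest (rletter g d r X u # z)) v)) w) = T3 + T4"
    proof (cases rs)
      case (Cons p rs')
      obtain g d r where p: "p = (g, d, r)" by (cases p)
      have rs': "is_word ?W g rs'" using rs Cons p by simp
      show ?thesis unfolding T3_def T4_def Cons p list.case prod.case cut_add[symmetric]
      proof (rule cut_cong)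
        fix u v assume uv: "u @ v = w"
        then have wu: "is_word A X u" "is_word A (wtgt X u) v" using w by (auto simp: is_word_append)
        have "length rs' + length v < length rs + length w" using uv Cons by auto
        from less.hyps[OF this rs' wu(2) letters(2)[OF Cons[unfolded p] wu(1)]]
        show "sg (d * wdeg v) (th g rs' (wtgt X u) (\<lambda>z. rest (rletter g d r X u # z)) v) =
           sg (d * wdeg v) (bh ?W g (\<lambda>rs'. th g rs' (wtgt X u) (?pR g d r u) v) rs') +
           sg (d * wdeg v + wdeg rs') (bh A (wtgt X u) (th g rs' (wtgt X u) (?pR g d r u)) v)"
          by (simp add: rest_def rletter_def sg_add)
      qed
    qed (simp add: T3_def T4_def)
    ultimately show ?thesis by (subst th_rec) (simp add: rest_def)
  qed
  have kappa: "th f rs X \<kappa> w = K1 + K2 + K3"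
  proof -
    let ?Z = "\<lambda>rs1 rs2 u v. if rs1 = [] \<and> u = [] then 0 else sg (wdeg rs1 * wdeg v)
       (th f rs1 X (\<lambda>z1. th (wtgt f rs1) rs2 (wtgt X u) (\<lambda>z2. sg (wdeg z2) (\<phi> (?bl z1 # z2))) v) u)"
    \<comment> \<open>The sign of a tail depends only on its degree, which is that of
      \<open>v\<close> plus that of \<open>rs2\<close>; it therefore leaves the functional, and the
      two sums over decompositions can be exchanged.\<close>
    have Z: "?Z rs1 rs2 u v = sg (wdeg rs1 * wdeg v + (wdeg v + wdeg rs2))
        (th (wtgt f rs1) rs2 (wtgt X u) (\<lambda>z2. th f rs1 X (\<lambda>z1. \<phi> (?bl z1 # z2)) u) v)"
      if uv: "u @ v = w" "rs1 @ rs2 = rs" "rs1 \<noteq> [] \<or> u \<noteq> []" for rs1 rs2 u v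
    proof -
      have wu: "is_word A X u" "is_word A (wtgt X u) v" using w uv by (auto simp: is_word_append)
      have wr: "is_word ?W f rs1" "is_word ?W (wtgt f rs1) rs2" using rs uv by (auto simp: is_word_append)
      have "th (wtgt f rs1) rs2 (wtgt X u) (\<lambda>z2. sg (wdeg z2) (\<phi> (?bl z1 # z2))) v =
         th (wtgt f rs1) rs2 (wtgt X u) (\<lambda>z2. sg (wdeg v + wdeg rs2) (\<phi> (?bl z1 # z2))) v" for z1
        by (rule th_cong_word[OF wr(2) wu(2)]) simp
      then show ?thesis using uv(3) by (auto simp: th_sg th_swap[of f rs1])
    qed
    have Z1: "cut (\<lambda>u v. ?Z [] rs u v) w = K1"
    proof -
      have "cut (\<lambda>u v. ?Z [] rs u v) w = cut1 (\<lambda>u v. ?Z [] rs u v) w" by (simp only: cut_cut1) simp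
      also have "\<dots> = K1" unfolding K1_def
      proof (rule cut1_cong)
        fix u v assume uv: "u @ v = w" "u \<noteq> []"
        then have wu: "is_word A X u" "is_word A (wtgt X u) v" using w by (auto simp: is_word_append)
        have "th f rs (wtgt X u) (\<lambda>z2. th f [] X (\<lambda>z1. \<phi> (?bl z1 # z2)) u) v =
           th f rs (wtgt X u) (\<lambda>z2. bh A X (\<lambda>u'. ?pF u' z2) u) v"
          by (rule th_cong_word[OF rs wu(2)]) (rule lin_functor_eq[OF f wu(1) uv(2) l])
        also have "\<dots> = bh A X (\<lambda>u'. th f rs (wtgt X u) (?pF u') v) u"
          by (rule bh_th_swap[symmetric])
        also have "\<dots> = bh A X (\<lambda>u'. th f rs (wtgt X u') (?pF u') v) u"
          by (rule bh_cong) simp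
        finally show "?Z [] rs u v = sg (wdeg v + wdeg rs) (bh A X (\<lambda>u'. th f rs (wtgt X u') (?pF u') v) u)"
          using uv by (subst Z) auto
      qed
      finally show ?thesis .
    qed
    have Z2: "cut1 (\<lambda>rs1 rs2. cut (\<lambda>u v. ?Z rs1 rs2 u v) w) rs = K2 + K3"
    proof -
      let ?S = "\<lambda>rs2 g d r. cut (\<lambda>u v. sg ((d + 1) * wdeg v + wdeg rs2 + d)
         (bh A X (\<lambda>u'. th g rs2 (wtgt X u') (?pR g d r u') v) u)) w"
      have "cut1 (\<lambda>rs1 rs2. cut (\<lambda>u v. ?Z rs1 rs2 u v) w) rs =
          cut1 (\<lambda>rs1 rs2. cut (\<lambda>u v. sg ((wdeg rs1 + 1) * wdeg v + wdeg rs2)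
     (th (wtgt f rs1) rs2 (wtgt X u) (?pR (wtgt f rs1) (wdeg rs1 + 1) (bop ?W f rs1) u) v)) w +
           sing rs1 (?S rs2)) rs"
      proof (rule cut1_cong)
        fix rs1 rs2 assume r12: "rs1 @ rs2 = rs" "rs1 \<noteq> []"
        have wr: "is_word ?W f rs1" "is_word ?W (wtgt f rs1) rs2" using rs r12 by (auto simp: is_word_append)
        have sS: "sing rs1 (?S rs2) = cut (\<lambda>u v. sing rs1 (\<lambda>g d r. sg ((d + 1) * wdeg v + wdeg rs2 + d)
         (bh A X (\<lambda>u'. th g rs2 (wtgt X u') (?pR g d r u') v) u))) w"
          by (auto simp: sing_def split: list.splits)
        show "cut (\<lambda>u v. ?Z rs1 rs2 u v) w = cut (\<lambda>u v. sg ((wdeg rs1 + 1) * wdeg v + wdeg rs2)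
     (th (wtgt f rs1) rs2 (wtgt X u) (?pR (wtgt f rs1) (wdeg rs1 + 1) (bop ?W f rs1) u) v)) w +
           sing rs1 (?S rs2)"
          unfolding sS cut_add[symmetric]
        proof (rule cut_cong)
          fix u v assume uv: "u @ v = w"
          then have wu: "is_word A X u" "is_word A (wtgt X u) v" using w by (auto simp: is_word_append)
          let ?g = "wtgt f rs1"
          let ?s = "wdeg rs1 * wdeg v + (wdeg v + wdeg rs2)"
          have "th ?g rs2 (wtgt X u) (\<lambda>z2. th f rs1 X (\<lambda>z1. \<phi> (?bl z1 # z2)) u) v =
             th ?g rs2 (wtgt X u) (\<lambda>z2. ?pR ?g (wdeg rs1 + 1) (bop ?W f rs1) u z2 +
               sing rs1 (\<lambda>g d r. sg d (bh A X (\<lambda>u'. ?pR g d r u' z2) u))) v"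
          proof (rule th_cong_word[OF wr(2) wu(2)])
            fix z assume z: "is_word B (fob ?g (wtgt X u)) z"
            show "th f rs1 X (\<lambda>z1. \<phi> (?bl z1 # z)) u = ?pR ?g (wdeg rs1 + 1) (bop ?W f rs1) u z +
               sing rs1 (\<lambda>g d r. sg d (bh A X (\<lambda>u'. ?pR g d r u' z) u))"
              using fun_cat_bop(2)[OF wr(1) r12(2) wu(1) l z] by simp
          qed
          also have "\<dots> = th ?g rs2 (wtgt X u) (?pR ?g (wdeg rs1 + 1) (bop ?W f rs1) u) v +
               sing rs1 (\<lambda>g d r. sg d (bh A X (\<lambda>u'. th g rs2 (wtgt X u') (?pR g d r u') v) u))"
          proof -
            have "th ?g rs2 (wtgt X u) (\<lambda>z. sing rs1 (\<lambda>g d r. sg d (bh A X (\<lambda>u'. ?pR g d r u' z) u))) v =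
               sing rs1 (\<lambda>g d r. sg d (bh A X (\<lambda>u'. th g rs2 (wtgt X u') (?pR g d r u') v) u))"
            proof (cases "\<exists>g d r. rs1 = [(g, d, r)]")
              case True
              then obtain g d r where r1: "rs1 = [(g, d, r)]" by blast
              have "bh A X (\<lambda>u'. th g rs2 (wtgt X u) (?pR g d r u') v) u =
                  bh A X (\<lambda>u'. th g rs2 (wtgt X u') (?pR g d r u') v) u"
                by (rule bh_cong) simp
              then show ?thesis by (simp add: r1 th_sg flip: bh_th_swap)
            next
              case False
              then have "sing rs1 \<Psi> = 0" for \<Psi> :: "_ \<Rightarrow> _ \<Rightarrow> _ \<Rightarrow> ('a, 'f) allmod"
                by (auto simp: sing_def split: list.splits)
              then show ?thesis by simp
            qed
            then show ?thesis by (simp add: th_add)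
          qed
          finally have "?Z rs1 rs2 u v = sg ?s (th ?g rs2 (wtgt X u) (?pR ?g (wdeg rs1 + 1) (bop ?W f rs1) u) v) +
               sg ?s (sing rs1 (\<lambda>g d r. sg d (bh A X (\<lambda>u'. th g rs2 (wtgt X u') (?pR g d r u') v) u)))"
            using uv r12 by (subst Z) (auto simp: sg_add)
          also have "sg ?s (sing rs1 (\<lambda>g d r. sg d (bh A X (\<lambda>u'. th g rs2 (wtgt X u') (?pR g d r u') v) u))) =
             sing rs1 (\<lambda>g d r. sg ((d + 1) * wdeg v + wdeg rs2 + d)
               (bh A X (\<lambda>u'. th g rs2 (wtgt X u') (?pR g d r u') v) u))"
            by (auto simp: sing_def algebra_simps split: list.splits)
          finally show "?Z rs1 rs2 u v = sg ((wdeg rs1 + 1) * wdeg v + wdeg rs2)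
             (th ?g rs2 (wtgt X u) (?pR ?g (wdeg rs1 + 1) (bop ?W f rs1) u) v) +
             sing rs1 (\<lambda>g d r. sg ((d + 1) * wdeg v + wdeg rs2 + d)
               (bh A X (\<lambda>u'. th g rs2 (wtgt X u') (?pR g d r u') v) u))"
            by (simp add: algebra_simps)
        qed
      qed
      also have "\<dots> = K2 + K3"
        unfolding cut1_add K2_def K3_def cut1_sing ..
      finally show ?thesis .
    qed
    have "th f rs X \<kappa> w = cut (\<lambda>rs1 rs2. cut (\<lambda>u v. ?Z rs1 rs2 u v) w) rs"
      unfolding \<kappa>_def by (rule th_cut1)
    then show ?thesis
      by (simp only: cut_cut1[of _ rs] Z1 Z2 add.assoc)
  qed
  \<comment> \<open>Expanded by the first piece of the inputs: a functor piece gives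
    \<open>T1\<close>; behind a transformation piece, the operation on transformations contains the
    head of the list (\<open>K2\<close>) or acts after it (\<open>T3\<close>).\<close>
  have RW: "bh ?W f (\<lambda>rs'. th f rs' X \<phi> w) rs = T1 + (K2 + T3)"
  proof -
    define c where "c rs' = (case rs' of [] \<Rightarrow> 0 | (g, d, r) # rs'' \<Rightarrow>
        cut (\<lambda>u v. sg (d * wdeg v) (th g rs'' (wtgt X u) (?pR g d r u) v)) w)" for rs'
    have "bh ?W f (\<lambda>rs'. th f rs' X \<phi> w) rs =
        bh ?W f (\<lambda>rs'. cut1 (\<lambda>u v. th f rs' (wtgt X u) (?pF u) v) w + c rs') rs"
      by (rule bh_cong, subst th_rec) (simp add: c_def)
    also have "\<dots> = T1 + bh ?W f c rs"
      by (simp add: bh_add bh_cut1_swap T1_def)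
    also have "bh ?W f c rs = K2 + T3"
    proof (cases rs)
      case (Cons p rs')
      obtain g d r where p: "p = (g, d, r)" by (cases p)
      have "bh ?W g (\<lambda>rs''. c ((g, d, r) # rs'')) rs' = T3"
        by (simp add: c_def T3_def Cons p bh_cut_swap bh_sg)
      moreover have "cut1 (\<lambda>rs1 rs2. sg (wdeg rs2) (c ((wtgt f rs1, wdeg rs1 + 1, bop ?W f rs1) # rs2))) rs = K2"
        unfolding K2_def by (rule cut1_cong) (simp add: c_def add.commute flip: cut_sg)
      ultimately show ?thesis using bh_cut1_Cons[of ?W f c g d r rs'] Cons p by simp
    qed (simp add: K2_def T3_def)
    finally show ?thesis .
  qed
  \<comment> \<open>The coderivation property puts an operation of \<open>A\<close> into the first
    piece (\<open>K1\<close>, \<open>K3\<close>) or behind it (\<open>T2\<close>,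
    \<open>T4\<close>).\<close>
  have RA: "sg (wdeg rs) (bh A X (th f rs X \<phi>) w) = (K1 + T2) + (K3 + T4)"
  proof -
    define c where "c w = (case rs of [] \<Rightarrow> 0 | (g, d, r) # rs' \<Rightarrow>
        cut (\<lambda>u v. sg (d * wdeg v) (th g rs' (wtgt X u) (?pR g d r u) v)) w)" for w
    have "bh A X (th f rs X \<phi>) w =
        bh A X (\<lambda>w. cut1 (\<lambda>u v. th f rs (wtgt X u) (?pF u) v) w + c w) w"
      by (rule bh_cong, subst th_rec) (simp add: c_def)
    also have "\<dots> = bh A X (cut1 (\<lambda>u v. th f rs (wtgt X u) (?pF u) v)) w + bh A X c w"
      by (rule bh_add)
    finally have "sg (wdeg rs) (bh A X (th f rs X \<phi>) w) =
       sg (wdeg rs) (bh A X (cut1 (\<lambda>u v. th f rs (wtgt X u) (?pF u) v)) w) + sg (wdeg rs) (bh A X c w)"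
      by (simp only: sg_add)
    moreover have "sg (wdeg rs) (bh A X (cut1 (\<lambda>u v. th f rs (wtgt X u) (?pF u) v)) w) = K1 + T2"
      unfolding K1_def T2_def bh_cut1 cut1_sg[symmetric] cut1_add[symmetric]
      by (rule cut1_cong) (simp add: sg_add add.commute)
    moreover have "sg (wdeg rs) (bh A X c w) = K3 + T4"
    proof (cases rs)
      case (Cons p rs')
      obtain g d r where p: "p = (g, d, r)" by (cases p)
      let ?G = "\<lambda>u v. sg (d * wdeg v) (th g rs' (wtgt X u) (?pR g d r u) v)"
      have c: "c = cut ?G" by (rule ext) (simp add: c_def Cons p)
      have "sg (wdeg rs) (bh A X (cut ?G) w) =
          cut (\<lambda>u v. sg (wdeg rs) (sg (wdeg v) (bh A X (\<lambda>u. ?G u v) u) + bh A (wtgt X u) (?G u) v)) w"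
        unfolding bh_cut cut_sg ..
      also have "\<dots> = cut (\<lambda>u v. sg ((d + 1) * wdeg v + wdeg rs' + d)
       (bh A X (\<lambda>u'. th g rs' (wtgt X u') (?pR g d r u') v) u) +
         sg (d * wdeg v + wdeg rs') (bh A (wtgt X u) (th g rs' (wtgt X u) (?pR g d r u)) v)) w"
      proof (rule cut_cong)
        fix u v
        have "bh A (wtgt X u) (?G u) v =
            bh A (wtgt X u) (\<lambda>v'. sg (d * (wdeg v + 1)) (th g rs' (wtgt X u) (?pR g d r u) v')) v"
          by (rule bh_cong) simp
        then show "sg (wdeg rs) (sg (wdeg v) (bh A X (\<lambda>u. ?G u v) u) + bh A (wtgt X u) (?G u) v) =
          sg ((d + 1) * wdeg v + wdeg rs' + d) (bh A X (\<lambda>u'. th g rs' (wtgt X u') (?pR g d r u') v) u) +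
         sg (d * wdeg v + wdeg rs') (bh A (wtgt X u) (th g rs' (wtgt X u) (?pR g d r u)) v)"
          unfolding Cons p by (simp add: bh_sg sg_add) (auto simp: sg_def algebra_simps)
      qed
      finally show ?thesis by (simp add: c K3_def T4_def Cons p cut_add)
    next
      case Nil
      then have "c = (\<lambda>w. 0)" by (intro ext) (simp add: c_def)
      then show ?thesis by (simp add: Nil K3_def T4_def)
    qed
    ultimately show ?thesis by simp
  qed
  show ?case unfolding LHS rest kappa RW RA by (simp only: ac_simps)
qed

text \<open>Here \<open>G\<close> attaches a functor to every object of \<open>W\<close>. It is the
  identity when the relations of the category of functors are proved, and composition with
  \<open>\<psi>\<close> when the equations of postcomposition are.\<close>

lemma rv_b_then:
  assumes f: "ainf_functor R A B f" and A: "bclosed W"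
    and rs: "is_word W P rs"
    and g: "\<And>Q. Q \<in> Obj W \<Longrightarrow> ainf_functor R A B (G Q)"
    and cl: "\<And>rs'. is_word W P rs' \<Longrightarrow> rs' \<noteq> [] \<Longrightarrow> 
      \<psi> P rs' \<in> carrier (trans_module R A B f (G (wtgt P rs')) (wdeg rs' + p))"
    and D: "D = wdeg rs + 1 + p"
  shows "b_then (trans_module R A B f (G (wtgt P rs)) D) W \<psi> P rs
      \<in> carrier (trans_module R A B f (G (wtgt P rs)) D)"
    and "is_word A X w \<Longrightarrow> rv R B f (G (wtgt P rs)) D (b_then (trans_module R A B f (G (wtgt P rs)) D) W \<psi> P rs) X w =
      bh W P (\<lambda>rs'. rv R B f (G (wtgt P rs')) (wdeg rs' + p) (\<psi> P rs') X w) rs"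
proof -
  let ?T = "trans_module R A B f (G (wtgt P rs)) D"
  have gg: "ainf_functor R A B (G (wtgt P rs))" using g is_word_tgt[OF rs] .
  have T: "module R ?T" by (rule trans_module_module[OF f gg])
  interpret T: module R ?T by (rule T)
  have c: "\<psi> P (b_insert W P rs r n) \<in> carrier ?T" if "1 \<le> n" "r + n \<le> length rs" for r n
    using cl[OF b_insert_word[OF A rs that] b_insert_facts(1)[OF that]]
    by (simp add: b_insert_facts[OF that] D)
  then show "b_then ?T W \<psi> P rs \<in> carrier ?T"
    unfolding b_then_def by (intro T.finsum_closed) (auto intro!: ksign_closed[OF T] c)
  assume w: "is_word A X w"
  have "rv R B f (G (wtgt P rs)) D (b_then ?T W \<psi> P rs) X w =
     (\<Sum>(r, n) \<in> {(r, n). 1 \<le> n \<and> r + n \<le> length rs}.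
       rv R B f (G (wtgt P rs)) D (ksign ?T (wdeg (drop (r + n) rs)) (\<psi> P (b_insert W P rs r n))) X w)"
    unfolding b_then_def
    by (subst rv_finsum[OF f gg]) (auto intro!: ksign_closed[OF T] c w sum.cong)
  also have "\<dots> = bh W P (\<lambda>rs'. rv R B f (G (wtgt P rs')) (wdeg rs' + p) (\<psi> P rs') X w) rs"
    unfolding bh_def
  proof (rule sum.cong[OF refl], clarify)
    fix r n assume rn: "1 \<le> n" "r + n \<le> length rs"
    show "rv R B f (G (wtgt P rs)) D (ksign ?T (wdeg (drop (r + n) rs)) (\<psi> P (b_insert W P rs r n))) X w =
      sg (wdeg (drop (r + n) rs)) (rv R B f (G (wtgt P (b_insert W P rs r n)))
        (wdeg (b_insert W P rs r n) + p) (\<psi> P (b_insert W P rs r n)) X w)"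
      unfolding rv_ksign[OF f gg c[OF rn] w] by (simp add: b_insert_facts[OF rn] D)
  qed
  finally show "rv R B f (G (wtgt P rs)) D (b_then ?T W \<psi> P rs) X w =
      bh W P (\<lambda>rs'. rv R B f (G (wtgt P rs')) (wdeg rs' + p) (\<psi> P rs') X w) rs" .
qed

lemma act_diff: "act R a (x - y) = act R a x - act R a y"
  using act_add[of R a x "- y"] by (simp add: act_minus)

lemma fun_cat_tlin:
  assumes A: "ainf_category R A" and B: "ainf_category R B"
  shows "tlin R (fun_cat R A B) (sMor (fun_cat R A B)) 1 1 (bop (fun_cat R A B))"
proof -
  let ?W = "fun_cat R A B"
  have mW: "modular R ?W" by (rule fun_cat_modular[OF A])
  have comb: "bop ?W f (rs1 @ (h, D, a \<odot>\<^bsub>sMor ?W (wtgt f rs1) h D\<^esub> x \<oplus>\<^bsub>sMor ?W (wtgt f rs1) h D\<^esub> y) # rs2) =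
      a \<odot>\<^bsub>sMor ?W f (wtgt h rs2) (wdeg rs1 + (D + wdeg rs2) + 1)\<^esub> bop ?W f (rs1 @ (h, D, x) # rs2)
      \<oplus>\<^bsub>sMor ?W f (wtgt h rs2) (wdeg rs1 + (D + wdeg rs2) + 1)\<^esub> bop ?W f (rs1 @ (h, D, y) # rs2)"
    if a: "a \<in> carrier R" and wx: "is_word ?W f (rs1 @ (h, D, x) # rs2)"
      and wy: "is_word ?W f (rs1 @ (h, D, y) # rs2)" for f rs1 h D x y rs2 a
  proof -
    let ?S = "sMor ?W (wtgt f rs1) h D" and ?d = "wdeg rs1 + (D + wdeg rs2) + 1" and ?g = "wtgt h rs2"
    let ?z = "a \<odot>\<^bsub>?S\<^esub> x \<oplus>\<^bsub>?S\<^esub> y"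
    let ?r = "\<lambda>t. rs1 @ (h, D, t) # rs2"
    let ?T = "trans_module R A B f ?g ?d"
    have wz: "is_word ?W f (?r ?z)" by (rule word_comb[OF mW a wx wy])
    have f: "ainf_functor R A B f" and g: "ainf_functor R A B ?g"
      using is_word_src[OF wx] is_word_tgt[OF wx] by simp_all
    have bc: "bop ?W f (?r t) \<in> carrier ?T" if "is_word ?W f (?r t)" for t
      using fun_cat_bop_carrier[OF that _ A B] by simp
    have bv: "rv R B f ?g ?d (bop ?W f (?r t)) X w = th f (?r t) X (bv R B (fob f X)) w -
        sing (?r t) (\<lambda>g d r. sg d (bh A X (rv R B f g d r X) w))"
      if "is_word ?W f (?r t)" "is_word A X w" for t X w
      using rv_bop[OF that(1) _ that(2) B] by simp
    have "bop ?W f (?r ?z) = a \<odot>\<^bsub>?T\<^esub> bop ?W f (?r x) \<oplus>\<^bsub>?T\<^esub> bop ?W f (?r y)"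
    proof (rule trans_ext[OF f g, of _ ?d])
      show "bop ?W f (?r ?z) \<in> carrier ?T" by (rule bc[OF wz])
      show "a \<odot>\<^bsub>?T\<^esub> bop ?W f (?r x) \<oplus>\<^bsub>?T\<^esub> bop ?W f (?r y) \<in> carrier ?T"
        by (intro trans_add_closed trans_smult_closed f g a bc wx wy)
      fix X w assume w: "is_word A X w"
      have 1: "th f (?r ?z) X (bv R B (fob f X)) w = act R a (th f (?r x) X (bv R B (fob f X)) w) +
         th f (?r y) X (bv R B (fob f X)) w"
        by (rule linD[OF th_rs_lin[OF A B w lin_bv[OF B] f] a wx wy])
      have 2: "sing (?r ?z) (\<lambda>g d r. sg d (bh A X (rv R B f g d r X) w)) =
         act R a (sing (?r x) (\<lambda>g d r. sg d (bh A X (rv R B f g d r X) w))) +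
         sing (?r y) (\<lambda>g d r. sg d (bh A X (rv R B f g d r X) w))"
      proof (cases "rs1 = [] \<and> rs2 = []")
        case True
        have h: "ainf_functor R A B h" and xy: "x \<in> carrier (trans_module R A B f h D)"
          "y \<in> carrier (trans_module R A B f h D)"
          using wx wy True by simp_all
        have "bh A X (rv R B f h D ?z X) w =
          bh A X (\<lambda>w. act R a (rv R B f h D x X w) + rv R B f h D y X w) w"
          by (rule bh_cong_word[OF ainf_bclosed[OF A] w])
            (use xy True a in \<open>simp add: rv_add[OF f h] rv_smult[OF f h] trans_smult_closed[OF f h]\<close>)
        then show ?thesis using True by (simp add: bh_add bh_act act_sg sg_add)
      next
        case False
        then have "sing (?r t) (\<lambda>g d r. sg d (bh A X (rv R B f g d r X) w)) = 0" for t
          by (cases rs1; cases "tl rs1"; cases rs2) auto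
        then show ?thesis by simp
      qed
      show "rv R B f ?g ?d (bop ?W f (?r ?z)) X w =
        rv R B f ?g ?d (a \<odot>\<^bsub>?T\<^esub> bop ?W f (?r x) \<oplus>\<^bsub>?T\<^esub> bop ?W f (?r y)) X w"
        unfolding rv_add[OF f g trans_smult_closed[OF f g bc[OF wx] a] bc[OF wy] w]
          rv_smult[OF f g bc[OF wx] a w] bv[OF wx w] bv[OF wy w] bv[OF wz w] 1 2
        by (simp add: act_diff)
    qed
    then show ?thesis by simp
  qed
  show ?thesis
    unfolding tlin_def using fun_cat_bclosed[OF A B, unfolded bclosed_def] comb
    by (metis (no_types, lifting) One_nat_def Suc_le_eq length_greater_0_conv)
qed

text \<open>Evaluated at a word, the relations are \<open>th_bh\<close> for the functional
  \<open>bv\<close>. The operations of \<open>B\<close> vanish after the codifferential; the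
  remaining term with an operation of \<open>A\<close> is cancelled by the extra summand of
  \<open>B_1\<close>, and that summand applied twice is zero by \<open>bh_bh\<close>.\<close>

theorem fun_cat_ainf:
  assumes A: "ainf_category R A" and B: "ainf_category R B"
  shows "ainf_category R (fun_cat R A B)"
proof -
  let ?W = "fun_cat R A B"
  have mW: "modular R ?W" by (rule fun_cat_modular[OF A])
  have bW: "bclosed ?W" by (rule fun_cat_bclosed[OF A B])
  have "module R (Mor ?W f g d)" if "f \<in> Obj ?W" "g \<in> Obj ?W" for f g d
    using modularD[OF mW that, of "d - 1"] by (simp add: sMor_def del: fun_cat_Obj)
  moreover have "tensor_map R ?W (sMor ?W) n 1 (bop ?W)" if "n \<ge> 1" for n
    using fun_cat_tlin[OF A B] that tlin_iff_tensor_map[OF mW, of "sMor ?W" 1 1 "bop ?W"] mW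
    by (simp add: modfam_def modular_def)
  moreover have "b_then (sMor ?W f (wtgt f rs) (wdeg rs + 2)) ?W (bop ?W) f rs =
      \<zero>\<^bsub>sMor ?W f (wtgt f rs) (wdeg rs + 2)\<^esub>" if rs: "is_word ?W f rs" "rs \<noteq> []" for f rs
  proof -
    let ?g = "wtgt f rs" and ?d = "wdeg rs + 2"
    let ?T = "trans_module R A B f ?g ?d"
    have f: "ainf_functor R A B f" and g: "ainf_functor R A B ?g"
      using is_word_src[OF rs(1)] is_word_tgt[OF rs(1)] by simp_all
    have G: "ainf_functor R A B Q" if "Q \<in> Obj ?W" for Q using that by simp
    have cl: "bop ?W f rs' \<in> carrier (trans_module R A B f (wtgt f rs') (wdeg rs' + 1))"
      if "is_word ?W f rs'" "rs' \<noteq> []" for rs' by (rule fun_cat_bop_carrier[OF that A B])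
    have d: "?d = wdeg rs + 1 + 1" by simp
    note bt = rv_b_then[where G = "\<lambda>Q. Q" and \<psi> = "bop ?W", OF f bW rs(1) G cl d]
    have "b_then ?T ?W (bop ?W) f rs = \<zero>\<^bsub>?T\<^esub>"
    proof (rule trans_ext[OF f g])
      show "\<zero>\<^bsub>?T\<^esub> \<in> carrier ?T" by (rule trans_zero_closed[OF f g])
      show "b_then ?T ?W (bop ?W) f rs \<in> carrier ?T"
        by (rule bt(1)) simp_all
      fix X w assume w: "is_word A X w"
      define t where "t = (\<lambda>rs. th f rs X (bv R B (fob f X)) w)"
      define s where "s = (\<lambda>rs. sing rs (\<lambda>g d r. sg d (bh A X (rv R B f g d r X) w)))"
      have "rv R B f ?g ?d (b_then ?T ?W (bop ?W) f rs) X w =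
          bh ?W f (\<lambda>rs'. rv R B f (wtgt f rs') (wdeg rs' + 1) (bop ?W f rs') X w) rs"
        by (rule bt(2)[OF _ _ _ w]) simp_all
      also have "\<dots> = bh ?W f (\<lambda>rs'. t rs' - s rs') rs"
      proof (rule bh_cong_word[OF bW rs(1)])
        fix rs' assume "is_word ?W f rs'" "rs' \<noteq> []"
        from rv_bop[OF this w B] show "rv R B f (wtgt f rs') (wdeg rs' + 1) (bop ?W f rs') X w = t rs' - s rs'"
          by (simp only: t_def s_def)
      qed
      also have "\<dots> = bh ?W f t rs - bh ?W f s rs" by (rule bh_diff)
      \<comment> \<open>The correction \<open>s\<close> lives on words of length one, so only the
        operation that consumes all of \<open>rs\<close> contributes.\<close>
      also have "bh ?W f s rs = s [(?g, wdeg rs + 1, bop ?W f rs)]"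
        by (rule bh_singleton_support[OF rs(2)]) (auto simp: s_def sing_def split: list.splits)
      also have "\<dots> = sg (wdeg rs + 1) (bh A X (rv R B f ?g (wdeg rs + 1) (bop ?W f rs) X) w)"
        by (simp add: s_def)
      also have "bh A X (rv R B f ?g (wdeg rs + 1) (bop ?W f rs) X) w =
         bh A X (\<lambda>w. th f rs X (bv R B (fob f X)) w - sing rs (\<lambda>g d r. sg d (bh A X (rv R B f g d r X) w))) w"
        by (rule bh_cong_word[OF ainf_bclosed[OF A] w]) (simp add: rv_bop[OF rs _ B])
      also have "\<dots> = bh A X (th f rs X (bv R B (fob f X))) w"
      proof -
        have "bh A X (\<lambda>w. sing rs (\<lambda>g d r. sg d (bh A X (rv R B f g d r X) w))) w = 0"
        proof (cases "\<exists>g d r. rs = [(g, d, r)]")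
          case True
          then obtain g d r where r: "rs = [(g, d, r)]" by blast
          then have "ainf_functor R A B g" "r \<in> carrier (trans_module R A B f g d)" using rs by simp_all
          from bh_bh[OF A w lin_rv[OF f this]] show ?thesis by (simp add: r bh_sg)
        next
          case False
          then have "sing rs (\<lambda>g d r. sg d (bh A X (rv R B f g d r X) w)) = 0" for w
            using rs(2) by (cases rs; cases "tl rs") auto
          then show ?thesis by simp
        qed
        then show ?thesis by (simp add: bh_diff)
      qed
      also have "bh ?W f t rs = th f rs X (bh B (fob f X) (bv R B (fob f X))) w -
          sg (wdeg rs) (bh A X (th f rs X (bv R B (fob f X))) w)"
        unfolding t_def using th_bh[OF A B rs(1) w lin_bv[OF B]] by simp
      also have "th f rs X (bh B (fob f X) (bv R B (fob f X))) w = th f rs X (\<lambda>z. 0) w"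
        by (rule th_cong_word[OF rs(1) w]) (simp add: bh_bv[OF B])
      finally show "rv R B f ?g ?d (b_then ?T ?W (bop ?W) f rs) X w = rv R B f ?g ?d \<zero>\<^bsub>?T\<^esub> X w"
        by (simp add: rv_zero[OF f g w] sg_def)
    qed
    then show ?thesis by simp
  qed
  ultimately show ?thesis using A by (simp add: ainf_category_def)
qed

section \<open>Composition\<close>

text \<open>Only typing is assumed of \<open>f\<close>; the equivalence is therefore used in both
  directions, to exploit the equations of a given functor and to establish those of a new
  one.\<close>

lemma functor_eqn_emb:
  assumes A: "ainf_category R A" and B: "ainf_category R B"
    and ob: "\<And>X. X \<in> Obj A \<Longrightarrow> fob f X \<in> Obj B"
    and mp: "\<And>X w. is_word A X w \<Longrightarrow> w \<noteq> [] \<Longrightarrow>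
      fmp f X w \<in> carrier (sMor B (fob f X) (fob f (wtgt X w)) (wdeg w))"
    and w: "is_word A X w" "w \<noteq> []"
    and M: "M = sMor B (fob f X) (fob f (wtgt X w)) (wdeg w + 1)"
  shows "(\<Oplus>\<^bsub>M\<^esub>ws \<in> splits w. bop B (fob f X) (fun_tensor f X ws)) = b_then M A (fmp f) X w \<longleftrightarrow>
    th f [] X (bv R B (fob f X)) w = bh A X (fv R B f X) w"
proof -
  have X: "fob f X \<in> Obj B" and Y: "fob f (wtgt X w) \<in> Obj B"
    using is_word_src[OF w(1)] is_word_tgt[OF w(1)] by (simp_all add: ob)
  have N: "module R M" unfolding M by (rule modularD[OF ainf_modular[OF B] X Y])
  interpret N: module R M by (rule N)
  have c: "bop B (fob f X) (fun_tensor f X ws) \<in> carrier M" if "ws \<in> splits w" for ws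
    using fun_tensor_word_closed[where A = A and B = B and f = f, OF ob mp w(1) that] ainf_bclosed[OF B] w(2)
    unfolding bclosed_def M by metis
  then have c': "(\<lambda>ws. bop B (fob f X) (fun_tensor f X ws)) \<in> splits w \<rightarrow> carrier M" by blast
  have "emb R M (\<Oplus>\<^bsub>M\<^esub>ws \<in> splits w. bop B (fob f X) (fun_tensor f X ws)) =
      (\<Sum>ws \<in> splits w. bv R B (fob f X) (fun_tensor f X ws))"
    unfolding emb_finsum[OF N c']
  proof (rule sum.cong[OF refl])
    fix ws assume "ws \<in> splits w"
    from fun_tensor_word_closed[where A = A and B = B and f = f, OF ob mp w(1) this]
    show "emb R M (bop B (fob f X) (fun_tensor f X ws)) = bv R B (fob f X) (fun_tensor f X ws)"
      by (simp add: bv_eq M)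
  qed
  then have 1: "emb R M (\<Oplus>\<^bsub>M\<^esub>ws \<in> splits w. bop B (fob f X) (fun_tensor f X ws)) =
      th f [] X (bv R B (fob f X)) w" by (simp add: sum_splits)
  let ?N = "\<lambda>Y d. sMor B (fob f X) (fob f Y) d"
  have 2: "b_then M A (fmp f) X w \<in> carrier M"
    "emb R M (b_then M A (fmp f) X w) = bh A X (\<lambda>w'. emb R (?N (wtgt X w') (wdeg w')) (fmp f X w')) w"
    using N by (intro emb_b_then[OF ainf_bclosed[OF A] w(1), where N = ?N]; simp add: mp M)+
  show ?thesis
    using emb_inject[OF N N.finsum_closed[OF c'] 2(1)] 1 2(2) by (simp add: fv_eq[abs_def])
qed

lemma functor_fv_eq:
  assumes f: "ainf_functor R A B f" and w: "is_word A X w"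
  shows "w \<noteq> [] \<Longrightarrow> th f [] X (bv R B (fob f X)) w = bh A X (fv R B f X) w"
proof -
  assume "w \<noteq> []"
  note w = w this
  have "(\<Oplus>\<^bsub>sMor B (fob f X) (fob f (wtgt X w)) (wdeg w + 1)\<^esub>ws \<in> splits w. bop B (fob f X) (fun_tensor f X ws)) =
      b_then (sMor B (fob f X) (fob f (wtgt X w)) (wdeg w + 1)) A (fmp f) X w"
    using f w by (simp add: ainf_functor_def Let_def)
  then show ?thesis
    using functor_eqn_emb[where A = A and B = B and f = f, OF conjunct1[OF functor_cats[OF f]]
      conjunct2[OF functor_cats[OF f]] functor_ob[OF f] functor_closed[OF f] w refl] by simp
qed

lemma ainf_functorI:
  assumes A: "ainf_category R A" and B: "ainf_category R B"
    and ob: "\<And>X. X \<in> Obj A \<Longrightarrow> fob f X \<in> Obj B"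
    and mp: "tlin R A (\<lambda>X Y. sMor B (fob f X) (fob f Y)) 1 0 (fmp f)"
    and eq: "\<And>X w. is_word A X w \<Longrightarrow> w \<noteq> [] \<Longrightarrow>
      (\<Oplus>\<^bsub>sMor B (fob f X) (fob f (wtgt X w)) (wdeg w + 1)\<^esub>ws \<in> splits w. bop B (fob f X) (fun_tensor f X ws)) =
      b_then (sMor B (fob f X) (fob f (wtgt X w)) (wdeg w + 1)) A (fmp f) X w"
    and ext: "\<And>X. X \<notin> Obj A \<Longrightarrow> fob f X = undefined"
      "\<And>X w. \<not> (is_word A X w \<and> w \<noteq> []) \<Longrightarrow> fmp f X w = undefined"
  shows "ainf_functor R A B f"
proof -
  have "modfam R A (\<lambda>X Y. sMor B (fob f X) (fob f Y))" by (rule modfam_pull[OF B ob ob])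
  from tlin_iff_tensor_map[OF ainf_modular[OF A] this order_refl] mp
  have "\<forall>n\<ge>1. tensor_map R A (\<lambda>X Y. sMor B (fob f X) (fob f Y)) n 0 (fmp f)" by blast
  then show ?thesis using A B ob eq ext by (simp add: ainf_functor_def Let_def)
qed

text \<open>The functor from \<open>A_\<infinity>(A, B)\<close> to
  \<open>A_\<infinity>(A, C)\<close> given by composition with \<open>\<psi>\<close>. Unlike
  precomposition it need not be strict: a word of transformations goes to its image under
  \<open>\<theta>\<close> followed by the components of \<open>\<psi>\<close>.\<close>

definition post_fun ::
  "'k ring \<Rightarrow> ('k, 'oa, 'ma) ainf_cat \<Rightarrow> ('k, 'ob, 'mb) ainf_cat \<Rightarrow> ('k, 'oc, 'mc) ainf_cat
    \<Rightarrow> ('ob, 'mb, 'oc, 'mc) ainf_fun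
    \<Rightarrow> (('oa, 'ma, 'ob, 'mb) ainf_fun, ('oa, 'ma, 'mb) ainf_trans,
        ('oa, 'ma, 'oc, 'mc) ainf_fun, ('oa, 'ma, 'mc) ainf_trans) ainf_fun" where
  "post_fun R A B C \<psi> =
     \<lparr>fob = (\<lambda>f. if ainf_functor R A B f then comp_fun A C f \<psi> else undefined),
      fmp = (\<lambda>f rs. if is_word (fun_cat R A B) f rs \<and> rs \<noteq> [] then
         (\<lambda>X w. if is_word A X w then
            (let M = sMor C (fob \<psi> (fob f X)) (fob \<psi> (fob (wtgt f rs) (wtgt X w))) (wdeg w + wdeg rs)
             in \<Oplus>\<^bsub>M\<^esub>ps \<in> theta_splits (length rs) w.
                  ksign M (theta_sign rs ps) (fmp \<psi> (fob f X) (theta_tensor f X rs ps)))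
          else undefined) else undefined)\<rparr>"

context
  fixes R :: "'k ring" and A :: "('k, 'oa, 'ma) ainf_cat" and B :: "('k, 'ob, 'mb) ainf_cat"
    and C :: "('k, 'oc, 'mc) ainf_cat" and \<psi> :: "('ob, 'mb, 'oc, 'mc) ainf_fun"
  assumes A: "ainf_category R A" and psi: "ainf_functor R B C \<psi>"
begin

lemma comp_ob: "X \<in> Obj A \<Longrightarrow> fob (comp_fun A C f \<psi>) X = fob \<psi> (fob f X)"
  by (simp add: comp_fun_def)

text \<open>The sum over what \<open>f\<close> makes of \<open>u\<close>, followed by a component of
  \<open>\<psi>\<close>, is by definition a component of the composite; linearity collects this sum
  into a single letter.\<close>

lemma comp_letter:
  assumes f: "ainf_functor R A B f" and u: "is_word A X u" "u \<noteq> []"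
  shows "fmp (comp_fun A C f \<psi>) X u \<in> carrier (sMor C (fob \<psi> (fob f X)) (fob \<psi> (fob f (wtgt X u))) (wdeg u))"
    and "lin R C (fob \<psi> (fob f X)) \<phi> \<Longrightarrow> is_word C (fob \<psi> (fob f (wtgt X u))) z \<Longrightarrow>
      th f [] X (\<lambda>y. \<phi> (fletter \<psi> (fob f X) y # z)) u = \<phi> (fletter (comp_fun A C f \<psi>) X u # z)"
proof -
  let ?Z = "fob \<psi> (fob f (wtgt X u))"
  let ?M = "sMor C (fob \<psi> (fob f X)) ?Z (wdeg u)"
  have C: "ainf_category R C" using psi by (simp add: functor_cats)
  have X: "X \<in> Obj A" "wtgt X u \<in> Obj A" using is_word_src[OF u(1)] is_word_tgt[OF u(1)] .
  have X': "fob \<psi> (fob f X) \<in> Obj C" and Z: "?Z \<in> Obj C"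
    using X functor_ob[OF psi] functor_ob[OF f] by simp_all
  have cl: "fmp \<psi> (fob f X) y \<in> carrier ?M"
    if "is_word B (fob f X) y" "wtgt (fob f X) y = fob f (wtgt X u)" "wdeg y = wdeg u" "u \<noteq> [] \<Longrightarrow> y \<noteq> []" for y
    using functor_closed[OF psi that(1)] that u(2) by simp
  have e: "fmp (comp_fun A C f \<psi>) X u = finsum ?M (\<lambda>ws. fmp \<psi> (fob f X) (fun_tensor f X ws)) (splits u)"
    using u by (simp add: comp_fun_def)
  show "fmp (comp_fun A C f \<psi>) X u \<in> carrier ?M"
    unfolding e by (rule lin_splits_sum(1)[OF C f u(1) lin_0 X', where z = "[]"]) (use cl Z in auto)
  assume l: "lin R C (fob \<psi> (fob f X)) \<phi>" and z: "is_word C ?Z z"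
  have "th f [] X (\<lambda>y. \<phi> (fletter \<psi> (fob f X) y # z)) u = th f [] X (\<lambda>y. \<phi> ((?Z, wdeg u, fmp \<psi> (fob f X) y) # z)) u"
    using f u(1) by (intro th_cong_word[where R = R and A = A and B = B]) (simp_all add: fletter_def)
  also have "\<dots> = \<phi> ((?Z, wdeg u, fmp (comp_fun A C f \<psi>) X u) # z)"
    unfolding e by (rule lin_splits_sum(2)[OF C f u(1) l X' z cl, symmetric])
  finally show "th f [] X (\<lambda>y. \<phi> (fletter \<psi> (fob f X) y # z)) u = \<phi> (fletter (comp_fun A C f \<psi>) X u # z)"
    by (simp add: fletter_def comp_ob X)
qed

lemma post_letter:
  assumes f: "is_word (fun_cat R A B) f rs" "rs \<noteq> []" and u: "is_word A X u"
  shows "fmp (post_fun R A B C \<psi>) f rs X u \<in>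
      carrier (sMor C (fob \<psi> (fob f X)) (fob \<psi> (fob (wtgt f rs) (wtgt X u))) (wdeg u + wdeg rs))"
    and "lin R C (fob \<psi> (fob f X)) \<phi> \<Longrightarrow> is_word C (fob \<psi> (fob (wtgt f rs) (wtgt X u))) z \<Longrightarrow>
      th f rs X (\<lambda>y. \<phi> (fletter \<psi> (fob f X) y # z)) u =
      \<phi> (rletter (comp_fun A C (wtgt f rs) \<psi>) (wdeg rs) (fmp (post_fun R A B C \<psi>) f rs) X u # z)"
proof -
  let ?Z = "fob \<psi> (fob (wtgt f rs) (wtgt X u))"
  let ?M = "sMor C (fob \<psi> (fob f X)) ?Z (wdeg u + wdeg rs)"
  have C: "ainf_category R C" using psi by (simp add: functor_cats)
  have ff: "ainf_functor R A B f" and g: "ainf_functor R A B (wtgt f rs)"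
    using is_word_src[OF f(1)] is_word_tgt[OF f(1)] by simp_all
  have X: "X \<in> Obj A" "wtgt X u \<in> Obj A" using is_word_src[OF u] is_word_tgt[OF u] .
  have X': "fob \<psi> (fob f X) \<in> Obj C" and Z: "?Z \<in> Obj C"
    using X functor_ob[OF psi] functor_ob[OF ff] functor_ob[OF g] by simp_all
  have cl: "fmp \<psi> (fob f X) y \<in> carrier ?M"
    if "is_word B (fob f X) y" "wtgt (fob f X) y = fob (wtgt f rs) (wtgt X u)" "wdeg y = wdeg u + wdeg rs"
      "rs \<noteq> [] \<or> u \<noteq> [] \<Longrightarrow> y \<noteq> []" for y
    using functor_closed[OF psi that(1)] that f(2) by simp
  have e: "fmp (post_fun R A B C \<psi>) f rs X u = finsum ?M (\<lambda>ps. ksign ?M (theta_sign rs ps)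
      (fmp \<psi> (fob f X) (theta_tensor f X rs ps))) (theta_splits (length rs) u)"
    using u f by (simp add: post_fun_def Let_def)
  show "fmp (post_fun R A B C \<psi>) f rs X u \<in> carrier ?M"
    unfolding e by (rule lin_th_sum(1)[OF C f(1) u lin_0 X', where z = "[]"]) (use cl Z in auto)
  assume l: "lin R C (fob \<psi> (fob f X)) \<phi>" and z: "is_word C ?Z z"
  have "th f rs X (\<lambda>y. \<phi> (fletter \<psi> (fob f X) y # z)) u =
      th f rs X (\<lambda>y. \<phi> ((?Z, wdeg u + wdeg rs, fmp \<psi> (fob f X) y) # z)) u"
    by (rule th_cong_word[OF f(1) u]) (simp add: fletter_def)
  also have "\<dots> = \<phi> ((?Z, wdeg u + wdeg rs, fmp (post_fun R A B C \<psi>) f rs X u) # z)"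
    unfolding e by (rule lin_th_sum(2)[OF C f(1) u l X' z cl, symmetric])
  finally show "th f rs X (\<lambda>y. \<phi> (fletter \<psi> (fob f X) y # z)) u =
      \<phi> (rletter (comp_fun A C (wtgt f rs) \<psi>) (wdeg rs) (fmp (post_fun R A B C \<psi>) f rs) X u # z)"
    by (simp add: rletter_def comp_ob X)
qed

end

lemma th_cut_param: "th f rs X (\<lambda>z. cut (\<lambda>u v. F u v z) q) w = cut (\<lambda>u v. th f rs X (F u v) w) q"
  by (induction q arbitrary: F) (simp_all add: th_add)

lemma th_cut1_param: "th f rs X (\<lambda>z. cut1 (\<lambda>u v. F u v z) q) w = cut1 (\<lambda>u v. th f rs X (F u v) w) q"
  by (cases q) (simp_all add: th_cut_param)

lemma th_0_fun [simp]: "th f rs X (\<lambda>z. 0) = (\<lambda>w. 0)"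
  by (rule ext) simp

text \<open>Functoriality of \<open>\<theta>\<close> under composition with \<open>\<psi>\<close>: the words of transformations are
  themselves decomposed, and mapped by the functor of composition with \<open>\<psi>\<close>.\<close>

theorem th_post:
  assumes A: "ainf_category R A" and psi: "ainf_functor R B C \<psi>"
    and "is_word (fun_cat R A B) f rs" "is_word A X w" "lin R C (fob \<psi> (fob f X)) \<phi>"
  shows "th f rs X (th \<psi> [] (fob f X) \<phi>) w =
    th (post_fun R A B C \<psi>) [] f (\<lambda>rs'. th (comp_fun A C f \<psi>) rs' X \<phi> w) rs"
  using assms(3-)
proof (induction "length rs + length w" arbitrary: f rs X \<phi> w rule: less_induct)
  case less
  let ?W = "fun_cat R A B" and ?P = "post_fun R A B C \<psi>"
  let ?c = "\<lambda>f. comp_fun A C f \<psi>"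
  note rs = less.prems(1) and w = less.prems(2) and l = less.prems(3)
  have f: "ainf_functor R A B f" using is_word_src[OF rs] by simp
  have X: "X \<in> Obj A" using is_word_src[OF w] .
  have X': "fob \<psi> (fob f X) \<in> Obj C" using functor_ob[OF psi functor_ob[OF f X]] .
  have C: "ainf_category R C" using psi by (simp add: functor_cats)
  let ?X = "fob f X"
  let ?pF = "\<lambda>u z. \<phi> (fletter (?c f) X u # z)" and ?pR = "\<lambda>g d r u z. \<phi> (rletter g d r X u # z)"
  \<comment> \<open>\<open>E\<close> comes from the empty output; in \<open>S1\<close> the first
    letter made by \<open>\<psi>\<close> uses functor pieces only, in \<open>S2\<close> it also uses
    the initial part \<open>rs1\<close> of the transformations.\<close>
  define E where "E = (if rs = [] \<and> w = [] then \<phi> [] else 0)"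
  define S1 where "S1 = cut1 (\<lambda>u v. th ?P [] f (\<lambda>rs'. th (?c f) rs' (wtgt X u) (?pF u) v) rs) w"
  define S2 where "S2 = cut1 (\<lambda>rs1 rs2. cut (\<lambda>u v. sg (wdeg rs1 * wdeg v)
    (th ?P [] (wtgt f rs1) (\<lambda>rs'. th (?c (wtgt f rs1)) rs' (wtgt X u)
      (?pR (?c (wtgt f rs1)) (wdeg rs1) (fmp ?P f rs1) u) v) rs2)) w) rs"
  let ?Z = "\<lambda>rs1 rs2 u v. if rs1 = [] \<and> u = [] then 0 else sg (wdeg rs1 * wdeg v)
       (th f rs1 X (\<lambda>z1. th (wtgt f rs1) rs2 (wtgt X u) (th \<psi> [] (wtgt ?X z1)
          (\<lambda>z3. \<phi> (fletter \<psi> ?X z1 # z3))) v) u)"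
  have LHS: "th f rs X (th \<psi> [] ?X \<phi>) w = E + cut (\<lambda>rs1 rs2. cut (\<lambda>u v. ?Z rs1 rs2 u v) w) rs"
  proof -
    have "th \<psi> [] ?X \<phi> = (\<lambda>z. (if z = [] then \<phi> [] else 0) +
        cut1 (\<lambda>z1. th \<psi> [] (wtgt ?X z1) (\<lambda>z3. \<phi> (fletter \<psi> ?X z1 # z3))) z)"
      by (rule ext, subst th_rec) simp
    moreover have "th f rs X (\<lambda>z. if z = [] then \<phi> [] else 0) w = E"
    proof (cases "rs = [] \<and> w = []")
      case False
      then have "rs \<noteq> [] \<or> w \<noteq> []" by simp
      from th_cong_nonempty[OF this, of "\<lambda>z. if z = [] then \<phi> [] else 0" "\<lambda>z. 0"]
      show ?thesis unfolding E_def if_not_P[OF False] by simp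
    qed (simp add: E_def)
    ultimately show ?thesis by (simp add: th_add th_cut1)
  qed
  \<comment> \<open>Replaces the first letter made by \<open>\<psi>\<close> by a single known letter
    and leaves the rest to the induction hypothesis. The parameters \<open>d\<close> and
    \<open>x\<close> of that letter allow both kinds of first letter to be treated at once.\<close>
  have Z: "th f rs1 X (\<lambda>z1. th (wtgt f rs1) rs2 (wtgt X u) (th \<psi> [] (wtgt ?X z1)
          (\<lambda>z3. \<phi> (fletter \<psi> ?X z1 # z3))) v) u =
      th ?P [] (wtgt f rs1) (\<lambda>rs'. th (?c (wtgt f rs1)) rs' (wtgt X u)
        (\<lambda>z. \<phi> ((fob \<psi> (fob (wtgt f rs1) (wtgt X u)), d, x) # z)) v) rs2"
    if uv: "u @ v = w" "rs1 @ rs2 = rs" "rs1 \<noteq> [] \<or> u \<noteq> []"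
      and cl: "x \<in> carrier (sMor C (fob \<psi> ?X) (fob \<psi> (fob (wtgt f rs1) (wtgt X u))) d)"
      and eq: "\<And>z. is_word C (fob \<psi> (fob (wtgt f rs1) (wtgt X u))) z \<Longrightarrow>
        th f rs1 X (\<lambda>y. \<phi> (fletter \<psi> ?X y # z)) u =
        \<phi> ((fob \<psi> (fob (wtgt f rs1) (wtgt X u)), d, x) # z)"
    for rs1 rs2 u v d x
  proof -
    let ?L = "(fob \<psi> (fob (wtgt f rs1) (wtgt X u)), d, x)"
    have wu: "is_word A X u" "is_word A (wtgt X u) v" using w uv by (auto simp: is_word_append)
    have wr: "is_word ?W f rs1" "is_word ?W (wtgt f rs1) rs2" using rs uv by (auto simp: is_word_append)
    let ?g = "wtgt f rs1"
    let ?Y = "fob ?g (wtgt X u)"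
    have g: "ainf_functor R A B ?g" using is_word_tgt[OF wr(1)] by simp
    have Y: "?Y \<in> Obj B" using functor_ob[OF g is_word_tgt[OF wu(1)]] .
    have p0: "is_word (fun_cat R B C) \<psi> []" using psi by simp
    have "th f rs1 X (\<lambda>z1. th ?g rs2 (wtgt X u) (th \<psi> [] (wtgt ?X z1) (\<lambda>z3. \<phi> (fletter \<psi> ?X z1 # z3))) v) u =
        th f rs1 X (\<lambda>z1. th ?g rs2 (wtgt X u) (\<lambda>z2. th \<psi> [] ?Y (\<lambda>z3. \<phi> (fletter \<psi> ?X z1 # z3)) z2) v) u"
      by (rule th_cong_word[OF wr(1) wu(1)]) simp
    also have "\<dots> = th ?g rs2 (wtgt X u) (\<lambda>z2. th f rs1 X (\<lambda>z1. th \<psi> [] ?Y (\<lambda>z3. \<phi> (fletter \<psi> ?X z1 # z3)) z2) u) v"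
      by (rule th_swap)
    also have "\<dots> = th ?g rs2 (wtgt X u) (\<lambda>z2. th \<psi> [] ?Y (\<lambda>z3. th f rs1 X (\<lambda>z1. \<phi> (fletter \<psi> ?X z1 # z3)) u) z2) v"
      by (simp only: th_swap[of f rs1])
    also have "\<dots> = th ?g rs2 (wtgt X u) (\<lambda>z2. th \<psi> [] ?Y (\<lambda>z3. \<phi> (?L # z3)) z2) v"
    proof (rule th_cong_word[OF wr(2) wu(2)])
      fix z2 assume z2: "is_word B (fob ?g (wtgt X u)) z2"
      show "th \<psi> [] ?Y (\<lambda>z3. th f rs1 X (\<lambda>z1. \<phi> (fletter \<psi> ?X z1 # z3)) u) z2 = th \<psi> [] ?Y (\<lambda>z3. \<phi> (?L # z3)) z2"
        by (rule th_cong_word[OF p0 z2]) (rule eq)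
    qed
    also have "\<dots> = th ?P [] ?g (\<lambda>rs'. th (?c ?g) rs' (wtgt X u) (\<lambda>z. \<phi> (?L # z)) v) rs2"
    proof (rule less.hyps[OF _ wr(2) wu(2)])
      show "length rs2 + length v < length rs + length w" using uv by (auto simp flip: uv(1,2))
      show "lin R C (fob \<psi> (fob ?g (wtgt X u))) (\<lambda>z. \<phi> (?L # z))"
        by (rule lin_tail[OF l X' cl])
    qed
    finally show ?thesis .
  qed
  have Z1: "cut (\<lambda>u v. ?Z [] rs u v) w = S1"
  proof -
    have "cut (\<lambda>u v. ?Z [] rs u v) w = cut1 (\<lambda>u v. ?Z [] rs u v) w" by (simp only: cut_cut1) simp
    also have "\<dots> = S1" unfolding S1_def
    proof (rule cut1_cong)
      fix u v assume uv: "u @ v = w" "u \<noteq> []"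
      then have wu: "is_word A X u" using w by (auto simp: is_word_append)
      have Y: "wtgt X u \<in> Obj A" by (rule is_word_tgt[OF wu])
      have L: "fletter (?c f) X u = (fob \<psi> (fob f (wtgt X u)), wdeg u, fmp (?c f) X u)"
        by (simp add: fletter_def comp_ob[OF A psi Y])
      note cl = comp_letter(1)[OF A psi f wu uv(2)]
      have "th f [] X (\<lambda>z1. th f rs (wtgt X u) (th \<psi> [] (wtgt ?X z1)
          (\<lambda>z3. \<phi> (fletter \<psi> ?X z1 # z3))) v) u =
        th ?P [] f (\<lambda>rs'. th (?c f) rs' (wtgt X u) (\<lambda>z. \<phi> (fletter (?c f) X u # z)) v) rs"
        using Z[OF uv(1), of "[]" rs "fmp (?c f) X u" "wdeg u"] uv cl comp_letter(2)[OF A psi f wu uv(2) l] by (simp add: L)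
      then show "?Z [] rs u v = th ?P [] f (\<lambda>rs'. th (?c f) rs' (wtgt X u) (?pF u) v) rs"
        using uv by simp
    qed
    finally show ?thesis .
  qed
  have Z2: "cut1 (\<lambda>rs1 rs2. cut (\<lambda>u v. ?Z rs1 rs2 u v) w) rs = S2"
    unfolding S2_def
  proof (intro cut1_cong cut_cong)
    fix rs1 rs2 u v assume uv: "rs1 @ rs2 = rs" "rs1 \<noteq> []" "u @ v = w"
    then have wu: "is_word A X u" using w by (auto simp: is_word_append)
    have wr: "is_word ?W f rs1" using rs uv by (auto simp: is_word_append)
    have Y: "wtgt X u \<in> Obj A" by (rule is_word_tgt[OF wu])
    let ?L = "rletter (?c (wtgt f rs1)) (wdeg rs1) (fmp ?P f rs1) X u"
    have L: "?L = (fob \<psi> (fob (wtgt f rs1) (wtgt X u)), wdeg u + wdeg rs1, fmp ?P f rs1 X u)"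
      by (simp add: rletter_def comp_ob[OF A psi Y])
    have "th f rs1 X (\<lambda>z1. th (wtgt f rs1) rs2 (wtgt X u) (th \<psi> [] (wtgt ?X z1)
        (\<lambda>z3. \<phi> (fletter \<psi> ?X z1 # z3))) v) u =
      th ?P [] (wtgt f rs1) (\<lambda>rs'. th (?c (wtgt f rs1)) rs' (wtgt X u) (\<lambda>z. \<phi> (?L # z)) v) rs2"
      unfolding L by (rule Z[OF uv(3,1) _ post_letter(1)[OF A psi wr uv(2) wu]])
        (use uv post_letter(2)[OF A psi wr uv(2) wu l] L in simp_all)
    then show "?Z rs1 rs2 u v = sg (wdeg rs1 * wdeg v) (th ?P [] (wtgt f rs1)
       (\<lambda>rs'. th (?c (wtgt f rs1)) rs' (wtgt X u) (\<lambda>z. \<phi> (?L # z)) v) rs2)"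
      using uv by simp
  qed
  have RHS: "th ?P [] f (\<lambda>rs'. th (?c f) rs' X \<phi> w) rs = E + (S1 + S2)"
  proof -
    define k where "k rs' = (case rs' of [] \<Rightarrow> 0 | (g, d, r) # rs'' \<Rightarrow>
        cut (\<lambda>u v. sg (d * wdeg v) (th g rs'' (wtgt X u) (?pR g d r u) v)) w)" for rs'
    have "(\<lambda>rs'. th (?c f) rs' X \<phi> w) = (\<lambda>rs'. (if rs' = [] then (if w = [] then \<phi> [] else 0) else 0) +
        cut1 (\<lambda>u v. th (?c f) rs' (wtgt X u) (?pF u) v) w + k rs')"
      by (rule ext, subst th_rec) (auto simp: k_def)
    then have "th ?P [] f (\<lambda>rs'. th (?c f) rs' X \<phi> w) rs =
        th ?P [] f (\<lambda>rs'. if rs' = [] then (if w = [] then \<phi> [] else 0) else 0) rs + S1 + th ?P [] f k rs"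
      by (simp add: th_add th_cut1_param S1_def)
    also have "th ?P [] f (\<lambda>rs'. if rs' = [] then (if w = [] then \<phi> [] else 0) else 0) rs = E"
      by (subst th_rec) (simp add: E_def)
    also have "th ?P [] f k rs = S2"
    proof -
      have "k [] = 0" by (simp add: k_def)
      then have "th ?P [] f k rs = cut1 (\<lambda>rs1 rs2. th ?P [] (wtgt f rs1) (\<lambda>z. k (fletter ?P f rs1 # z)) rs2) rs"
        by (subst th_rec) simp
      also have "\<dots> = S2" unfolding S2_def
      proof (rule cut1_cong)
        fix rs1 rs2 assume r: "rs1 @ rs2 = rs" "rs1 \<noteq> []"
        have "is_word ?W f rs1" using rs r by (auto simp: is_word_append)
        then have "ainf_functor R A B (wtgt f rs1)" using is_word_tgt by fastforce
        then have "fletter ?P f rs1 = (?c (wtgt f rs1), wdeg rs1, fmp ?P f rs1)"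
          by (simp add: fletter_def post_fun_def)
        then show "th ?P [] (wtgt f rs1) (\<lambda>z. k (fletter ?P f rs1 # z)) rs2 =
          cut (\<lambda>u v. sg (wdeg rs1 * wdeg v) (th ?P [] (wtgt f rs1) (\<lambda>rs'. th (?c (wtgt f rs1)) rs' (wtgt X u)
           (?pR (?c (wtgt f rs1)) (wdeg rs1) (fmp ?P f rs1) u) v) rs2)) w"
          by (simp add: k_def th_cut_param th_sg)
      qed
      finally show ?thesis .
    qed
    finally show ?thesis by (simp add: add.assoc)
  qed
  show ?case unfolding LHS RHS by (simp only: cut_cut1[of _ rs] Z1 Z2)
qed

section \<open>Composites and identities as functors\<close>

lemma cut1_last:
  assumes "\<And>u v. v \<noteq> [] \<Longrightarrow> F u v = 0" "w \<noteq> []"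
  shows "cut1 F w = F w []"
proof -
  have "cut F w = F w []" for w using assms(1)
  proof (induction w arbitrary: F)
    case (Cons p w)
    from Cons.IH[of "\<lambda>u. F (p # u)"] Cons.prems show ?case by simp
  qed simp
  from this[of w] show ?thesis using assms(1)[of w "[]"] assms by (simp add: cut_cut1)
qed

lemma th_singleton_support:
  fixes w :: "('oa, 'ma) word"
  assumes "\<And>z. length z \<noteq> 1 \<Longrightarrow> \<phi> z = 0" "w \<noteq> []"
  shows "th f [] X \<phi> w = \<phi> [fletter f X w]"
proof -
  have "cut1 (\<lambda>u v. th f [] (wtgt X u) (\<lambda>z. \<phi> (fletter f X u # z)) v) w =
    th f [] (wtgt X w) (\<lambda>z. \<phi> (fletter f X w # z)) []"
  proof (rule cut1_last[OF _ assms(2)])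
    fix u v :: "('oa, 'ma) word" assume "v \<noteq> []"
    then have "th f [] (wtgt X u) (\<lambda>z. \<phi> (fletter f X u # z)) v = th f [] (wtgt X u) (\<lambda>z. 0) v"
      by (intro th_cong_nonempty assms(1)) auto
    then show "th f [] (wtgt X u) (\<lambda>z. \<phi> (fletter f X u # z)) v = 0" by simp
  qed
  then show ?thesis using assms(2) by (subst th_rec) simp
qed

lemma emb_word_support: "length z \<noteq> 1 \<Longrightarrow> emb_word R B X z = 0"
  by (auto simp: emb_word_def split: list.splits)

text \<open>The case of \<open>th_post\<close> without transformations: the coalgebra map of a
  composite is the composite of the coalgebra maps.\<close>

lemma th_comp:
  assumes "ainf_functor R A B f" "ainf_functor R B C \<psi>" "is_word A X w" "lin R C (fob \<psi> (fob f X)) \<phi>"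
  shows "th f [] X (th \<psi> [] (fob f X) \<phi>) w = th (comp_fun A C f \<psi>) [] X \<phi> w"
  using th_post[of R A B C \<psi> f "[]" X w \<phi>] assms by (simp add: functor_cats)

lemma fv_comp:
  assumes f: "ainf_functor R A B f" and psi: "ainf_functor R B C \<psi>" and w: "is_word A X w" "w \<noteq> []"
  shows "fv R C (comp_fun A C f \<psi>) X w = th f [] X (fv R C \<psi> (fob f X)) w"
proof -
  have A: "ainf_category R A" and C: "ainf_category R C" using f psi by (simp_all add: functor_cats)
  have X: "X \<in> Obj A" "wtgt X w \<in> Obj A" using is_word_src[OF w(1)] is_word_tgt[OF w(1)] .
  have X': "fob \<psi> (fob f X) \<in> Obj C" "fob \<psi> (fob f (wtgt X w)) \<in> Obj C"
    using X functor_ob[OF psi] functor_ob[OF f] by simp_all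
  show ?thesis
    using comp_letter(2)[OF A psi f w lin_emb_word[OF ainf_modular[OF C] X'(1)], of "[]"] X' X
    by (simp add: fletter_def fv_eq[abs_def] comp_ob[OF A psi])
qed

text \<open>Both coalgebra maps commute with the codifferentials: the equations of
  \<open>\<psi>\<close> are applied under \<open>f\<close>, and \<open>th_bh\<close> without
  transformations then moves the codifferential past \<open>f\<close>.\<close>

theorem comp_functor:
  assumes f: "ainf_functor R A B f" and psi: "ainf_functor R B C \<psi>"
  shows "ainf_functor R A C (comp_fun A C f \<psi>)"
proof -
  let ?h = "comp_fun A C f \<psi>"
  have A: "ainf_category R A" and B: "ainf_category R B" and C: "ainf_category R C"
    using f psi by (simp_all add: functor_cats)
  have ob: "fob ?h X \<in> Obj C" if "X \<in> Obj A" for X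
    using that functor_ob[OF psi functor_ob[OF f that]] by (simp add: comp_ob[OF A psi])
  have f0: "is_word (fun_cat R A B) f []" using f by simp
  have mp: "fmp ?h X w \<in> carrier (sMor C (fob ?h X) (fob ?h (wtgt X w)) (wdeg w))"
    if "is_word A X w" "w \<noteq> []" for X w
    using comp_letter(1)[OF A psi f that] is_word_src[OF that(1)] is_word_tgt[OF that(1)]
    by (simp add: comp_ob[OF A psi])
  have "lin R A X (fv R C ?h X)" for X
  proof (cases "X \<in> Obj A")
    case True
    show ?thesis
      by (rule lin_cong[OF ainf_modular[OF A] lin_th[OF f0 lin_fv[OF psi] True]])
        (simp add: fv_comp[OF f psi])
  next
    case False
    then show ?thesis by (intro linI) (metis is_word_src)
  qed
  then have tl: "tlin R A (\<lambda>X Y. sMor C (fob ?h X) (fob ?h Y)) 1 0 (fmp ?h)"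
    using mp by (subst tlin_iff_lin[OF ainf_modular[OF A] modfam_pull[OF C ob ob]])
      (simp_all add: fv_def Suc_le_eq)
  have eq: "th ?h [] X (bv R C (fob ?h X)) w = bh A X (fv R C ?h X) w" if w: "is_word A X w" "w \<noteq> []" for X w
  proof -
    have X: "X \<in> Obj A" using is_word_src[OF w(1)] .
    have "th ?h [] X (bv R C (fob ?h X)) w = th f [] X (th \<psi> [] (fob f X) (bv R C (fob \<psi> (fob f X)))) w"
      using th_comp[OF f psi w(1) lin_bv[OF C]] X by (simp add: comp_ob[OF A psi])
    also have "\<dots> = th f [] X (bh B (fob f X) (fv R C \<psi> (fob f X))) w"
      by (rule th_cong_word[OF f0 w(1)]) (use w(2) functor_fv_eq[OF psi] in auto)
    also have "\<dots> = bh A X (th f [] X (fv R C \<psi> (fob f X))) w"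
      using th_bh[OF A B f0 w(1) lin_fv[OF psi]] by simp
    also have "\<dots> = bh A X (fv R C ?h X) w"
      by (rule bh_cong_word[OF ainf_bclosed[OF A] w(1)]) (simp add: fv_comp[OF f psi])
    finally show ?thesis .
  qed
  show ?thesis
    by (rule ainf_functorI[OF A C ob tl])
      (use functor_eqn_emb[where A = A and B = C and f = ?h, OF A C ob mp _ _ refl] eq
        in \<open>auto simp: comp_fun_def\<close>)
qed

text \<open>A decomposition with a piece of length at least two contains a zero letter, on which the
  linear \<open>\<phi>\<close> vanishes; only the decomposition into single letters
  survives.\<close>

lemma th_id_fun:
  assumes A: "ainf_category R A" and "is_word A X w" "lin R A X \<phi>"
  shows "th (id_fun A) [] X \<phi> w = \<phi> w"
proof -
  let ?i = "id_fun A"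
  have mA: "modular R A" using A by (rule ainf_modular)
  have ob: "fob ?i X = X" if "X \<in> Obj A" for X using that by (simp add: id_fun_def)
  have zero: "\<zero>\<^bsub>sMor A X Y d\<^esub> \<in> carrier (sMor A X Y d)" if "X \<in> Obj A" "Y \<in> Obj A" for X Y d
    using abelian_groupE(2)[OF ab_of_module[OF modularD[OF mA that]]] .
  have long: "fletter ?i X (p # q # w) = (wtgt X (p # q # w), wdeg (p # q # w),
      \<zero>\<^bsub>sMor A X (wtgt X (p # q # w)) (wdeg (p # q # w))\<^esub>)"
    if "is_word A X (p # q # w)" for X p q w
    using that is_word_tgt[OF that] ob by (auto simp: fletter_def id_fun_def split: list.splits)
  have one: "fletter ?i X [(Y, d, x)] = (Y, d, x)" if "is_word A X [(Y, d, x)]" for X Y d x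
    using that ob by (simp add: fletter_def id_fun_def)
  show ?thesis
    using assms(2,3)
  proof (induction w arbitrary: X \<phi> rule: length_induct)
    case (1 w)
    note w = 1(2) and l = 1(3)
    show ?case
    proof (cases w)
      case (Cons p w')
      obtain Y d x where p: "p = (Y, d, x)" by (cases p)
      have X: "X \<in> Obj A" "x \<in> carrier (sMor A X Y d)" "is_word A Y w'" using w Cons p by auto
      have "Y \<in> Obj A" using is_word_src[OF X(3)] .
      have "cut1 (\<lambda>u v. th ?i [] (wtgt X (p # u)) (\<lambda>z. \<phi> (fletter ?i X (p # u) # z)) v) w' = cut1 (\<lambda>u v. 0) w'"
      proof (rule cut1_cong)
        fix u v assume uv: "u @ v = w'" "u \<noteq> []"
        then obtain q u' where u: "u = q # u'" by (cases u) auto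
        have wu: "is_word A X (p # u)" "is_word A (wtgt X (p # u)) v"
          using w uv(1) is_word_append[of A X "p # u" v] Cons by auto
        let ?L = "(wtgt X (p # u), wdeg (p # u), \<zero>\<^bsub>sMor A X (wtgt X (p # u)) (wdeg (p # u))\<^esub>)"
        have L: "fletter ?i X (p # u) = ?L" using long[of X p q u'] wu u by simp
        have "lin R A (wtgt X (p # u)) (\<lambda>z. \<phi> (?L # z))"
          by (rule lin_tail[OF l X(1) zero[OF X(1) is_word_tgt[OF wu(1)]]])
        then have "th ?i [] (wtgt X (p # u)) (\<lambda>z. \<phi> (?L # z)) v = \<phi> (?L # v)"
          using 1(1) wu(2) uv Cons by auto
        also have "\<dots> = 0" by (rule lin_zero[OF mA l X(1) wu(2)])
        finally show "th ?i [] (wtgt X (p # u)) (\<lambda>z. \<phi> (fletter ?i X (p # u) # z)) v = 0" using L by simp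
      qed
      moreover have "th ?i [] Y (\<lambda>z. \<phi> (p # z)) w' = \<phi> (p # w')"
        using 1(1)[rule_format, of w' Y "\<lambda>z. \<phi> (p # z)"] X lin_tail[OF l X(1,2)] Cons p by simp
      ultimately show ?thesis
        using one[of X Y d x] X \<open>Y \<in> Obj A\<close> by (subst th_rec) (simp add: Cons p cut_cut1)
    qed simp
  qed
qed

lemma fv_id_fun:
  assumes A: "ainf_category R A" and w0: "is_word A X w" "w \<noteq> []"
  shows "fv R A (id_fun A) X w = emb_word R A X w"
proof -
  have mA: "modular R A" using A by (rule ainf_modular)
  obtain Y d x w' where w: "w = (Y, d, x) # w'" using w0(2) by (cases w) auto
  have "module R (sMor A X (wtgt X w) (wdeg w))"
    using modularD[OF mA is_word_src[OF w0(1)] is_word_tgt[OF w0(1)]] .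
  then show ?thesis
    using w0 is_word_src[OF w0(1)] is_word_tgt[OF w0(1)]
    by (cases w') (auto simp: fv_eq id_fun_def w emb_word_def emb_zero)
qed

theorem id_functor:
  assumes A: "ainf_category R A"
  shows "ainf_functor R A A (id_fun A)"
proof -
  let ?i = "id_fun A"
  have mA: "modular R A" using A by (rule ainf_modular)
  have ob: "fob ?i X = X" if "X \<in> Obj A" for X using that by (simp add: id_fun_def)
  have zero: "\<zero>\<^bsub>sMor A X Y d\<^esub> \<in> carrier (sMor A X Y d)" if "X \<in> Obj A" "Y \<in> Obj A" for X Y d
    using abelian_groupE(2)[OF ab_of_module[OF modularD[OF mA that]]] .
  have mp: "fmp ?i X w \<in> carrier (sMor A (fob ?i X) (fob ?i (wtgt X w)) (wdeg w))"
    if "is_word A X w" "w \<noteq> []" for X w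
  proof -
    have "w \<noteq> []" using that by simp
    then obtain Y d x w' where w: "w = (Y, d, x) # w'" by (cases w) auto
    then show ?thesis
      using that zero is_word_src[OF that(1)] is_word_tgt[OF that(1)]
      by (cases w') (auto simp: id_fun_def)
  qed
  have obI: "fob ?i X \<in> Obj A" if "X \<in> Obj A" for X using that ob by simp
  have "lin R A X (fv R A ?i X)" for X
  proof (cases "X \<in> Obj A")
    case True
    show ?thesis by (rule lin_cong[OF mA lin_emb_word[OF mA True]]) (simp add: fv_id_fun[OF A])
  next
    case False
    then show ?thesis by (intro linI) (metis is_word_src)
  qed
  then have tl: "tlin R A (\<lambda>X Y. sMor A (fob ?i X) (fob ?i Y)) 1 0 (fmp ?i)"
    using mp by (subst tlin_iff_lin[OF mA modfam_pull[OF A obI obI]])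
      (simp_all add: fv_def Suc_le_eq)
  have eq: "th ?i [] X (bv R A (fob ?i X)) w = bh A X (fv R A ?i X) w" if w: "is_word A X w" "w \<noteq> []" for X w
  proof -
    have "th ?i [] X (bv R A (fob ?i X)) w = bv R A X w"
      using th_id_fun[OF A w(1) lin_bv[OF A]] ob[OF is_word_src[OF w(1)]] by simp
    also have "\<dots> = bh A X (emb_word R A X) w"
      by (subst bh_singleton_support[OF w(2)]) (simp_all add: emb_word_support bv_eq)
    also have "\<dots> = bh A X (fv R A ?i X) w"
      by (rule bh_cong_word[OF ainf_bclosed[OF A] w(1)]) (simp add: fv_id_fun[OF A])
    finally show ?thesis .
  qed
  show "ainf_functor R A A ?i"
    by (rule ainf_functorI[OF A A obI tl])
      (use functor_eqn_emb[where A = A and B = A and f = ?i, OF A A obI mp _ _ refl] eq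
        in \<open>auto simp: id_fun_def\<close>)
qed

lemma functor_ext:
  assumes f: "ainf_functor R A B f" and g: "ainf_functor R A B g"
    and ob: "\<And>X. X \<in> Obj A \<Longrightarrow> fob f X = fob g X"
    and fv: "\<And>X w. is_word A X w \<Longrightarrow> w \<noteq> [] \<Longrightarrow> fv R B f X w = fv R B g X w"
  shows "f = g"
proof -
  have "fob f X = fob g X" for X
    using ob f g by (cases "X \<in> Obj A") (simp_all add: ainf_functor_def)
  moreover have "fmp f X w = fmp g X w" for X w
  proof (cases "is_word A X w \<and> w \<noteq> []")
    case True
    then have w: "is_word A X w" "w \<noteq> []" by simp_all
    have X: "X \<in> Obj A" "wtgt X w \<in> Obj A" using is_word_src[OF w(1)] is_word_tgt[OF w(1)] .
    have "module R (sMor B (fob f X) (fob f (wtgt X w)) (wdeg w))"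
      by (rule modularD[OF ainf_modular functor_ob[OF f X(1)] functor_ob[OF f X(2)]])
        (use f in \<open>simp add: functor_cats\<close>)
    from emb_inject[OF this functor_closed[OF f w], of "fmp g X w"]
    show ?thesis using functor_closed[OF g w] fv[OF w] by (simp add: fv_eq ob X)
  qed (use f g in \<open>simp add: ainf_functor_def\<close>)
  ultimately have "fob f = fob g" "fmp f = fmp g" by (blast intro: ext)+
  then show ?thesis by simp
qed

text \<open>Composition of coalgebra maps is associative, and a functor is determined by its objects
  and the values \<open>fv\<close>.\<close>

lemma comp_assoc:
  assumes e: "ainf_functor R A B e" and f: "ainf_functor R B C f" and g: "ainf_functor R C D g"
  shows "comp_fun A D e (comp_fun B D f g) = comp_fun A D (comp_fun A C e f) g"
proof -
  have cats: "ainf_category R A" "ainf_category R B" "ainf_category R D"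
    using e f g by (simp_all add: functor_cats)
  note fg = comp_functor[OF f g] and ef = comp_functor[OF e f]
  have e0: "is_word (fun_cat R A B) e []" using e by simp
  show ?thesis
  proof (rule functor_ext[OF comp_functor[OF e fg] comp_functor[OF ef g]])
    fix X assume "X \<in> Obj A"
    then show "fob (comp_fun A D e (comp_fun B D f g)) X = fob (comp_fun A D (comp_fun A C e f) g) X"
      using functor_ob[OF e] by (simp add: comp_fun_def)
  next
    fix X w assume w: "is_word A X w" "w \<noteq> []"
    have X: "X \<in> Obj A" using is_word_src[OF w(1)] .
    have eX: "fob e X \<in> Obj B" using functor_ob[OF e X] .
    have "fv R D (comp_fun A D e (comp_fun B D f g)) X w = th e [] X (fv R D (comp_fun B D f g) (fob e X)) w"
      by (rule fv_comp[OF e fg w])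
    also have "\<dots> = th e [] X (th f [] (fob e X) (fv R D g (fob f (fob e X)))) w"
      by (rule th_cong_word[OF e0 w(1)]) (use w(2) in \<open>simp add: fv_comp[OF f g]\<close>)
    also have "\<dots> = th (comp_fun A C e f) [] X (fv R D g (fob f (fob e X))) w"
      by (rule th_comp[OF e f w(1) lin_fv[OF g]])
    also have "\<dots> = fv R D (comp_fun A D (comp_fun A C e f) g) X w"
      using fv_comp[OF ef g w] X by (simp add: comp_ob[OF cats(1) f])
    finally show "fv R D (comp_fun A D e (comp_fun B D f g)) X w =
      fv R D (comp_fun A D (comp_fun A C e f) g) X w" .
  qed
qed

lemma comp_id:
  assumes e: "ainf_functor R A B e"
  shows "comp_fun A B e (id_fun B) = e"
proof -
  have A: "ainf_category R A" and B: "ainf_category R B" using e by (simp_all add: functor_cats)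
  note i = id_functor[OF B]
  have e0: "is_word (fun_cat R A B) e []" using e by simp
  show ?thesis
  proof (rule functor_ext[OF comp_functor[OF e i] e])
    fix X assume "X \<in> Obj A"
    then show "fob (comp_fun A B e (id_fun B)) X = fob e X"
      using functor_ob[OF e] by (simp add: comp_fun_def id_fun_def)
  next
    fix X w assume w: "is_word A X w" "w \<noteq> []"
    have "fv R B (comp_fun A B e (id_fun B)) X w = th e [] X (fv R B (id_fun B) (fob e X)) w"
      by (rule fv_comp[OF e i w])
    also have "\<dots> = th e [] X (emb_word R B (fob e X)) w"
      by (rule th_cong_word[OF e0 w(1)]) (use w(2) fv_id_fun[OF B] in auto)
    also have "\<dots> = emb_word R B (fob e X) [fletter e X w]"
      by (rule th_singleton_support[OF emb_word_support w(2)])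
    finally show "fv R B (comp_fun A B e (id_fun B)) X w = fv R B e X w"
      by (simp add: fletter_def fv_eq)
  qed
qed

section \<open>The functor equations for postcomposition\<close>

lemma rv_post:
  assumes A: "ainf_category R A" and psi: "ainf_functor R B C \<psi>"
    and rs: "is_word (fun_cat R A B) f rs" "rs \<noteq> []" and w: "is_word A X w"
  shows "rv R C (comp_fun A C f \<psi>) (comp_fun A C (wtgt f rs) \<psi>) (wdeg rs)
      (fmp (post_fun R A B C \<psi>) f rs) X w = th f rs X (fv R C \<psi> (fob f X)) w"
proof -
  have C: "ainf_category R C" using psi by (simp add: functor_cats)
  have ff: "ainf_functor R A B f" and g: "ainf_functor R A B (wtgt f rs)"
    using is_word_src[OF rs(1)] is_word_tgt[OF rs(1)] by simp_all
  have X: "X \<in> Obj A" "wtgt X w \<in> Obj A" using is_word_src[OF w] is_word_tgt[OF w] .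
  have X': "fob \<psi> (fob f X) \<in> Obj C" "fob \<psi> (fob (wtgt f rs) (wtgt X w)) \<in> Obj C"
    using X functor_ob[OF psi] functor_ob[OF ff] functor_ob[OF g] by simp_all
  show ?thesis
    using post_letter(2)[OF A psi rs w lin_emb_word[OF ainf_modular[OF C] X'(1)], of "[]"] X' X
    by (simp add: fletter_def rletter_def fv_eq[abs_def] rv_eq comp_ob[OF A psi])
qed

text \<open>Evaluated at a word, the left side of the functor equation becomes
  \<open>\<theta>\<close> followed by \<open>\<psi>\<close> and the operations of \<open>C\<close>,
  by \<open>th_post\<close>; the equations of \<open>\<psi>\<close> turn this into operations of
  \<open>B\<close> followed by \<open>\<psi>\<close>, and \<open>th_bh\<close> moves these to the
  transformations and the inputs.\<close>

theorem post_functor: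
  assumes A: "ainf_category R A" and psi: "ainf_functor R B C \<psi>"
  shows "ainf_functor R (fun_cat R A B) (fun_cat R A C) (post_fun R A B C \<psi>)"
proof -
  let ?V = "fun_cat R A B" and ?W = "fun_cat R A C" and ?P = "post_fun R A B C \<psi>"
  let ?c = "\<lambda>f. comp_fun A C f \<psi>"
  have B: "ainf_category R B" and C: "ainf_category R C" using psi by (simp_all add: functor_cats)
  have mV: "modular R ?V" by (rule fun_cat_modular[OF A])
  have ob: "fob ?P f = ?c f" if "ainf_functor R A B f" for f using that by (simp add: post_fun_def)
  have obW: "fob ?P f \<in> Obj ?W" if "f \<in> Obj ?V" for f
    using that comp_functor[OF _ psi] by (simp add: ob)
  have mp: "fmp ?P f rs \<in> carrier (trans_module R A C (?c f) (?c (wtgt f rs)) (wdeg rs))"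
    if rs: "is_word ?V f rs" "rs \<noteq> []" for f rs
  proof -
    have f: "ainf_functor R A B f" and g: "ainf_functor R A B (wtgt f rs)"
      using is_word_src[OF rs(1)] is_word_tgt[OF rs(1)] by simp_all
    note fc = comp_functor[OF f psi] and gc = comp_functor[OF g psi]
    have "lin R A X (rv R C (?c f) (?c (wtgt f rs)) (wdeg rs) (fmp ?P f rs) X)" for X
    proof (cases "X \<in> Obj A")
      case True
      show ?thesis
        by (rule lin_cong[OF ainf_modular[OF A] lin_th[OF rs(1) lin_fv[OF psi] True]])
          (simp add: rv_post[OF A psi rs])
    next
      case False
      then show ?thesis by (intro linI) (metis is_word_src)
    qed
    moreover have "fmp ?P f rs X w \<in> carrier (sMor C (fob (?c f) X) (fob (?c (wtgt f rs)) (wtgt X w)) (wdeg w + wdeg rs))"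
      if w: "is_word A X w" for X w
      using post_letter(1)[OF A psi rs w] is_word_src[OF w] is_word_tgt[OF w] by (simp add: comp_ob[OF A psi])
    moreover have "fmp ?P f rs X w = undefined" if "\<not> is_word A X w" for X w
      using that rs by (simp add: post_fun_def)
    ultimately show ?thesis by (simp add: trans_carrier_iff[OF fc gc])
  qed
  have mp': "fmp ?P f rs \<in> carrier (sMor ?W (fob ?P f) (fob ?P (wtgt f rs)) (wdeg rs))"
    if rs: "is_word ?V f rs" "rs \<noteq> []" for f rs
    using mp[OF rs] is_word_src[OF rs(1)] is_word_tgt[OF rs(1)] by (simp add: ob)
  have comb: "fmp ?P f (rs1 @ (h, D, a \<odot>\<^bsub>sMor ?V (wtgt f rs1) h D\<^esub> x \<oplus>\<^bsub>sMor ?V (wtgt f rs1) h D\<^esub> y) # rs2) =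
      a \<odot>\<^bsub>sMor ?W (fob ?P f) (fob ?P (wtgt h rs2)) (wdeg rs1 + (D + wdeg rs2) + 0)\<^esub> fmp ?P f (rs1 @ (h, D, x) # rs2)
      \<oplus>\<^bsub>sMor ?W (fob ?P f) (fob ?P (wtgt h rs2)) (wdeg rs1 + (D + wdeg rs2) + 0)\<^esub> fmp ?P f (rs1 @ (h, D, y) # rs2)"
    if a: "a \<in> carrier R" and wx: "is_word ?V f (rs1 @ (h, D, x) # rs2)"
      and wy: "is_word ?V f (rs1 @ (h, D, y) # rs2)" for f rs1 h D x y rs2 a
  proof -
    let ?S = "sMor ?V (wtgt f rs1) h D" and ?d = "wdeg rs1 + (D + wdeg rs2)" and ?g = "wtgt h rs2"
    let ?z = "a \<odot>\<^bsub>?S\<^esub> x \<oplus>\<^bsub>?S\<^esub> y"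
    let ?r = "\<lambda>t. rs1 @ (h, D, t) # rs2"
    let ?T = "trans_module R A C (?c f) (?c ?g) ?d"
    have wz: "is_word ?V f (?r ?z)" by (rule word_comb[OF mV a wx wy])
    have f: "ainf_functor R A B f" and g: "ainf_functor R A B ?g"
      using is_word_src[OF wx] is_word_tgt[OF wx] by simp_all
    note fc = comp_functor[OF f psi] and gc = comp_functor[OF g psi]
    have bc: "fmp ?P f (?r t) \<in> carrier ?T" if "is_word ?V f (?r t)" for t
      using mp[OF that] by simp
    have bv: "rv R C (?c f) (?c ?g) ?d (fmp ?P f (?r t)) X w = th f (?r t) X (fv R C \<psi> (fob f X)) w"
      if "is_word ?V f (?r t)" "is_word A X w" for t X w
      using rv_post[OF A psi that(1) _ that(2)] by simp
    have "fmp ?P f (?r ?z) = a \<odot>\<^bsub>?T\<^esub> fmp ?P f (?r x) \<oplus>\<^bsub>?T\<^esub> fmp ?P f (?r y)"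
    proof (rule trans_ext[OF fc gc, of _ ?d])
      show "fmp ?P f (?r ?z) \<in> carrier ?T" by (rule bc[OF wz])
      show "a \<odot>\<^bsub>?T\<^esub> fmp ?P f (?r x) \<oplus>\<^bsub>?T\<^esub> fmp ?P f (?r y) \<in> carrier ?T"
        by (intro trans_add_closed trans_smult_closed fc gc a bc wx wy)
      fix X w assume w: "is_word A X w"
      show "rv R C (?c f) (?c ?g) ?d (fmp ?P f (?r ?z)) X w =
        rv R C (?c f) (?c ?g) ?d (a \<odot>\<^bsub>?T\<^esub> fmp ?P f (?r x) \<oplus>\<^bsub>?T\<^esub> fmp ?P f (?r y)) X w"
        unfolding rv_add[OF fc gc trans_smult_closed[OF fc gc bc[OF wx] a] bc[OF wy] w]
          rv_smult[OF fc gc bc[OF wx] a w] bv[OF wx w] bv[OF wy w] bv[OF wz w]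
        by (rule linD[OF th_rs_lin[OF A B w lin_fv[OF psi] f] a wx wy])
    qed
    then show ?thesis using f g by (simp add: ob)
  qed
  have tl: "tlin R ?V (\<lambda>f g. sMor ?W (fob ?P f) (fob ?P g)) 1 0 (fmp ?P)"
    unfolding tlin_def using mp' comb
    by (metis (no_types, lifting) One_nat_def Suc_le_eq length_greater_0_conv add_0_right)
  have eq: "(\<Oplus>\<^bsub>sMor ?W (fob ?P f) (fob ?P (wtgt f rs)) (wdeg rs + 1)\<^esub>ws \<in> splits rs.
      bop ?W (fob ?P f) (fun_tensor ?P f ws)) =
      b_then (sMor ?W (fob ?P f) (fob ?P (wtgt f rs)) (wdeg rs + 1)) ?V (fmp ?P) f rs"
    if rs: "is_word ?V f rs" "rs \<noteq> []" for f rs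
  proof -
    let ?g = "wtgt f rs" and ?d = "wdeg rs + 1"
    have f: "ainf_functor R A B f" and g: "ainf_functor R A B ?g"
      using is_word_src[OF rs(1)] is_word_tgt[OF rs(1)] by simp_all
    note fc = comp_functor[OF f psi] and gc = comp_functor[OF g psi]
    let ?T = "trans_module R A C (?c f) (?c ?g) ?d"
    interpret T: module R ?T by (rule trans_module_module[OF fc gc])
    have fw: "is_word ?W (?c f) (fun_tensor ?P f ws)" "wtgt (?c f) (fun_tensor ?P f ws) = ?c ?g"
      "wdeg (fun_tensor ?P f ws) = wdeg rs" "fun_tensor ?P f ws \<noteq> []" if "ws \<in> splits rs" for ws
      using fun_tensor_word_closed[where f = ?P and A = ?V and B = ?W, OF obW mp' rs(1) that] rs(2) f g
      by (auto simp: ob)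
    have c1: "bop ?W (?c f) (fun_tensor ?P f ws) \<in> carrier ?T" if "ws \<in> splits rs" for ws
      using fun_cat_bop_carrier[OF fw(1,4)[OF that] A C] fw[OF that] by simp
    have G: "ainf_functor R A C (?c Q)" if "Q \<in> Obj ?V" for Q using that comp_functor[OF _ psi] by simp
    have d: "?d = wdeg rs + 1 + 0" by simp
    have mp0: "fmp ?P f rs' \<in> carrier (trans_module R A C (?c f) (?c (wtgt f rs')) (wdeg rs' + 0))"
      if "is_word ?V f rs'" "rs' \<noteq> []" for rs' using mp[OF that] by simp
    have bV: "bclosed ?V" by (rule fun_cat_bclosed[OF A B])
    note bt = rv_b_then[where G = ?c and \<psi> = "fmp ?P", OF fc bV rs(1) G mp0 d]
    have "finsum ?T (\<lambda>ws. bop ?W (?c f) (fun_tensor ?P f ws)) (splits rs) = b_then ?T ?V (fmp ?P) f rs"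
    proof (rule trans_ext[OF fc gc, of _ ?d])
      show "finsum ?T (\<lambda>ws. bop ?W (?c f) (fun_tensor ?P f ws)) (splits rs) \<in> carrier ?T"
        by (intro T.finsum_closed) (auto intro: c1)
      show "b_then ?T ?V (fmp ?P) f rs \<in> carrier ?T"
        by (rule bt(1)) simp_all
      fix X w assume w: "is_word A X w"
      have X: "X \<in> Obj A" using is_word_src[OF w] .
      define t where "t = (\<lambda>rs. th (?c f) rs X (bv R C (fob (?c f) X)) w)"
      define s where "s = (\<lambda>rs. sing rs (\<lambda>g d r. sg d (bh A X (rv R C (?c f) g d r X) w)))"
      \<comment> \<open>The term with an operation on the inputs. It arises twice, from
        \<open>th_bh\<close> and from the extra summand of \<open>B_1\<close> on the composed
        transformations, and cancels.\<close>
      let ?y = "sg (wdeg rs) (bh A X (th f rs X (fv R C \<psi> (fob f X))) w)"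
      have "rv R C (?c f) (?c ?g) ?d (finsum ?T (\<lambda>ws. bop ?W (?c f) (fun_tensor ?P f ws)) (splits rs)) X w =
          (\<Sum>ws \<in> splits rs. rv R C (?c f) (?c ?g) ?d (bop ?W (?c f) (fun_tensor ?P f ws)) X w)"
        by (rule rv_finsum[OF fc gc c1 w])
      also have "\<dots> = (\<Sum>ws \<in> splits rs. t (fun_tensor ?P f ws) - s (fun_tensor ?P f ws))"
      proof (rule sum.cong[OF refl])
        fix ws assume ws: "ws \<in> splits rs"
        from rv_bop[OF fw(1,4)[OF ws] w C] fw[OF ws]
        show "rv R C (?c f) (?c ?g) ?d (bop ?W (?c f) (fun_tensor ?P f ws)) X w =
          t (fun_tensor ?P f ws) - s (fun_tensor ?P f ws)" by (simp add: t_def s_def)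
      qed
      also have "\<dots> = th ?P [] f t rs - th ?P [] f s rs"
        by (simp add: sum_subtractf sum_splits)
      also have "th ?P [] f s rs = s [fletter ?P f rs]"
        by (rule th_singleton_support[OF _ rs(2)]) (auto simp: s_def sing_def split: list.splits)
      also have "\<dots> = sg (wdeg rs) (bh A X (rv R C (?c f) (?c ?g) (wdeg rs) (fmp ?P f rs) X) w)"
        by (simp add: s_def fletter_def ob g)
      also have "\<dots> = ?y"
        by (rule arg_cong[where f = "sg _"], rule bh_cong_word[OF ainf_bclosed[OF A] w])
          (simp add: rv_post[OF A psi rs])
      also have "th ?P [] f t rs = th f rs X (th \<psi> [] (fob f X) (bv R C (fob \<psi> (fob f X)))) w"
        unfolding t_def using th_post[OF A psi rs(1) w lin_bv[OF C]] X by (simp add: comp_ob[OF A psi])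
      also have "\<dots> = th f rs X (bh B (fob f X) (fv R C \<psi> (fob f X))) w"
        by (rule th_cong_word[OF rs(1) w]) (use rs(2) functor_fv_eq[OF psi] in auto)
      also have "\<dots> = bh ?V f (\<lambda>rs'. th f rs' X (fv R C \<psi> (fob f X)) w) rs + ?y"
        by (rule th_bh[OF A B rs(1) w lin_fv[OF psi]])
      also have "bh ?V f (\<lambda>rs'. th f rs' X (fv R C \<psi> (fob f X)) w) rs =
          bh ?V f (\<lambda>rs'. rv R C (?c f) (?c (wtgt f rs')) (wdeg rs' + 0) (fmp ?P f rs') X w) rs"
        proof (rule bh_cong_word[OF bV rs(1)])
          fix rs' assume "is_word ?V f rs'" "rs' \<noteq> []"
          from rv_post[OF A psi this w]
          show "th f rs' X (fv R C \<psi> (fob f X)) w =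
            rv R C (?c f) (?c (wtgt f rs')) (wdeg rs' + 0) (fmp ?P f rs') X w" by simp
        qed
      also have "\<dots> = rv R C (?c f) (?c ?g) ?d (b_then ?T ?V (fmp ?P) f rs) X w"
        by (rule bt(2)[OF _ _ _ w, symmetric]) simp_all
      finally show "rv R C (?c f) (?c ?g) ?d (finsum ?T (\<lambda>ws. bop ?W (?c f) (fun_tensor ?P f ws)) (splits rs)) X w =
        rv R C (?c f) (?c ?g) ?d (b_then ?T ?V (fmp ?P) f rs) X w" by simp
    qed
    then show ?thesis using f g by (simp add: ob)
  qed
  show ?thesis
    by (rule ainf_functorI[OF fun_cat_ainf[OF A B] fun_cat_ainf[OF A C] obW tl eq])
      (auto simp: post_fun_def)
qed

section \<open>Elementwise identities\<close>

lemma lin_bop: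
  assumes C: "ainf_category R C" and l: "lin R C X \<phi>" and X: "X \<in> Obj C"
  shows "lin R C X (\<lambda>w. \<phi> [(wtgt X w, wdeg w + 1, bop C X w)])"
proof (rule linI)
  fix u Y d x y v a
  assume *: "a \<in> carrier R" "is_word C X (u @ (Y, d, x) # v)" "is_word C X (u @ (Y, d, y) # v)"
  have Z: "wtgt Y v \<in> Obj C" using is_word_tgt[OF *(2)] by simp
  have bc: "bop C X (u @ (Y, d, t) # v) \<in> carrier (sMor C X (wtgt Y v) (wdeg u + (d + wdeg v) + 1))"
    if "is_word C X (u @ (Y, d, t) # v)" for t
    using ainf_bclosed[OF C, unfolded bclosed_def, rule_format, OF that] by simp
  show "\<phi> [(wtgt X (u @ (Y, d, a \<odot>\<^bsub>sMor C (wtgt X u) Y d\<^esub> x \<oplus>\<^bsub>sMor C (wtgt X u) Y d\<^esub> y) # v),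
      wdeg (u @ (Y, d, a \<odot>\<^bsub>sMor C (wtgt X u) Y d\<^esub> x \<oplus>\<^bsub>sMor C (wtgt X u) Y d\<^esub> y) # v) + 1,
      bop C X (u @ (Y, d, a \<odot>\<^bsub>sMor C (wtgt X u) Y d\<^esub> x \<oplus>\<^bsub>sMor C (wtgt X u) Y d\<^esub> y) # v))] =
    act R a (\<phi> [(wtgt X (u @ (Y, d, x) # v), wdeg (u @ (Y, d, x) # v) + 1, bop C X (u @ (Y, d, x) # v))]) +
    \<phi> [(wtgt X (u @ (Y, d, y) # v), wdeg (u @ (Y, d, y) # v) + 1, bop C X (u @ (Y, d, y) # v))]"
    using tlin_comb[OF ainf_tlin[OF C] *]
      lin_comb[OF ainf_modular[OF C] l X bc[OF *(2)] bc[OF *(3)] _ *(1), of "[]"] Z by simp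
qed

abbreviation b2 where "b2 C X Y Z d e x y \<equiv> bop C X [(Y, d, x), (Z, e, y)]"
abbreviation b3 where "b3 C X Y Z V d e g x y z \<equiv> bop C X [(Y, d, x), (Z, e, y), (V, g, z)]"

context
  fixes R :: "'k ring" and C :: "('k, 'o, 'm) ainf_cat"
  assumes C: "ainf_category R C"
begin

lemma sMor_module: "X \<in> Obj C \<Longrightarrow> Y \<in> Obj C \<Longrightarrow> module R (sMor C X Y d)"
  by (rule modularD[OF ainf_modular[OF C]])

lemma b1_closed:
  assumes "X \<in> Obj C" "Y \<in> Obj C" "x \<in> carrier (sMor C X Y d)"
  shows "b1 C X Y d x \<in> carrier (sMor C X Y (d + 1))"
  using ainf_bclosed[OF C, unfolded bclosed_def, rule_format, of X "[(Y, d, x)]"] assms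
  by (simp add: b1_def)

lemma b2_closed:
  assumes "X \<in> Obj C" "Y \<in> Obj C" "Z \<in> Obj C" "x \<in> carrier (sMor C X Y d)" "y \<in> carrier (sMor C Y Z e)"
  shows "b2 C X Y Z d e x y \<in> carrier (sMor C X Z (d + e + 1))"
  using ainf_bclosed[OF C, unfolded bclosed_def, rule_format, of X "[(Y, d, x), (Z, e, y)]"] assms
  by simp

lemma b3_closed:
  assumes "X \<in> Obj C" "Y \<in> Obj C" "Z \<in> Obj C" "V \<in> Obj C" "x \<in> carrier (sMor C X Y d)"
    "y \<in> carrier (sMor C Y Z e)" "z \<in> carrier (sMor C Z V g)"
  shows "b3 C X Y Z V d e g x y z \<in> carrier (sMor C X V (d + e + g + 1))"
  using ainf_bclosed[OF C, unfolded bclosed_def, rule_format, of X "[(Y, d, x), (Z, e, y), (V, g, z)]"] assms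
  by (simp add: add.assoc)

text \<open>The relations are kept under an arbitrary functional, so that their forms with one, two
  and three inputs serve hom-modules through \<open>emb_word\<close> and, later, values of
  transformations at a word.\<close>

lemma rel_lin:
  assumes "lin R C X \<phi>" "is_word C X u" "u \<noteq> []"
  shows "bh C X (\<lambda>u'. \<phi> [(wtgt X u', wdeg u' + 1, bop C X u')]) u = 0"
  using lin_bop_cut[OF C assms(2,3) _ assms(1), of "[]"] is_word_tgt[OF assms(2)] by simp

lemma rel1_lin:
  assumes "lin R C X \<phi>" "X \<in> Obj C" "Y \<in> Obj C" "x \<in> carrier (sMor C X Y d)"
  shows "\<phi> [(Y, d + 2, b1 C X Y (d + 1) (b1 C X Y d x))] = 0"
  using rel_lin[OF assms(1), of "[(Y, d, x)]"] assms by (simp add: bh_cut1_Cons b1_def add.assoc)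

lemma rel2_lin:
  assumes "lin R C X \<phi>" "X \<in> Obj C" "Y \<in> Obj C" "Z \<in> Obj C"
    "x \<in> carrier (sMor C X Y d)" "y \<in> carrier (sMor C Y Z e)"
  shows "sg e (\<phi> [(Z, d + e + 2, b2 C X Y Z (d + 1) e (b1 C X Y d x) y)]) +
    \<phi> [(Z, d + e + 2, b2 C X Y Z d (e + 1) x (b1 C Y Z e y))] +
    \<phi> [(Z, d + e + 2, b1 C X Z (d + e + 1) (b2 C X Y Z d e x y))] = 0"
  using rel_lin[OF assms(1), of "[(Y, d, x), (Z, e, y)]"] assms
  by (simp add: bh_cut1_Cons b1_def algebra_simps)

lemma rel3_lin:
  assumes "lin R C X \<phi>" "X \<in> Obj C" "Y \<in> Obj C" "Z \<in> Obj C" "V \<in> Obj C"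
    "x \<in> carrier (sMor C X Y d)" "y \<in> carrier (sMor C Y Z e)" "z \<in> carrier (sMor C Z V g)"
  shows "sg (e + g) (\<phi> [(V, d + e + g + 2, b3 C X Y Z V (d + 1) e g (b1 C X Y d x) y z)]) +
    sg g (\<phi> [(V, d + e + g + 2, b3 C X Y Z V d (e + 1) g x (b1 C Y Z e y) z)]) +
    \<phi> [(V, d + e + g + 2, b3 C X Y Z V d e (g + 1) x y (b1 C Z V g z))] +
    sg g (\<phi> [(V, d + e + g + 2, b2 C X Z V (d + e + 1) g (b2 C X Y Z d e x y) z)]) +
    \<phi> [(V, d + e + g + 2, b2 C X Y V d (e + g + 1) x (b2 C Y Z V e g y z))] +
    \<phi> [(V, d + e + g + 2, b1 C X V (d + e + g + 1) (b3 C X Y Z V d e g x y z))] = 0"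
  using rel_lin[OF assms(1), of "[(Y, d, x), (Z, e, y), (V, g, z)]"] assms
  by (simp add: bh_cut1_Cons b1_def algebra_simps)

lemma b1_comb:
  assumes "X \<in> Obj C" "Y \<in> Obj C" "x \<in> carrier (sMor C X Y d)" "y \<in> carrier (sMor C X Y d)" "a \<in> carrier R"
  shows "b1 C X Y d (a \<odot>\<^bsub>sMor C X Y d\<^esub> x \<oplus>\<^bsub>sMor C X Y d\<^esub> y) =
    a \<odot>\<^bsub>sMor C X Y (d + 1)\<^esub> b1 C X Y d x \<oplus>\<^bsub>sMor C X Y (d + 1)\<^esub> b1 C X Y d y"
  using tlin_comb[OF ainf_tlin[OF C] assms(5), of X "[]" Y d x "[]" y] assms by (simp add: b1_def)

lemma b2_comb_left:
  assumes "X \<in> Obj C" "Y \<in> Obj C" "Z \<in> Obj C" "x \<in> carrier (sMor C X Y d)" "x' \<in> carrier (sMor C X Y d)"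
    "y \<in> carrier (sMor C Y Z e)" "a \<in> carrier R"
  shows "b2 C X Y Z d e (a \<odot>\<^bsub>sMor C X Y d\<^esub> x \<oplus>\<^bsub>sMor C X Y d\<^esub> x') y =
    a \<odot>\<^bsub>sMor C X Z (d + e + 1)\<^esub> b2 C X Y Z d e x y \<oplus>\<^bsub>sMor C X Z (d + e + 1)\<^esub> b2 C X Y Z d e x' y"
  using tlin_comb[OF ainf_tlin[OF C] assms(7), of X "[]" Y d x "[(Z, e, y)]" x'] assms by simp

lemma b2_comb_right:
  assumes "X \<in> Obj C" "Y \<in> Obj C" "Z \<in> Obj C" "x \<in> carrier (sMor C X Y d)"
    "y \<in> carrier (sMor C Y Z e)" "y' \<in> carrier (sMor C Y Z e)" "a \<in> carrier R"
  shows "b2 C X Y Z d e x (a \<odot>\<^bsub>sMor C Y Z e\<^esub> y \<oplus>\<^bsub>sMor C Y Z e\<^esub> y') =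
    a \<odot>\<^bsub>sMor C X Z (d + e + 1)\<^esub> b2 C X Y Z d e x y \<oplus>\<^bsub>sMor C X Z (d + e + 1)\<^esub> b2 C X Y Z d e x y'"
  using tlin_comb[OF ainf_tlin[OF C] assms(7), of X "[(Y, d, x)]" Z e y "[]" y'] assms by simp

lemma b3_comb_left:
  assumes "X \<in> Obj C" "Y \<in> Obj C" "Z \<in> Obj C" "V \<in> Obj C" "x \<in> carrier (sMor C X Y d)"
    "x' \<in> carrier (sMor C X Y d)" "y \<in> carrier (sMor C Y Z e)" "z \<in> carrier (sMor C Z V g)" "a \<in> carrier R"
  shows "b3 C X Y Z V d e g (a \<odot>\<^bsub>sMor C X Y d\<^esub> x \<oplus>\<^bsub>sMor C X Y d\<^esub> x') y z =
    a \<odot>\<^bsub>sMor C X V (d + e + g + 1)\<^esub> b3 C X Y Z V d e g x y z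
      \<oplus>\<^bsub>sMor C X V (d + e + g + 1)\<^esub> b3 C X Y Z V d e g x' y z"
  using tlin_comb[OF ainf_tlin[OF C] assms(9), of X "[]" Y d x "[(Z, e, y), (V, g, z)]" x'] assms
  by (simp add: add.assoc)

lemma b3_comb_right:
  assumes "X \<in> Obj C" "Y \<in> Obj C" "Z \<in> Obj C" "V \<in> Obj C" "x \<in> carrier (sMor C X Y d)"
    "y \<in> carrier (sMor C Y Z e)" "z \<in> carrier (sMor C Z V g)" "z' \<in> carrier (sMor C Z V g)" "a \<in> carrier R"
  shows "b3 C X Y Z V d e g x y (a \<odot>\<^bsub>sMor C Z V g\<^esub> z \<oplus>\<^bsub>sMor C Z V g\<^esub> z') =
    a \<odot>\<^bsub>sMor C X V (d + e + g + 1)\<^esub> b3 C X Y Z V d e g x y z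
      \<oplus>\<^bsub>sMor C X V (d + e + g + 1)\<^esub> b3 C X Y Z V d e g x y z'"
  using tlin_comb[OF ainf_tlin[OF C] assms(9), of X "[(Y, d, x), (Z, e, y)]" V g z "[]" z'] assms
  by (simp add: add.assoc)

end

section \<open>Graded maps and homotopies\<close>

text \<open>\<open>graded_linear\<close> read in the universal group, with additivity and
  homogeneity merged; the equivalence is \<open>glin_iff\<close>.\<close>

definition glin :: "'k ring \<Rightarrow> (int \<Rightarrow> ('k, 'm) module) \<Rightarrow> (int \<Rightarrow> ('k, 'n) module) \<Rightarrow> int
    \<Rightarrow> (int \<Rightarrow> 'm \<Rightarrow> 'n) \<Rightarrow> bool" where
  "glin R M N p h \<longleftrightarrow>
     (\<forall>d. \<forall>x \<in> carrier (M d). h d x \<in> carrier (N (d + p))) \<and>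
     (\<forall>d. \<forall>x \<in> carrier (M d). \<forall>y \<in> carrier (M d). \<forall>a \<in> carrier R.
        emb R (N (d + p)) (h d (a \<odot>\<^bsub>M d\<^esub> x \<oplus>\<^bsub>M d\<^esub> y)) =
          act R a (emb R (N (d + p)) (h d x)) + emb R (N (d + p)) (h d y))"

lemma glin_closed: "glin R M N p h \<Longrightarrow> x \<in> carrier (M d) \<Longrightarrow> d + p = e \<Longrightarrow> h d x \<in> carrier (N e)"
  by (auto simp: glin_def)

lemma glin_comb:
  "glin R M N p h \<Longrightarrow> x \<in> carrier (M d) \<Longrightarrow> y \<in> carrier (M d) \<Longrightarrow> a \<in> carrier R \<Longrightarrow> d + p = e \<Longrightarrow>
    emb R (N e) (h d (a \<odot>\<^bsub>M d\<^esub> x \<oplus>\<^bsub>M d\<^esub> y)) = act R a (emb R (N e) (h d x)) + emb R (N e) (h d y)"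
  by (auto simp: glin_def)

context
  fixes R :: "'k ring" and M :: "int \<Rightarrow> ('k, 'm) module" and N :: "int \<Rightarrow> ('k, 'n) module"
  assumes M: "\<And>d. module R (M d)" and N: "\<And>d. module R (N d)"
begin

lemma module_one: "\<one>\<^bsub>R\<^esub> \<in> carrier R"
  by (meson M module.axioms(1) cring.axioms(1) ring.is_monoid monoid.one_closed)

lemma glin_add:
  assumes "glin R M N p h" "x \<in> carrier (M d)" "y \<in> carrier (M d)" "d + p = e"
  shows "emb R (N e) (h d (x \<oplus>\<^bsub>M d\<^esub> y)) = emb R (N e) (h d x) + emb R (N e) (h d y)"
  using glin_comb[OF assms(1-3) module_one assms(4)] module.smult_one[OF M assms(2)] by simp

lemma glin_zero:
  assumes "glin R M N p h" "d + p = e"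
  shows "emb R (N e) (h d \<zero>\<^bsub>M d\<^esub>) = 0"
proof -
  interpret module R "M d" by (rule M)
  show ?thesis using glin_add[OF assms(1) _ _ assms(2), of "\<zero>\<^bsub>M d\<^esub>" "\<zero>\<^bsub>M d\<^esub>"] by simp
qed

lemma glin_minus:
  assumes "glin R M N p h" "x \<in> carrier (M d)" "d + p = e"
  shows "emb R (N e) (h d (\<ominus>\<^bsub>M d\<^esub> x)) = - emb R (N e) (h d x)"
proof -
  interpret module R "M d" by (rule M)
  have "emb R (N e) (h d x) + emb R (N e) (h d (\<ominus>\<^bsub>M d\<^esub> x)) = 0"
    using glin_add[OF assms(1,2) _ assms(3), of "\<ominus>\<^bsub>M d\<^esub> x"] glin_zero[OF assms(1,3)] assms(2)
    by (simp add: r_neg)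
  then show ?thesis by (rule group_add_class.minus_unique[symmetric])
qed

lemma glin_diff:
  assumes "glin R M N p h" "x \<in> carrier (M d)" "y \<in> carrier (M d)" "d + p = e"
  shows "emb R (N e) (h d (x \<ominus>\<^bsub>M d\<^esub> y)) = emb R (N e) (h d x) - emb R (N e) (h d y)"
proof -
  interpret module R "M d" by (rule M)
  show ?thesis using assms by (simp add: minus_eq glin_add glin_minus)
qed

lemma glin_smult:
  assumes "glin R M N p h" "x \<in> carrier (M d)" "a \<in> carrier R" "d + p = e"
  shows "emb R (N e) (h d (a \<odot>\<^bsub>M d\<^esub> x)) = act R a (emb R (N e) (h d x))"
proof -
  interpret module R "M d" by (rule M)
  show ?thesis using glin_comb[OF assms(1,2) _ assms(3,4), of "\<zero>\<^bsub>M d\<^esub>"] glin_zero[OF assms(1,4)] assms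
    by simp
qed

lemma glin_iff: "glin R M N p h \<longleftrightarrow> graded_linear R M N p h"
proof
  assume h: "glin R M N p h"
  show "graded_linear R M N p h"
    unfolding graded_linear_def
  proof (intro conjI allI ballI)
    fix d x assume x: "x \<in> carrier (M d)"
    interpret N: module R "N (d + p)" by (rule N)
    interpret M: module R "M d" by (rule M)
    note cl = glin_closed[OF h _ refl, of _ d]
    show "h d x \<in> carrier (N (d + p))" by (rule cl[OF x])
    show "h d (x \<oplus>\<^bsub>M d\<^esub> y) = h d x \<oplus>\<^bsub>N (d + p)\<^esub> h d y" if y: "y \<in> carrier (M d)" for y
      using glin_add[OF h x y refl] cl x y emb_inject[OF N, of "h d (x \<oplus>\<^bsub>M d\<^esub> y)" "d + p"]
      by (simp add: emb_add[OF N, symmetric])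
    show "h d (a \<odot>\<^bsub>M d\<^esub> x) = a \<odot>\<^bsub>N (d + p)\<^esub> h d x" if a: "a \<in> carrier R" for a
      using glin_smult[OF h x a refl] cl x a emb_inject[OF N, of "h d (a \<odot>\<^bsub>M d\<^esub> x)" "d + p"]
      by (simp add: emb_smult[OF N, symmetric])
  qed
next
  assume h: "graded_linear R M N p h"
  show "glin R M N p h"
    unfolding glin_def
  proof (intro conjI allI ballI)
    fix d x assume x: "x \<in> carrier (M d)"
    have cl: "h d x \<in> carrier (N (d + p))" if "x \<in> carrier (M d)" for x using h that by (simp add: graded_linear_def)
    show "h d x \<in> carrier (N (d + p))" by (rule cl[OF x])
    fix y a assume y: "y \<in> carrier (M d)" and a: "a \<in> carrier R"
    have "h d (a \<odot>\<^bsub>M d\<^esub> x \<oplus>\<^bsub>M d\<^esub> y) = a \<odot>\<^bsub>N (d + p)\<^esub> h d x \<oplus>\<^bsub>N (d + p)\<^esub> h d y"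
      using h x y a module.smult_closed[OF M a x] by (simp add: graded_linear_def)
    then show "emb R (N (d + p)) (h d (a \<odot>\<^bsub>M d\<^esub> x \<oplus>\<^bsub>M d\<^esub> y)) =
        act R a (emb R (N (d + p)) (h d x)) + emb R (N (d + p)) (h d y)"
      using cl x y a by (simp add: emb_add[OF N] emb_smult[OF N] module.smult_closed[OF N])
  qed
qed

end

section \<open>Chain maps and homotopies on a fixed complex\<close>

locale cocomplex =
  fixes R :: "'k ring" and E :: "int \<Rightarrow> ('k, 'm) module" and \<delta> :: "int \<Rightarrow> 'm \<Rightarrow> 'm"
  assumes E: "module R (E d)" and \<delta>: "glin R E E 1 \<delta>"
    and \<delta>\<delta>: "x \<in> carrier (E d) \<Longrightarrow> emb R (E (d + 2)) (\<delta> (d + 1) (\<delta> d x)) = 0"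
begin

abbreviation "em d \<equiv> emb R (E d)"

definition chain :: "(int \<Rightarrow> 'm \<Rightarrow> 'm) \<Rightarrow> bool" where
  "chain \<phi> \<longleftrightarrow> glin R E E 0 \<phi> \<and> (\<forall>d. \<forall>x \<in> carrier (E d). \<delta> d (\<phi> d x) = \<phi> (d + 1) (\<delta> d x))"

definition hmt :: "(int \<Rightarrow> 'm \<Rightarrow> 'm) \<Rightarrow> (int \<Rightarrow> 'm \<Rightarrow> 'm) \<Rightarrow> bool" where
  "hmt \<phi> \<psi> \<longleftrightarrow> (\<exists>h. glin R E E (- 1) h \<and> (\<forall>d. \<forall>x \<in> carrier (E d).
     em d (\<phi> d x) = em d (\<psi> d x) + em d (\<delta> (d - 1) (h d x)) + em d (h (d + 1) (\<delta> d x))))"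

lemma delta_closed: "x \<in> carrier (E d) \<Longrightarrow> d + 1 = e \<Longrightarrow> \<delta> d x \<in> carrier (E e)"
  by (rule glin_closed[OF \<delta>])

lemma chain_closed: "chain \<phi> \<Longrightarrow> x \<in> carrier (E d) \<Longrightarrow> \<phi> d x \<in> carrier (E d)"
  unfolding chain_def using glin_closed[of R E E 0 \<phi> x d d] by simp

lemma chain_add: "chain \<phi> \<Longrightarrow> x \<in> carrier (E d) \<Longrightarrow> y \<in> carrier (E d) \<Longrightarrow>
    em d (\<phi> d (x \<oplus>\<^bsub>E d\<^esub> y)) = em d (\<phi> d x) + em d (\<phi> d y)"
  unfolding chain_def by (elim conjE, rule glin_add[OF E E]) simp_all

lemma em_inject: "x \<in> carrier (E d) \<Longrightarrow> y \<in> carrier (E d) \<Longrightarrow> em d x = em d y \<longleftrightarrow> x = y"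
  by (rule emb_inject[OF E])

lemma glin_plus:
  assumes "glin R E E p h" "glin R E E p k"
  shows "glin R E E p (\<lambda>d x. h d x \<oplus>\<^bsub>E (d + p)\<^esub> k d x)"
  unfolding glin_def
proof (intro conjI allI ballI)
  fix d x assume x: "x \<in> carrier (E d)"
  interpret E': module R "E (d + p)" by (rule E)
  interpret E0: module R "E d" by (rule E)
  note cl = glin_closed[OF assms(1) _ refl, of _ d] glin_closed[OF assms(2) _ refl, of _ d]
  show "h d x \<oplus>\<^bsub>E (d + p)\<^esub> k d x \<in> carrier (E (d + p))" using cl x by simp
  fix y a assume y: "y \<in> carrier (E d)" and a: "a \<in> carrier R"
  show "em (d + p) (h d (a \<odot>\<^bsub>E d\<^esub> x \<oplus>\<^bsub>E d\<^esub> y) \<oplus>\<^bsub>E (d + p)\<^esub> k d (a \<odot>\<^bsub>E d\<^esub> x \<oplus>\<^bsub>E d\<^esub> y)) =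
     act R a (em (d + p) (h d x \<oplus>\<^bsub>E (d + p)\<^esub> k d x)) + em (d + p) (h d y \<oplus>\<^bsub>E (d + p)\<^esub> k d y)"
    using cl x y a by (simp add: emb_add[OF E] act_add
        glin_comb[OF assms(1) x y a refl] glin_comb[OF assms(2) x y a refl] algebra_simps)
qed

lemma glin_comp:
  assumes "glin R E E p h" "glin R E E q k"
  shows "glin R E E (p + q) (\<lambda>d x. k (d + p) (h d x))"
  unfolding glin_def
proof (intro conjI allI ballI)
  fix d x assume x: "x \<in> carrier (E d)"
  have pq: "d + p + q = d + (p + q)" by simp
  note cl = glin_closed[OF assms(1) _ refl, of _ d] glin_closed[OF assms(2) _ pq]
  show "k (d + p) (h d x) \<in> carrier (E (d + (p + q)))" using cl x by simp
  fix y a assume y: "y \<in> carrier (E d)" and a: "a \<in> carrier R"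
  interpret E0: module R "E d" by (rule E)
  interpret E1: module R "E (d + p)" by (rule E)
  have "h d (a \<odot>\<^bsub>E d\<^esub> x \<oplus>\<^bsub>E d\<^esub> y) = a \<odot>\<^bsub>E (d + p)\<^esub> h d x \<oplus>\<^bsub>E (d + p)\<^esub> h d y"
    using glin_comb[OF assms(1) x y a refl] cl x y a
      em_inject[of "h d (a \<odot>\<^bsub>E d\<^esub> x \<oplus>\<^bsub>E d\<^esub> y)" "d + p" "a \<odot>\<^bsub>E (d + p)\<^esub> h d x \<oplus>\<^bsub>E (d + p)\<^esub> h d y"]
    by (simp add: emb_add[OF E] emb_smult[OF E])
  then show "em (d + (p + q)) (k (d + p) (h d (a \<odot>\<^bsub>E d\<^esub> x \<oplus>\<^bsub>E d\<^esub> y))) =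
     act R a (em (d + (p + q)) (k (d + p) (h d x))) + em (d + (p + q)) (k (d + p) (h d y))"
    using glin_comb[OF assms(2) _ _ a pq] cl x y by simp
qed

lemma hmt_sym: "hmt \<phi> \<psi> \<Longrightarrow> hmt \<psi> \<phi>"
proof -
  assume "hmt \<phi> \<psi>"
  then obtain h where h: "glin R E E (- 1) h"
    and eq: "\<And>d x. x \<in> carrier (E d) \<Longrightarrow>
      em d (\<phi> d x) = em d (\<psi> d x) + em d (\<delta> (d - 1) (h d x)) + em d (h (d + 1) (\<delta> d x))"
    by (auto simp: hmt_def)
  define k where "k d x = \<ominus>\<^bsub>E (d - 1)\<^esub> h d x" for d x
  have cl: "h d x \<in> carrier (E e)" if "x \<in> carrier (E d)" "d - 1 = e" for d x e
    using glin_closed[OF h that(1), of e] that(2) by simp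
  have kc: "k d x \<in> carrier (E (d - 1))" if "x \<in> carrier (E d)" for d x
    unfolding k_def using cl[OF that refl] E by (intro abelian_group.a_inv_closed ab_of_module)
  have ke: "em e (k d x) = - em e (h d x)" if "x \<in> carrier (E d)" "d - 1 = e" for d x e
    using that cl[OF that] by (auto simp: k_def emb_minus[OF E])
  have "glin R E E (- 1) k"
    unfolding glin_def
  proof (intro conjI allI ballI)
    fix d x assume x: "x \<in> carrier (E d)"
    then show "k d x \<in> carrier (E (d + - 1))" using kc by simp
    fix y a assume y: "y \<in> carrier (E d)" and a: "a \<in> carrier R"
    interpret E0: module R "E d" by (rule E)
    show "em (d + - 1) (k d (a \<odot>\<^bsub>E d\<^esub> x \<oplus>\<^bsub>E d\<^esub> y)) =
      act R a (em (d + - 1) (k d x)) + em (d + - 1) (k d y)"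
      using x y a glin_comb[OF h x y a, of "d - 1"] by (simp add: ke act_minus)
  qed
  moreover have "em d (\<psi> d x) = em d (\<phi> d x) + em d (\<delta> (d - 1) (k d x)) + em d (k (d + 1) (\<delta> d x))"
    if x: "x \<in> carrier (E d)" for d x
    using eq[OF x] glin_minus[OF E E \<delta> cl[OF x refl], of d] ke[OF delta_closed[OF x refl], of d]
    by (simp add: k_def)
  ultimately show "hmt \<psi> \<phi>" by (auto simp: hmt_def)
qed

lemma hmt_trans: "hmt \<phi> \<psi> \<Longrightarrow> hmt \<psi> \<chi> \<Longrightarrow> hmt \<phi> \<chi>"
proof -
  assume "hmt \<phi> \<psi>" "hmt \<psi> \<chi>"
  then obtain h k where h: "glin R E E (- 1) h" and k: "glin R E E (- 1) k"
    and eq: "\<And>d x. x \<in> carrier (E d) \<Longrightarrow>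
      em d (\<phi> d x) = em d (\<psi> d x) + em d (\<delta> (d - 1) (h d x)) + em d (h (d + 1) (\<delta> d x))"
      "\<And>d x. x \<in> carrier (E d) \<Longrightarrow>
      em d (\<psi> d x) = em d (\<chi> d x) + em d (\<delta> (d - 1) (k d x)) + em d (k (d + 1) (\<delta> d x))"
    by (auto simp: hmt_def)
  let ?l = "\<lambda>d x. h d x \<oplus>\<^bsub>E (d + - 1)\<^esub> k d x"
  have "em d (\<phi> d x) = em d (\<chi> d x) + em d (\<delta> (d - 1) (?l d x)) + em d (?l (d + 1) (\<delta> d x))"
    if x: "x \<in> carrier (E d)" for d x
    using glin_closed[OF h x, of "d - 1"] glin_closed[OF k x, of "d - 1"]
      glin_closed[OF h delta_closed[OF x refl], of d] glin_closed[OF k delta_closed[OF x refl], of d]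
    by (simp add: eq[OF x] glin_add[OF E E \<delta>] emb_add[OF E] algebra_simps)
  then show "hmt \<phi> \<chi>" unfolding hmt_def using glin_plus[OF h k] by blast
qed

lemma hmt_left:
  assumes "chain \<chi>" "chain \<phi>" "chain \<psi>" "hmt \<phi> \<psi>"
  shows "hmt (\<lambda>d x. \<chi> d (\<phi> d x)) (\<lambda>d x. \<chi> d (\<psi> d x))"
proof -
  obtain h where h: "glin R E E (- 1) h"
    and eq: "\<And>d x. x \<in> carrier (E d) \<Longrightarrow>
      em d (\<phi> d x) = em d (\<psi> d x) + em d (\<delta> (d - 1) (h d x)) + em d (h (d + 1) (\<delta> d x))"
    using assms(4) by (auto simp: hmt_def)
  have c: "glin R E E 0 \<chi>" using assms(1) by (simp add: chain_def)
  have "em d (\<chi> d (\<phi> d x)) = em d (\<chi> d (\<psi> d x)) + em d (\<delta> (d - 1) (\<chi> (d - 1) (h d x))) +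
     em d (\<chi> d (h (d + 1) (\<delta> d x)))" if x: "x \<in> carrier (E d)" for d x
  proof -
    interpret module R "E d" by (rule E)
    have cl: "h d x \<in> carrier (E (d - 1))" "\<delta> (d - 1) (h d x) \<in> carrier (E d)" "h (d + 1) (\<delta> d x) \<in> carrier (E d)"
      using glin_closed[OF h x, of "d - 1"] delta_closed[of "h d x" "d - 1" d]
        glin_closed[OF h delta_closed[OF x refl], of d] by simp_all
    note cc = chain_closed[OF assms(2) x] chain_closed[OF assms(3) x]
    have "\<phi> d x = \<psi> d x \<oplus>\<^bsub>E d\<^esub> \<delta> (d - 1) (h d x) \<oplus>\<^bsub>E d\<^esub> h (d + 1) (\<delta> d x)"
      using eq[OF x] cl cc by (intro em_inject[THEN iffD1, of _ d]) (simp_all add: emb_add[OF E])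
    moreover have "\<delta> (d - 1) (\<chi> (d - 1) (h d x)) = \<chi> d (\<delta> (d - 1) (h d x))"
      using assms(1) cl(1) unfolding chain_def by fastforce
    ultimately show ?thesis using cl cc by (simp add: chain_add[OF assms(1)])
  qed
  moreover have "glin R E E (- 1) (\<lambda>d x. \<chi> (d - 1) (h d x))"
    using glin_comp[OF h c] by simp
  ultimately show ?thesis unfolding hmt_def by (intro exI[of _ "\<lambda>d x. \<chi> (d - 1) (h d x)"]) simp
qed

lemma hmt_right:
  assumes "chain \<chi>" "hmt \<phi> \<psi>"
  shows "hmt (\<lambda>d x. \<phi> d (\<chi> d x)) (\<lambda>d x. \<psi> d (\<chi> d x))"
proof -
  obtain h where h: "glin R E E (- 1) h"
    and eq: "\<And>d x. x \<in> carrier (E d) \<Longrightarrow>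
      em d (\<phi> d x) = em d (\<psi> d x) + em d (\<delta> (d - 1) (h d x)) + em d (h (d + 1) (\<delta> d x))"
    using assms(2) by (auto simp: hmt_def)
  have c: "glin R E E 0 \<chi>" using assms(1) by (simp add: chain_def)
  have "em d (\<phi> d (\<chi> d x)) = em d (\<psi> d (\<chi> d x)) + em d (\<delta> (d - 1) (h d (\<chi> d x))) +
     em d (h (d + 1) (\<chi> (d + 1) (\<delta> d x)))" if x: "x \<in> carrier (E d)" for d x
    using eq[OF chain_closed[OF assms(1) x]] assms(1) x by (simp add: chain_def)
  moreover have "glin R E E (- 1) (\<lambda>d x. h d (\<chi> d x))"
    using glin_comp[OF c h] by simp
  ultimately show ?thesis unfolding hmt_def by (intro exI[of _ "\<lambda>d x. h d (\<chi> d x)"]) simp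
qed

text \<open>The graded map \<open>h\<close> is arbitrary: the correction built from it commutes with
  \<open>\<delta>\<close> because \<open>\<delta>\<close> squares to zero, so subtracting it from a
  chain map leaves a chain map.\<close>

lemma chain_homotopic:
  assumes c: "chain \<phi>" and h: "glin R E E (- 1) h"
    and \<psi>: "\<And>d x. x \<in> carrier (E d) \<Longrightarrow> \<psi> d x = \<phi> d x \<ominus>\<^bsub>E d\<^esub> (\<delta> (d - 1) (h d x) \<oplus>\<^bsub>E d\<^esub> h (d + 1) (\<delta> d x))"
  shows "chain \<psi>" and "hmt \<phi> \<psi>"
proof -
  have cl: "h d x \<in> carrier (E (d - 1))" "\<delta> (d - 1) (h d x) \<in> carrier (E d)"
    "h (d + 1) (\<delta> d x) \<in> carrier (E d)" "\<phi> d x \<in> carrier (E d)" if x: "x \<in> carrier (E d)" for d x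
    using glin_closed[OF h x, of "d - 1"] delta_closed[of "h d x" "d - 1" d]
      glin_closed[OF h delta_closed[OF x refl], of d] chain_closed[OF c x] by simp_all
  have cc: "\<psi> d x \<in> carrier (E d)" if x: "x \<in> carrier (E d)" for d x
  proof -
    interpret module R "E d" by (rule E)
    show ?thesis using cl[OF x] by (simp add: \<psi>[OF x])
  qed
  have e: "em d (\<psi> d x) = em d (\<phi> d x) - (em d (\<delta> (d - 1) (h d x)) + em d (h (d + 1) (\<delta> d x)))"
    if x: "x \<in> carrier (E d)" for d x
  proof -
    interpret module R "E d" by (rule E)
    show ?thesis using cl[OF x] by (simp add: \<psi>[OF x] emb_diff[OF E] emb_add[OF E])
  qed
  then show "hmt \<phi> \<psi>" unfolding hmt_def using h by (auto intro!: exI[of _ h])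
  have h1: "glin R E E 0 (\<lambda>d x. \<delta> (d - 1) (h d x))" and h2: "glin R E E 0 (\<lambda>d x. h (d + 1) (\<delta> d x))"
    using glin_comp[OF h \<delta>] glin_comp[OF \<delta> h] by simp_all
  have c0: "glin R E E 0 \<phi>" using c by (simp add: chain_def)
  have "glin R E E 0 \<psi>"
    unfolding glin_def
  proof (intro conjI allI ballI)
    fix d x assume x: "x \<in> carrier (E d)"
    then show "\<psi> d x \<in> carrier (E (d + 0))" using cc by simp
    fix y a assume y: "y \<in> carrier (E d)" and a: "a \<in> carrier R"
    interpret module R "E d" by (rule E)
    show "em (d + 0) (\<psi> d (a \<odot>\<^bsub>E d\<^esub> x \<oplus>\<^bsub>E d\<^esub> y)) = act R a (em (d + 0) (\<psi> d x)) + em (d + 0) (\<psi> d y)"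
      using x y a glin_comb[OF h1 x y a, of d] glin_comb[OF h2 x y a, of d] glin_comb[OF c0 x y a, of d]
      by (simp add: e act_diff act_add)
  qed
  moreover have "\<delta> d (\<psi> d x) = \<psi> (d + 1) (\<delta> d x)" if x: "x \<in> carrier (E d)" for d x
  proof (rule em_inject[THEN iffD1])
    have dx: "\<delta> d x \<in> carrier (E (d + 1))" by (rule delta_closed[OF x refl])
    show "\<delta> d (\<psi> d x) \<in> carrier (E (d + 1))" by (rule delta_closed[OF cc[OF x] refl])
    show "\<psi> (d + 1) (\<delta> d x) \<in> carrier (E (d + 1))" by (rule cc[OF dx])
    interpret module R "E d" by (rule E)
    have dd: "em (d + 1) (\<delta> d (\<delta> (d - 1) (h d x))) = 0"
      using \<delta>\<delta>[OF cl(1)[OF x]] by (simp add: algebra_simps)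
    have "\<delta> (d + 1) (\<delta> d x) = \<zero>\<^bsub>E (d + 2)\<^esub>"
      using \<delta>\<delta>[OF x] delta_closed[OF dx, of "d + 2"] emb_zero[OF E, of "d + 2"]
        abelian_groupE(2)[OF ab_of_module[OF E, of "d + 2"]]
      by (intro em_inject[THEN iffD1, of _ "d + 2"]) simp_all
    then have hdd: "em (d + 1) (h (2 + d) (\<delta> (d + 1) (\<delta> d x))) = 0"
      using glin_zero[OF E E h, of "d + 2" "d + 1"] by (simp add: add.commute)
    have "em (d + 1) (\<delta> d (\<psi> d x)) = em (d + 1) (\<delta> d (\<phi> d x)) -
      (em (d + 1) (\<delta> d (\<delta> (d - 1) (h d x))) + em (d + 1) (\<delta> d (h (d + 1) (\<delta> d x))))"
      using cl[OF x] by (simp add: \<psi>[OF x] glin_diff[OF E E \<delta>] glin_add[OF E E \<delta>])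
    also have "\<dots> = em (d + 1) (\<psi> (d + 1) (\<delta> d x))"
      using c x by (simp add: e[OF dx] dd hdd chain_def)
    finally show "em (d + 1) (\<delta> d (\<psi> d x)) = em (d + 1) (\<psi> (d + 1) (\<delta> d x))" .
  qed
  ultimately show "chain \<psi>" by (simp add: chain_def)
qed

text \<open>An idempotent in the homotopy category which is an isomorphism is the identity.\<close>

theorem idempotent_hmt_id:
  assumes \<phi>: "chain \<phi>" and h: "glin R E E (- 1) h"
    and \<psi>: "\<And>d x. x \<in> carrier (E d) \<Longrightarrow> \<psi> d x = \<phi> d x \<ominus>\<^bsub>E d\<^esub> (\<delta> (d - 1) (h d x) \<oplus>\<^bsub>E d\<^esub> h (d + 1) (\<delta> d x))"
    and bij: "\<And>d. bij_betw (\<psi> d) (carrier (E d)) (carrier (E d))"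
    and idem: "hmt (\<lambda>d x. \<phi> d (\<phi> d x)) \<phi>"
  shows "hmt \<phi> (\<lambda>d x. x)"
proof -
  have psi: "chain \<psi>" "hmt \<phi> \<psi>"
    by (rule chain_homotopic[OF \<phi> h], rule \<psi>, assumption)+
  \<comment> \<open>The degreewise inverse of \<open>\<psi>\<close>. Linearity and compatibility
    with \<open>\<delta>\<close> are inherited from \<open>\<psi>\<close> by injectivity.\<close>
  define P where "P d = the_inv_into (carrier (E d)) (\<psi> d)" for d
  have Pc: "P d x \<in> carrier (E d)" and Pr: "\<psi> d (P d x) = x" if "x \<in> carrier (E d)" for d x
    using bij[of d] that unfolding P_def bij_betw_def by (auto intro: the_inv_into_into f_the_inv_into_f)
  have Pl: "P d (\<psi> d x) = x" if "x \<in> carrier (E d)" for d x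
    using bij[of d] that unfolding P_def bij_betw_def by (auto intro: the_inv_into_f_f)
  have inj: "x = y" if "\<psi> d x = \<psi> d y" "x \<in> carrier (E d)" "y \<in> carrier (E d)" for d x y
    using that Pl by metis
  have "chain P"
    unfolding chain_def
  proof (intro conjI allI ballI)
    have p0: "glin R E E 0 \<psi>" using psi(1) by (simp add: chain_def)
    show "glin R E E 0 P"
      unfolding glin_def
    proof (intro conjI allI ballI)
      fix d x assume x: "x \<in> carrier (E d)"
      then show "P d x \<in> carrier (E (d + 0))" using Pc by simp
      fix y a assume y: "y \<in> carrier (E d)" and a: "a \<in> carrier R"
      interpret module R "E d" by (rule E)
      have "P d (a \<odot>\<^bsub>E d\<^esub> x \<oplus>\<^bsub>E d\<^esub> y) = a \<odot>\<^bsub>E d\<^esub> P d x \<oplus>\<^bsub>E d\<^esub> P d y"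
      proof (rule inj)
        have "em d (\<psi> d (a \<odot>\<^bsub>E d\<^esub> P d x \<oplus>\<^bsub>E d\<^esub> P d y)) = em d (a \<odot>\<^bsub>E d\<^esub> x \<oplus>\<^bsub>E d\<^esub> y)"
          using glin_comb[OF p0 Pc[OF x] Pc[OF y] a, of d] x y a
          by (simp add: Pr emb_add[OF E] emb_smult[OF E])
        moreover have "\<psi> d (a \<odot>\<^bsub>E d\<^esub> P d x \<oplus>\<^bsub>E d\<^esub> P d y) \<in> carrier (E d)"
          by (intro chain_closed[OF psi(1)] a_closed smult_closed Pc a x y)
        ultimately have "\<psi> d (a \<odot>\<^bsub>E d\<^esub> P d x \<oplus>\<^bsub>E d\<^esub> P d y) = a \<odot>\<^bsub>E d\<^esub> x \<oplus>\<^bsub>E d\<^esub> y"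
          using x y a by (intro em_inject[THEN iffD1, of _ d]) simp_all
        then show "\<psi> d (P d (a \<odot>\<^bsub>E d\<^esub> x \<oplus>\<^bsub>E d\<^esub> y)) = \<psi> d (a \<odot>\<^bsub>E d\<^esub> P d x \<oplus>\<^bsub>E d\<^esub> P d y)"
          using x y a by (simp add: Pr)
      qed (use x y a Pc in simp_all)
      then show "em (d + 0) (P d (a \<odot>\<^bsub>E d\<^esub> x \<oplus>\<^bsub>E d\<^esub> y)) = act R a (em (d + 0) (P d x)) + em (d + 0) (P d y)"
        using Pc x y a by (simp add: emb_add[OF E] emb_smult[OF E])
    qed
    fix d x assume x: "x \<in> carrier (E d)"
    note dx = delta_closed[OF x refl] and dP = delta_closed[OF Pc[OF x] refl]
    show "\<delta> d (P d x) = P (d + 1) (\<delta> d x)"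
    proof (rule inj)
      show "\<psi> (d + 1) (\<delta> d (P d x)) = \<psi> (d + 1) (P (d + 1) (\<delta> d x))"
        using psi(1)[unfolded chain_def, THEN conjunct2, rule_format, OF Pc[OF x]] Pr[OF x] Pr[OF dx]
        by simp
    qed (use dP Pc[OF dx] in simp_all)
  qed
  have cpp: "chain (\<lambda>d x. \<psi> d (\<psi> d x))"
    using psi(1) glin_comp[of 0 \<psi> 0 \<psi>] chain_closed[OF psi(1)] by (simp add: chain_def)
  have 1: "hmt (\<lambda>d x. \<psi> d (\<psi> d x)) (\<lambda>d x. \<phi> d (\<psi> d x))"
    by (rule hmt_right[OF psi(1) hmt_sym[OF psi(2)]])
  have 2: "hmt (\<lambda>d x. \<phi> d (\<psi> d x)) (\<lambda>d x. \<phi> d (\<phi> d x))"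
    by (rule hmt_left[OF \<phi> psi(1) \<phi> hmt_sym[OF psi(2)]])

  \<comment> \<open>Idempotency passes from \<open>\<phi>\<close> to the homotopic map
    \<open>\<psi>\<close>, where one factor can be cancelled by means of \<open>P\<close>.\<close>
  have "hmt (\<lambda>d x. \<psi> d (\<psi> d x)) \<psi>"
    by (rule hmt_trans[OF 1 hmt_trans[OF 2 hmt_trans[OF idem psi(2)]]])
  from hmt_left[OF \<open>chain P\<close> cpp psi(1) this]
  have "hmt (\<lambda>d x. P d (\<psi> d (\<psi> d x))) (\<lambda>d x. P d (\<psi> d x))" .
  then have "hmt \<psi> (\<lambda>d x. x)"
    unfolding hmt_def using Pl chain_closed[OF psi(1)] by auto
  with psi(2) show ?thesis by (rule hmt_trans)
qed

end

section \<open>Unit elements\<close>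

lemma category_complex:
  assumes C: "ainf_category R C" and X: "X \<in> Obj C" and Y: "Y \<in> Obj C"
  shows "cocomplex R (sMor C X Y) (b1 C X Y)"
proof (rule cocomplex.intro)
  show "module R (sMor C X Y d)" for d by (rule sMor_module[OF C X Y])
  note E = this
  show "glin R (sMor C X Y) (sMor C X Y) 1 (b1 C X Y)"
    unfolding glin_def
    by (auto simp: b1_closed[OF C X Y] b1_comb[OF C X Y] emb_add[OF E] emb_smult[OF E]
        module.smult_closed[OF E])
  show "emb R (sMor C X Y (d + 2)) (b1 C X Y (d + 1) (b1 C X Y d x)) = 0"
    if "x \<in> carrier (sMor C X Y d)" for x d
    using rel1_lin[OF C lin_emb_word[OF ainf_modular[OF C] X] X Y that] by simp
qed

lemma homotopic_to_id_iff:
  assumes C: "ainf_category R C" and X: "X \<in> Obj C" and Y: "Y \<in> Obj C"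
    and \<phi>: "\<And>d x. x \<in> carrier (sMor C X Y d) \<Longrightarrow> \<phi> d x \<in> carrier (sMor C X Y d)"
  shows "homotopic_to_id R C X Y \<phi> \<longleftrightarrow> cocomplex.hmt R (sMor C X Y) (b1 C X Y) \<phi> (\<lambda>d x. x)"
proof -
  interpret K: cocomplex R "sMor C X Y" "b1 C X Y" by (rule category_complex[OF C X Y])
  have "(\<phi> d x \<ominus>\<^bsub>sMor C X Y d\<^esub> x = b1 C X Y (d - 1) (h d x) \<oplus>\<^bsub>sMor C X Y d\<^esub> h (d + 1) (b1 C X Y d x)) =
    (K.em d (\<phi> d x) = K.em d x + K.em d (b1 C X Y (d - 1) (h d x)) + K.em d (h (d + 1) (b1 C X Y d x)))"
    if h: "glin R (sMor C X Y) (sMor C X Y) (- 1) h" and x: "x \<in> carrier (sMor C X Y d)" for h d x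
  proof -
    interpret module R "sMor C X Y d" by (rule K.E)
    have cl: "b1 C X Y (d - 1) (h d x) \<in> carrier (sMor C X Y d)" "h (d + 1) (b1 C X Y d x) \<in> carrier (sMor C X Y d)"
      using K.delta_closed[OF glin_closed[OF h x refl], of d] glin_closed[OF h K.delta_closed[OF x refl], of d]
      by simp_all
    then have "(\<phi> d x \<ominus>\<^bsub>sMor C X Y d\<^esub> x = b1 C X Y (d - 1) (h d x) \<oplus>\<^bsub>sMor C X Y d\<^esub> h (d + 1) (b1 C X Y d x)) =
      (K.em d (\<phi> d x \<ominus>\<^bsub>sMor C X Y d\<^esub> x) =
        K.em d (b1 C X Y (d - 1) (h d x) \<oplus>\<^bsub>sMor C X Y d\<^esub> h (d + 1) (b1 C X Y d x)))"
      using \<phi>[OF x] x by (intro K.em_inject[symmetric]) simp_all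
    then show ?thesis using \<phi>[OF x] x cl
      by (simp add: emb_diff[OF K.E] emb_add[OF K.E] algebra_simps)
  qed
  then show ?thesis
    unfolding homotopic_to_id_def null_homotopic_def K.hmt_def glin_iff[OF K.E K.E, symmetric] by blast
qed

abbreviation rmul where "rmul C X Y i d x \<equiv> b2 C X Y Y d (- 1) x i"
abbreviation lmul where
  "lmul C X Y i d x \<equiv> \<ominus>\<^bsub>sMor C X Y d\<^esub> ksign (sMor C X Y d) d (b2 C X X Y (- 1) d i x)"

context
  fixes R :: "'k ring" and C :: "('k, 'o, 'm) ainf_cat"
  assumes C: "ainf_category R C"
begin

lemma em_eqI:
  assumes "X \<in> Obj C" "Y \<in> Obj C" "x \<in> carrier (sMor C X Y d)" "y \<in> carrier (sMor C X Y d)"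
    "emb R (sMor C X Y d) x = emb R (sMor C X Y d) y"
  shows "x = y"
  using emb_inject[OF sMor_module[OF C assms(1,2)] assms(3,4)] assms(5) by simp

lemma rmul_closed:
  assumes "X \<in> Obj C" "Y \<in> Obj C" "i \<in> carrier (sMor C Y Y (- 1))" "x \<in> carrier (sMor C X Y d)"
  shows "rmul C X Y i d x \<in> carrier (sMor C X Y d)"
  using b2_closed[OF C assms(1,2,2,4,3)] by simp

lemma lmul_closed:
  assumes "X \<in> Obj C" "Y \<in> Obj C" "i \<in> carrier (sMor C X X (- 1))" "x \<in> carrier (sMor C X Y d)"
  shows "lmul C X Y i d x \<in> carrier (sMor C X Y d)"
proof -
  have E: "module R (sMor C X Y d)" by (rule sMor_module[OF C assms(1,2)])
  have "b2 C X X Y (- 1) d i x \<in> carrier (sMor C X Y d)"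
    using b2_closed[OF C assms(1,1,2,3,4)] by simp
  then show ?thesis by (intro abelian_group.a_inv_closed[OF ab_of_module[OF E]] ksign_closed[OF E])
qed

lemma em_lmul:
  assumes "X \<in> Obj C" "Y \<in> Obj C" "i \<in> carrier (sMor C X X (- 1))" "x \<in> carrier (sMor C X Y d)"
  shows "emb R (sMor C X Y d) (lmul C X Y i d x) = sg (d + 1) (emb R (sMor C X Y d) (b2 C X X Y (- 1) d i x))"
proof -
  have E: "module R (sMor C X Y d)" by (rule sMor_module[OF C assms(1,2)])
  have c: "b2 C X X Y (- 1) d i x \<in> carrier (sMor C X Y d)"
    using b2_closed[OF C assms(1,1,2,3,4)] by simp
  show ?thesis unfolding emb_minus[OF E ksign_closed[OF E c]] emb_ksign[OF E c] by (simp add: sg_def)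
qed

text \<open>A cycle that is idempotent in cohomology. The primitive \<open>w\<close> of the defect
  is part of the data, because it enters the homotopies below and has to be constructed along with
  \<open>i\<close>.\<close>

definition idem :: "'o \<Rightarrow> 'm \<Rightarrow> 'm \<Rightarrow> bool" where
  "idem X i w \<longleftrightarrow> X \<in> Obj C \<and> i \<in> carrier (sMor C X X (- 1)) \<and> w \<in> carrier (sMor C X X (- 2)) \<and>
     b1 C X X (- 1) i = \<zero>\<^bsub>sMor C X X 0\<^esub> \<and>
     b2 C X X X (- 1) (- 1) i i = i \<oplus>\<^bsub>sMor C X X (- 1)\<^esub> b1 C X X (- 2) w"

text \<open>The two-input relation with the cycle \<open>i\<close> makes the multiplication a chain
  map, and the three-input relation makes it idempotent up to homotopy.\<close>

lemma idem_rmul: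
  assumes i: "idem Y i w" and X: "X \<in> Obj C"
  shows "cocomplex.chain R (sMor C X Y) (b1 C X Y) (rmul C X Y i)"
    and "cocomplex.hmt R (sMor C X Y) (b1 C X Y) (\<lambda>d x. rmul C X Y i d (rmul C X Y i d x)) (rmul C X Y i)"
proof -
  have Y: "Y \<in> Obj C" and ic: "i \<in> carrier (sMor C Y Y (- 1))" and wc: "w \<in> carrier (sMor C Y Y (- 2))"
    and i0: "b1 C Y Y (- 1) i = \<zero>\<^bsub>sMor C Y Y 0\<^esub>"
    and ii: "b2 C Y Y Y (- 1) (- 1) i i = i \<oplus>\<^bsub>sMor C Y Y (- 1)\<^esub> b1 C Y Y (- 2) w"
    using i by (simp_all add: idem_def)
  interpret K: cocomplex R "sMor C X Y" "b1 C X Y" by (rule category_complex[OF C X Y])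
  note l = lin_emb_word[OF ainf_modular[OF C] X]
  note rc = rmul_closed[OF X Y ic]
  have bc: "b1 C X Y d x \<in> carrier (sMor C X Y (d + 1))" if "x \<in> carrier (sMor C X Y d)" for d x
    by (rule b1_closed[OF C X Y that])
  have b2l: "K.em d (b2 C X Y Y d (- 1) (a \<odot>\<^bsub>sMor C X Y d\<^esub> x \<oplus>\<^bsub>sMor C X Y d\<^esub> y) i) =
      act R a (K.em d (b2 C X Y Y d (- 1) x i)) + K.em d (b2 C X Y Y d (- 1) y i)"
    if "x \<in> carrier (sMor C X Y d)" "y \<in> carrier (sMor C X Y d)" "a \<in> carrier R" for a x y d
    using b2_comb_left[OF C X Y Y that(1,2) ic that(3)] rc[OF that(1)] rc[OF that(2)] that
    by (simp add: emb_add[OF K.E] emb_smult[OF K.E] module.smult_closed[OF K.E])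
  show "K.chain (rmul C X Y i)"
    unfolding K.chain_def glin_def
  proof (intro conjI allI ballI)
    fix d x assume x: "x \<in> carrier (sMor C X Y d)"
    show "rmul C X Y i d x \<in> carrier (sMor C X Y (d + 0))" using rc[OF x] by simp
    show "K.em (d + 0) (rmul C X Y i d (a \<odot>\<^bsub>sMor C X Y d\<^esub> x \<oplus>\<^bsub>sMor C X Y d\<^esub> y)) =
      act R a (K.em (d + 0) (rmul C X Y i d x)) + K.em (d + 0) (rmul C X Y i d y)"
      if "y \<in> carrier (sMor C X Y d)" "a \<in> carrier R" for y a using b2l[OF x that] by simp
    have "emb_word R C X [(Y, d + 1, b2 C X Y Y d 0 x (b1 C Y Y (- 1) i))] = 0"
      unfolding i0
      using lin_zero[OF ainf_modular[OF C] lin_tail[OF lin_bop[OF C l X] X x] Y, where v = "[]" and Y = Y and d = 0] Y by simp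
    then have "K.em (d + 1) (b1 C X Y d (rmul C X Y i d x)) = K.em (d + 1) (rmul C X Y i (d + 1) (b1 C X Y d x))"
      using rel2_lin[OF C l X Y Y x ic] by (simp add: sg_def add.commute[of 1])
    then show "b1 C X Y d (rmul C X Y i d x) = rmul C X Y i (d + 1) (b1 C X Y d x)"
      using x by (intro em_eqI[OF X Y]) (simp_all add: rc bc)
  qed
  \<comment> \<open>By the relation for the inputs \<open>x\<close>, \<open>i\<close>,
    \<open>i\<close>, the products \<open>(xi)i\<close> and \<open>x(ii)\<close> differ by the terms
    of the homotopy \<open>b3\<close>; replacing \<open>ii\<close> by \<open>i\<close> costs the
    boundary of \<open>w\<close>, which the two-input relation for \<open>x\<close> and
    \<open>w\<close> turns into the term with \<open>b2\<close>.\<close>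
  define k where "k d x = b3 C X Y Y Y d (- 1) (- 1) x i i \<ominus>\<^bsub>sMor C X Y (d - 1)\<^esub> b2 C X Y Y d (- 2) x w" for d x
  have b3c: "b3 C X Y Y Y d (- 1) (- 1) x i i \<in> carrier (sMor C X Y (d - 1))"
    and b2c: "b2 C X Y Y d (- 2) x w \<in> carrier (sMor C X Y (d - 1))"
    if "x \<in> carrier (sMor C X Y d)" for d x
    using b3_closed[OF C X Y Y Y that ic ic] b2_closed[OF C X Y Y that wc] by simp_all
  have kc: "k d x \<in> carrier (sMor C X Y (d - 1))" if "x \<in> carrier (sMor C X Y d)" for d x
    unfolding k_def using b3c[OF that] b2c[OF that] abelian_group.minus_closed[OF ab_of_module[OF K.E]]
    by blast
  have ke: "K.em (d - 1) (k d x) = K.em (d - 1) (b3 C X Y Y Y d (- 1) (- 1) x i i) -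
      K.em (d - 1) (b2 C X Y Y d (- 2) x w)" if "x \<in> carrier (sMor C X Y d)" for d x
    unfolding k_def by (rule emb_diff[OF K.E b3c[OF that] b2c[OF that]])
  have kg: "glin R (sMor C X Y) (sMor C X Y) (- 1) k"
    unfolding glin_def
  proof (intro conjI allI ballI)
    fix d x assume x: "x \<in> carrier (sMor C X Y d)"
    show "k d x \<in> carrier (sMor C X Y (d + - 1))" using kc[OF x] by simp
    fix y a assume y: "y \<in> carrier (sMor C X Y d)" and a: "a \<in> carrier R"
    have z: "a \<odot>\<^bsub>sMor C X Y d\<^esub> x \<oplus>\<^bsub>sMor C X Y d\<^esub> y \<in> carrier (sMor C X Y d)"
    proof -
      interpret module R "sMor C X Y d" by (rule K.E)
      show ?thesis using x y a by simp
    qed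
    have "K.em (d - 1) (k d (a \<odot>\<^bsub>sMor C X Y d\<^esub> x \<oplus>\<^bsub>sMor C X Y d\<^esub> y)) =
      act R a (K.em (d - 1) (k d x)) + K.em (d - 1) (k d y)"
      unfolding ke[OF x] ke[OF y] ke[OF z]
      using b3_comb_left[OF C X Y Y Y x y ic ic a] b2_comb_left[OF C X Y Y x y wc a] b3c b2c x y a
      by (simp add: emb_add[OF K.E] emb_smult[OF K.E] module.smult_closed[OF K.E] act_diff)
    then show "K.em (d + - 1) (k d (a \<odot>\<^bsub>sMor C X Y d\<^esub> x \<oplus>\<^bsub>sMor C X Y d\<^esub> y)) =
      act R a (K.em (d + - 1) (k d x)) + K.em (d + - 1) (k d y)" by simp
  qed
  have "K.em d (rmul C X Y i d (rmul C X Y i d x)) = K.em d (rmul C X Y i d x) +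
      K.em d (b1 C X Y (d - 1) (k d x)) + K.em d (k (d + 1) (b1 C X Y d x))"
    if x: "x \<in> carrier (sMor C X Y d)" for d x
  proof -
    note lx = lin_tail[OF lin_bop[OF C l X] X x]
    have z3: "K.em d (b3 C X Y Y Y d (- 1) 0 x i (b1 C Y Y (- 1) i)) = 0"
      "K.em d (b3 C X Y Y Y d 0 (- 1) x (b1 C Y Y (- 1) i) i) = 0"
      unfolding i0
      using lin_zero[OF ainf_modular[OF C] lin_tail[OF lx Y ic] Y, where v = "[]" and Y = Y and d = 0]
        lin_zero[OF ainf_modular[OF C] lx Y, where v = "[(Y, - 1, i)]" and Y = Y and d = 0] Y ic by simp_all
    have 1: "K.em d (b1 C X Y (d - 1) (b3 C X Y Y Y d (- 1) (- 1) x i i)) +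
        K.em d (b3 C X Y Y Y (d + 1) (- 1) (- 1) (b1 C X Y d x) i i) +
        K.em d (b2 C X Y Y d (- 1) x (b2 C Y Y Y (- 1) (- 1) i i)) =
        K.em d (rmul C X Y i d (rmul C X Y i d x))"
      using rel3_lin[OF C l X Y Y Y x ic ic] z3 by (simp add: sg_def algebra_simps)
    have b1w: "b1 C Y Y (- 2) w \<in> carrier (sMor C Y Y (- 1))" using b1_closed[OF C Y Y wc] by simp
    have 2: "K.em d (b2 C X Y Y d (- 1) x (b2 C Y Y Y (- 1) (- 1) i i)) =
        K.em d (rmul C X Y i d x) + K.em d (b2 C X Y Y d (- 1) x (b1 C Y Y (- 2) w))"
      unfolding ii using lin_add[OF ainf_modular[OF C] lx Y ic b1w, of "[]"] Y by simp
    have 3: "K.em d (b2 C X Y Y d (- 1) x (b1 C Y Y (- 2) w)) =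
        - K.em d (b2 C X Y Y (d + 1) (- 2) (b1 C X Y d x) w) - K.em d (b1 C X Y (d - 1) (b2 C X Y Y d (- 2) x w))"
      using rel2_lin[OF C l X Y Y x wc] by (simp add: sg_def algebra_simps eq_neg_iff_add_eq_0)
    have 4: "K.em d (b1 C X Y (d - 1) (k d x)) = K.em d (b1 C X Y (d - 1) (b3 C X Y Y Y d (- 1) (- 1) x i i)) -
       K.em d (b1 C X Y (d - 1) (b2 C X Y Y d (- 2) x w))"
      unfolding k_def using b3c[OF x] b2c[OF x] by (intro glin_diff[OF K.E K.E K.\<delta>]) simp_all
    have 5: "K.em d (k (d + 1) (b1 C X Y d x)) = K.em d (b3 C X Y Y Y (d + 1) (- 1) (- 1) (b1 C X Y d x) i i) -
       K.em d (b2 C X Y Y (d + 1) (- 2) (b1 C X Y d x) w)"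
      using ke[OF bc[OF x]] by simp
    show ?thesis unfolding 1[symmetric] 2 3 4 5 by simp
  qed
  then show "K.hmt (\<lambda>d x. rmul C X Y i d (rmul C X Y i d x)) (rmul C X Y i)"
    unfolding K.hmt_def using kg by blast
qed

text \<open>The mirror image of right multiplication. The sign built into \<open>lmul\<close> makes
  it commute with the differential, since \<open>i\<close> has odd degree.\<close>

lemma idem_lmul:
  assumes i: "idem X i w" and Y: "Y \<in> Obj C"
  shows "cocomplex.chain R (sMor C X Y) (b1 C X Y) (lmul C X Y i)"
    and "cocomplex.hmt R (sMor C X Y) (b1 C X Y) (\<lambda>d x. lmul C X Y i d (lmul C X Y i d x)) (lmul C X Y i)"
proof -
  have X: "X \<in> Obj C" and ic: "i \<in> carrier (sMor C X X (- 1))" and wc: "w \<in> carrier (sMor C X X (- 2))"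
    and i0: "b1 C X X (- 1) i = \<zero>\<^bsub>sMor C X X 0\<^esub>"
    and ii: "b2 C X X X (- 1) (- 1) i i = i \<oplus>\<^bsub>sMor C X X (- 1)\<^esub> b1 C X X (- 2) w"
    using i by (simp_all add: idem_def)
  interpret K: cocomplex R "sMor C X Y" "b1 C X Y" by (rule category_complex[OF C X Y])
  note l = lin_emb_word[OF ainf_modular[OF C] X]
  note lc = lmul_closed[OF X Y ic] and le = em_lmul[OF X Y ic]
  have b2i: "b2 C X X Y (- 1) d i x \<in> carrier (sMor C X Y d)" if "x \<in> carrier (sMor C X Y d)" for d x
    using b2_closed[OF C X X Y ic that] by simp
  have bc: "b1 C X Y d x \<in> carrier (sMor C X Y (d + 1))" if "x \<in> carrier (sMor C X Y d)" for d x
    by (rule b1_closed[OF C X Y that])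
  have b2g: "glin R (sMor C X Y) (sMor C X Y) 0 (\<lambda>d. b2 C X X Y (- 1) d i)"
    unfolding glin_def
    using b2_comb_right[OF C X X Y ic] b2i
    by (auto simp: emb_add[OF K.E] emb_smult[OF K.E] module.smult_closed[OF K.E])
  note cl = module.smult_closed[OF K.E] abelian_groupE(1)[OF ab_of_module[OF K.E]]
  show "K.chain (lmul C X Y i)"
    unfolding K.chain_def glin_def
  proof (intro conjI allI ballI)
    fix d x assume x: "x \<in> carrier (sMor C X Y d)"
    show "lmul C X Y i d x \<in> carrier (sMor C X Y (d + 0))" using lc[OF x] by simp
    show "K.em (d + 0) (lmul C X Y i d (a \<odot>\<^bsub>sMor C X Y d\<^esub> x \<oplus>\<^bsub>sMor C X Y d\<^esub> y)) =
      act R a (K.em (d + 0) (lmul C X Y i d x)) + K.em (d + 0) (lmul C X Y i d y)"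
      if "y \<in> carrier (sMor C X Y d)" "a \<in> carrier R" for y a
      using glin_comb[OF b2g x that, of d] le[OF cl(2)[OF cl(1)[OF that(2) x] that(1)]] le[OF x] le[OF that(1)]
      by (simp add: sg_add act_sg)
    have "emb_word R C X [(Y, d + 1, b2 C X X Y 0 d (b1 C X X (- 1) i) x)] = 0"
      unfolding i0
      using lin_zero[OF ainf_modular[OF C] lin_bop[OF C l X] X, where v = "[(Y, d, x)]" and Y = X and d = 0] X Y x
      by (simp add: add.commute)
    then have "K.em (d + 1) (b2 C X X Y (- 1) (d + 1) i (b1 C X Y d x)) = - K.em (d + 1) (b1 C X Y d (b2 C X X Y (- 1) d i x))"
      using rel2_lin[OF C l X X Y ic x] by (simp add: add.commute eq_neg_iff_add_eq_0)
    moreover have "K.em (d + 1) (b1 C X Y d (lmul C X Y i d x)) = sg (d + 1) (K.em (d + 1) (b1 C X Y d (b2 C X X Y (- 1) d i x)))"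
    proof -
      have "K.em (d + 1) (b1 C X Y d (lmul C X Y i d x)) = - K.em (d + 1) (b1 C X Y d (ksign (sMor C X Y d) d (b2 C X X Y (- 1) d i x)))"
        by (rule glin_minus[OF K.E K.E K.\<delta> ksign_closed[OF K.E b2i[OF x]] refl])
      then show ?thesis
        using glin_minus[OF K.E K.E K.\<delta> b2i[OF x] refl] by (simp add: ksign_def sg_def)
    qed
    ultimately have "K.em (d + 1) (b1 C X Y d (lmul C X Y i d x)) = K.em (d + 1) (lmul C X Y i (d + 1) (b1 C X Y d x))"
      using le[OF bc[OF x]] by (simp add: sg_def)
    then show "b1 C X Y d (lmul C X Y i d x) = lmul C X Y i (d + 1) (b1 C X Y d x)"
      by (rule em_eqI[OF X Y bc[OF lc[OF x]] lc[OF bc[OF x]]])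
  qed
  \<comment> \<open>The same two corrections with both signs reversed, because in the three-input
    relation the iterated product \<open>i(ix)\<close> and the terms with \<open>b3\<close> now
    enter with the same sign.\<close>
  define k where "k d x = b2 C X X Y (- 2) d w x \<ominus>\<^bsub>sMor C X Y (d - 1)\<^esub> b3 C X X X Y (- 1) (- 1) d i i x" for d x
  have b3c: "b3 C X X X Y (- 1) (- 1) d i i x \<in> carrier (sMor C X Y (d - 1))"
    and b2c: "b2 C X X Y (- 2) d w x \<in> carrier (sMor C X Y (d - 1))"
    if "x \<in> carrier (sMor C X Y d)" for d x
    using b3_closed[OF C X X X Y ic ic that] b2_closed[OF C X X Y wc that] by simp_all
  have kc: "k d x \<in> carrier (sMor C X Y (d - 1))" if "x \<in> carrier (sMor C X Y d)" for d x
    unfolding k_def by (intro abelian_group.minus_closed[OF ab_of_module[OF K.E]] b3c b2c that)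
  have ke: "K.em (d - 1) (k d x) = K.em (d - 1) (b2 C X X Y (- 2) d w x) -
      K.em (d - 1) (b3 C X X X Y (- 1) (- 1) d i i x)" if "x \<in> carrier (sMor C X Y d)" for d x
    unfolding k_def by (rule emb_diff[OF K.E b2c[OF that] b3c[OF that]])
  have kg: "glin R (sMor C X Y) (sMor C X Y) (- 1) k"
    unfolding glin_def
  proof (intro conjI allI ballI)
    fix d x assume x: "x \<in> carrier (sMor C X Y d)"
    show "k d x \<in> carrier (sMor C X Y (d + - 1))" using kc[OF x] by simp
    fix y a assume y: "y \<in> carrier (sMor C X Y d)" and a: "a \<in> carrier R"
    have "K.em (d - 1) (k d (a \<odot>\<^bsub>sMor C X Y d\<^esub> x \<oplus>\<^bsub>sMor C X Y d\<^esub> y)) =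
      act R a (K.em (d - 1) (k d x)) + K.em (d - 1) (k d y)"
      unfolding ke[OF x] ke[OF y] ke[OF cl(2)[OF cl(1)[OF a x] y]]
      using b3_comb_right[OF C X X X Y ic ic x y a] b2_comb_right[OF C X X Y wc x y a] b3c b2c x y a
      by (simp add: emb_add[OF K.E] emb_smult[OF K.E] cl act_diff act_minus act_sg sg_add)
    then show "K.em (d + - 1) (k d (a \<odot>\<^bsub>sMor C X Y d\<^esub> x \<oplus>\<^bsub>sMor C X Y d\<^esub> y)) =
      act R a (K.em (d + - 1) (k d x)) + K.em (d + - 1) (k d y)" by simp
  qed
  have "K.em d (lmul C X Y i d (lmul C X Y i d x)) = K.em d (lmul C X Y i d x) +
      K.em d (b1 C X Y (d - 1) (k d x)) + K.em d (k (d + 1) (b1 C X Y d x))"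
    if x: "x \<in> carrier (sMor C X Y d)" for d x
  proof -
    note lx = lin_tail[OF lin_bop[OF C l X] X ic]
    have z3: "K.em d (b3 C X X X Y (- 1) 0 d i (b1 C X X (- 1) i) x) = 0"
      "K.em d (b3 C X X X Y 0 (- 1) d (b1 C X X (- 1) i) i x) = 0"
      unfolding i0
      using lin_zero[OF ainf_modular[OF C] lx X, where v = "[(Y, d, x)]" and Y = X and d = 0]
        lin_zero[OF ainf_modular[OF C] lin_bop[OF C l X] X, where v = "[(X, - 1, i), (Y, d, x)]" and Y = X and d = 0] X Y ic x by simp_all
    let ?L2 = "K.em d (b2 C X X Y (- 1) d i (b2 C X X Y (- 1) d i x))"
    let ?b3 = "K.em d (b1 C X Y (d - 1) (b3 C X X X Y (- 1) (- 1) d i i x))"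
    let ?b3' = "K.em d (b3 C X X X Y (- 1) (- 1) (d + 1) i i (b1 C X Y d x))"
    let ?b2 = "K.em d (b1 C X Y (d - 1) (b2 C X X Y (- 2) d w x))"
    let ?b2' = "K.em d (b2 C X X Y (- 2) (d + 1) w (b1 C X Y d x))"
    have 0: "K.em d (lmul C X Y i d (lmul C X Y i d x)) = ?L2"
    proof -
      have "K.em d (b2 C X X Y (- 1) d i (lmul C X Y i d x)) = sg (d + 1) ?L2"
        using glin_minus[OF K.E K.E b2g ksign_closed[OF K.E b2i[OF x]], of d d]
          glin_minus[OF K.E K.E b2g b2i[OF x], of d] by (simp add: ksign_def sg_def)
      then show ?thesis by (simp add: le[OF lc[OF x]] sg_def)
    qed
    have 1: "?L2 = - sg d (K.em d (b2 C X X Y (- 1) d (b2 C X X X (- 1) (- 1) i i) x)) - ?b3 - ?b3'"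
      using rel3_lin[OF C l X X X Y ic ic x] z3 by (simp add: algebra_simps eq_neg_iff_add_eq_0)
    have b1w: "b1 C X X (- 2) w \<in> carrier (sMor C X X (- 1))" using b1_closed[OF C X X wc] by simp
    have 2: "K.em d (b2 C X X Y (- 1) d (b2 C X X X (- 1) (- 1) i i) x) =
        K.em d (b2 C X X Y (- 1) d i x) + K.em d (b2 C X X Y (- 1) d (b1 C X X (- 2) w) x)"
      unfolding ii using lin_add[OF ainf_modular[OF C] lin_bop[OF C l X] X ic b1w, of "[(Y, d, x)]"] X Y x by simp
    have 3: "sg d (K.em d (b2 C X X Y (- 1) d (b1 C X X (- 2) w) x)) = - ?b2' - ?b2"
      using rel2_lin[OF C l X X Y wc x] by (simp add: algebra_simps eq_neg_iff_add_eq_0)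
    have 4: "K.em d (b1 C X Y (d - 1) (k d x)) = ?b2 - ?b3"
      unfolding k_def by (rule glin_diff[OF K.E K.E K.\<delta> b2c[OF x] b3c[OF x]]) simp
    have 5: "K.em d (k (d + 1) (b1 C X Y d x)) = ?b2' - ?b3'"
      using ke[OF bc[OF x]] by simp
    show ?thesis unfolding 0 1 2 4 5 sg_add 3 le[OF x] by (simp add: sg_def)
  qed
  then show "K.hmt (\<lambda>d x. lmul C X Y i d (lmul C X Y i d x)) (lmul C X Y i)"
    unfolding K.hmt_def using kg by blast
qed

end

lemma is_unit_elt_iff:
  assumes C: "ainf_category R C" and X: "X \<in> Obj C"
  shows "is_unit_elt R C X i \<longleftrightarrow> i \<in> carrier (sMor C X X (- 1)) \<and> b1 C X X (- 1) i = \<zero>\<^bsub>sMor C X X 0\<^esub> \<and>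
     (\<forall>Y \<in> Obj C. cocomplex.hmt R (sMor C Y X) (b1 C Y X) (rmul C Y X i) (\<lambda>d x. x) \<and>
       cocomplex.hmt R (sMor C X Y) (b1 C X Y) (lmul C X Y i) (\<lambda>d x. x))"
proof (cases "i \<in> carrier (sMor C X X (- 1))")
  case True
  have "homotopic_to_id R C Y X (rmul C Y X i) \<longleftrightarrow>
      cocomplex.hmt R (sMor C Y X) (b1 C Y X) (rmul C Y X i) (\<lambda>d x. x)"
    "homotopic_to_id R C X Y (lmul C X Y i) \<longleftrightarrow>
      cocomplex.hmt R (sMor C X Y) (b1 C X Y) (lmul C X Y i) (\<lambda>d x. x)" if Y: "Y \<in> Obj C" for Y
    using homotopic_to_id_iff[OF C Y X rmul_closed[OF C Y X True]]
      homotopic_to_id_iff[OF C X Y lmul_closed[OF C X Y True]] by simp_all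
  then show ?thesis by (simp add: is_unit_elt_def)
qed (simp add: is_unit_elt_def)

text \<open>For cycles this is equality in cohomology in degree zero, since degree -1 in the
  suspension is degree 0 in \<open>C\<close>. It is stated for elements, so that no classes have to
  be handled.\<close>

definition hlg :: "'k ring \<Rightarrow> ('k, 'o, 'm) ainf_cat \<Rightarrow> 'o \<Rightarrow> 'o \<Rightarrow> 'm \<Rightarrow> 'm \<Rightarrow> bool" where
  "hlg R C X Y x y \<longleftrightarrow> x \<in> carrier (sMor C X Y (- 1)) \<and> y \<in> carrier (sMor C X Y (- 1)) \<and>
     (\<exists>z \<in> carrier (sMor C X Y (- 2)). emb R (sMor C X Y (- 1)) x =
        emb R (sMor C X Y (- 1)) y + emb R (sMor C X Y (- 1)) (b1 C X Y (- 2) z))"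

context
  fixes R :: "'k ring" and C :: "('k, 'o, 'm) ainf_cat"
  assumes C: "ainf_category R C"
begin

lemma hlg_iff:
  assumes X: "X \<in> Obj C" and Y: "Y \<in> Obj C" and x: "x \<in> carrier (sMor C X Y (- 1))"
    and y: "y \<in> carrier (sMor C X Y (- 1))"
  shows "hlg R C X Y x y \<longleftrightarrow>
    (\<exists>z \<in> carrier (sMor C X Y (- 2)). x = y \<oplus>\<^bsub>sMor C X Y (- 1)\<^esub> b1 C X Y (- 2) z)"
proof -
  have "(emb R (sMor C X Y (- 1)) x = emb R (sMor C X Y (- 1)) y + emb R (sMor C X Y (- 1)) (b1 C X Y (- 2) z)) =
    (x = y \<oplus>\<^bsub>sMor C X Y (- 1)\<^esub> b1 C X Y (- 2) z)" if "z \<in> carrier (sMor C X Y (- 2))" for z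
  proof -
    have E: "module R (sMor C X Y (- 1))" by (rule sMor_module[OF C X Y])
    interpret module R "sMor C X Y (- 1)" by (rule E)
    have "b1 C X Y (- 2) z \<in> carrier (sMor C X Y (- 1))" using b1_closed[OF C X Y that] by simp
    then show ?thesis using x y emb_inject[OF E x, of "y \<oplus>\<^bsub>sMor C X Y (- 1)\<^esub> b1 C X Y (- 2) z"]
      by (simp add: emb_add[OF E])
  qed
  then show ?thesis using x y by (auto simp: hlg_def)
qed

lemma hlg_refl:
  assumes X: "X \<in> Obj C" and Y: "Y \<in> Obj C" and x: "x \<in> carrier (sMor C X Y (- 1))"
  shows "hlg R C X Y x x"
proof -
  interpret K: cocomplex R "sMor C X Y" "b1 C X Y" by (rule category_complex[OF C X Y])
  have "K.em (- 1) (b1 C X Y (- 2) \<zero>\<^bsub>sMor C X Y (- 2)\<^esub>) = 0" by (rule glin_zero[OF K.E K.E K.\<delta>]) simp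
  then show ?thesis unfolding hlg_def
    using x abelian_groupE(2)[OF ab_of_module[OF K.E]] by auto
qed

lemma hlg_sym:
  assumes X: "X \<in> Obj C" and Y: "Y \<in> Obj C" and h: "hlg R C X Y x y"
  shows "hlg R C X Y y x"
proof -
  interpret K: cocomplex R "sMor C X Y" "b1 C X Y" by (rule category_complex[OF C X Y])
  obtain z where z: "z \<in> carrier (sMor C X Y (- 2))" "K.em (- 1) x = K.em (- 1) y + K.em (- 1) (b1 C X Y (- 2) z)"
    using h by (auto simp: hlg_def)
  have "K.em (- 1) (b1 C X Y (- 2) (\<ominus>\<^bsub>sMor C X Y (- 2)\<^esub> z)) = - K.em (- 1) (b1 C X Y (- 2) z)"
    by (rule glin_minus[OF K.E K.E K.\<delta> z(1)]) simp
  then show ?thesis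
    using h z abelian_group.a_inv_closed[OF ab_of_module[OF K.E] z(1)] unfolding hlg_def
    by (auto intro!: bexI[of _ "\<ominus>\<^bsub>sMor C X Y (- 2)\<^esub> z"])
qed

lemma hlg_trans:
  assumes X: "X \<in> Obj C" and Y: "Y \<in> Obj C" and h: "hlg R C X Y x y" "hlg R C X Y y z"
  shows "hlg R C X Y x z"
proof -
  interpret K: cocomplex R "sMor C X Y" "b1 C X Y" by (rule category_complex[OF C X Y])
  obtain p q where p: "p \<in> carrier (sMor C X Y (- 2))" "K.em (- 1) x = K.em (- 1) y + K.em (- 1) (b1 C X Y (- 2) p)"
    and q: "q \<in> carrier (sMor C X Y (- 2))" "K.em (- 1) y = K.em (- 1) z + K.em (- 1) (b1 C X Y (- 2) q)"
    using h by (auto simp: hlg_def)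
  have "K.em (- 1) (b1 C X Y (- 2) (q \<oplus>\<^bsub>sMor C X Y (- 2)\<^esub> p)) =
      K.em (- 1) (b1 C X Y (- 2) q) + K.em (- 1) (b1 C X Y (- 2) p)"
    by (rule glin_add[OF K.E K.E K.\<delta> q(1) p(1)]) simp
  then show ?thesis
    using h p q abelian_groupE(1)[OF ab_of_module[OF K.E] q(1) p(1)] unfolding hlg_def
    by (auto intro!: bexI[of _ "q \<oplus>\<^bsub>sMor C X Y (- 2)\<^esub> p"])
qed

text \<open>At a cycle the homotopy formula loses the term in which the differential comes first,
  and what remains is a boundary.\<close>

lemma hmt_id_hlg:
  assumes X: "X \<in> Obj C" and Y: "Y \<in> Obj C" and h: "cocomplex.hmt R (sMor C X Y) (b1 C X Y) \<phi> (\<lambda>d x. x)"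
    and x: "x \<in> carrier (sMor C X Y (- 1))" "b1 C X Y (- 1) x = \<zero>\<^bsub>sMor C X Y 0\<^esub>"
    and fx: "\<phi> (- 1) x \<in> carrier (sMor C X Y (- 1))"
  shows "hlg R C X Y (\<phi> (- 1) x) x"
proof -
  interpret K: cocomplex R "sMor C X Y" "b1 C X Y" by (rule category_complex[OF C X Y])
  obtain h where h: "glin R (sMor C X Y) (sMor C X Y) (- 1) h"
    and eq: "K.em (- 1) (\<phi> (- 1) x) = K.em (- 1) x + K.em (- 1) (b1 C X Y (- 1 - 1) (h (- 1) x)) +
      K.em (- 1) (h (- 1 + 1) (b1 C X Y (- 1) x))"
    using h x(1) unfolding K.hmt_def by blast
  have "K.em (- 1) (h 0 \<zero>\<^bsub>sMor C X Y 0\<^esub>) = 0" by (rule glin_zero[OF K.E K.E h]) simp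
  moreover have "h (- 1) x \<in> carrier (sMor C X Y (- 2))" by (rule glin_closed[OF h x(1)]) simp
  ultimately show ?thesis using eq x fx by (auto simp: hlg_def)
qed

text \<open>The product of \<open>i\<close> and \<open>j\<close> is homologous to \<open>i\<close>
  because \<open>j\<close> is a unit on the right, and to \<open>j\<close> because \<open>i\<close>
  is a unit on the left.\<close>

lemma unit_elt_hlg:
  assumes X: "X \<in> Obj C" and i: "is_unit_elt R C X i" and j: "is_unit_elt R C X j"
  shows "hlg R C X X i j"
proof -
  note ii = i[unfolded is_unit_elt_iff[OF C X]] and jj = j[unfolded is_unit_elt_iff[OF C X]]
  have ic: "i \<in> carrier (sMor C X X (- 1))" and jc: "j \<in> carrier (sMor C X X (- 1))"
    and i0: "b1 C X X (- 1) i = \<zero>\<^bsub>sMor C X X 0\<^esub>" and j0: "b1 C X X (- 1) j = \<zero>\<^bsub>sMor C X X 0\<^esub>"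
    using ii jj by simp_all
  have E: "module R (sMor C X X (- 1))" by (rule sMor_module[OF C X X])
  have b: "b2 C X X X (- 1) (- 1) i j \<in> carrier (sMor C X X (- 1))" using b2_closed[OF C X X X ic jc] by simp
  have 1: "hlg R C X X (b2 C X X X (- 1) (- 1) i j) i"
    using hmt_id_hlg[OF X X _ ic i0, of "rmul C X X j"] jj X b by simp
  have "lmul C X X i (- 1) j = b2 C X X X (- 1) (- 1) i j"
    using em_lmul[OF C X X ic jc] by (intro em_eqI[OF C X X lmul_closed[OF C X X ic jc] b]) simp
  then have 2: "hlg R C X X (b2 C X X X (- 1) (- 1) i j) j"
    using hmt_id_hlg[OF X X _ jc j0, of "lmul C X X i"] ii X b by simp
  show ?thesis using hlg_trans[OF X X hlg_sym[OF X X 1] 2] .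
qed

text \<open>If \<open>j\<close> is \<open>i\<close> plus the boundary of \<open>z\<close>, the
  two-input relation shows that multiplication by \<open>z\<close> is a homotopy between the
  multiplications by \<open>i\<close> and by \<open>j\<close>, on either side.\<close>

lemma unit_elt_shift:
  assumes X: "X \<in> Obj C" and i: "is_unit_elt R C X i" and ij: "hlg R C X X j i"
  shows "is_unit_elt R C X j"
proof -
  note ii = i[unfolded is_unit_elt_iff[OF C X]]
  have ic: "i \<in> carrier (sMor C X X (- 1))" and i0: "b1 C X X (- 1) i = \<zero>\<^bsub>sMor C X X 0\<^esub>"
    using ii by simp_all
  obtain z where z: "z \<in> carrier (sMor C X X (- 2))" and jz: "j = i \<oplus>\<^bsub>sMor C X X (- 1)\<^esub> b1 C X X (- 2) z"
    and jc: "j \<in> carrier (sMor C X X (- 1))"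
    using ij hlg_iff[OF X X] by (auto simp: hlg_def)
  have bz: "b1 C X X (- 2) z \<in> carrier (sMor C X X (- 1))" using b1_closed[OF C X X z] by simp
  note l = lin_emb_word[OF ainf_modular[OF C]]
  have "b1 C X X (- 1) j = \<zero>\<^bsub>sMor C X X 0\<^esub>"
  proof -
    interpret K: cocomplex R "sMor C X X" "b1 C X X" by (rule category_complex[OF C X X])
    have "K.em 0 (b1 C X X (- 1) j) = K.em 0 (b1 C X X (- 1) i) + K.em 0 (b1 C X X (- 1) (b1 C X X (- 2) z))"
      unfolding jz by (rule glin_add[OF K.E K.E K.\<delta> ic bz]) simp
    also have "\<dots> = 0" using K.\<delta>\<delta>[OF z] i0 by (simp add: emb_zero[OF K.E])
    finally have "K.em 0 (b1 C X X (- 1) j) = 0" .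
    from trans[OF this emb_zero[OF K.E, symmetric]] show ?thesis
      using b1_closed[OF C X X jc] abelian_groupE(2)[OF ab_of_module[OF K.E]]
      by (intro em_eqI[OF C X X]) simp_all
  qed
  moreover have "cocomplex.hmt R (sMor C Y X) (b1 C Y X) (rmul C Y X j) (\<lambda>d x. x)" if Y: "Y \<in> Obj C" for Y
  proof -
    interpret K: cocomplex R "sMor C Y X" "b1 C Y X" by (rule category_complex[OF C Y X])
    define h where "h d x = b2 C Y X X d (- 2) x z" for d x
    have hc: "h d x \<in> carrier (sMor C Y X (d - 1))" if "x \<in> carrier (sMor C Y X d)" for d x
      using b2_closed[OF C Y X X that z] by (simp add: h_def)
    have hg: "glin R (sMor C Y X) (sMor C Y X) (- 1) h"
      unfolding glin_def using hc b2_comb_left[OF C Y X X _ _ z]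
      by (auto simp: h_def emb_add[OF K.E] emb_smult[OF K.E] module.smult_closed[OF K.E])
    have "K.em d (rmul C Y X i d x) = K.em d (rmul C Y X j d x) + K.em d (b1 C Y X (d - 1) (h d x)) +
      K.em d (h (d + 1) (b1 C Y X d x))" if x: "x \<in> carrier (sMor C Y X d)" for d x
    proof -
      have "K.em d (rmul C Y X j d x) = K.em d (rmul C Y X i d x) + K.em d (b2 C Y X X d (- 1) x (b1 C X X (- 2) z))"
        unfolding jz using lin_add[OF ainf_modular[OF C] lin_tail[OF lin_bop[OF C l[OF Y] Y] Y x] X ic bz, of "[]"] X by simp
      moreover have "K.em d (b2 C Y X X d (- 1) x (b1 C X X (- 2) z)) =
        - K.em d (h (d + 1) (b1 C Y X d x)) - K.em d (b1 C Y X (d - 1) (h d x))"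
        unfolding h_def using rel2_lin[OF C l[OF Y] Y X X x z] by (simp add: sg_def algebra_simps eq_neg_iff_add_eq_0)
      ultimately show ?thesis by simp
    qed
    then have "K.hmt (rmul C Y X i) (rmul C Y X j)" unfolding K.hmt_def using hg by blast
    then show ?thesis using ii Y K.hmt_trans[OF K.hmt_sym] by blast
  qed
  moreover have "cocomplex.hmt R (sMor C X Y) (b1 C X Y) (lmul C X Y j) (\<lambda>d x. x)" if Y: "Y \<in> Obj C" for Y
  proof -
    interpret K: cocomplex R "sMor C X Y" "b1 C X Y" by (rule category_complex[OF C X Y])
    define h where "h d x = b2 C X X Y (- 2) d z x" for d x
    have hc: "h d x \<in> carrier (sMor C X Y (d - 1))" if "x \<in> carrier (sMor C X Y d)" for d x
      using b2_closed[OF C X X Y z that] by (simp add: h_def)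
    have hg: "glin R (sMor C X Y) (sMor C X Y) (- 1) h"
      unfolding glin_def using hc b2_comb_right[OF C X X Y z]
      by (auto simp: h_def emb_add[OF K.E] emb_smult[OF K.E] module.smult_closed[OF K.E])
    have "K.em d (lmul C X Y j d x) = K.em d (lmul C X Y i d x) + K.em d (b1 C X Y (d - 1) (h d x)) +
      K.em d (h (d + 1) (b1 C X Y d x))" if x: "x \<in> carrier (sMor C X Y d)" for d x
    proof -
      have "K.em d (b2 C X X Y (- 1) d j x) = K.em d (b2 C X X Y (- 1) d i x) + K.em d (b2 C X X Y (- 1) d (b1 C X X (- 2) z) x)"
        unfolding jz using lin_add[OF ainf_modular[OF C] lin_bop[OF C l[OF X] X] X ic bz, of "[(Y, d, x)]"] X Y x by simp
      moreover have "sg d (K.em d (b2 C X X Y (- 1) d (b1 C X X (- 2) z) x)) =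
        - K.em d (h (d + 1) (b1 C X Y d x)) - K.em d (b1 C X Y (d - 1) (h d x))"
        unfolding h_def using rel2_lin[OF C l[OF X] X X Y z x] by (simp add: algebra_simps eq_neg_iff_add_eq_0)
      ultimately show ?thesis
        unfolding em_lmul[OF C X Y jc x] em_lmul[OF C X Y ic x] by (simp add: sg_add sg_opp[of "d + 1" d])
    qed
    then have "K.hmt (lmul C X Y j) (lmul C X Y i)" unfolding K.hmt_def using hg by blast
    then show ?thesis using ii Y K.hmt_trans by blast
  qed
  ultimately show ?thesis unfolding is_unit_elt_iff[OF C X] using jc by blast
qed

end

section \<open>The filtration of the transformations by word length\<close>

lemma cut_last:
  assumes "\<And>u v. u @ v = w \<Longrightarrow> v \<noteq> [] \<Longrightarrow> F u v = 0"
  shows "cut F w = F w []"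
  using assms
proof (induction w arbitrary: F)
  case (Cons p w)
  have "cut (\<lambda>u. F (p # u)) w = F (p # w) []" by (rule Cons.IH) (use Cons.prems in auto)
  then show ?case using Cons.prems[of "[]" "p # w"] by simp
qed simp

locale transf =
  fixes R :: "'k ring" and A :: "('k, 'oa, 'ma) ainf_cat" and B :: "('k, 'ob, 'mb) ainf_cat"
  assumes A: "ainf_category R A" and B: "ainf_category R B"
begin

abbreviation "W \<equiv> fun_cat R A B"
abbreviation "T f g d \<equiv> trans_module R A B f g d"
abbreviation "fctr f \<equiv> ainf_functor R A B f"

text \<open>The filtration step of transformations that vanish on words shorter than
  \<open>n\<close>. It is separated and complete, and the operations respect it.\<close>

definition fil :: "nat \<Rightarrow> ('oa, 'ma, 'ob, 'mb) ainf_fun \<Rightarrow> ('oa, 'ma, 'ob, 'mb) ainf_fun \<Rightarrow> int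
    \<Rightarrow> ('oa, 'ma, 'mb) ainf_trans \<Rightarrow> bool" where
  "fil n f g d r \<longleftrightarrow> (\<forall>X w. is_word A X w \<longrightarrow> length w < n \<longrightarrow> rv R B f g d r X w = 0)"

lemma filD: "fil n f g d r \<Longrightarrow> is_word A X w \<Longrightarrow> length w < n \<Longrightarrow> rv R B f g d r X w = 0"
  by (simp add: fil_def)

lemma fil_letter:
  assumes f: "fctr f" and g: "fctr g" and r: "r \<in> carrier (T f g d)" and fil: "fil n f g d r"
    and u: "is_word A X u" "length u < n" and l: "lin R B (fob f X) \<phi>" and z: "is_word B (fob g (wtgt X u)) z"
  shows "\<phi> (rletter g d r X u # z) = 0"
proof -
  let ?M = "sMor B (fob f X) (fob g (wtgt X u)) (wdeg u + d)"
  have X: "X \<in> Obj A" using is_word_src[OF u(1)] .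
  have M: "module R ?M" by (rule trans_fibre_module[OF f g u(1)])
  have "r X u = \<zero>\<^bsub>?M\<^esub>"
    using filD[OF fil u] trans_closed[OF f g r u(1)] emb_inject[OF M, of "r X u" "\<zero>\<^bsub>?M\<^esub>"]
      abelian_groupE(2)[OF ab_of_module[OF M]] by (simp add: rv_eq emb_zero[OF M])
  then show ?thesis
    using lin_zero[OF ainf_modular[OF B] l functor_ob[OF f X] z] by (simp add: rletter_def)
qed

lemma lin_rletter:
  assumes "fctr f" "fctr g" "r \<in> carrier (T f g d)" "is_word A X u" "lin R B (fob f X) \<phi>"
  shows "lin R B (fob g (wtgt X u)) (\<lambda>z. \<phi> (rletter g d r X u # z))"
  unfolding rletter_def
  by (rule lin_tail[OF assms(5) functor_ob[OF assms(1) is_word_src[OF assms(4)]]])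
    (rule trans_closed[OF assms(1-4)])

lemma lin_fletter:
  assumes "fctr f" "is_word A X u" "u \<noteq> []" "lin R B (fob f X) \<phi>"
  shows "lin R B (fob f (wtgt X u)) (\<lambda>z. \<phi> (fletter f X u # z))"
  unfolding fletter_def
  by (rule lin_tail[OF assms(4) functor_ob[OF assms(1) is_word_src[OF assms(2)]]])
    (rule functor_closed[OF assms(1-3)])

lemma th_fil_zero:
  assumes f: "fctr f" and r: "r \<in> carrier (T f g d)" and fil: "fil n f g d r"
    and rs: "is_word W g rs" and w: "is_word A X w" "length w < n" and l: "lin R B (fob f X) \<phi>"
  shows "th f ((g, d, r) # rs) X \<phi> w = 0"
  using w l
proof (induction "length w" arbitrary: X \<phi> w rule: less_induct)
  case less
  note w = less.prems(1,2) and l = less.prems(3)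
  have g: "fctr g" using is_word_src[OF rs] by simp
  have "cut1 (\<lambda>u v. th f ((g, d, r) # rs) (wtgt X u) (\<lambda>z. \<phi> (fletter f X u # z)) v) w = cut1 (\<lambda>u v. 0) w"
  proof (rule cut1_cong)
    fix u v assume uv: "u @ v = w" "u \<noteq> []"
    then have wu: "is_word A X u" "is_word A (wtgt X u) v" using w by (auto simp: is_word_append)
    show "th f ((g, d, r) # rs) (wtgt X u) (\<lambda>z. \<phi> (fletter f X u # z)) v = 0"
      using uv w by (intro less.hyps wu lin_fletter[OF f wu(1) uv(2) l]) auto
  qed
  moreover have "cut (\<lambda>u v. sg (d * wdeg v) (th g rs (wtgt X u) (\<lambda>z. \<phi> (rletter g d r X u # z)) v)) w = cut (\<lambda>u v. 0) w"
  proof (rule cut_cong)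
    fix u v assume uv: "u @ v = w"
    then have wu: "is_word A X u" "is_word A (wtgt X u) v" "length u < n" using w by (auto simp: is_word_append)
    have "th g rs (wtgt X u) (\<lambda>z. \<phi> (rletter g d r X u # z)) v = th g rs (wtgt X u) (\<lambda>z. 0) v"
      by (rule th_cong_word[OF rs wu(2)]) (rule fil_letter[OF f g r fil wu(1,3) l])
    then show "sg (d * wdeg v) (th g rs (wtgt X u) (\<lambda>z. \<phi> (rletter g d r X u # z)) v) = 0" by simp
  qed
  ultimately show ?case by (subst th_rec) simp
qed

text \<open>The leading term: a piece of length less than \<open>n\<close> is killed by
  \<open>r\<close>, so on words of length at most \<open>n\<close> the whole word has to go into
  \<open>r\<close>, leaving nothing to the functors and the later transformations.\<close>

lemma th_fil:
  assumes f: "fctr f" and r: "r \<in> carrier (T f g d)" and fil: "fil n f g d r"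
    and rs: "is_word W g rs" and w: "is_word A X w" "length w \<le> n" and l: "lin R B (fob f X) \<phi>"
  shows "th f ((g, d, r) # rs) X \<phi> w = th g rs (wtgt X w) (\<lambda>z. \<phi> (rletter g d r X w # z)) []"
proof -
  have g: "fctr g" using is_word_src[OF rs] by simp
  have "cut1 (\<lambda>u v. th f ((g, d, r) # rs) (wtgt X u) (\<lambda>z. \<phi> (fletter f X u # z)) v) w = cut1 (\<lambda>u v. 0) w"
  proof (rule cut1_cong)
    fix u v assume uv: "u @ v = w" "u \<noteq> []"
    then have wu: "is_word A X u" "is_word A (wtgt X u) v" using w by (auto simp: is_word_append)
    have "length v < n" using uv w by (cases u) auto
    then show "th f ((g, d, r) # rs) (wtgt X u) (\<lambda>z. \<phi> (fletter f X u # z)) v = 0"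
      by (intro th_fil_zero[OF f r fil rs wu(2)] lin_fletter[OF f wu(1) uv(2) l])
  qed
  moreover define F where "F u v = sg (d * wdeg v) (th g rs (wtgt X u) (\<lambda>z. \<phi> (rletter g d r X u # z)) v)" for u v
  have "cut F w = F w []"
  proof (rule cut_last)
    fix u v assume uv: "u @ v = w" "v \<noteq> []"
    then have wu: "is_word A X u" "is_word A (wtgt X u) v" using w by (auto simp: is_word_append)
    have "length u < n" using uv w by (cases v) auto
    then have "th g rs (wtgt X u) (\<lambda>z. \<phi> (rletter g d r X u # z)) v = th g rs (wtgt X u) (\<lambda>z. 0) v"
      by (intro th_cong_word[OF rs wu(2)] fil_letter[OF f g r fil wu(1) _ l])
    then show "F u v = 0" by (simp add: F_def)
  qed
  ultimately show ?thesis unfolding F_def by (subst th_rec) simp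
qed

lemma th_fil_second_zero:
  assumes f: "fctr f" and q: "q \<in> carrier (T f h e)" and r: "r \<in> carrier (T h g d)" and fil: "fil n h g d r"
    and g: "fctr g" and h: "fctr h" and w: "is_word A X w" "length w < n" and l: "lin R B (fob f X) \<phi>"
  shows "th f [(h, e, q), (g, d, r)] X \<phi> w = 0"
  using w l
proof (induction "length w" arbitrary: X \<phi> w rule: less_induct)
  case less
  note w = less.prems(1,2) and l = less.prems(3)
  have g0: "is_word W g []" using g by simp
  have "cut1 (\<lambda>u v. th f [(h, e, q), (g, d, r)] (wtgt X u) (\<lambda>z. \<phi> (fletter f X u # z)) v) w = cut1 (\<lambda>u v. 0) w"
  proof (rule cut1_cong)
    fix u v assume uv: "u @ v = w" "u \<noteq> []"
    then have wu: "is_word A X u" "is_word A (wtgt X u) v" using w by (auto simp: is_word_append)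
    show "th f [(h, e, q), (g, d, r)] (wtgt X u) (\<lambda>z. \<phi> (fletter f X u # z)) v = 0"
      using uv w by (intro less.hyps wu lin_fletter[OF f wu(1) uv(2) l]) auto
  qed
  moreover have "cut (\<lambda>u v. sg (e * wdeg v) (th h [(g, d, r)] (wtgt X u) (\<lambda>z. \<phi> (rletter h e q X u # z)) v)) w = cut (\<lambda>u v. 0) w"
  proof (rule cut_cong)
    fix u v assume uv: "u @ v = w"
    then have wu: "is_word A X u" "is_word A (wtgt X u) v" "length v < n" using w by (auto simp: is_word_append)
    have "th h [(g, d, r)] (wtgt X u) (\<lambda>z. \<phi> (rletter h e q X u # z)) v = 0"
      by (rule th_fil_zero[OF h r fil g0 wu(2,3) lin_rletter[OF f h q wu(1) l]])
    then show "sg (e * wdeg v) (th h [(g, d, r)] (wtgt X u) (\<lambda>z. \<phi> (rletter h e q X u # z)) v) = 0" by simp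
  qed
  ultimately show ?case by (subst th_rec) simp
qed

text \<open>The leading term when the second transformation is the deep one: it takes the whole
  word, \<open>q\<close> takes the empty word in front of it, and the sign is that of moving
  \<open>q\<close> past the inputs.\<close>

lemma th_fil_second:
  assumes f: "fctr f" and q: "q \<in> carrier (T f h e)" and r: "r \<in> carrier (T h g d)" and fil: "fil n h g d r"
    and g: "fctr g" and h: "fctr h" and w: "is_word A X w" "length w \<le> n" and l: "lin R B (fob f X) \<phi>"
  shows "th f [(h, e, q), (g, d, r)] X \<phi> w = sg (e * wdeg w) (\<phi> [rletter h e q X [], rletter g d r X w])"
proof -
  have g0: "is_word W g []" using g by simp
  have X: "is_word A X []" using is_word_src[OF w(1)] by simp
  have "cut1 (\<lambda>u v. th f [(h, e, q), (g, d, r)] (wtgt X u) (\<lambda>z. \<phi> (fletter f X u # z)) v) w = cut1 (\<lambda>u v. 0) w"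
  proof (rule cut1_cong)
    fix u v assume uv: "u @ v = w" "u \<noteq> []"
    then have wu: "is_word A X u" "is_word A (wtgt X u) v" using w by (auto simp: is_word_append)
    have "length v < n" using uv w by (cases u) auto
    then show "th f [(h, e, q), (g, d, r)] (wtgt X u) (\<lambda>z. \<phi> (fletter f X u # z)) v = 0"
      by (intro th_fil_second_zero[OF f q r fil g h wu(2)] lin_fletter[OF f wu(1) uv(2) l])
  qed
  moreover have "cut1 (\<lambda>u v. sg (e * wdeg v) (th h [(g, d, r)] (wtgt X u) (\<lambda>z. \<phi> (rletter h e q X u # z)) v)) w = cut1 (\<lambda>u v. 0) w"
  proof (rule cut1_cong)
    fix u v assume uv: "u @ v = w" "u \<noteq> []"
    then have wu: "is_word A X u" "is_word A (wtgt X u) v" using w by (auto simp: is_word_append)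
    have "length v < n" using uv w by (cases u) auto
    then have "th h [(g, d, r)] (wtgt X u) (\<lambda>z. \<phi> (rletter h e q X u # z)) v = 0"
      by (rule th_fil_zero[OF h r fil g0 wu(2) _ lin_rletter[OF f h q wu(1) l]])
    then show "sg (e * wdeg v) (th h [(g, d, r)] (wtgt X u) (\<lambda>z. \<phi> (rletter h e q X u # z)) v) = 0" by simp
  qed
  moreover have "th h [(g, d, r)] X (\<lambda>z. \<phi> (rletter h e q X [] # z)) w = \<phi> [rletter h e q X [], rletter g d r X w]"
  proof -
    have "lin R B (fob h X) (\<lambda>z. \<phi> (rletter h e q X [] # z))" using lin_rletter[OF f h q X l] by simp
    from th_fil[OF h r fil g0 w this] show ?thesis by simp
  qed
  ultimately show ?thesis by (subst th_rec) (simp add: cut_cut1)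
qed

lemma rv_b1:
  assumes "fctr f" "fctr g" "r \<in> carrier (T f g d)" "is_word A X w"
  shows "rv R B f g (d + 1) (b1 W f g d r) X w = th f [(g, d, r)] X (bv R B (fob f X)) w - sg d (bh A X (rv R B f g d r X) w)"
  using rv_bop[of R A B f "[(g, d, r)]" X w] assms B by (simp add: b1_def)

lemma rv_b2:
  assumes "fctr f" "fctr h" "fctr g" "q \<in> carrier (T f h e)" "r \<in> carrier (T h g d)" "is_word A X w"
  shows "rv R B f g (e + d + 1) (b2 W f h g e d q r) X w = th f [(h, e, q), (g, d, r)] X (bv R B (fob f X)) w"
  using rv_bop[of R A B f "[(h, e, q), (g, d, r)]" X w] assms B by simp

lemma fil_b1:
  assumes f: "fctr f" and g: "fctr g" and r: "r \<in> carrier (T f g d)" and fil: "fil n f g d r"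
  shows "fil n f g (d + 1) (b1 W f g d r)"
  unfolding fil_def
proof (intro allI impI)
  fix X w assume w: "is_word A X w" "length w < n"
  have "bh A X (rv R B f g d r X) w = bh A X (\<lambda>w. 0) w"
    by (rule bh_cong_word[OF ainf_bclosed[OF A] w(1)]) (use w fil in \<open>simp add: fil_def\<close>)
  then show "rv R B f g (d + 1) (b1 W f g d r) X w = 0"
    using rv_b1[OF f g r w(1)] th_fil_zero[OF f r fil _ w lin_bv[OF B], of "[]"] g by simp
qed

lemma fil_b2_left:
  assumes f: "fctr f" and h: "fctr h" and g: "fctr g" and q: "q \<in> carrier (T f h e)" and r: "r \<in> carrier (T h g d)"
    and fil: "fil n f h e q"
  shows "fil n f g (e + d + 1) (b2 W f h g e d q r)"
  unfolding fil_def
  using rv_b2[OF f h g q r] th_fil_zero[OF f q fil _ _ _ lin_bv[OF B], of "[(g, d, r)]"] g h r by simp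

lemma fil_b2_right:
  assumes f: "fctr f" and h: "fctr h" and g: "fctr g" and q: "q \<in> carrier (T f h e)" and r: "r \<in> carrier (T h g d)"
    and fil: "fil n h g d r"
  shows "fil n f g (e + d + 1) (b2 W f h g e d q r)"
  unfolding fil_def
  using rv_b2[OF f h g q r] th_fil_second_zero[OF f q r fil g h _ _ lin_bv[OF B]] by simp

text \<open>At a word of given length the sequence is constant from the next index on, so the limit
  takes its value there. The words compared in linearity have equal length and hence use the same
  member of the sequence.\<close>

lemma fil_limit:
  assumes f: "fctr f" and g: "fctr g" and s: "\<And>k. s k \<in> carrier (T f g d)"
    and step: "\<And>k. fil k f g d (s (Suc k) \<ominus>\<^bsub>T f g d\<^esub> s k)"
  shows "\<exists>r \<in> carrier (T f g d). \<forall>k. fil k f g d (r \<ominus>\<^bsub>T f g d\<^esub> s k)"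
proof -
  define v where "v k = rv R B f g d (s k)" for k
  have v: "v (Suc k) X w = v k X w" if "is_word A X w" "length w < k" for k X w
    using filD[OF step that] rv_diff[OF f g s s that(1)] by (simp add: v_def)
  have st: "v (k + m) X w = v k X w" if "is_word A X w" "length w < k" for k m X w
    using that by (induction m) (simp_all add: v)
  define r where "r X w = (if is_word A X w then s (Suc (length w)) X w else undefined)" for X w
  have rv: "rv R B f g d r X w = v (Suc (length w)) X w" if "is_word A X w" for X w
    using that by (simp add: rv_eq r_def v_def)
  have "lin R A X (rv R B f g d r X)" for X
  proof (rule linI)
    fix u Y d' x y v' a
    assume *: "a \<in> carrier R" "is_word A X (u @ (Y, d', x) # v')" "is_word A X (u @ (Y, d', y) # v')"
    show "rv R B f g d r X (u @ (Y, d', a \<odot>\<^bsub>sMor A (wtgt X u) Y d'\<^esub> x \<oplus>\<^bsub>sMor A (wtgt X u) Y d'\<^esub> y) # v')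
      = act R a (rv R B f g d r X (u @ (Y, d', x) # v')) + rv R B f g d r X (u @ (Y, d', y) # v')"
      using linD[OF lin_rv[OF f g s] *] * word_comb[OF ainf_modular[OF A] *] by (simp add: rv v_def)
  qed
  then have rc: "r \<in> carrier (T f g d)"
    using trans_closed[OF f g s] by (auto simp: trans_carrier_iff[OF f g] r_def)
  have "fil k f g d (r \<ominus>\<^bsub>T f g d\<^esub> s k)" for k
    unfolding fil_def
  proof (intro allI impI)
    fix X w assume w: "is_word A X w" "length w < k"
    have "v (Suc (length w) + (k - Suc (length w))) X w = v (Suc (length w)) X w" by (rule st) (use w in auto)
    then show "rv R B f g d (r \<ominus>\<^bsub>T f g d\<^esub> s k) X w = 0"
      using w rv_diff[OF f g rc s w(1)] rv[OF w(1)] by (simp add: v_def)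
  qed
  with rc show ?thesis by blast
qed

lemma fil_zero:
  assumes f: "fctr f" and g: "fctr g" and r: "r \<in> carrier (T f g d)" and fil: "\<And>n. fil n f g d r"
  shows "r = \<zero>\<^bsub>T f g d\<^esub>"
proof (rule trans_ext[OF f g r trans_zero_closed[OF f g]])
  fix X w assume "is_word A X w"
  then show "rv R B f g d r X w = rv R B f g d \<zero>\<^bsub>T f g d\<^esub> X w"
    using filD[OF fil, of X w "Suc (length w)"] by (simp add: rv_zero[OF f g])
qed

text \<open>A linear map which is the identity on the associated graded is bijective.\<close>

lemma fil_bij:
  assumes f: "fctr f" and g: "fctr g"
    and cl: "\<And>r. r \<in> carrier (T f g d) \<Longrightarrow> \<psi> r \<in> carrier (T f g d)"
    and diff: "\<And>r q. r \<in> carrier (T f g d) \<Longrightarrow> q \<in> carrier (T f g d) \<Longrightarrow>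
      \<psi> (r \<ominus>\<^bsub>T f g d\<^esub> q) = \<psi> r \<ominus>\<^bsub>T f g d\<^esub> \<psi> q"
    and raise: "\<And>r n X w. r \<in> carrier (T f g d) \<Longrightarrow> fil n f g d r \<Longrightarrow> is_word A X w \<Longrightarrow> length w \<le> n \<Longrightarrow>
      rv R B f g d (\<psi> r) X w = rv R B f g d r X w"
  shows "bij_betw \<psi> (carrier (T f g d)) (carrier (T f g d))"
proof -
  let ?T = "T f g d"
  note TM = trans_module_module[OF f g, of d]
  interpret T: module R ?T by (rule TM)
  have eqz: "a = b" if "a \<in> carrier ?T" "b \<in> carrier ?T" "a \<ominus>\<^bsub>?T\<^esub> b = \<zero>\<^bsub>?T\<^esub>" for a b
    using emb_diff[OF TM that(1,2)] unfolding that(3) emb_zero[OF TM] emb_inject[OF TM that(1,2), symmetric] by simp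
  have raise': "fil (Suc n) f g d (\<psi> r \<ominus>\<^bsub>?T\<^esub> r)" if "r \<in> carrier ?T" "fil n f g d r" for r n
    using raise[OF that] rv_diff[OF f g cl[OF that(1)] that(1)] by (simp add: fil_def less_Suc_eq_le)
  have fil0: "fil 0 f g d r" for r by (simp add: fil_def)
  \<comment> \<open>On words of length \<open>n\<close> a transformation in step \<open>n\<close>
    agrees with its image, so a vanishing image pushes it one step deeper, and thus into all
    steps.\<close>
  have inj: "r = \<zero>\<^bsub>?T\<^esub>" if r: "r \<in> carrier ?T" "\<psi> r = \<zero>\<^bsub>?T\<^esub>" for r
  proof (rule fil_zero[OF f g r(1)])
    fix n show "fil n f g d r"
    proof (induction n)
      case (Suc n)
      show ?case using raise[OF r(1) Suc] by (simp add: fil_def r(2) rv_zero[OF f g] less_Suc_eq_le)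
    qed (rule fil0)
  qed
  show ?thesis
    unfolding bij_betw_def
  proof (intro conjI inj_onI equalityI subsetI)
    fix r q assume rq: "r \<in> carrier ?T" "q \<in> carrier ?T" "\<psi> r = \<psi> q"
    have "\<psi> (r \<ominus>\<^bsub>?T\<^esub> q) = \<psi> r \<ominus>\<^bsub>?T\<^esub> \<psi> q" by (rule diff[OF rq(1,2)])
    also have "\<dots> = \<zero>\<^bsub>?T\<^esub>" using cl[OF rq(2)] unfolding rq(3) T.minus_eq by (rule T.r_neg)
    finally show "r = q" by (rule eqz[OF rq(1,2) inj[OF T.minus_closed[OF rq(1,2)]]])
  next
    fix y assume "y \<in> \<psi> ` carrier ?T" then show "y \<in> carrier ?T" using cl by blast
  next
    fix y assume y: "y \<in> carrier ?T"
    \<comment> \<open>Successive approximation of a preimage of \<open>y\<close>: adding the residue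
      removes its leading term, because \<open>\<psi>\<close> is the identity on leading
      terms.\<close>
    define s where "s = rec_nat \<zero>\<^bsub>?T\<^esub> (\<lambda>_ r. r \<oplus>\<^bsub>?T\<^esub> (y \<ominus>\<^bsub>?T\<^esub> \<psi> r))"
    have s0: "s 0 = \<zero>\<^bsub>?T\<^esub>" and sS: "s (Suc k) = s k \<oplus>\<^bsub>?T\<^esub> (y \<ominus>\<^bsub>?T\<^esub> \<psi> (s k))" for k
      by (simp_all add: s_def)
    have sc: "s k \<in> carrier ?T" for k by (induction k) (simp_all add: s0 sS y cl)
    have res: "fil k f g d (y \<ominus>\<^bsub>?T\<^esub> \<psi> (s k))" for k
    proof (induction k)
      case (Suc k)
      let ?e = "y \<ominus>\<^bsub>?T\<^esub> \<psi> (s k)"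
      have ec: "?e \<in> carrier ?T" by (rule T.minus_closed[OF y cl[OF sc]])
      have "\<psi> (s k) = \<psi> (s (Suc k) \<ominus>\<^bsub>?T\<^esub> ?e)"
      proof -
        have "emb R ?T (s (Suc k) \<ominus>\<^bsub>?T\<^esub> ?e) = emb R ?T (s k)"
          unfolding emb_diff[OF TM sc ec] unfolding sS emb_add[OF TM sc ec] by simp
        then show ?thesis unfolding emb_inject[OF TM T.minus_closed[OF sc ec] sc] by simp
      qed
      also have "\<dots> = \<psi> (s (Suc k)) \<ominus>\<^bsub>?T\<^esub> \<psi> ?e" by (rule diff[OF sc ec])
      finally have eq: "\<psi> (s k) = \<psi> (s (Suc k)) \<ominus>\<^bsub>?T\<^esub> \<psi> ?e" .
      have "rv R B f g d (y \<ominus>\<^bsub>?T\<^esub> \<psi> (s (Suc k))) X w = 0" if w: "is_word A X w" "length w < Suc k" for X w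
        using raise[OF ec Suc w(1)] w arg_cong[OF eq, of "\<lambda>t. rv R B f g d t X w"]
        by (simp add: rv_diff[OF f g] cl sc ec y)
      then show ?case by (simp add: fil_def)
    qed (rule fil0)
    have step: "fil k f g d (s (Suc k) \<ominus>\<^bsub>?T\<^esub> s k)" for k
      using res[of k] unfolding fil_def sS by (simp add: rv_diff[OF f g] rv_add[OF f g] cl sc y)
    from fil_limit[OF f g sc step] obtain r where r: "r \<in> carrier ?T" "\<And>k. fil k f g d (r \<ominus>\<^bsub>?T\<^esub> s k)" by blast
    have "y \<ominus>\<^bsub>?T\<^esub> \<psi> r = \<zero>\<^bsub>?T\<^esub>"
    proof (rule fil_zero[OF f g])
      show "y \<ominus>\<^bsub>?T\<^esub> \<psi> r \<in> carrier ?T" using y cl[OF r(1)] by simp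
      fix k
      have "rv R B f g d (\<psi> r) X w = rv R B f g d (\<psi> (s k)) X w" if w: "is_word A X w" "length w < k" for X w
      proof -
        have rs: "r \<ominus>\<^bsub>?T\<^esub> s k \<in> carrier ?T" using r(1) sc by simp
        have "rv R B f g d (\<psi> (r \<ominus>\<^bsub>?T\<^esub> s k)) X w = rv R B f g d (r \<ominus>\<^bsub>?T\<^esub> s k) X w"
          using raise[OF rs r(2) w(1)] w(2) by simp
        also have "\<dots> = 0" by (rule filD[OF r(2) w])
        finally show ?thesis using w(1) by (simp add: diff[OF r(1) sc] rv_diff[OF f g cl[OF r(1)] cl[OF sc]])
      qed
      then show "fil k f g d (y \<ominus>\<^bsub>?T\<^esub> \<psi> r)"
        using res[of k] unfolding fil_def by (simp add: rv_diff[OF f g] cl sc y r(1))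
    qed
    then have "y = \<psi> r" by (rule eqz[OF y cl[OF r(1)]])
    then show "y \<in> \<psi> ` carrier ?T" using r(1) by blast
  qed
qed

end

section \<open>Leading terms of differentials and multiplications\<close>

context transf
begin

lemma W: "ainf_category R W"
  by (rule fun_cat_ainf[OF A B])

lemma mB: "modular R B" and mW: "modular R W"
  by (rule ainf_modular[OF B], rule ainf_modular[OF W])

lemma trans_comb:
  assumes f: "fctr f" and g: "fctr g" and r: "r \<in> carrier (T f g d)" and a: "a \<in> carrier R"
    and w: "is_word A X (u @ (Y, e, x) # v)" "is_word A X (u @ (Y, e, y) # v)"
  shows "r X (u @ (Y, e, a \<odot>\<^bsub>sMor A (wtgt X u) Y e\<^esub> x \<oplus>\<^bsub>sMor A (wtgt X u) Y e\<^esub> y) # v) =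
    a \<odot>\<^bsub>sMor B (fob f X) (fob g (wtgt Y v)) (wdeg u + (e + wdeg v) + d)\<^esub> r X (u @ (Y, e, x) # v)
      \<oplus>\<^bsub>sMor B (fob f X) (fob g (wtgt Y v)) (wdeg u + (e + wdeg v) + d)\<^esub> r X (u @ (Y, e, y) # v)"
    (is "r X ?c = a \<odot>\<^bsub>?M\<^esub> ?x \<oplus>\<^bsub>?M\<^esub> ?y")
proof -
  have M: "module R ?M" using trans_fibre_module[OF f g w(1)] by simp
  interpret module R ?M by (rule M)
  have c: "?x \<in> carrier ?M" "?y \<in> carrier ?M" "r X ?c \<in> carrier ?M"
    using trans_closed[OF f g r w(1)] trans_closed[OF f g r w(2)]
      trans_closed[OF f g r word_comb[OF ainf_modular[OF A] a w]] by simp_all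
  have "emb R ?M (r X ?c) = emb R ?M (a \<odot>\<^bsub>?M\<^esub> ?x \<oplus>\<^bsub>?M\<^esub> ?y)"
    using linD[OF lin_rv[OF f g r] a w] c a by (simp add: rv_eq emb_add[OF M] emb_smult[OF M])
  then show ?thesis using emb_inject[OF M c(3), of "a \<odot>\<^bsub>?M\<^esub> ?x \<oplus>\<^bsub>?M\<^esub> ?y"] c a by simp
qed

text \<open>
  Applied to these functionals, the \<open>A\<^sub>\<infinity>\<close> relations of the category of functors become identities
  between the values of transformations at a word.
\<close>

definition rvw :: "'oa \<Rightarrow> ('oa, 'ma) word \<Rightarrow> ('oa, 'ma, 'ob, 'mb) ainf_fun
    \<Rightarrow> (('oa, 'ma, 'ob, 'mb) ainf_fun, ('oa, 'ma, 'mb) ainf_trans) word \<Rightarrow> ('k, 'mb) allmod" where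
  "rvw X w f z = (case z of [(g, d, r)] \<Rightarrow> rv R B f g d r X w | _ \<Rightarrow> 0)"

lemma rvw_single [simp]: "rvw X w f [(g, d, r)] = rv R B f g d r X w"
  by (simp add: rvw_def)

lemma lin_rvw:
  assumes f: "fctr f" and w: "is_word A X w"
  shows "lin R W f (rvw X w f)"
proof (rule linI)
  fix u g d r q v a
  assume *: "a \<in> carrier R" "is_word W f (u @ (g, d, r) # v)" "is_word W f (u @ (g, d, q) # v)"
  show "rvw X w f (u @ (g, d, a \<odot>\<^bsub>sMor W (wtgt f u) g d\<^esub> r \<oplus>\<^bsub>sMor W (wtgt f u) g d\<^esub> q) # v) =
    act R a (rvw X w f (u @ (g, d, r) # v)) + rvw X w f (u @ (g, d, q) # v)"
  proof (cases "u = [] \<and> v = []")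
    case True
    then have g: "fctr g" and r: "r \<in> carrier (T f g d)" and q: "q \<in> carrier (T f g d)" using * by simp_all
    interpret module R "T f g d" by (rule trans_module_module[OF f g])
    show ?thesis using True r q *(1) w by (simp add: rv_add[OF f g] rv_smult[OF f g])
  next
    case False
    then have "rvw X w f (u @ (g, d, t) # v) = 0" for t
      by (cases u; cases v) (auto simp: rvw_def split: list.splits)
    then show ?thesis by simp
  qed
qed

lemma T_glinI:
  assumes f: "fctr f" and g: "fctr g"
    and cl: "\<And>d r. r \<in> carrier (T f g d) \<Longrightarrow> h d r \<in> carrier (T f g (d + p))"
    and comb: "\<And>d r q a X w. r \<in> carrier (T f g d) \<Longrightarrow> q \<in> carrier (T f g d) \<Longrightarrow> a \<in> carrier R \<Longrightarrow> is_word A X w \<Longrightarrow>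
      rv R B f g (d + p) (h d (a \<odot>\<^bsub>T f g d\<^esub> r \<oplus>\<^bsub>T f g d\<^esub> q)) X w =
        act R a (rv R B f g (d + p) (h d r) X w) + rv R B f g (d + p) (h d q) X w"
  shows "glin R (T f g) (T f g) p h"
  unfolding glin_def
proof (intro conjI allI ballI)
  fix d r assume r: "r \<in> carrier (T f g d)"
  show "h d r \<in> carrier (T f g (d + p))" by (rule cl[OF r])
  fix q a assume q: "q \<in> carrier (T f g d)" and a: "a \<in> carrier R"
  note M = trans_module_module[OF f g]
  interpret M: module R "T f g d" by (rule M)
  interpret N: module R "T f g (d + p)" by (rule M)
  have "h d (a \<odot>\<^bsub>T f g d\<^esub> r \<oplus>\<^bsub>T f g d\<^esub> q) = a \<odot>\<^bsub>T f g (d + p)\<^esub> h d r \<oplus>\<^bsub>T f g (d + p)\<^esub> h d q"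
    by (rule trans_ext[OF f g, where d = "d + p"])
      (simp_all add: cl comb[OF r q a] rv_add[OF f g] rv_smult[OF f g] r q a)
  then show "emb R (T f g (d + p)) (h d (a \<odot>\<^bsub>T f g d\<^esub> r \<oplus>\<^bsub>T f g d\<^esub> q)) =
      act R a (emb R (T f g (d + p)) (h d r)) + emb R (T f g (d + p)) (h d q)"
    by (simp add: emb_add[OF M] emb_smult[OF M] cl r q a)
qed

text \<open>One graded map of degree -1 on each complex from \<open>f X\<close> to
  \<open>g Y\<close>; no compatibility between different pairs of objects is asked for.\<close>

definition hfam where
  "hfam f g h \<longleftrightarrow> (\<forall>X \<in> Obj A. \<forall>Y \<in> Obj A.
     glin R (sMor B (fob f X) (fob g Y)) (sMor B (fob f X) (fob g Y)) (- 1) (h X Y))"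

text \<open>The maps of the family applied to each value of a transformation. This ignores the
  operations of \<open>A\<close>, so it is a homotopy only up to longer words.\<close>

definition hop :: "('oa \<Rightarrow> 'oa \<Rightarrow> int \<Rightarrow> 'mb \<Rightarrow> 'mb) \<Rightarrow> int \<Rightarrow> ('oa, 'ma, 'mb) ainf_trans \<Rightarrow> ('oa, 'ma, 'mb) ainf_trans" where
  "hop h d r = (\<lambda>X w. if is_word A X w then h X (wtgt X w) (wdeg w + d) (r X w) else undefined)"

text \<open>A member of the family turned into a functional on words, which brings
  \<open>hop\<close> under the general calculus; words other than a single letter ending at
  \<open>g Y\<close> are sent to zero.\<close>

definition hlet where
  "hlet f g h X Y z = (case z of [(Z, D, x)] \<Rightarrow>
     if Z = fob g Y then emb R (sMor B (fob f X) (fob g Y) (D - 1)) (h X Y D x) else 0 | _ \<Rightarrow> 0)"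

context
  fixes f g h
  assumes f: "fctr f" and g: "fctr g" and h: "hfam f g h"
begin

lemma hfamD: "X \<in> Obj A \<Longrightarrow> Y \<in> Obj A \<Longrightarrow>
    glin R (sMor B (fob f X) (fob g Y)) (sMor B (fob f X) (fob g Y)) (- 1) (h X Y)"
  using h by (simp add: hfam_def)

lemma lin_hlet:
  assumes X: "X \<in> Obj A" and Y: "Y \<in> Obj A"
  shows "lin R B (fob f X) (hlet f g h X Y)"
proof (rule linI)
  fix u Z d x y v a
  assume *: "a \<in> carrier R" "is_word B (fob f X) (u @ (Z, d, x) # v)" "is_word B (fob f X) (u @ (Z, d, y) # v)"
  show "hlet f g h X Y (u @ (Z, d, a \<odot>\<^bsub>sMor B (wtgt (fob f X) u) Z d\<^esub> x \<oplus>\<^bsub>sMor B (wtgt (fob f X) u) Z d\<^esub> y) # v) =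
    act R a (hlet f g h X Y (u @ (Z, d, x) # v)) + hlet f g h X Y (u @ (Z, d, y) # v)"
  proof (cases "u = [] \<and> v = [] \<and> Z = fob g Y")
    case True
    then show ?thesis using * glin_comb[OF hfamD[OF X Y], of x d y a "d - 1"] by (simp add: hlet_def)
  next
    case False
    then have "hlet f g h X Y (u @ (Z, d, t) # v) = 0" for t
      by (cases u; cases v) (auto simp: hlet_def split: list.splits)
    then show ?thesis by simp
  qed
qed

lemma rv_hop: "is_word A X w \<Longrightarrow> rv R B f g (d - 1) (hop h d r) X w = hlet f g h X (wtgt X w) [rletter g d r X w]"
  by (simp add: hop_def hlet_def rv_eq rletter_def diff_add_eq add_diff_eq)

lemma hop_closed:
  assumes r: "r \<in> carrier (T f g d)"
  shows "hop h d r \<in> carrier (T f g (d - 1))"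
proof -
  have cl: "hop h d r X w \<in> carrier (sMor B (fob f X) (fob g (wtgt X w)) (wdeg w + (d - 1)))" if w: "is_word A X w" for X w
    using glin_closed[OF hfamD[OF is_word_src[OF w] is_word_tgt[OF w]] trans_closed[OF f g r w] refl] w
    by (simp add: hop_def add_diff_eq)
  have "lin R A X (rv R B f g (d - 1) (hop h d r) X)" for X
  proof (rule linI)
    fix u Y e x y v a
    assume *: "a \<in> carrier R" "is_word A X (u @ (Y, e, x) # v)" "is_word A X (u @ (Y, e, y) # v)"
    note c = word_comb[OF ainf_modular[OF A] *]
    have X: "X \<in> Obj A" and Z: "wtgt Y v \<in> Obj A" using is_word_src[OF *(2)] is_word_tgt[OF *(2)] by simp_all
    show "rv R B f g (d - 1) (hop h d r) X (u @ (Y, e, a \<odot>\<^bsub>sMor A (wtgt X u) Y e\<^esub> x \<oplus>\<^bsub>sMor A (wtgt X u) Y e\<^esub> y) # v)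
      = act R a (rv R B f g (d - 1) (hop h d r) X (u @ (Y, e, x) # v)) + rv R B f g (d - 1) (hop h d r) X (u @ (Y, e, y) # v)"
      unfolding rv_hop[OF c] rv_hop[OF *(2)] rv_hop[OF *(3)] rletter_def trans_comb[OF f g r *]
      using lin_comb[OF mB lin_hlet[OF X Z] functor_ob[OF f X] _ _ _ *(1), where v = "[]"]
        trans_closed[OF f g r *(2)] trans_closed[OF f g r *(3)] functor_ob[OF g Z] by simp
  qed
  then show ?thesis using cl by (simp add: trans_carrier_iff[OF f g] hop_def)
qed

lemma hop_glin: "glin R (T f g) (T f g) (- 1) (hop h)"
proof (rule T_glinI[OF f g])
  show "hop h d r \<in> carrier (T f g (d + - 1))" if "r \<in> carrier (T f g d)" for d r
    using hop_closed[OF that] by simp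
  fix d r q a X w
  assume r: "r \<in> carrier (T f g d)" and q: "q \<in> carrier (T f g d)" and a: "a \<in> carrier R" and w: "is_word A X w"
  interpret module R "T f g d" by (rule trans_module_module[OF f g])
  let ?M = "sMor B (fob f X) (fob g (wtgt X w)) (wdeg w + d)"
  have X: "X \<in> Obj A" and Z: "wtgt X w \<in> Obj A" using is_word_src[OF w] is_word_tgt[OF w] .
  have "(a \<odot>\<^bsub>T f g d\<^esub> r \<oplus>\<^bsub>T f g d\<^esub> q) X w = a \<odot>\<^bsub>?M\<^esub> r X w \<oplus>\<^bsub>?M\<^esub> q X w"
    using w by (simp add: trans_add trans_smult)
  then have "rv R B f g (d - 1) (hop h d (a \<odot>\<^bsub>T f g d\<^esub> r \<oplus>\<^bsub>T f g d\<^esub> q)) X w =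
      act R a (rv R B f g (d - 1) (hop h d r) X w) + rv R B f g (d - 1) (hop h d q) X w"
    unfolding rv_hop[OF w] rletter_def
    using lin_comb[OF mB lin_hlet[OF X Z] functor_ob[OF f X] _ _ _ a, where v = "[]"]
      trans_closed[OF f g r w] trans_closed[OF f g q w] functor_ob[OF g Z] by simp
  then show "rv R B f g (d + - 1) (hop h d (a \<odot>\<^bsub>T f g d\<^esub> r \<oplus>\<^bsub>T f g d\<^esub> q)) X w =
      act R a (rv R B f g (d + - 1) (hop h d r) X w) + rv R B f g (d + - 1) (hop h d q) X w" by simp
qed

lemma fil_hop:
  assumes r: "r \<in> carrier (T f g d)" and fil: "fil n f g d r"
  shows "fil n f g (d - 1) (hop h d r)"
  unfolding fil_def
proof (intro allI impI)
  fix X w assume w: "is_word A X w" "length w < n"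
  have X: "X \<in> Obj A" and Z: "wtgt X w \<in> Obj A" using is_word_src[OF w(1)] is_word_tgt[OF w(1)] .
  show "rv R B f g (d - 1) (hop h d r) X w = 0"
    unfolding rv_hop[OF w(1)]
    by (rule fil_letter[OF f g r fil w lin_hlet[OF X Z]]) (simp add: functor_ob[OF g Z])
qed

text \<open>The leading term of the boundary of \<open>hop\<close> is the boundary of
  \<open>h\<close> in each hom-complex of \<open>B\<close>: by \<open>th_fil\<close> only the
  first-order operation of \<open>B\<close> survives, and the two terms with operations of
  \<open>A\<close> cancel, \<open>hop\<close> having shifted the degree by one.\<close>

lemma hop_boundary:
  assumes r: "r \<in> carrier (T f g d)" and fil: "fil n f g d r" and w: "is_word A X w" "length w \<le> n"
  shows "rv R B f g d (b1 W f g (d - 1) (hop h d r)) X w + rv R B f g d (hop h (d + 1) (b1 W f g d r)) X w =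
    emb R (sMor B (fob f X) (fob g (wtgt X w)) (wdeg w + d))
      (b1 B (fob f X) (fob g (wtgt X w)) (wdeg w + d - 1) (h X (wtgt X w) (wdeg w + d) (r X w))) +
    emb R (sMor B (fob f X) (fob g (wtgt X w)) (wdeg w + d))
      (h X (wtgt X w) (wdeg w + d + 1) (b1 B (fob f X) (fob g (wtgt X w)) (wdeg w + d) (r X w)))"
proof -
  let ?Y = "wtgt X w"
  have X: "X \<in> Obj A" and Z: "?Y \<in> Obj A" using is_word_src[OF w(1)] is_word_tgt[OF w(1)] .
  note l = lin_hlet[OF X Z]
  have g0: "is_word W g []" using g by simp
  have fw: "is_word W f [(g, d, r)]" using f g r by simp
  have bh: "bh A X (rv R B f g (d - 1) (hop h d r) X) w = bh A X (\<lambda>u. hlet f g h X ?Y [rletter g d r X u]) w"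
    by (rule bh_cong_word[OF ainf_bclosed[OF A] w(1)]) (simp add: rv_hop)
  have "rv R B f g d (b1 W f g (d - 1) (hop h d r)) X w =
      bv R B (fob f X) [rletter g (d - 1) (hop h d r) X w] - sg (d - 1) (bh A X (rv R B f g (d - 1) (hop h d r) X) w)"
    using rv_b1[OF f g hop_closed[OF r] w(1)] th_fil[OF f hop_closed[OF r] fil_hop[OF r fil] g0 w lin_bv[OF B]] by simp
  moreover have "rv R B f g d (hop h (d + 1) (b1 W f g d r)) X w =
      hlet f g h X ?Y [(fob g ?Y, wdeg w + d + 1, b1 B (fob f X) (fob g ?Y) (wdeg w + d) (r X w))] -
      sg d (bh A X (\<lambda>u. hlet f g h X ?Y [rletter g d r X u]) w)"
    using rv_hop[OF w(1), of "d + 1" "b1 W f g d r"] fun_cat_bop(2)[OF fw _ w(1) l, of "[]"] functor_ob[OF g Z]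
      th_fil[OF f r fil g0 w lin_bop[OF B l functor_ob[OF f X]]] by (simp add: b1_def rletter_def)
  ultimately show ?thesis
    unfolding bh using w(1)
    by (simp add: bv_eq rletter_def hop_def hlet_def b1_def sg_opp[of "d - 1" d] add_diff_eq)
qed

end

text \<open>Subtracting the boundary of \<open>hop\<close> from \<open>\<Phi>\<close> leaves a chain
  map that is the identity on leading terms, hence bijective by \<open>fil_bij\<close>;
  \<open>idempotent_hmt_id\<close> does the rest.\<close>

lemma hmt_id_of_fibres:
  assumes f: "fctr f" and g: "fctr g" and h: "hfam f g h"
    and ch: "cocomplex.chain R (T f g) (b1 W f g) \<Phi>"
    and id: "cocomplex.hmt R (T f g) (b1 W f g) (\<lambda>d r. \<Phi> d (\<Phi> d r)) \<Phi>"
    and fib: "\<And>n d r X w. r \<in> carrier (T f g d) \<Longrightarrow> fil n f g d r \<Longrightarrow> is_word A X w \<Longrightarrow> length w \<le> n \<Longrightarrow>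
      rv R B f g d (\<Phi> d r) X w = emb R (sMor B (fob f X) (fob g (wtgt X w)) (wdeg w + d)) (\<phi> X (wtgt X w) (wdeg w + d) (r X w))"
    and hm: "\<And>X Y d x. X \<in> Obj A \<Longrightarrow> Y \<in> Obj A \<Longrightarrow> x \<in> carrier (sMor B (fob f X) (fob g Y) d) \<Longrightarrow>
      emb R (sMor B (fob f X) (fob g Y) d) (\<phi> X Y d x) = emb R (sMor B (fob f X) (fob g Y) d) x +
      emb R (sMor B (fob f X) (fob g Y) d) (b1 B (fob f X) (fob g Y) (d - 1) (h X Y d x)) +
      emb R (sMor B (fob f X) (fob g Y) d) (h X Y (d + 1) (b1 B (fob f X) (fob g Y) d x))"
  shows "cocomplex.hmt R (T f g) (b1 W f g) \<Phi> (\<lambda>d r. r)"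
proof -
  have fW: "f \<in> Obj W" "g \<in> Obj W" using f g by simp_all
  interpret K: cocomplex R "T f g" "b1 W f g" using category_complex[OF W fW] unfolding fun_cat_sMor[abs_def] .
  define \<psi> where "\<psi> d r = \<Phi> d r \<ominus>\<^bsub>T f g d\<^esub> (b1 W f g (d - 1) (hop h d r) \<oplus>\<^bsub>T f g d\<^esub> hop h (d + 1) (b1 W f g d r))" for d r
  note hg = hop_glin[OF f g h] and hc = hop_closed[OF f g h]
  have ps: "K.chain \<psi>" by (rule K.chain_homotopic(1)[OF ch hg \<psi>_def])
  have bc: "b1 W f g (d - 1) (hop h d r) \<in> carrier (T f g d)" "hop h (d + 1) (b1 W f g d r) \<in> carrier (T f g d)"
    if "r \<in> carrier (T f g d)" for d r
    using K.delta_closed[OF hc[OF that], of d] hc[OF K.delta_closed[OF that refl]] by simp_all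
  have bij: "bij_betw (\<psi> d) (carrier (T f g d)) (carrier (T f g d))" for d
  proof (rule fil_bij[OF f g])
    note TM = trans_module_module[OF f g, of d]
    interpret T: module R "T f g d" by (rule TM)
    fix r assume r: "r \<in> carrier (T f g d)"
    show "\<psi> d r \<in> carrier (T f g d)" by (rule K.chain_closed[OF ps r])
    show "\<psi> d (r \<ominus>\<^bsub>T f g d\<^esub> q) = \<psi> d r \<ominus>\<^bsub>T f g d\<^esub> \<psi> d q" if q: "q \<in> carrier (T f g d)" for q
    proof -
      have "glin R (T f g) (T f g) 0 \<psi>" using ps by (simp add: K.chain_def)
      from glin_diff[OF K.E K.E this r q, of d] show ?thesis
        using emb_inject[OF TM K.chain_closed[OF ps T.minus_closed[OF r q]]
            T.minus_closed[OF K.chain_closed[OF ps r] K.chain_closed[OF ps q]]]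
          emb_diff[OF TM K.chain_closed[OF ps r] K.chain_closed[OF ps q]] by simp
    qed
    fix n X w assume fil: "fil n f g d r" and w: "is_word A X w" "length w \<le> n"
    have "rv R B f g d (\<psi> d r) X w = rv R B f g d (\<Phi> d r) X w -
      (rv R B f g d (b1 W f g (d - 1) (hop h d r)) X w + rv R B f g d (hop h (d + 1) (b1 W f g d r)) X w)"
      unfolding \<psi>_def rv_diff[OF f g K.chain_closed[OF ch r] T.a_closed[OF bc[OF r]] w(1)]
        rv_add[OF f g bc[OF r] w(1)] ..
    then show "rv R B f g d (\<psi> d r) X w = rv R B f g d r X w"
      unfolding hop_boundary[OF f g h r fil w] fib[OF r fil w]
        hm[OF is_word_src[OF w(1)] is_word_tgt[OF w(1)] trans_closed[OF f g r w(1)]]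
      by (simp add: rv_eq)
  qed
  show ?thesis by (rule K.idempotent_hmt_id[OF ch hg \<psi>_def bij id])
qed

text \<open>The whole word goes into \<open>r\<close>, which leaves the empty word at the target
  object for \<open>i\<close>; so only the component of \<open>i\<close> at an object enters the
  leading term.\<close>

lemma fib_rmul:
  assumes f: "fctr f" and g: "fctr g" and i: "i \<in> carrier (T g g (- 1))"
    and r: "r \<in> carrier (T f g d)" and fil: "fil n f g d r" and w: "is_word A X w" "length w \<le> n"
  shows "rv R B f g d (rmul W f g i d r) X w = emb R (sMor B (fob f X) (fob g (wtgt X w)) (wdeg w + d))
    (rmul B (fob f X) (fob g (wtgt X w)) (i (wtgt X w) []) (wdeg w + d) (r X w))"
proof -
  have X: "X \<in> Obj A" and Z: "wtgt X w \<in> Obj A" using is_word_src[OF w(1)] is_word_tgt[OF w(1)] .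
  have gi: "is_word W g [(g, - 1, i)]" and g0: "is_word W g []" using g i by simp_all
  have l: "lin R B (fob g (wtgt X w)) (\<lambda>z. bv R B (fob f X) (rletter g d r X w # z))"
    by (rule lin_rletter[OF f g r w(1) lin_bv[OF B]])
  have "rv R B f g d (rmul W f g i d r) X w = bv R B (fob f X) [rletter g d r X w, rletter g (- 1) i (wtgt X w) []]"
    using rv_b2[OF f g g r i w(1)] th_fil[OF f r fil gi w lin_bv[OF B]]
      th_fil[OF g i _ g0 _ _ l, of 0 "[]"] Z by (simp add: fil_def)
  then show ?thesis by (simp add: bv_eq rletter_def)
qed

text \<open>Here \<open>i\<close> takes the empty word at the source object. The sign of moving
  \<open>i\<close> past the inputs is what turns the sign of \<open>lmul\<close> in degree
  \<open>d\<close> into the one for the degree of \<open>r X w\<close>.\<close>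

lemma fib_lmul:
  assumes f: "fctr f" and g: "fctr g" and i: "i \<in> carrier (T f f (- 1))"
    and r: "r \<in> carrier (T f g d)" and fil: "fil n f g d r" and w: "is_word A X w" "length w \<le> n"
  shows "rv R B f g d (lmul W f g i d r) X w = emb R (sMor B (fob f X) (fob g (wtgt X w)) (wdeg w + d))
    (lmul B (fob f X) (fob g (wtgt X w)) (i X []) (wdeg w + d) (r X w))"
proof -
  have X: "X \<in> Obj A" and Z: "wtgt X w \<in> Obj A" using is_word_src[OF w(1)] is_word_tgt[OF w(1)] .
  have fW: "f \<in> Obj W" "g \<in> Obj W" using f g by simp_all
  interpret module R "T f g d" by (rule trans_module_module[OF f g])
  have ic: "i X [] \<in> carrier (sMor B (fob f X) (fob f X) (- 1))" using trans_closed[OF f f i, of X "[]"] X by simp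
  have bc: "b2 W f f g (- 1) d i r \<in> carrier (T f g d)" using b2_closed[OF W fW(1,1,2), of i "- 1" r d] i r by simp
  have "rv R B f g d (lmul W f g i d r) X w = sg (d + 1) (rv R B f g d (b2 W f f g (- 1) d i r) X w)"
    unfolding fun_cat_sMor
    using rv_minus[OF f g ksign_closed[OF trans_module_module[OF f g] bc] w(1)] rv_ksign[OF f g bc w(1)]
    by (simp add: sg_def)
  also have "\<dots> = sg (d + 1) (sg (wdeg w) (bv R B (fob f X) [rletter f (- 1) i X [], rletter g d r X w]))"
    using rv_b2[OF f f g i r w(1)] th_fil_second[OF f i r fil g f w lin_bv[OF B]] by (simp add: sg_cong[of "- wdeg w" "wdeg w"])
  also have "\<dots> = sg (wdeg w + d + 1) (bv R B (fob f X) [rletter f (- 1) i X [], rletter g d r X w])"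
    by (auto simp: sg_def)
  finally show ?thesis
    unfolding em_lmul[OF B functor_ob[OF f X] functor_ob[OF g Z] ic trans_closed[OF f g r w(1)]]
    by (simp add: bv_eq rletter_def add.commute[of "- 1"])
qed

end

section \<open>Recognition and existence of units\<close>

context transf
begin

lemma hmt_family:
  assumes f: "fctr f" and g: "fctr g"
    and hm: "\<And>X Y. X \<in> Obj A \<Longrightarrow> Y \<in> Obj A \<Longrightarrow>
      cocomplex.hmt R (sMor B (fob f X) (fob g Y)) (b1 B (fob f X) (fob g Y)) (\<phi> X Y) (\<lambda>d x. x)"
  obtains h where "hfam f g h"
    "\<And>X Y d x. X \<in> Obj A \<Longrightarrow> Y \<in> Obj A \<Longrightarrow> x \<in> carrier (sMor B (fob f X) (fob g Y) d) \<Longrightarrow>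
      emb R (sMor B (fob f X) (fob g Y) d) (\<phi> X Y d x) = emb R (sMor B (fob f X) (fob g Y) d) x +
      emb R (sMor B (fob f X) (fob g Y) d) (b1 B (fob f X) (fob g Y) (d - 1) (h X Y d x)) +
      emb R (sMor B (fob f X) (fob g Y) d) (h X Y (d + 1) (b1 B (fob f X) (fob g Y) d x))"
proof -
  let ?P = "\<lambda>X Y h. glin R (sMor B (fob f X) (fob g Y)) (sMor B (fob f X) (fob g Y)) (- 1) h \<and>
    (\<forall>d. \<forall>x \<in> carrier (sMor B (fob f X) (fob g Y) d).
      emb R (sMor B (fob f X) (fob g Y) d) (\<phi> X Y d x) = emb R (sMor B (fob f X) (fob g Y) d) x +
      emb R (sMor B (fob f X) (fob g Y) d) (b1 B (fob f X) (fob g Y) (d - 1) (h d x)) +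
      emb R (sMor B (fob f X) (fob g Y) d) (h (d + 1) (b1 B (fob f X) (fob g Y) d x)))"
  define h where "h X Y = (SOME h. ?P X Y h)" for X Y
  have "?P X Y (h X Y)" if "X \<in> Obj A" "Y \<in> Obj A" for X Y
  proof -
    have "\<exists>h. ?P X Y h"
      using hm[OF that] cocomplex.hmt_def[OF category_complex[OF B functor_ob[OF f that(1)] functor_ob[OF g that(2)]]] by simp
    then show ?thesis unfolding h_def by (rule someI_ex[of "?P X Y"])
  qed
  then show thesis by (intro that[of h]) (simp_all add: hfam_def)
qed

lemma rmul_family:
  assumes f: "fctr f" and g: "fctr g" and U: "\<And>Y. Y \<in> Obj A \<Longrightarrow> is_unit_elt R B (fob g Y) (U Y)"
    and X: "X \<in> Obj A" and Y: "Y \<in> Obj A"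
  shows "cocomplex.hmt R (sMor B (fob f X) (fob g Y)) (b1 B (fob f X) (fob g Y))
    (rmul B (fob f X) (fob g Y) (U Y)) (\<lambda>d x. x)"
  using U[OF Y] functor_ob[OF f X] unfolding is_unit_elt_iff[OF B functor_ob[OF g Y]] by blast

lemma lmul_family:
  assumes f: "fctr f" and g: "fctr g" and U: "\<And>X. X \<in> Obj A \<Longrightarrow> is_unit_elt R B (fob f X) (U X)"
    and X: "X \<in> Obj A" and Y: "Y \<in> Obj A"
  shows "cocomplex.hmt R (sMor B (fob f X) (fob g Y)) (b1 B (fob f X) (fob g Y))
    (lmul B (fob f X) (fob g Y) (U X)) (\<lambda>d x. x)"
  using U[OF X] functor_ob[OF g Y] unfolding is_unit_elt_iff[OF B functor_ob[OF f X]] by blast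

text \<open>Of the components of \<open>i\<close> only those at objects are tested individually, the
  higher ones enter through idempotency alone. This makes the criterion easy to verify for
  constructed units and for images under postcomposition.\<close>

theorem unit_criterion:
  assumes i: "idem W f i w" and U: "\<And>X. X \<in> Obj A \<Longrightarrow> is_unit_elt R B (fob f X) (i X [])"
  shows "is_unit_elt R W f i"
proof -
  have fW: "f \<in> Obj W" and f: "fctr f" and ic: "i \<in> carrier (sMor W f f (- 1))" and ic': "i \<in> carrier (T f f (- 1))"
    and i0: "b1 W f f (- 1) i = \<zero>\<^bsub>sMor W f f 0\<^esub>"
    using i by (simp_all add: idem_def[OF W])
  show ?thesis
    unfolding is_unit_elt_iff[OF W fW]
  proof (intro conjI ic i0 ballI)
    fix g assume gW: "g \<in> Obj W"
    then have g: "fctr g" by simp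
    obtain h where h: "hfam g f h" "\<And>X Y d x. X \<in> Obj A \<Longrightarrow> Y \<in> Obj A \<Longrightarrow> x \<in> carrier (sMor B (fob g X) (fob f Y) d) \<Longrightarrow>
      emb R (sMor B (fob g X) (fob f Y) d) (rmul B (fob g X) (fob f Y) (i Y []) d x) = emb R (sMor B (fob g X) (fob f Y) d) x +
      emb R (sMor B (fob g X) (fob f Y) d) (b1 B (fob g X) (fob f Y) (d - 1) (h X Y d x)) +
      emb R (sMor B (fob g X) (fob f Y) d) (h X Y (d + 1) (b1 B (fob g X) (fob f Y) d x))"
      using hmt_family[OF g f rmul_family[OF g f U]] by blast
    show "cocomplex.hmt R (sMor W g f) (b1 W g f) (rmul W g f i) (\<lambda>d x. x)"
      using idem_rmul[OF W i gW] unfolding fun_cat_sMor[abs_def]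
      by (rule hmt_id_of_fibres[OF g f h(1) _ _ fib_rmul[OF g f ic'] h(2)])
    obtain k where k: "hfam f g k" "\<And>X Y d x. X \<in> Obj A \<Longrightarrow> Y \<in> Obj A \<Longrightarrow> x \<in> carrier (sMor B (fob f X) (fob g Y) d) \<Longrightarrow>
      emb R (sMor B (fob f X) (fob g Y) d) (lmul B (fob f X) (fob g Y) (i X []) d x) = emb R (sMor B (fob f X) (fob g Y) d) x +
      emb R (sMor B (fob f X) (fob g Y) d) (b1 B (fob f X) (fob g Y) (d - 1) (k X Y d x)) +
      emb R (sMor B (fob f X) (fob g Y) d) (k X Y (d + 1) (b1 B (fob f X) (fob g Y) d x))"
      using hmt_family[OF f g lmul_family[OF f g U]] by blast
    show "cocomplex.hmt R (sMor W f g) (b1 W f g) (lmul W f g i) (\<lambda>d x. x)"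
      using idem_lmul[OF W i gW] fib_lmul[OF f g ic'] unfolding fun_cat_sMor[abs_def]
      by (rule hmt_id_of_fibres[OF f g k(1) _ _ _ k(2)])
  qed
qed

lemma rv_b1_add:
  assumes f: "fctr f" and g: "fctr g" and r: "r \<in> carrier (T f g d)" and q: "q \<in> carrier (T f g d)" and w: "is_word A X w"
  shows "rv R B f g (d + 1) (b1 W f g d (r \<oplus>\<^bsub>T f g d\<^esub> q)) X w =
    rv R B f g (d + 1) (b1 W f g d r) X w + rv R B f g (d + 1) (b1 W f g d q) X w"
  using lin_add[OF mW lin_bop[OF W lin_rvw[OF f w]], where x = r and y = q and Y = g and d = d and v = "[]"] f g r q
  by (simp add: b1_def)

lemma rv_b2_add_left:
  assumes f: "fctr f" and h: "fctr h" and g: "fctr g" and r: "r \<in> carrier (T f h d)" and q: "q \<in> carrier (T f h d)"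
    and s: "s \<in> carrier (T h g e)" and w: "is_word A X w"
  shows "rv R B f g (d + e + 1) (b2 W f h g d e (r \<oplus>\<^bsub>T f h d\<^esub> q) s) X w =
    rv R B f g (d + e + 1) (b2 W f h g d e r s) X w + rv R B f g (d + e + 1) (b2 W f h g d e q s) X w"
  using lin_add[OF mW lin_bop[OF W lin_rvw[OF f w]], where x = r and y = q and Y = h and d = d and v = "[(g, e, s)]"] assms
  by simp

lemma rv_b2_add_right:
  assumes f: "fctr f" and h: "fctr h" and g: "fctr g" and r: "r \<in> carrier (T h g e)" and q: "q \<in> carrier (T h g e)"
    and s: "s \<in> carrier (T f h d)" and w: "is_word A X w"
  shows "rv R B f g (d + e + 1) (b2 W f h g d e s (r \<oplus>\<^bsub>T h g e\<^esub> q)) X w =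
    rv R B f g (d + e + 1) (b2 W f h g d e s r) X w + rv R B f g (d + e + 1) (b2 W f h g d e s q) X w"
  using lin_add[OF mW lin_tail[OF lin_bop[OF W lin_rvw[OF f w]], where x = s and d = d and Y = h],
      where x = r and y = q and Y = g and d = e and v = "[]"] assms by simp

lemma trans_split:
  assumes f: "fctr f" and g: "fctr g" and r: "r \<in> carrier (T f g d)" and s: "s \<in> carrier (T f g d)"
  shows "r = s \<oplus>\<^bsub>T f g d\<^esub> (r \<ominus>\<^bsub>T f g d\<^esub> s)"
proof -
  interpret module R "T f g d" by (rule trans_module_module[OF f g])
  show ?thesis
    by (rule trans_ext[OF f g r a_closed[OF s minus_closed[OF r s]]])
      (simp add: rv_add[OF f g s minus_closed[OF r s]] rv_diff[OF f g r s])
qed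

text \<open>Extension by zero to nonempty words. Linearity concerns only words with a letter, so the
  values at the objects may be prescribed freely.\<close>

lemma point_trans:
  assumes f: "fctr f" and u: "\<And>X. X \<in> Obj A \<Longrightarrow> u X \<in> carrier (sMor B (fob f X) (fob f X) d)"
  obtains r where "r \<in> carrier (T f f d)" "\<And>X. X \<in> Obj A \<Longrightarrow> r X [] = u X"
proof -
  define r where "r X w = (if is_word A X w \<and> w = [] then u X else \<zero>\<^bsub>T f f d\<^esub> X w)" for X w
  have "lin R A X (rv R B f f d r X)" for X
    by (rule lin_cong[OF ainf_modular[OF A] lin_rv[OF f f trans_zero_closed[OF f f]]]) (simp add: rv_eq r_def)
  then have "r \<in> carrier (T f f d)"
    using u trans_closed[OF f f trans_zero_closed[OF f f]] by (auto simp: trans_carrier_iff[OF f f] r_def trans_zero)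
  then show thesis using that by (simp add: r_def)
qed

text \<open>The equations of \<open>idem\<close> for the pair of \<open>i\<close> and
  \<open>w\<close>, required only on words shorter than \<open>n\<close>, with the components of
  \<open>i\<close> at objects fixed to be \<open>U\<close>.\<close>

definition approx where
  "approx U f n i w \<longleftrightarrow> i \<in> carrier (T f f (- 1)) \<and> w \<in> carrier (T f f (- 2)) \<and> (\<forall>X \<in> Obj A. i X [] = U X) \<and>
     fil n f f 0 (b1 W f f (- 1) i) \<and>
     fil n f f (- 1) (b2 W f f f (- 1) (- 1) i i \<ominus>\<^bsub>T f f (- 1)\<^esub> (i \<oplus>\<^bsub>T f f (- 1)\<^esub> b1 W f f (- 2) w))"

context
  fixes f and U :: "'oa \<Rightarrow> 'mb"
  assumes f: "fctr f" and U: "\<And>X. X \<in> Obj A \<Longrightarrow> is_unit_elt R B (fob f X) (U X)"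
begin

lemma W_closed:
  "r \<in> carrier (T f f d) \<Longrightarrow> d + 1 = e \<Longrightarrow> b1 W f f d r \<in> carrier (T f f e)"
  "r \<in> carrier (T f f d) \<Longrightarrow> q \<in> carrier (T f f e) \<Longrightarrow> d + e + 1 = m \<Longrightarrow> b2 W f f f d e r q \<in> carrier (T f f m)"
  using b1_closed[OF W, of f f r d] b2_closed[OF W, of f f f r d q e] f by auto

lemma rv_defect:
  assumes i: "i \<in> carrier (T f f (- 1))" and w: "w \<in> carrier (T f f (- 2))" and u: "is_word A X u"
  shows "rv R B f f (- 1) (b2 W f f f (- 1) (- 1) i i \<ominus>\<^bsub>T f f (- 1)\<^esub> (i \<oplus>\<^bsub>T f f (- 1)\<^esub> b1 W f f (- 2) w)) X u =
    rv R B f f (- 1) (b2 W f f f (- 1) (- 1) i i) X u - rv R B f f (- 1) i X u - rv R B f f (- 1) (b1 W f f (- 2) w) X u"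
proof -
  interpret module R "T f f (- 1)" by (rule trans_module_module[OF f f])
  have c: "b2 W f f f (- 1) (- 1) i i \<in> carrier (T f f (- 1))" "b1 W f f (- 2) w \<in> carrier (T f f (- 1))"
    using W_closed i w by simp_all
  show ?thesis using rv_diff[OF f f c(1) a_closed[OF i c(2)] u] rv_add[OF f f i c(2) u] by simp
qed

text \<open>On empty words the equations are those in \<open>B\<close>: a unit is a cycle, and it is
  idempotent up to the boundary of some \<open>z X\<close>, which becomes the component of
  \<open>w\<close> at \<open>X\<close>.\<close>

lemma approx_base: obtains i w where "approx U f 1 i w"
proof -
  have uc: "U X \<in> carrier (sMor B (fob f X) (fob f X) (- 1))" and u0: "b1 B (fob f X) (fob f X) (- 1) (U X) = \<zero>\<^bsub>sMor B (fob f X) (fob f X) 0\<^esub>"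
    if "X \<in> Obj A" for X
    using U[OF that] by (simp_all add: is_unit_elt_def)
  have "\<exists>z \<in> carrier (sMor B (fob f X) (fob f X) (- 2)). emb R (sMor B (fob f X) (fob f X) (- 1)) (rmul B (fob f X) (fob f X) (U X) (- 1) (U X)) =
    emb R (sMor B (fob f X) (fob f X) (- 1)) (U X) + emb R (sMor B (fob f X) (fob f X) (- 1)) (b1 B (fob f X) (fob f X) (- 2) z)"
    if X: "X \<in> Obj A" for X
    using hmt_id_hlg[OF B functor_ob[OF f X] functor_ob[OF f X] rmul_family[OF f f U X X] uc[OF X] u0[OF X]]
      rmul_closed[OF B functor_ob[OF f X] functor_ob[OF f X] uc[OF X] uc[OF X]] by (simp add: hlg_def)
  then obtain z where z: "\<And>X. X \<in> Obj A \<Longrightarrow> z X \<in> carrier (sMor B (fob f X) (fob f X) (- 2))"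
    "\<And>X. X \<in> Obj A \<Longrightarrow> emb R (sMor B (fob f X) (fob f X) (- 1)) (rmul B (fob f X) (fob f X) (U X) (- 1) (U X)) =
    emb R (sMor B (fob f X) (fob f X) (- 1)) (U X) + emb R (sMor B (fob f X) (fob f X) (- 1)) (b1 B (fob f X) (fob f X) (- 2) (z X))"
    by metis
  obtain i where i: "i \<in> carrier (T f f (- 1))" "\<And>X. X \<in> Obj A \<Longrightarrow> i X [] = U X" by (rule point_trans[OF f uc]) auto
  obtain w where w: "w \<in> carrier (T f f (- 2))" "\<And>X. X \<in> Obj A \<Longrightarrow> w X [] = z X" by (rule point_trans[OF f z(1)]) auto
  have b1e: "rv R B f f (d + 1) (b1 W f f d r) X [] = emb R (sMor B (fob f X) (fob f X) (d + 1)) (b1 B (fob f X) (fob f X) d (r X []))"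
    if r: "r \<in> carrier (T f f d)" and X: "X \<in> Obj A" for d r X
    using rv_b1[OF f f r, of X "[]"] th_fil[OF f r, of 0 "[]" X "[]", OF _ _ _ _ lin_bv[OF B]] X f
    by (simp add: fil_def bv_eq rletter_def b1_def)
  have "rv R B f f 0 (b1 W f f (- 1) i) X [] = 0" if X: "X \<in> Obj A" for X
    using b1e[OF i(1) X] i(2)[OF X] u0[OF X] emb_zero[OF sMor_module[OF B functor_ob[OF f X] functor_ob[OF f X]], of 0] by simp
  moreover have "rv R B f f (- 1) (b2 W f f f (- 1) (- 1) i i \<ominus>\<^bsub>T f f (- 1)\<^esub> (i \<oplus>\<^bsub>T f f (- 1)\<^esub> b1 W f f (- 2) w)) X [] = 0"
    if X: "X \<in> Obj A" for X
  proof -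
    have "is_word A X []" using X by simp
    then show ?thesis
      using rv_defect[OF i(1) w(1), of X "[]"] fib_rmul[OF f f i(1) i(1), of 0 X "[]"] b1e[OF w(1) X] z(2)[OF X] X i(2)[OF X] w(2)[OF X]
      by (simp add: fil_def rv_eq)
  qed
  ultimately have "approx U f 1 i w" using i w by (auto simp: approx_def fil_def)
  then show thesis by (rule that)
qed

text \<open>
  Let \<open>\<lambda> = iB\<^sub>1\<close>, let \<open>c\<close> be the defect of the idempotency equation, and let \<open>K\<close> be the sum of
  the homotopies for the multiplications by the units of \<open>B\<close> on both sides. Up to longer words, the
  relation for \<open>(i \<otimes> i)B\<^sub>2B\<^sub>1\<close> says \<open>cB\<^sub>1 = \<lambda> + \<lambda>KB\<^sub>1\<close>, so that \<open>y = \<lambda>K - c\<close> and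
  \<open>z = yK\<close> correct \<open>i\<close> and \<open>w\<close>.
\<close>

lemma approx_step:
  assumes good: "approx U f n i w" and n: "1 \<le> n"
  obtains i' w' where "approx U f (Suc n) i' w'" "fil n f f (- 1) (i' \<ominus>\<^bsub>T f f (- 1)\<^esub> i)" "fil n f f (- 2) (w' \<ominus>\<^bsub>T f f (- 2)\<^esub> w)"
proof -
  have i: "i \<in> carrier (T f f (- 1))" and w: "w \<in> carrier (T f f (- 2))" and iU: "\<And>X. X \<in> Obj A \<Longrightarrow> i X [] = U X"
    and fl: "fil n f f 0 (b1 W f f (- 1) i)"
    and fc: "fil n f f (- 1) (b2 W f f f (- 1) (- 1) i i \<ominus>\<^bsub>T f f (- 1)\<^esub> (i \<oplus>\<^bsub>T f f (- 1)\<^esub> b1 W f f (- 2) w))"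
    using good by (simp_all add: approx_def)
  have fW: "f \<in> Obj W" and f0: "is_word W f []" using f by simp_all
  interpret T: module R "T f f d" for d by (rule trans_module_module[OF f f])
  obtain hR where hR: "hfam f f hR" "\<And>X Y d x. X \<in> Obj A \<Longrightarrow> Y \<in> Obj A \<Longrightarrow> x \<in> carrier (sMor B (fob f X) (fob f Y) d) \<Longrightarrow>
      emb R (sMor B (fob f X) (fob f Y) d) (rmul B (fob f X) (fob f Y) (U Y) d x) = emb R (sMor B (fob f X) (fob f Y) d) x +
      emb R (sMor B (fob f X) (fob f Y) d) (b1 B (fob f X) (fob f Y) (d - 1) (hR X Y d x)) +
      emb R (sMor B (fob f X) (fob f Y) d) (hR X Y (d + 1) (b1 B (fob f X) (fob f Y) d x))"
    using hmt_family[OF f f rmul_family[OF f f U]] by blast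
  obtain hL where hL: "hfam f f hL" "\<And>X Y d x. X \<in> Obj A \<Longrightarrow> Y \<in> Obj A \<Longrightarrow> x \<in> carrier (sMor B (fob f X) (fob f Y) d) \<Longrightarrow>
      emb R (sMor B (fob f X) (fob f Y) d) (lmul B (fob f X) (fob f Y) (U X) d x) = emb R (sMor B (fob f X) (fob f Y) d) x +
      emb R (sMor B (fob f X) (fob f Y) d) (b1 B (fob f X) (fob f Y) (d - 1) (hL X Y d x)) +
      emb R (sMor B (fob f X) (fob f Y) d) (hL X Y (d + 1) (b1 B (fob f X) (fob f Y) d x))"
    using hmt_family[OF f f lmul_family[OF f f U]] by blast
  let ?V = "\<lambda>d r X u. rv R B f f d r X u"
  let ?b1 = "b1 W f f" let ?b2 = "b2 W f f f"
  note hc = hop_closed[OF f f hR(1)] hop_closed[OF f f hL(1)]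
  \<comment> \<open>On leading terms, multiplication by \<open>i\<close> on either side is the
    identity plus the boundary of \<open>hop\<close>, because the components of \<open>i\<close> at
    objects are units of \<open>B\<close>.\<close>
  have rm: "?V d (?b2 d (- 1) r i) X u = ?V d r X u + (?V d (?b1 (d - 1) (hop hR d r)) X u + ?V d (hop hR (d + 1) (?b1 d r)) X u)"
    and lm: "sg (d + 1) (?V d (?b2 (- 1) d i r) X u) = ?V d r X u + (?V d (?b1 (d - 1) (hop hL d r)) X u + ?V d (hop hL (d + 1) (?b1 d r)) X u)"
    if r: "r \<in> carrier (T f f d)" "fil n f f d r" and u: "is_word A X u" "length u \<le> n" for d r X u
  proof -
    note uX = is_word_src[OF u(1)] and uY = is_word_tgt[OF u(1)]
    show "?V d (?b2 d (- 1) r i) X u = ?V d r X u + (?V d (?b1 (d - 1) (hop hR d r)) X u + ?V d (hop hR (d + 1) (?b1 d r)) X u)"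
      using fib_rmul[OF f f i r u] hR(2)[OF uX uY trans_closed[OF f f r(1) u(1)]] hop_boundary[OF f f hR(1) r u] iU[OF uY]
      by (simp add: rv_eq)
    have bc: "?b2 (- 1) d i r \<in> carrier (T f f d)" by (rule W_closed(2)[OF i r(1)]) simp
    have "sg (d + 1) (?V d (?b2 (- 1) d i r) X u) = ?V d (lmul W f f i d r) X u"
      unfolding fun_cat_sMor
      using rv_minus[OF f f ksign_closed[OF trans_module_module[OF f f] bc] u(1)] rv_ksign[OF f f bc u(1)]
      by (simp add: sg_def)
    then show "sg (d + 1) (?V d (?b2 (- 1) d i r) X u) = ?V d r X u + (?V d (?b1 (d - 1) (hop hL d r)) X u + ?V d (hop hL (d + 1) (?b1 d r)) X u)"
      using fib_lmul[OF f f i r u] hL(2)[OF uX uY trans_closed[OF f f r(1) u(1)]] hop_boundary[OF f f hL(1) r u] iU[OF uX]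
      by (simp add: rv_eq)
  qed
  define l where "l = ?b1 (- 1) i"
  define c where "c = ?b2 (- 1) (- 1) i i \<ominus>\<^bsub>T f f (- 1)\<^esub> (i \<oplus>\<^bsub>T f f (- 1)\<^esub> ?b1 (- 2) w)"
  define y where "y = (hop hR 0 l \<oplus>\<^bsub>T f f (- 1)\<^esub> hop hL 0 l) \<ominus>\<^bsub>T f f (- 1)\<^esub> c"
  define z where "z = hop hR (- 1) y \<oplus>\<^bsub>T f f (- 2)\<^esub> hop hL (- 1) y"
  have lc: "l \<in> carrier (T f f 0)" unfolding l_def by (rule W_closed(1)[OF i]) simp
  have cc: "c \<in> carrier (T f f (- 1))"
    unfolding c_def by (intro T.minus_closed T.a_closed W_closed(1)[OF w] W_closed(2)[OF i i] i) simp_all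
  have kc: "hop hR 0 l \<in> carrier (T f f (- 1))" "hop hL 0 l \<in> carrier (T f f (- 1))" using hc[OF lc] by simp_all
  have yc: "y \<in> carrier (T f f (- 1))" unfolding y_def using kc cc by (intro T.minus_closed T.a_closed)
  have jc: "hop hR (- 1) y \<in> carrier (T f f (- 2))" "hop hL (- 1) y \<in> carrier (T f f (- 2))" using hc[OF yc] by simp_all
  have zc: "z \<in> carrier (T f f (- 2))" unfolding z_def using jc by (intro T.a_closed)
  have ll: "fil n f f 0 l" using fl by (simp add: l_def)
  have lcf: "fil n f f (- 1) c" using fc by (simp add: c_def)
  have yV: "?V (- 1) y X u = ?V (- 1) (hop hR 0 l) X u + ?V (- 1) (hop hL 0 l) X u - ?V (- 1) c X u" if "is_word A X u" for X u
    unfolding y_def rv_diff[OF f f T.a_closed[OF kc] cc that] rv_add[OF f f kc that] ..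
  have zV: "?V (- 2) z X u = ?V (- 2) (hop hR (- 1) y) X u + ?V (- 2) (hop hL (- 1) y) X u" if "is_word A X u" for X u
    unfolding z_def by (rule rv_add[OF f f jc that])
  have fy: "fil n f f (- 1) y"
    using fil_hop[OF f f hR(1) lc ll] fil_hop[OF f f hL(1) lc ll] lcf by (simp add: fil_def yV)
  have fz: "fil n f f (- 2) z"
    using fil_hop[OF f f hR(1) yc fy] fil_hop[OF f f hL(1) yc fy] by (simp add: fil_def zV)
  have b1y: "?b1 (- 1) y \<in> carrier (T f f 0)" by (rule W_closed(1)[OF yc]) simp
  have b1l: "?b1 0 l \<in> carrier (T f f 1)" by (rule W_closed(1)[OF lc]) simp
  have bl0: "?V 1 (?b1 0 l) X u = 0" if "is_word A X u" for X u
    using rel1_lin[OF W lin_rvw[OF f that] fW fW, of i "- 1"] i by (simp add: l_def)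
  then have hl0: "?V 0 (hop h 1 (?b1 0 l)) X u = 0" if "is_word A X u" "hfam f f h" for h X u
    using filD[OF fil_hop[OF f f that(2) b1l, of "Suc (length u)"] that(1)] by (simp add: fil_def)
  have b1_diff: "?V (d + 1) (?b1 d (r \<ominus>\<^bsub>T f f d\<^esub> q)) X u = ?V (d + 1) (?b1 d r) X u - ?V (d + 1) (?b1 d q) X u"
    if "r \<in> carrier (T f f d)" "q \<in> carrier (T f f d)" "is_word A X u" for d r q X u
    using lin_diff[OF mW lin_bop[OF W lin_rvw[OF f that(3)]], where x = r and y = q and Y = f and d = d and v = "[]"] f that
    by (simp add: b1_def)
  \<comment> \<open>The boundary of the product of \<open>i\<close> with itself contains
    \<open>l\<close> once from each side, while the boundary of the summand \<open>i\<close> of the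
    defect removes one copy. The choice of \<open>y\<close> leaves exactly \<open>- l\<close>, which
    makes the corrected \<open>i\<close> a cycle at this length.\<close>
  have key: "?V 0 (?b1 (- 1) y) X u = - ?V 0 l X u" if u: "is_word A X u" "length u \<le> n" for X u
  proof -
    have c1: "?b2 (- 1) (- 1) i i \<in> carrier (T f f (- 1))" "?b1 (- 2) w \<in> carrier (T f f (- 1))"
      by (rule W_closed(2)[OF i i], simp, rule W_closed(1)[OF w], simp)
    have 1: "?V 0 (?b1 (- 1) y) X u = ?V 0 (?b1 (- 1) (hop hR 0 l)) X u + ?V 0 (?b1 (- 1) (hop hL 0 l)) X u - ?V 0 (?b1 (- 1) c) X u"
      unfolding y_def using b1_diff[OF T.a_closed[OF kc] cc u(1)] rv_b1_add[OF f f kc u(1)] by simp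
    have 2: "?V 0 (?b1 (- 1) c) X u = ?V 0 (?b1 (- 1) (?b2 (- 1) (- 1) i i)) X u - ?V 0 l X u"
      unfolding c_def
      using b1_diff[OF c1(1) T.a_closed[OF i c1(2)] u(1)] rv_b1_add[OF f f i c1(2) u(1)]
        rel1_lin[OF W lin_rvw[OF f u(1)] fW fW, of w "- 2"] w by (simp add: l_def)
    have 3: "?V 0 (?b1 (- 1) (?b2 (- 1) (- 1) i i)) X u = ?V 0 (?b2 0 (- 1) l i) X u - ?V 0 (?b2 (- 1) 0 i l) X u"
      using rel2_lin[OF W lin_rvw[OF f u(1)] fW fW fW, of i "- 1" i "- 1"] i by (simp add: l_def sg_def algebra_simps)
    have "- ?V 0 (?b2 (- 1) 0 i l) X u = ?V 0 l X u + ?V 0 (?b1 (- 1) (hop hL 0 l)) X u"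
      using lm[OF lc ll u] hl0[OF u(1) hL(1)] by (simp add: sg_def)
    then have 4: "?V 0 (?b2 (- 1) 0 i l) X u = - (?V 0 l X u + ?V 0 (?b1 (- 1) (hop hL 0 l)) X u)"
      by (metis minus_minus)
    show ?thesis unfolding 1 2 3 4
      using rm[OF lc ll u] hl0[OF u(1) hR(1)] by (simp add: algebra_simps)
  qed
  have fly: "fil (Suc n) f f 0 (?b1 (- 1) y \<oplus>\<^bsub>T f f 0\<^esub> l)"
    by (simp add: fil_def rv_add[OF f f b1y lc] key)
  \<comment> \<open>\<open>hop\<close> preserves the filtration, so the previous identity may be
    used inside it.\<close>
  have hkey: "?V (- 1) (hop h 0 (?b1 (- 1) y)) X u = - ?V (- 1) (hop h 0 l) X u"
    if u: "is_word A X u" "length u \<le> n" and h: "hfam f f h" for h X u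
  proof -
    note hc = hop_closed[OF f f h]
    have cl: "hop h 0 (?b1 (- 1) y) \<in> carrier (T f f (- 1))" "hop h 0 l \<in> carrier (T f f (- 1))" using hc[OF b1y] hc[OF lc] by simp_all
    have cs: "hop h 0 (?b1 (- 1) y \<oplus>\<^bsub>T f f 0\<^esub> l) \<in> carrier (T f f (- 1))" using hc[OF T.a_closed[OF b1y lc]] by simp
    note M = trans_module_module[OF f f]
    have "emb R (T f f (- 1)) (hop h 0 (?b1 (- 1) y \<oplus>\<^bsub>T f f 0\<^esub> l)) = emb R (T f f (- 1)) (hop h 0 (?b1 (- 1) y) \<oplus>\<^bsub>T f f (- 1)\<^esub> hop h 0 l)"
      using glin_add[OF M M hop_glin[OF f f h] b1y lc, of "- 1"] emb_add[OF M cl] by simp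
    then have "hop h 0 (?b1 (- 1) y \<oplus>\<^bsub>T f f 0\<^esub> l) = hop h 0 (?b1 (- 1) y) \<oplus>\<^bsub>T f f (- 1)\<^esub> hop h 0 l"
      unfolding emb_inject[OF M cs T.a_closed[OF cl]] .
    then show ?thesis
      using filD[OF fil_hop[OF f f h T.a_closed[OF b1y lc] fly] u(1)] u(2) rv_add[OF f f cl u(1)]
      by (simp add: eq_neg_iff_add_eq_0)
  qed
  define i' w' where "i' = i \<oplus>\<^bsub>T f f (- 1)\<^esub> y" and "w' = w \<oplus>\<^bsub>T f f (- 2)\<^esub> z"
  have ic: "i' \<in> carrier (T f f (- 1))" and wc: "w' \<in> carrier (T f f (- 2))"
    unfolding i'_def w'_def by (rule T.a_closed[OF i yc], rule T.a_closed[OF w zc])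
  have "approx U f (Suc n) i' w'"
    unfolding approx_def
  proof (intro conjI ballI ic wc)
    show "i' X [] = U X" if X: "X \<in> Obj A" for X
    proof -
      have X0: "is_word A X []" using X by simp
      \<comment> \<open>The correction \<open>y\<close> vanishes on empty words because
        \<open>1 \<le> n\<close>; the components at objects therefore never change.\<close>
      have "?V (- 1) i' X [] = ?V (- 1) i X []" unfolding i'_def
        using rv_add[OF f f i yc X0] filD[OF fy X0] n by simp
      then show ?thesis
        using emb_inject[OF trans_fibre_module[OF f f X0] trans_closed[OF f f ic X0] trans_closed[OF f f i X0]] iU[OF X]
        by (simp add: rv_eq)
    qed
    show "fil (Suc n) f f 0 (?b1 (- 1) i')"
      using rv_b1_add[OF f f i yc] key by (simp add: fil_def i'_def l_def)
    have "?V (- 1) (?b2 (- 1) (- 1) i' i') X u - ?V (- 1) i' X u - ?V (- 1) (?b1 (- 2) w') X u = 0"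
      if u: "is_word A X u" "length u \<le> n" for X u
    proof -
      \<comment> \<open>The quadratic term is deeper: if the first \<open>y\<close> takes the whole
        word, the second receives the empty word, on which it vanishes.\<close>
      have yy: "?V (- 1) (?b2 (- 1) (- 1) y y) X u = 0"
      proof -
        have l: "lin R B (fob f (wtgt X u)) (\<lambda>z. bv R B (fob f X) (rletter f (- 1) y X u # z))"
          by (rule lin_rletter[OF f f yc u(1) lin_bv[OF B]])
        have yw: "is_word W f [(f, - 1, y)]" using f yc by simp
        have "th f [(f, - 1, y)] (wtgt X u) (\<lambda>z. bv R B (fob f X) (rletter f (- 1) y X u # z)) [] = 0"
          by (rule th_fil_zero[OF f yc fy f0 _ _ l]) (use n is_word_tgt[OF u(1)] in simp_all)
        then show ?thesis using rv_b2[OF f f f yc yc u(1)] th_fil[OF f yc fy yw u lin_bv[OF B]] by simp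
      qed
      have Q: "?V (- 1) (?b2 (- 1) (- 1) i' i') X u = ?V (- 1) (?b2 (- 1) (- 1) i i) X u + ?V (- 1) (?b2 (- 1) (- 1) i y) X u +
          (?V (- 1) (?b2 (- 1) (- 1) y i) X u + ?V (- 1) (?b2 (- 1) (- 1) y y) X u)"
        using rv_b2_add_left[OF f f f i yc ic u(1)] rv_b2_add_right[OF f f f i yc i u(1)] rv_b2_add_right[OF f f f i yc yc u(1)]
        by (simp add: i'_def)
      have b: "?V (- 1) (?b1 (- 2) w') X u = ?V (- 1) (?b1 (- 2) w) X u +
          (?V (- 1) (?b1 (- 2) (hop hR (- 1) y)) X u + ?V (- 1) (?b1 (- 2) (hop hL (- 1) y)) X u)"
        using rv_b1_add[OF f f w zc u(1)] rv_b1_add[OF f f jc u(1)] by (simp add: w'_def z_def)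
      have s: "?V (- 1) i' X u = ?V (- 1) i X u + ?V (- 1) y X u"
        unfolding i'_def by (rule rv_add[OF f f i yc u(1)])
      have m: "?V (- 1) (?b2 (- 1) (- 1) y i) X u = ?V (- 1) y X u + (?V (- 1) (?b1 (- 2) (hop hR (- 1) y)) X u - ?V (- 1) (hop hR 0 l) X u)"
        "?V (- 1) (?b2 (- 1) (- 1) i y) X u = ?V (- 1) y X u + (?V (- 1) (?b1 (- 2) (hop hL (- 1) y)) X u - ?V (- 1) (hop hL 0 l) X u)"
        using rm[OF yc fy u] hkey[OF u hR(1)] lm[OF yc fy u] hkey[OF u hL(1)] by simp_all
      show ?thesis
        unfolding Q b s m yy yV[OF u(1)] c_def rv_defect[OF i w u(1)] by (simp add: algebra_simps)
    qed
    then show "fil (Suc n) f f (- 1) (?b2 (- 1) (- 1) i' i' \<ominus>\<^bsub>T f f (- 1)\<^esub> (i' \<oplus>\<^bsub>T f f (- 1)\<^esub> ?b1 (- 2) w'))"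
      by (simp add: fil_def rv_defect[OF ic wc])
  qed
  moreover have "fil n f f (- 1) (i' \<ominus>\<^bsub>T f f (- 1)\<^esub> i)"
    using fy rv_diff[OF f f ic i] rv_add[OF f f i yc] by (simp add: fil_def i'_def)
  moreover have "fil n f f (- 2) (w' \<ominus>\<^bsub>T f f (- 2)\<^esub> w)"
    using fz rv_diff[OF f f wc w] rv_add[OF f f w zc] by (simp add: fil_def w'_def)
  ultimately show thesis by (rule that)
qed

lemma fil_mono: "fil n g g' d r \<Longrightarrow> m \<le> n \<Longrightarrow> fil m g g' d r"
  by (simp add: fil_def)

text \<open>Successive corrections change \<open>i\<close> and \<open>w\<close> only on ever longer
  words, so they converge; the limit satisfies the equations on all words, and
  \<open>unit_criterion\<close> applies to it.\<close>

theorem unit_lift: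
  obtains i where "is_unit_elt R W f i" "\<And>X. X \<in> Obj A \<Longrightarrow> i X [] = U X"
proof -
  obtain i0 w0 where b: "approx U f 1 i0 w0" by (rule approx_base)
  have "\<exists>p. p 0 = (i0, w0) \<and> (\<forall>k. approx U f (Suc k) (fst (p k)) (snd (p k)) \<and>
      fil k f f (- 1) (fst (p (Suc k)) \<ominus>\<^bsub>T f f (- 1)\<^esub> fst (p k)) \<and> fil k f f (- 2) (snd (p (Suc k)) \<ominus>\<^bsub>T f f (- 2)\<^esub> snd (p k)))"
  proof -
    have "\<exists>q. approx U f (Suc (Suc k)) (fst q) (snd q) \<and>
      fil k f f (- 1) (fst q \<ominus>\<^bsub>T f f (- 1)\<^esub> fst p) \<and> fil k f f (- 2) (snd q \<ominus>\<^bsub>T f f (- 2)\<^esub> snd p)"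
      if ap: "approx U f (Suc k) (fst p) (snd p)" for k p
    proof -
      \<comment> \<open>The member with index \<open>k\<close> satisfies the equations on words
        shorter than \<open>Suc k\<close>, since the correction requires at least 1. The differences
        are weakened to step \<open>k\<close>, the form that \<open>fil_limit\<close>
        expects.\<close>
      obtain i' w' where "approx U f (Suc (Suc k)) i' w'" "fil (Suc k) f f (- 1) (i' \<ominus>\<^bsub>T f f (- 1)\<^esub> fst p)"
        "fil (Suc k) f f (- 2) (w' \<ominus>\<^bsub>T f f (- 2)\<^esub> snd p)" by (rule approx_step[OF ap]) simp_all
      then show ?thesis by (intro exI[of _ "(i', w')"]) (auto intro: fil_mono[of "Suc k"])
    qed
    then have "\<exists>p. \<forall>k. (approx U f (Suc k) (fst (p k)) (snd (p k)) \<and> (k = 0 \<longrightarrow> p k = (i0, w0))) \<and>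
      (fil k f f (- 1) (fst (p (Suc k)) \<ominus>\<^bsub>T f f (- 1)\<^esub> fst (p k)) \<and> fil k f f (- 2) (snd (p (Suc k)) \<ominus>\<^bsub>T f f (- 2)\<^esub> snd (p k)))"
      using b by (intro dependent_nat_choice) auto
    then show ?thesis by blast
  qed
  then obtain p where ap: "\<And>k. approx U f (Suc k) (fst (p k)) (snd (p k))"
    and pi: "\<And>k. fil k f f (- 1) (fst (p (Suc k)) \<ominus>\<^bsub>T f f (- 1)\<^esub> fst (p k))"
    and pw: "\<And>k. fil k f f (- 2) (snd (p (Suc k)) \<ominus>\<^bsub>T f f (- 2)\<^esub> snd (p k))" by blast
  let ?i = "\<lambda>k. fst (p k)" and ?w = "\<lambda>k. snd (p k)"
  have ic: "?i k \<in> carrier (T f f (- 1))" and wc: "?w k \<in> carrier (T f f (- 2))" for k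
    using ap[of k] by (simp_all add: approx_def)
  obtain i where i: "i \<in> carrier (T f f (- 1))" "\<And>k. fil k f f (- 1) (i \<ominus>\<^bsub>T f f (- 1)\<^esub> ?i k)"
    using fil_limit[OF f f ic pi] by blast
  obtain w where w: "w \<in> carrier (T f f (- 2))" "\<And>k. fil k f f (- 2) (w \<ominus>\<^bsub>T f f (- 2)\<^esub> ?w k)"
    using fil_limit[OF f f wc pw] by blast
  interpret T: module R "T f f d" for d by (rule trans_module_module[OF f f])
  define di dw where "di k = i \<ominus>\<^bsub>T f f (- 1)\<^esub> ?i k" and "dw k = w \<ominus>\<^bsub>T f f (- 2)\<^esub> ?w k" for k
  have dic: "di k \<in> carrier (T f f (- 1))" and dwc: "dw k \<in> carrier (T f f (- 2))" for k
    unfolding di_def dw_def by (rule T.minus_closed[OF i(1) ic], rule T.minus_closed[OF w(1) wc])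
  have ie: "i = ?i k \<oplus>\<^bsub>T f f (- 1)\<^esub> di k" and we: "w = ?w k \<oplus>\<^bsub>T f f (- 2)\<^esub> dw k" for k
    unfolding di_def dw_def by (rule trans_split[OF f f i(1) ic], rule trans_split[OF f f w(1) wc])
  have fi: "fil k f f (- 1) (di k)" and fw: "fil k f f (- 2) (dw k)" for k
    using i w by (simp_all add: di_def dw_def)
  let ?V = "\<lambda>d r X u. rv R B f f d r X u"
  have iU: "i X [] = U X" if X: "X \<in> Obj A" for X
  proof -
    have X0: "is_word A X []" using X by simp
    have "?V (- 1) i X [] = ?V (- 1) (?i 1) X []"
      using rv_add[OF f f ic dic X0, of 1 1] filD[OF fi[of 1] X0] ie[of 1] by simp
    then show ?thesis
      using emb_inject[OF trans_fibre_module[OF f f X0] trans_closed[OF f f i(1) X0] trans_closed[OF f f ic[of 1] X0]]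
        ap[of 1] X by (simp add: rv_eq approx_def)
  qed
  let ?c = "b2 W f f f (- 1) (- 1) i i" and ?e = "i \<oplus>\<^bsub>T f f (- 1)\<^esub> b1 W f f (- 2) w"
  have b1i: "b1 W f f (- 1) i \<in> carrier (T f f 0)" and cc: "?c \<in> carrier (T f f (- 1))" and ec: "?e \<in> carrier (T f f (- 1))"
    using W_closed(1)[OF i(1)] W_closed(2)[OF i(1) i(1)] T.a_closed[OF i(1) W_closed(1)[OF w(1)]] by simp_all
  \<comment> \<open>Modulo step \<open>k\<close> the boundary of \<open>i\<close> is that of the
    approximation with index \<open>k\<close>, so it lies in every step of the filtration.\<close>
  have 1: "b1 W f f (- 1) i = \<zero>\<^bsub>T f f 0\<^esub>"
  proof (rule fil_zero[OF f f b1i])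
    fix k
    have "fil k f f 0 (b1 W f f (- 1) (?i k))" using ap[of k] by (auto simp: approx_def intro: fil_mono)
    then show "fil k f f 0 (b1 W f f (- 1) i)"
      using fil_b1[OF f f dic fi, of k] rv_b1_add[OF f f ic[of k] dic[of k]] ie[of k] by (simp add: fil_def)
  qed
  have 2: "?c = ?e"
  proof (rule trans_ext[OF f f cc ec])
    fix X u assume u: "is_word A X u"
    \<comment> \<open>At a fixed word the limit may be replaced by an approximation beyond the
      length of that word; \<open>di k\<close> and \<open>dw k\<close> contribute nothing
      there.\<close>
    define k where "k = Suc (length u)"
    have "?V (- 1) (b2 W f f f (- 1) (- 1) (?i k) (?i k)) X u - ?V (- 1) (?i k) X u - ?V (- 1) (b1 W f f (- 2) (?w k)) X u = 0"
      unfolding rv_defect[OF ic wc u, symmetric] using ap[of k] u by (simp add: approx_def fil_def k_def)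
    moreover have "?V (- 1) ?c X u = ?V (- 1) (b2 W f f f (- 1) (- 1) (?i k) (?i k)) X u +
        ?V (- 1) (b2 W f f f (- 1) (- 1) (?i k) (di k)) X u + ?V (- 1) (b2 W f f f (- 1) (- 1) (di k) i) X u"
      using rv_b2_add_left[OF f f f ic[of k] dic[of k] i(1) u] rv_b2_add_right[OF f f f ic[of k] dic[of k] ic[of k] u] ie[of k] by simp
    moreover have "?V (- 1) (b2 W f f f (- 1) (- 1) (?i k) (di k)) X u = 0" "?V (- 1) (b2 W f f f (- 1) (- 1) (di k) i) X u = 0"
      using filD[OF fil_b2_right[OF f f f ic dic fi] u, of k k] filD[OF fil_b2_left[OF f f f dic i(1) fi] u, of k]
      by (simp_all add: k_def)
    moreover have "?V (- 1) (b1 W f f (- 2) w) X u = ?V (- 1) (b1 W f f (- 2) (?w k)) X u"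
      using rv_b1_add[OF f f wc[of k] dwc[of k] u] filD[OF fil_b1[OF f f dwc fw] u, of k] we[of k] by (simp add: k_def)
    moreover have "?V (- 1) i X u = ?V (- 1) (?i k) X u"
      using rv_add[OF f f ic[of k] dic[of k] u] filD[OF fi[of k] u] ie[of k] by (simp add: k_def)
    moreover have "?V (- 1) ?e X u = ?V (- 1) i X u + ?V (- 1) (b1 W f f (- 2) w) X u"
      by (rule rv_add[OF f f i(1) _ u]) (use W_closed(1)[OF w(1)] in simp)
    ultimately show "?V (- 1) ?c X u = ?V (- 1) ?e X u" by (simp add: algebra_simps)
  qed
  have "idem W f i w"
    unfolding idem_def[OF W] using f i(1) w(1) 1 2 by simp
  then have "is_unit_elt R W f i" by (rule unit_criterion) (simp add: iU U)
  then show thesis using iU by (rule that)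
qed

end

text \<open>Isomorphism in the homotopy category is phrased with chosen unit elements, which are
  meaningful only once units exist in the category of functors.\<close>

lemma fun_cat_unital:
  assumes U: "unital_category R B"
  shows "unital_category R W"
  unfolding unital_category_def
proof (intro conjI W ballI)
  fix f assume "f \<in> Obj W"
  then have f: "fctr f" by simp
  have "is_unit_elt R B (fob f X) (unit_elt R B (fob f X))" if "X \<in> Obj A" for X
    using U functor_ob[OF f that] someI_ex[of "is_unit_elt R B (fob f X)"] by (auto simp: unital_category_def unit_elt_def)
  from unit_lift[OF f this] show "\<exists>i. is_unit_elt R W f i" by blast
qed

end

section \<open>Isomorphic objects\<close>

abbreviation mu where "mu C X Y Z x y \<equiv> b2 C X Y Z (- 1) (- 1) x y"

definition cyc :: "('k, 'o, 'm) ainf_cat \<Rightarrow> 'o \<Rightarrow> 'o \<Rightarrow> 'm \<Rightarrow> bool" where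
  "cyc C X Y x \<longleftrightarrow> x \<in> carrier (sMor C X Y (- 1)) \<and> b1 C X Y (- 1) x = \<zero>\<^bsub>sMor C X Y 0\<^esub>"

text \<open>The composite is compared with some unit element instead of the chosen one, which a
  functor has no reason to preserve.\<close>

definition linv where
  "linv R C X Y p q \<longleftrightarrow> (\<exists>i. is_unit_elt R C X i \<and> hlg R C X X (mu C X Y X p q) i)"

text \<open>Isomorphism in the homotopy category in terms of cycles and boundaries, free of classes
  and of the choice of units; all transport arguments are carried out in this form.\<close>

definition hiso :: "'k ring \<Rightarrow> ('k, 'o, 'm) ainf_cat \<Rightarrow> 'o \<Rightarrow> 'o \<Rightarrow> bool" where
  "hiso R C X Y \<longleftrightarrow> X \<in> Obj C \<and> Y \<in> Obj C \<and>
     (\<exists>p q. cyc C X Y p \<and> cyc C Y X q \<and> linv R C X Y p q \<and> linv R C Y X q p)"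

lemma unit_cyc: "is_unit_elt R C X i \<Longrightarrow> cyc C X X i"
  by (simp add: is_unit_elt_def cyc_def)

lemma hiso_sym: "hiso R C X Y \<Longrightarrow> hiso R C Y X"
  unfolding hiso_def by blast

context
  fixes R :: "'k ring" and C :: "('k, 'o, 'm) ainf_cat"
  assumes C: "ainf_category R C"
begin

lemma b2_zero:
  assumes X: "X \<in> Obj C" and Y: "Y \<in> Obj C" and Z: "Z \<in> Obj C"
  shows "y \<in> carrier (sMor C Y Z e) \<Longrightarrow> emb R (sMor C X Z (d + e + 1)) (b2 C X Y Z d e \<zero>\<^bsub>sMor C X Y d\<^esub> y) = 0"
    and "x \<in> carrier (sMor C X Y d) \<Longrightarrow> emb R (sMor C X Z (d + e + 1)) (b2 C X Y Z d e x \<zero>\<^bsub>sMor C Y Z e\<^esub>) = 0"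
  using lin_zero[OF ainf_modular[OF C] lin_bop[OF C lin_emb_word[OF ainf_modular[OF C] X] X] X, where v = "[(Z, e, y)]" and Y = Y and d = d]
    lin_zero[OF ainf_modular[OF C] lin_tail[OF lin_bop[OF C lin_emb_word[OF ainf_modular[OF C] X] X] X, of x Y d] Y, where v = "[]" and Y = Z and d = e] Y Z
  by simp_all

lemma cyc_iff:
  assumes X: "X \<in> Obj C" and Y: "Y \<in> Obj C"
  shows "cyc C X Y x \<longleftrightarrow> x \<in> carrier (sMor C X Y (- 1)) \<and> emb R (sMor C X Y 0) (b1 C X Y (- 1) x) = 0"
proof -
  have E: "module R (sMor C X Y 0)" by (rule sMor_module[OF C X Y])
  have "b1 C X Y (- 1) x \<in> carrier (sMor C X Y 0)" if "x \<in> carrier (sMor C X Y (- 1))"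
    using b1_closed[OF C X Y that] by simp
  then show ?thesis
    unfolding cyc_def using emb_inject[OF E _ abelian_groupE(2)[OF ab_of_module[OF E]]] emb_zero[OF E] by auto
qed

lemma cyc_hlg:
  assumes X: "X \<in> Obj C" and Y: "Y \<in> Obj C" and y: "cyc C X Y y" and h: "hlg R C X Y x y"
  shows "cyc C X Y x"
proof -
  interpret K: cocomplex R "sMor C X Y" "b1 C X Y" by (rule category_complex[OF C X Y])
  obtain z where z: "z \<in> carrier (sMor C X Y (- 2))" "x = y \<oplus>\<^bsub>sMor C X Y (- 1)\<^esub> b1 C X Y (- 2) z"
    and xy: "x \<in> carrier (sMor C X Y (- 1))" "y \<in> carrier (sMor C X Y (- 1))"
    using h hlg_iff[OF C X Y] by (auto simp: hlg_def)
  have bz: "b1 C X Y (- 2) z \<in> carrier (sMor C X Y (- 1))" using b1_closed[OF C X Y z(1)] by simp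
  have "K.em 0 (b1 C X Y (- 1) x) = K.em 0 (b1 C X Y (- 1) y) + K.em 0 (b1 C X Y (- 1) (b1 C X Y (- 2) z))"
    unfolding z(2) by (rule glin_add[OF K.E K.E K.\<delta> xy(2) bz]) simp
  then show ?thesis using K.\<delta>\<delta>[OF z(1)] y xy by (simp add: cyc_iff[OF X Y])
qed

context
  fixes X Y Z
  assumes X: "X \<in> Obj C" and Y: "Y \<in> Obj C" and Z: "Z \<in> Obj C"
begin

lemma mu_closed: "x \<in> carrier (sMor C X Y (- 1)) \<Longrightarrow> y \<in> carrier (sMor C Y Z (- 1)) \<Longrightarrow>
    mu C X Y Z x y \<in> carrier (sMor C X Z (- 1))"
  using b2_closed[OF C X Y Z, of x "- 1" y "- 1"] by simp

lemma cyc_mu: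
  assumes x: "cyc C X Y x" and y: "cyc C Y Z y"
  shows "cyc C X Z (mu C X Y Z x y)"
  using rel2_lin[OF C lin_emb_word[OF ainf_modular[OF C] X] X Y Z, of x "- 1" y "- 1"] x y mu_closed
    b2_zero(1)[OF X Y Z, of y "- 1" 0] b2_zero(2)[OF X Y Z, of x "- 1" 0]
  unfolding cyc_iff[OF X Z] by (simp add: cyc_def)

lemma hlg_mu_left:
  assumes h: "hlg R C X Y x x'" and y: "cyc C Y Z y"
  shows "hlg R C X Z (mu C X Y Z x y) (mu C X Y Z x' y)"
proof -
  obtain z where z: "z \<in> carrier (sMor C X Y (- 2))" "x = x' \<oplus>\<^bsub>sMor C X Y (- 1)\<^esub> b1 C X Y (- 2) z"
    and xx: "x \<in> carrier (sMor C X Y (- 1))" "x' \<in> carrier (sMor C X Y (- 1))"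
    using h hlg_iff[OF C X Y] by (auto simp: hlg_def)
  have yc: "y \<in> carrier (sMor C Y Z (- 1))" using y by (simp add: cyc_def)
  have bz: "b1 C X Y (- 2) z \<in> carrier (sMor C X Y (- 1))" using b1_closed[OF C X Y z(1)] by simp
  note l = lin_emb_word[OF ainf_modular[OF C] X]
  have "emb R (sMor C X Z (- 1)) (mu C X Y Z x y) = emb R (sMor C X Z (- 1)) (mu C X Y Z x' y) +
      emb R (sMor C X Z (- 1)) (mu C X Y Z (b1 C X Y (- 2) z) y)"
    unfolding z(2)
    using lin_add[OF ainf_modular[OF C] lin_bop[OF C l X] X xx(2) bz, of "[(Z, - 1, y)]"] Y Z yc by simp
  moreover have "emb R (sMor C X Z (- 1)) (mu C X Y Z (b1 C X Y (- 2) z) y) =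
      emb R (sMor C X Z (- 1)) (b1 C X Z (- 2) (b2 C X Y Z (- 2) (- 1) z y))"
    using rel2_lin[OF C l X Y Z z(1) yc] b2_zero(2)[OF X Y Z z(1), of 0] y by (simp add: cyc_def sg_def)
  ultimately show ?thesis
    using mu_closed[OF xx(1) yc] mu_closed[OF xx(2) yc] b2_closed[OF C X Y Z z(1) yc]
    unfolding hlg_def by (auto intro!: bexI[of _ "b2 C X Y Z (- 2) (- 1) z y"])
qed

lemma hlg_mu_right:
  assumes x: "cyc C X Y x" and h: "hlg R C Y Z y y'"
  shows "hlg R C X Z (mu C X Y Z x y) (mu C X Y Z x y')"
proof -
  obtain z where z: "z \<in> carrier (sMor C Y Z (- 2))" "y' = y \<oplus>\<^bsub>sMor C Y Z (- 1)\<^esub> b1 C Y Z (- 2) z"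
    and yy: "y \<in> carrier (sMor C Y Z (- 1))" "y' \<in> carrier (sMor C Y Z (- 1))"
    using hlg_sym[OF C Y Z h] hlg_iff[OF C Y Z] by (auto simp: hlg_def)
  have xc: "x \<in> carrier (sMor C X Y (- 1))" using x by (simp add: cyc_def)
  have bz: "b1 C Y Z (- 2) z \<in> carrier (sMor C Y Z (- 1))" using b1_closed[OF C Y Z z(1)] by simp
  note l = lin_emb_word[OF ainf_modular[OF C] X]
  have "emb R (sMor C X Z (- 1)) (mu C X Y Z x y') = emb R (sMor C X Z (- 1)) (mu C X Y Z x y) +
      emb R (sMor C X Z (- 1)) (mu C X Y Z x (b1 C Y Z (- 2) z))"
    unfolding z(2)
    using lin_add[OF ainf_modular[OF C] lin_tail[OF lin_bop[OF C l X] X xc] Y yy(1) bz, of "[]"] Z by simp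
  moreover have "emb R (sMor C X Z (- 1)) (mu C X Y Z x (b1 C Y Z (- 2) z)) +
      emb R (sMor C X Z (- 1)) (b1 C X Z (- 2) (b2 C X Y Z (- 1) (- 2) x z)) = 0"
    using rel2_lin[OF C l X Y Z xc z(1)] b2_zero(1)[OF X Y Z z(1), of 0] x by (simp add: cyc_def)
  ultimately show ?thesis
    using mu_closed[OF xc yy(1)] mu_closed[OF xc yy(2)] b2_closed[OF C X Y Z xc z(1)]
    unfolding hlg_def by (auto intro!: bexI[of _ "b2 C X Y Z (- 1) (- 2) x z"] simp: add.assoc)
qed

lemma hlg_mu:
  assumes "hlg R C X Y x x'" "hlg R C Y Z y y'" "cyc C X Y x'" "cyc C Y Z y'"
  shows "hlg R C X Z (mu C X Y Z x y) (mu C X Y Z x' y')"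
  using hlg_trans[OF C X Z hlg_mu_left[OF assms(1) cyc_hlg[OF Y Z assms(4,2)]] hlg_mu_right[OF assms(3,2)]] .

text \<open>In the three-input relation for cycles all terms containing a differential of an input
  vanish, so the two bracketings differ by the boundary of \<open>b3\<close>.\<close>

lemma hlg_assoc:
  assumes V: "V \<in> Obj C" and x: "cyc C X Y x" and y: "cyc C Y Z y" and z: "cyc C Z V z"
  shows "hlg R C X V (mu C X Z V (mu C X Y Z x y) z) (mu C X Y V x (mu C Y Z V y z))"
proof -
  have c: "x \<in> carrier (sMor C X Y (- 1))" "y \<in> carrier (sMor C Y Z (- 1))" "z \<in> carrier (sMor C Z V (- 1))"
    using x y z by (simp_all add: cyc_def)
  note l = lin_emb_word[OF ainf_modular[OF C] X] and m = ainf_modular[OF C]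
  note lx = lin_tail[OF lin_bop[OF C l X] X c(1)]
  have "emb R (sMor C X V (- 1)) (b3 C X Y Z V 0 (- 1) (- 1) \<zero>\<^bsub>sMor C X Y 0\<^esub> y z) = 0"
    "emb R (sMor C X V (- 1)) (b3 C X Y Z V (- 1) 0 (- 1) x \<zero>\<^bsub>sMor C Y Z 0\<^esub> z) = 0"
    "emb R (sMor C X V (- 1)) (b3 C X Y Z V (- 1) (- 1) 0 x y \<zero>\<^bsub>sMor C Z V 0\<^esub>) = 0"
    using lin_zero[OF m lin_bop[OF C l X] X, where v = "[(Z, - 1, y), (V, - 1, z)]" and Y = Y and d = 0]
      lin_zero[OF m lx Y, where v = "[(V, - 1, z)]" and Y = Z and d = 0]
      lin_zero[OF m lin_tail[OF lx Y c(2)] Z, where v = "[]" and Y = V and d = 0] X Y Z V c by simp_all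
  then have "emb R (sMor C X V (- 1)) (mu C X Y V x (mu C Y Z V y z)) - emb R (sMor C X V (- 1)) (mu C X Z V (mu C X Y Z x y) z) +
      emb R (sMor C X V (- 1)) (b1 C X V (- 2) (b3 C X Y Z V (- 1) (- 1) (- 1) x y z)) = 0"
    using rel3_lin[OF C l X Y Z V c] x y z by (simp add: cyc_def sg_def)
  then have "emb R (sMor C X V (- 1)) (mu C X Z V (mu C X Y Z x y) z) = emb R (sMor C X V (- 1)) (mu C X Y V x (mu C Y Z V y z)) +
      emb R (sMor C X V (- 1)) (b1 C X V (- 2) (b3 C X Y Z V (- 1) (- 1) (- 1) x y z))"
    by (simp add: algebra_simps)
  then show ?thesis
    using b3_closed[OF C X Y Z V c] b2_closed[OF C X Y Z c(1,2)] b2_closed[OF C Y Z V c(2,3)]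
      b2_closed[OF C X Z V _ c(3), of "mu C X Y Z x y" "- 1"] b2_closed[OF C X Y V c(1), of "mu C Y Z V y z" "- 1"]
    unfolding hlg_def
    by (intro conjI bexI[of _ "b3 C X Y Z V (- 1) (- 1) (- 1) x y z"]) simp_all
qed

end

lemma hlg_units:
  assumes X: "X \<in> Obj C" and Y: "Y \<in> Obj C" and x: "cyc C X Y x"
  shows "is_unit_elt R C Y i \<Longrightarrow> hlg R C X Y (mu C X Y Y x i) x"
    and "is_unit_elt R C X j \<Longrightarrow> hlg R C X Y (mu C X X Y j x) x"
proof -
  have xc: "x \<in> carrier (sMor C X Y (- 1))" and x0: "b1 C X Y (- 1) x = \<zero>\<^bsub>sMor C X Y 0\<^esub>" using x by (simp_all add: cyc_def)
  show "hlg R C X Y (mu C X Y Y x i) x" if i: "is_unit_elt R C Y i"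
    using hmt_id_hlg[OF C X Y _ xc x0, of "rmul C X Y i"] i[unfolded is_unit_elt_iff[OF C Y]] X mu_closed[OF X Y Y xc] by simp
  show "hlg R C X Y (mu C X X Y j x) x" if j: "is_unit_elt R C X j"
  proof -
    have jc: "j \<in> carrier (sMor C X X (- 1))" using j by (simp add: is_unit_elt_def)
    note mc = mu_closed[OF X X Y jc xc]
    have "lmul C X Y j (- 1) x = mu C X X Y j x"
      using em_lmul[OF C X Y jc xc] by (intro em_eqI[OF C X Y lmul_closed[OF C X Y jc xc] mc]) simp
    then show ?thesis
      using hmt_id_hlg[OF C X Y _ xc x0, of "lmul C X Y j"] j[unfolded is_unit_elt_iff[OF C X]] Y mc by simp
  qed
qed

text \<open>Reassociating brings \<open>p'\<close> next to \<open>q'\<close>; their product is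
  homologous to a unit and disappears, which leaves the product of \<open>p\<close> and
  \<open>q\<close>.\<close>

lemma linv_comp:
  assumes X: "X \<in> Obj C" and Y: "Y \<in> Obj C" and Z: "Z \<in> Obj C"
    and c: "cyc C X Y p" "cyc C Y X q" "cyc C Y Z p'" "cyc C Z Y q'" and l: "linv R C X Y p q" "linv R C Y Z p' q'"
  shows "linv R C X Z (mu C X Y Z p p') (mu C Z Y X q' q)"
proof -
  obtain i j where i: "is_unit_elt R C X i" "hlg R C X X (mu C X Y X p q) i"
    and j: "is_unit_elt R C Y j" "hlg R C Y Y (mu C Y Z Y p' q') j" using l by (auto simp: linv_def)
  note t = hlg_trans[OF C X X]
  have "hlg R C X X (mu C X Z X (mu C X Y Z p p') (mu C Z Y X q' q)) (mu C X Y X p (mu C Y Z X p' (mu C Z Y X q' q)))"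
    by (rule hlg_assoc[OF X Y Z X c(1,3) cyc_mu[OF Z Y X c(4,2)]])
  moreover have "hlg R C X X (mu C X Y X p (mu C Y Z X p' (mu C Z Y X q' q))) (mu C X Y X p q)"
  proof (rule hlg_mu_right[OF X Y X c(1)])
    have "hlg R C Y X (mu C Y Z X p' (mu C Z Y X q' q)) (mu C Y Y X (mu C Y Z Y p' q') q)"
      by (rule hlg_sym[OF C Y X hlg_assoc[OF Y Z Y X c(3,4,2)]])
    from hlg_trans[OF C Y X hlg_trans[OF C Y X this hlg_mu_left[OF Y Y X j(2) c(2)]] hlg_units(2)[OF Y X c(2) j(1)]]
    show "hlg R C Y X (mu C Y Z X p' (mu C Z Y X q' q)) q" .
  qed
  ultimately have "hlg R C X X (mu C X Z X (mu C X Y Z p p') (mu C Z Y X q' q)) i" by (rule t[OF t i(2)])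
  then show ?thesis using i(1) unfolding linv_def by blast
qed

lemma hiso_trans:
  assumes "hiso R C X Y" "hiso R C Y Z"
  shows "hiso R C X Z"
proof -
  obtain p q p' q' where o: "X \<in> Obj C" "Y \<in> Obj C" "Z \<in> Obj C"
    and c: "cyc C X Y p" "cyc C Y X q" "cyc C Y Z p'" "cyc C Z Y q'"
    and l: "linv R C X Y p q" "linv R C Y X q p" "linv R C Y Z p' q'" "linv R C Z Y q' p'"
    using assms unfolding hiso_def by blast
  show ?thesis
    using o cyc_mu[OF o c(1,3)] cyc_mu[OF o(3,2,1) c(4,2)] linv_comp[OF o c l(1,3)] linv_comp[OF o(3,2,1) c(4,3,2,1) l(4,2)]
    unfolding hiso_def by blast
qed

section \<open>Comparison with the category \<open>H^0\<close>\<close>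

lemma h0_class_eq:
  assumes X: "X \<in> Obj C" and Y: "Y \<in> Obj C" and x: "x \<in> carrier (sMor C X Y (- 1))"
  shows "h0_class C X Y x = {t. hlg R C X Y t x}"
proof -
  have E: "module R (sMor C X Y (- 1))" by (rule sMor_module[OF C X Y])
  have "x \<oplus>\<^bsub>sMor C X Y (- 1)\<^esub> b1 C X Y (- 2) z \<in> carrier (sMor C X Y (- 1))" if "z \<in> carrier (sMor C X Y (- 2))" for z
    using abelian_groupE(1)[OF ab_of_module[OF E] x] b1_closed[OF C X Y that] by simp
  note c = this
  show ?thesis
  proof (intro equalityI subsetI CollectI)
    fix t assume "t \<in> h0_class C X Y x"
    then obtain z where z: "t = x \<oplus>\<^bsub>sMor C X Y (- 1)\<^esub> b1 C X Y (- 2) z" "z \<in> carrier (sMor C X Y (- 2))"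
      unfolding h0_class_def by blast
    show "hlg R C X Y t x" unfolding z(1) hlg_iff[OF C X Y c[OF z(2)] x] using z(2) by blast
  next
    fix t assume "t \<in> {t. hlg R C X Y t x}"
    then have h: "hlg R C X Y t x" by simp
    then have "t \<in> carrier (sMor C X Y (- 1))" by (simp add: hlg_def)
    from h[unfolded hlg_iff[OF C X Y this x]] show "t \<in> h0_class C X Y x" unfolding h0_class_def by blast
  qed
qed

lemma h0_class_eq_iff:
  assumes X: "X \<in> Obj C" and Y: "Y \<in> Obj C" and x: "x \<in> carrier (sMor C X Y (- 1))" and y: "y \<in> carrier (sMor C X Y (- 1))"
  shows "h0_class C X Y x = h0_class C X Y y \<longleftrightarrow> hlg R C X Y x y"
  unfolding h0_class_eq[OF X Y x] h0_class_eq[OF X Y y]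
  using hlg_refl[OF C X Y x] hlg_sym[OF C X Y] hlg_trans[OF C X Y] by blast

lemma h0_comp_class:
  assumes X: "X \<in> Obj C" and Y: "Y \<in> Obj C" and Z: "Z \<in> Obj C" and p: "cyc C X Y p" and q: "cyc C Y Z q"
  shows "h0_comp C X Y Z (h0_class C X Y p) (h0_class C Y Z q) = h0_class C X Z (mu C X Y Z p q)"
proof -
  have pc: "p \<in> carrier (sMor C X Y (- 1))" and qc: "q \<in> carrier (sMor C Y Z (- 1))" using p q by (simp_all add: cyc_def)
  have "h0_class C X Z (mu C X Y Z x y) = h0_class C X Z (mu C X Y Z p q)"
    if "hlg R C X Y x p" "hlg R C Y Z y q" for x y
    using hlg_mu[OF X Y Z that p q] by (subst h0_class_eq_iff[OF X Z]) (simp_all add: hlg_def)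
  note eq = this
  show ?thesis
    unfolding h0_comp_def h0_class_eq[OF X Y pc] h0_class_eq[OF Y Z qc]
  proof (intro equalityI UN_least)
    fix x y assume "x \<in> {t. hlg R C X Y t p}" "y \<in> {t. hlg R C Y Z t q}"
    then have "h0_class C X Z (mu C X Y Z x y) = h0_class C X Z (mu C X Y Z p q)" by (intro eq) simp_all
    then show "h0_class C X Z (mu C X Y Z x y) \<subseteq> h0_class C X Z (mu C X Y Z p q)" by (rule equalityD1)
  next
    show "h0_class C X Z (mu C X Y Z p q) \<subseteq> (\<Union>x\<in>{t. hlg R C X Y t p}. \<Union>y\<in>{t. hlg R C Y Z t q}. h0_class C X Z (mu C X Y Z x y))"
      by (intro subsetI UN_I[of p] UN_I[of q]) (simp_all add: hlg_refl[OF C X Y pc] hlg_refl[OF C Y Z qc])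
  qed
qed

end

lemma unit_elt_unit: "unital_category R C \<Longrightarrow> X \<in> Obj C \<Longrightarrow> is_unit_elt R C X (unit_elt R C X)"
  unfolding unital_category_def unit_elt_def by (meson someI_ex)

text \<open>Units are unique up to boundaries, so being homologous to the chosen unit and being
  homologous to some unit are the same.\<close>

lemma h0_isomorphic_iff:
  assumes U: "unital_category R C"
  shows "h0_isomorphic R C X Y \<longleftrightarrow> hiso R C X Y"
proof (cases "X \<in> Obj C \<and> Y \<in> Obj C")
  case True
  have C: "ainf_category R C" using U by (simp add: unital_category_def)
  have *: "h0_comp C X Y X (h0_class C X Y p) (h0_class C Y X q) = h0_id R C X \<longleftrightarrow> linv R C X Y p q"
    if X: "X \<in> Obj C" and Y: "Y \<in> Obj C" and p: "cyc C X Y p" and q: "cyc C Y X q" for X Y p q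
  proof -
    note u = unit_elt_unit[OF U X]
    have "mu C X Y X p q \<in> carrier (sMor C X X (- 1))" "unit_elt R C X \<in> carrier (sMor C X X (- 1))"
      using cyc_mu[OF C X Y X p q] unit_cyc[OF u] by (simp_all add: cyc_def)
    then have "h0_comp C X Y X (h0_class C X Y p) (h0_class C Y X q) = h0_id R C X \<longleftrightarrow> hlg R C X X (mu C X Y X p q) (unit_elt R C X)"
      unfolding h0_comp_class[OF C X Y X p q] h0_id_def by (rule h0_class_eq_iff[OF C X X])
    moreover have "hlg R C X X t (unit_elt R C X) \<longleftrightarrow> (\<exists>i. is_unit_elt R C X i \<and> hlg R C X X t i)" for t
    proof
      assume "\<exists>i. is_unit_elt R C X i \<and> hlg R C X X t i"
      then obtain i where i: "is_unit_elt R C X i" "hlg R C X X t i" by blast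
      show "hlg R C X X t (unit_elt R C X)" by (rule hlg_trans[OF C X X i(2) unit_elt_hlg[OF C X i(1) u]])
    qed (use u in blast)
    ultimately show ?thesis unfolding linv_def by simp
  qed
  have h: "h0_hom C X Y = h0_class C X Y ` {x. cyc C X Y x}" for X Y by (simp add: h0_hom_def cyc_def)
  have XY: "X \<in> Obj C" "Y \<in> Obj C" using True by simp_all
  show ?thesis
    unfolding h0_isomorphic_def hiso_def h bex_simps(7) mem_Collect_eq
    using XY *[OF XY] *[OF XY(2,1)] by (intro conj_cong refl) blast
qed (auto simp: h0_isomorphic_def hiso_def)

text \<open>Collects what a map on cycles must respect to transport isomorphisms. It covers the
  first components of functors and also the evaluation of transformations at an object, which is not
  set up as a functor here.\<close>

lemma hiso_map:
  assumes D: "ainf_category R D" and i: "hiso R C X Y" and o: "ob X \<in> Obj D" "ob Y \<in> Obj D"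
    and cyc: "\<And>U V x. U \<in> {X, Y} \<Longrightarrow> V \<in> {X, Y} \<Longrightarrow> cyc C U V x \<Longrightarrow> cyc D (ob U) (ob V) (m U V x)"
    and hlg: "\<And>U x y. U \<in> {X, Y} \<Longrightarrow> hlg R C U U x y \<Longrightarrow> hlg R D (ob U) (ob U) (m U U x) (m U U y)"
    and mu: "\<And>U V x y. U \<in> {X, Y} \<Longrightarrow> V \<in> {X, Y} \<Longrightarrow> cyc C U V x \<Longrightarrow> cyc C V U y \<Longrightarrow>
      hlg R D (ob U) (ob U) (mu D (ob U) (ob V) (ob U) (m U V x) (m V U y)) (m U U (mu C U V U x y))"
    and unit: "\<And>U i. U \<in> {X, Y} \<Longrightarrow> is_unit_elt R C U i \<Longrightarrow> is_unit_elt R D (ob U) (m U U i)"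
  shows "hiso R D (ob X) (ob Y)"
proof -
  obtain p q where pq: "cyc C X Y p" "cyc C Y X q" "linv R C X Y p q" "linv R C Y X q p" using i by (auto simp: hiso_def)
  have *: "linv R D (ob U) (ob V) (m U V p) (m V U q)"
    if U: "U \<in> {X, Y}" "V \<in> {X, Y}" "cyc C U V p" "cyc C V U q" "linv R C U V p q" for U V p q
  proof -
    obtain j where j: "is_unit_elt R C U j" "hlg R C U U (mu C U V U p q) j" using U(5) by (auto simp: linv_def)
    have "ob U \<in> Obj D" using U(1) o by auto
    then have "hlg R D (ob U) (ob U) (mu D (ob U) (ob V) (ob U) (m U V p) (m V U q)) (m U U j)"
      using hlg_trans[OF D _ _ mu[OF U(1-4)] hlg[OF U(1) j(2)]] by simp
    then show ?thesis unfolding linv_def using unit[OF U(1) j(1)] by blast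
  qed
  have XY: "X \<in> {X, Y}" "Y \<in> {X, Y}" by simp_all
  show ?thesis
    unfolding hiso_def
    using o cyc[OF XY pq(1)] cyc[OF XY(2,1) pq(2)] *[OF XY pq(1-3)] *[OF XY(2,1) pq(2,1,4)] by blast
qed

section \<open>Functors and isomorphisms\<close>

context
  fixes R :: "'k ring" and A :: "('k, 'oa, 'ma) ainf_cat" and B :: "('k, 'ob, 'mb) ainf_cat" and F
  assumes F: "ainf_functor R A B F"
begin

lemma AB: "ainf_category R A" "ainf_category R B"
  using F by (simp_all add: functor_cats)

lemma functor1_closed: "X \<in> Obj A \<Longrightarrow> Y \<in> Obj A \<Longrightarrow> x \<in> carrier (sMor A X Y d) \<Longrightarrow>
    fmp F X [(Y, d, x)] \<in> carrier (sMor B (fob F X) (fob F Y) d)"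
  using functor_closed[OF F, of X "[(Y, d, x)]"] by simp

lemma functor_b1:
  assumes "X \<in> Obj A" "Y \<in> Obj A" "x \<in> carrier (sMor A X Y d)"
  shows "emb R (sMor B (fob F X) (fob F Y) (d + 1)) (b1 B (fob F X) (fob F Y) d (fmp F X [(Y, d, x)])) =
    emb R (sMor B (fob F X) (fob F Y) (d + 1)) (fmp F X [(Y, d + 1, b1 A X Y d x)])"
  using functor_fv_eq[OF F, of X "[(Y, d, x)]"] th_rec[of F "[]" X "bv R B (fob F X)" "[(Y, d, x)]"] assms
  by (simp add: bh_cut1_Cons bv_eq fv_eq b1_def fletter_def)

lemma functor_hlg:
  assumes X: "X \<in> Obj A" and Y: "Y \<in> Obj A" and h: "hlg R A X Y x y"
  shows "hlg R B (fob F X) (fob F Y) (fmp F X [(Y, - 1, x)]) (fmp F X [(Y, - 1, y)])"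
proof -
  obtain z where z: "z \<in> carrier (sMor A X Y (- 2))" "x = y \<oplus>\<^bsub>sMor A X Y (- 1)\<^esub> b1 A X Y (- 2) z"
    and xy: "x \<in> carrier (sMor A X Y (- 1))" "y \<in> carrier (sMor A X Y (- 1))"
    using h hlg_iff[OF AB(1) X Y] by (auto simp: hlg_def)
  have bz: "b1 A X Y (- 2) z \<in> carrier (sMor A X Y (- 1))" using b1_closed[OF AB(1) X Y z(1)] by simp
  have "emb R (sMor B (fob F X) (fob F Y) (- 1)) (fmp F X [(Y, - 1, x)]) = emb R (sMor B (fob F X) (fob F Y) (- 1)) (fmp F X [(Y, - 1, y)]) +
      emb R (sMor B (fob F X) (fob F Y) (- 1)) (b1 B (fob F X) (fob F Y) (- 2) (fmp F X [(Y, - 2, z)]))"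
    using lin_add[OF ainf_modular[OF AB(1)] lin_fv[OF F] X xy(2) bz, of "[]"] functor_b1[OF X Y z(1)] Y
    unfolding z(2) by (simp add: fv_eq)
  then show ?thesis using functor1_closed[OF X Y z(1)] functor1_closed[OF X Y] xy unfolding hlg_def by blast
qed

lemma functor_cyc:
  assumes X: "X \<in> Obj A" and Y: "Y \<in> Obj A" and x: "cyc A X Y x"
  shows "cyc B (fob F X) (fob F Y) (fmp F X [(Y, - 1, x)])"
  using functor_b1[OF X Y, of x "- 1"] functor1_closed[OF X Y, of x "- 1"] x
    lin_zero[OF ainf_modular[OF AB(1)] lin_fv[OF F] X, where v = "[]" and Y = Y and d = 0] Y
  unfolding cyc_iff[OF AB(2) functor_ob[OF F X] functor_ob[OF F Y]] by (simp add: cyc_def fv_eq)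

text \<open>In the functor equation for two cycles the terms with differentials of the inputs
  vanish, and the second component of \<open>F\<close> supplies the primitive.\<close>

lemma functor_mu:
  assumes X: "X \<in> Obj A" and Y: "Y \<in> Obj A" and Z: "Z \<in> Obj A" and x: "cyc A X Y x" and y: "cyc A Y Z y"
  shows "hlg R B (fob F X) (fob F Z)
    (mu B (fob F X) (fob F Y) (fob F Z) (fmp F X [(Y, - 1, x)]) (fmp F Y [(Z, - 1, y)])) (fmp F X [(Z, - 1, mu A X Y Z x y)])"
proof -
  let ?w = "[(Y, - 1, x), (Z, - 1, y)]" and ?e = "emb R (sMor B (fob F X) (fob F Z) (- 1))"
  note o = functor_ob[OF F X] functor_ob[OF F Y] functor_ob[OF F Z]
  have c: "x \<in> carrier (sMor A X Y (- 1))" "y \<in> carrier (sMor A Y Z (- 1))" using x y by (simp_all add: cyc_def)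
  note l = lin_fv[OF F] and m = ainf_modular[OF AB(1)]
  have "?e (fmp F X [(Y, 0, \<zero>\<^bsub>sMor A X Y 0\<^esub>), (Z, - 1, y)]) = 0" "?e (fmp F X [(Y, - 1, x), (Z, 0, \<zero>\<^bsub>sMor A Y Z 0\<^esub>)]) = 0"
    using lin_zero[OF m l X, where v = "[(Z, - 1, y)]" and Y = Y and d = 0]
      lin_zero[OF m lin_tail[OF l X c(1)] Y, where v = "[]" and Y = Z and d = 0] c Y Z by (simp_all add: fv_eq)
  then have "?e (fmp F X [(Z, - 1, mu A X Y Z x y)]) =
      ?e (mu B (fob F X) (fob F Y) (fob F Z) (fmp F X [(Y, - 1, x)]) (fmp F Y [(Z, - 1, y)])) +
      ?e (b1 B (fob F X) (fob F Z) (- 2) (fmp F X ?w))"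
    using functor_fv_eq[OF F, of X ?w] th_rec[of F "[]" X "bv R B (fob F X)" ?w]
      th_rec[of F "[]" Y "\<lambda>z. bv R B (fob F X) (fletter F X [(Y, - 1, x)] # z)" "[(Z, - 1, y)]"] X Y Z x y
    by (simp add: bh_cut1_Cons bv_eq fv_eq b1_def fletter_def cyc_def)
  moreover have "fmp F X ?w \<in> carrier (sMor B (fob F X) (fob F Z) (- 2))" using functor_closed[OF F, of X ?w] X Y Z c by simp
  ultimately have "hlg R B (fob F X) (fob F Z) (fmp F X [(Z, - 1, mu A X Y Z x y)])
      (mu B (fob F X) (fob F Y) (fob F Z) (fmp F X [(Y, - 1, x)]) (fmp F Y [(Z, - 1, y)]))"
    unfolding hlg_def using functor1_closed[OF X Z mu_closed[OF AB(1) X Y Z c]]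
      mu_closed[OF AB(2) o functor1_closed[OF X Y c(1)] functor1_closed[OF Y Z c(2)]] by blast
  then show ?thesis by (rule hlg_sym[OF AB(2) o(1,3)])
qed

text \<open>The image of a unit under any functor is a homotopy idempotent, whether or not the
  functor is unital; this is the half of the unit criterion that comes for free.\<close>

lemma functor_idem:
  assumes X: "X \<in> Obj A" and i: "is_unit_elt R A X i"
  obtains w where "idem B (fob F X) (fmp F X [(X, - 1, i)]) w"
proof -
  let ?j = "fmp F X [(X, - 1, i)]" and ?X = "fob F X"
  have "hlg R B ?X ?X (mu B ?X ?X ?X ?j ?j) ?j"
    by (rule hlg_trans[OF AB(2) functor_ob[OF F X] functor_ob[OF F X] functor_mu[OF X X X unit_cyc[OF i] unit_cyc[OF i]]
          functor_hlg[OF X X hlg_units(1)[OF AB(1) X X unit_cyc[OF i] i]]])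
  moreover have "?j \<in> carrier (sMor B ?X ?X (- 1))" "mu B ?X ?X ?X ?j ?j \<in> carrier (sMor B ?X ?X (- 1))"
    using calculation by (simp_all add: hlg_def)
  ultimately obtain w where "w \<in> carrier (sMor B ?X ?X (- 2))" "mu B ?X ?X ?X ?j ?j = ?j \<oplus>\<^bsub>sMor B ?X ?X (- 1)\<^esub> b1 B ?X ?X (- 2) w"
    using hlg_iff[OF AB(2) functor_ob[OF F X] functor_ob[OF F X]] by blast
  then have "idem B ?X ?j w"
    using functor_cyc[OF X X unit_cyc[OF i]] functor_ob[OF F X] unfolding idem_def[OF AB(2)] by (simp add: cyc_def)
  then show thesis by (rule that)
qed

end

text \<open>Unitality without chosen units; in this form it is stable under composition at
  sight.\<close>

definition preserves_units where
  "preserves_units R A B F \<longleftrightarrow>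
     (\<forall>X \<in> Obj A. \<forall>i. is_unit_elt R A X i \<longrightarrow> is_unit_elt R B (fob F X) (fmp F X [(X, - 1, i)]))"

lemma hiso_functor:
  assumes F: "ainf_functor R A B F" and u: "preserves_units R A B F" and h: "hiso R A X Y"
  shows "hiso R B (fob F X) (fob F Y)"
proof -
  have o: "X \<in> Obj A" "Y \<in> Obj A" using h by (simp_all add: hiso_def)
  show ?thesis
    by (rule hiso_map[where ob = "fob F" and m = "\<lambda>U V x. fmp F U [(V, - 1, x)]", OF AB(2)[OF F] h])
      (use o u in \<open>auto simp: preserves_units_def functor_ob[OF F] intro: functor_cyc[OF F] functor_hlg[OF F] functor_mu[OF F]\<close>)
qed

text \<open>The chosen units may be replaced by arbitrary ones: a functor maps homologous elements
  to homologous ones, units of an object are homologous, and whatever is homologous to a unit is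
  one.\<close>

lemma unital_functor_iff:
  "unital_functor R A B f \<longleftrightarrow>
    unital_category R A \<and> unital_category R B \<and> ainf_functor R A B f \<and> preserves_units R A B f"
proof (cases "unital_category R A \<and> unital_category R B \<and> ainf_functor R A B f")
  case True
  then have U: "unital_category R A" "unital_category R B" and f: "ainf_functor R A B f" by simp_all
  note c = AB[OF f]
  have "(\<exists>z \<in> carrier (sMor B (fob f X) (fob f X) (- 2)). fmp f X [(X, - 1, unit_elt R A X)]
      \<ominus>\<^bsub>sMor B (fob f X) (fob f X) (- 1)\<^esub> unit_elt R B (fob f X) = b1 B (fob f X) (fob f X) (- 2) z) \<longleftrightarrow>
    (\<forall>i. is_unit_elt R A X i \<longrightarrow> is_unit_elt R B (fob f X) (fmp f X [(X, - 1, i)]))" (is "?l \<longleftrightarrow> ?r") if X: "X \<in> Obj A" for X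
  proof -
    let ?Y = "fob f X" and ?F = "\<lambda>i. fmp f X [(X, - 1, i)]" and ?u = "unit_elt R A X" and ?v = "unit_elt R B (fob f X)"
    let ?M = "sMor B ?Y ?Y (- 1)"
    note Y = functor_ob[OF f X]
    note uu = unit_elt_unit[OF U(1) X] and vu = unit_elt_unit[OF U(2) Y]
    have fc: "?F ?u \<in> carrier ?M" and vc: "?v \<in> carrier ?M"
      using functor1_closed[OF f X X] uu vu by (simp_all add: is_unit_elt_def)
    note M = sMor_module[OF c(2) Y Y]
    have "?l \<longleftrightarrow> hlg R B ?Y ?Y (?F ?u) ?v"
    proof -
      have "?F ?u \<ominus>\<^bsub>?M\<^esub> ?v = b1 B ?Y ?Y (- 2) z \<longleftrightarrow> emb R ?M (?F ?u) = emb R ?M ?v + emb R ?M (b1 B ?Y ?Y (- 2) z)"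
        if "z \<in> carrier (sMor B ?Y ?Y (- 2))" for z
        using emb_inject[OF M abelian_group.minus_closed[OF ab_of_module[OF M] fc vc], of "b1 B ?Y ?Y (- 2) z"]
          b1_closed[OF c(2) Y Y that] emb_diff[OF M fc vc] by (auto simp: algebra_simps)
      then show ?thesis unfolding hlg_def using fc vc by blast
    qed
    also have "\<dots> \<longleftrightarrow> ?r"
    proof
      assume h: "hlg R B ?Y ?Y (?F ?u) ?v"
      show ?r
      proof (intro allI impI)
        fix i assume "is_unit_elt R A X i"
        from unit_elt_shift[OF c(2) Y vu hlg_trans[OF c(2) Y Y functor_hlg[OF f X X unit_elt_hlg[OF c(1) X this uu]] h]]
        show "is_unit_elt R B ?Y (?F i)" .
      qed
    next
      assume ?r then show "hlg R B ?Y ?Y (?F ?u) ?v" using uu unit_elt_hlg[OF c(2) Y _ vu] by blast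
    qed
    finally show ?thesis .
  qed
  then show ?thesis using True by (simp add: unital_functor_def preserves_units_def)
qed (auto simp: unital_functor_def)

lemma unital_comp:
  assumes "unital_functor R A B f" "unital_functor R B C g"
  shows "unital_functor R A C (comp_fun A C f g)"
proof -
  have f: "ainf_functor R A B f" "preserves_units R A B f" and g: "ainf_functor R B C g" "preserves_units R B C g"
    using assms by (simp_all add: unital_functor_iff)
  note c = AB[OF f(1)] AB(2)[OF g(1)] and h = comp_functor[OF f(1) g(1)]
  \<comment> \<open>A word of length one has a single decomposition, so the first component of the
    composite is the composite of the first components.\<close>
  have "fmp (comp_fun A C f g) X [(X, - 1, i)] = fmp g (fob f X) [(fob f X, - 1, fmp f X [(X, - 1, i)])]"
    if X: "X \<in> Obj A" and i: "i \<in> carrier (sMor A X X (- 1))" for X i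
  proof -
    note ob = comp_ob[OF c(1) g(1) X] and Y = functor_ob[OF f(1) X]
    have "emb R (sMor C (fob g (fob f X)) (fob g (fob f X)) (- 1)) (fmp (comp_fun A C f g) X [(X, - 1, i)]) =
      emb R (sMor C (fob g (fob f X)) (fob g (fob f X)) (- 1)) (fmp g (fob f X) [(fob f X, - 1, fmp f X [(X, - 1, i)])])"
      using fv_comp[OF f(1) g(1), of X "[(X, - 1, i)]"] th_rec[of f "[]" X "fv R C g (fob f X)" "[(X, - 1, i)]"] X i
      by (simp add: fv_eq ob fletter_def)
    then show ?thesis
      using functor1_closed[OF h X X i] functor1_closed[OF g(1) Y Y functor1_closed[OF f(1) X X i]]
        functor_ob[OF g(1) Y] unfolding ob by (intro em_eqI[OF c(3)])
  qed
  then have "preserves_units R A C (comp_fun A C f g)"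
    using f(2) g(2) functor_ob[OF f(1)] by (simp add: preserves_units_def comp_ob[OF c(1) g(1)] is_unit_elt_def[of R A])
  then show ?thesis using assms h by (simp add: unital_functor_iff)
qed

lemma unital_id:
  assumes "unital_category R A"
  shows "unital_functor R A A (id_fun A)"
  using assms id_functor[of R A]
  by (auto simp: unital_functor_iff unital_category_def preserves_units_def id_fun_def is_unit_elt_def)

section \<open>Full subcategories\<close>

lemma full_sub_simps [simp]:
  "Obj (full_sub C S) = S" "sMor (full_sub C S) = sMor C" "bop (full_sub C S) = bop C" "b1 (full_sub C S) = b1 C"
  by (auto simp: full_sub_def sMor_def b1_def fun_eq_iff)

lemma full_sub_word: "S \<subseteq> Obj C \<Longrightarrow> is_word (full_sub C S) X w \<Longrightarrow> is_word C X w"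
  by (induction C X w rule: is_word.induct) auto

lemma full_sub_ainf:
  assumes C: "ainf_category R C" and S: "S \<subseteq> Obj C"
  shows "ainf_category R (full_sub C S)"
proof -
  note w = full_sub_word[OF S]
  have "tensor_map R (full_sub C S) (sMor C) n 1 (bop C)" if "1 \<le> n" for n
  proof -
    have "tensor_map R C (sMor C) n 1 (bop C)" using C that by (simp add: ainf_category_def)
    then show ?thesis unfolding tensor_map_def full_sub_simps using w by blast
  qed
  moreover have "b_then M (full_sub C S) \<phi> = b_then M C \<phi>" for M :: "('a, 'c) module" and \<phi>
    by (simp add: b_then_def b_insert_def fun_eq_iff)
  moreover have "Mor (full_sub C S) = Mor C" by (simp add: full_sub_def)
  ultimately show ?thesis using C w subsetD[OF S] unfolding ainf_category_def by auto
qed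

context
  fixes R :: "'k ring" and C :: "('k, 'o, 'm) ainf_cat" and S
  assumes C: "unital_category R C" and S: "S \<subseteq> Obj C"
begin

text \<open>A unit of the subcategory is tested against fewer objects. It is nevertheless homologous
  to a unit of \<open>C\<close>, which is also one of the subcategory, and so is itself a unit of
  \<open>C\<close>.\<close>

lemma full_sub_unit:
  assumes X: "X \<in> S"
  shows "is_unit_elt R (full_sub C S) X i \<longleftrightarrow> is_unit_elt R C X i"
proof -
  have c: "ainf_category R C" using C by (simp add: unital_category_def)
  have XC: "X \<in> Obj C" using X S by blast
  have *: "is_unit_elt R (full_sub C S) X j" if "is_unit_elt R C X j" for j
    using that S by (auto simp: is_unit_elt_def homotopic_to_id_def null_homotopic_def)
  note u = unit_elt_unit[OF C XC]
  have "is_unit_elt R C X i" if "is_unit_elt R (full_sub C S) X i"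
    using unit_elt_hlg[OF full_sub_ainf[OF c S] _ that *[OF u]] X unit_elt_shift[OF c XC u] by (simp add: hlg_def)
  then show ?thesis using * by blast
qed

lemma full_sub_unital: "unital_category R (full_sub C S)"
  using full_sub_ainf[OF _ S] full_sub_unit unit_elt_unit[OF C] C S unfolding unital_category_def full_sub_simps by blast

text \<open>Cycles, boundaries and products between the two objects are the same in the full
  subcategory, and so are the units by \<open>full_sub_unit\<close>.\<close>

lemma full_sub_hiso:
  assumes "X \<in> S" "Y \<in> S"
  shows "hiso R (full_sub C S) X Y \<longleftrightarrow> hiso R C X Y"
  unfolding hiso_def linv_def using assms S by (auto simp: full_sub_unit cyc_def hlg_def)

end

section \<open>Evaluation and postcomposition\<close>

context transf
begin

lemma ev_b1:
  assumes f: "fctr f" and g: "fctr g" and r: "r \<in> carrier (T f g d)" and X: "X \<in> Obj A"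
  shows "emb R (sMor B (fob f X) (fob g X) (d + 1)) (b1 W f g d r X []) =
    emb R (sMor B (fob f X) (fob g X) (d + 1)) (b1 B (fob f X) (fob g X) d (r X []))"
  using rv_b1[OF f g r, of X "[]"] th_fil[OF f r, of 0 "[]" X "[]", OF _ _ _ _ lin_bv[OF B]] X g
  by (simp add: fil_def bv_eq rv_eq rletter_def b1_def)

lemma ev_closed: "fctr f \<Longrightarrow> fctr g \<Longrightarrow> r \<in> carrier (T f g d) \<Longrightarrow> X \<in> Obj A \<Longrightarrow> r X [] \<in> carrier (sMor B (fob f X) (fob g X) d)"
  using trans_closed[of R A B f g r d X "[]"] by simp

text \<open>On the empty word both transformations receive empty pieces and no functor letters
  occur, so the product at \<open>X\<close> is the product of the components, with no
  correction.\<close>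

lemma ev_mu:
  assumes f: "fctr f" and h: "fctr h" and g: "fctr g" and q: "q \<in> carrier (T f h (- 1))" and r: "r \<in> carrier (T h g (- 1))"
    and X: "X \<in> Obj A"
  shows "mu W f h g q r X [] = mu B (fob f X) (fob h X) (fob g X) (q X []) (r X [])"
proof -
  have fW: "f \<in> Obj W" "h \<in> Obj W" "g \<in> Obj W" and X0: "is_word A X []" and w: "is_word W h [(g, - 1, r)]" "is_word W g []"
    using f h g X r by simp_all
  note o = functor_ob[OF f X] functor_ob[OF h X] functor_ob[OF g X]
  have "lin R B (fob h X) (\<lambda>z. bv R B (fob f X) (rletter h (- 1) q X [] # z))" using lin_rletter[OF f h q X0 lin_bv[OF B]] by simp
  from th_fil[OF h r _ w(2) X0 _ this, of 0] th_fil[OF f q _ w(1) X0 _ lin_bv[OF B], of 0]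
  have "rv R B f g (- 1) (mu W f h g q r) X [] = bv R B (fob f X) [rletter h (- 1) q X [], rletter g (- 1) r X []]"
    using rv_b2[OF f h g q r X0] by (simp add: fil_def)
  then show ?thesis
    using ev_closed[OF f g _ X, of "mu W f h g q r" "- 1"] mu_closed[OF W fW, of q r] q r
      mu_closed[OF B o ev_closed[OF f h q X] ev_closed[OF h g r X]]
    by (intro em_eqI[OF B o(1,3)]) (simp_all add: rv_eq bv_eq rletter_def)
qed

lemma ev_hlg:
  assumes f: "fctr f" and g: "fctr g" and h: "hlg R W f g r q" and X: "X \<in> Obj A"
  shows "hlg R B (fob f X) (fob g X) (r X []) (q X [])"
proof -
  have fW: "f \<in> Obj W" "g \<in> Obj W" and X0: "is_word A X []" using f g X by simp_all
  obtain z where z: "z \<in> carrier (T f g (- 2))" "r = q \<oplus>\<^bsub>T f g (- 1)\<^esub> b1 W f g (- 2) z"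
    and c: "r \<in> carrier (T f g (- 1))" "q \<in> carrier (T f g (- 1))"
    using h hlg_iff[OF W fW, of r q] by (auto simp: hlg_def)
  have bz: "b1 W f g (- 2) z \<in> carrier (T f g (- 1))" using b1_closed[OF W fW, of z "- 2"] z by simp
  have "rv R B f g (- 1) r X [] = rv R B f g (- 1) q X [] + rv R B f g (- 1) (b1 W f g (- 2) z) X []"
    unfolding z(2) by (rule rv_add[OF f g c(2) bz X0])
  then show ?thesis
    unfolding hlg_def using ev_closed[OF f g _ X] c z ev_b1[OF f g z(1) X]
    by (auto simp: rv_eq intro!: bexI[of _ "z X []"])
qed

text \<open>The unit supplied by \<open>unit_lift\<close> has units of \<open>B\<close> as its
  components. Any other unit of \<open>f\<close> is homologous to it, and this persists at each
  object.\<close>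

lemma ev_unit:
  assumes U: "unital_category R B" and f: "fctr f" and i: "is_unit_elt R W f i" and X: "X \<in> Obj A"
  shows "is_unit_elt R B (fob f X) (i X [])"
proof -
  note u = unit_elt_unit[OF U functor_ob[OF f]]
  obtain j where j: "is_unit_elt R W f j" "\<And>X. X \<in> Obj A \<Longrightarrow> j X [] = unit_elt R B (fob f X)"
    using unit_lift[OF f u] by blast
  have fW: "f \<in> Obj W" using f by simp
  have "hlg R B (fob f X) (fob f X) (i X []) (unit_elt R B (fob f X))"
    using ev_hlg[OF f f unit_elt_hlg[OF W fW i j(1)] X] j(2)[OF X] by simp
  then show ?thesis by (rule unit_elt_shift[OF B functor_ob[OF f X] u[OF X]])
qed

lemma hiso_eval:
  assumes U: "unital_category R B" and h: "hiso R W f g" and X: "X \<in> Obj A"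
  shows "hiso R B (fob f X) (fob g X)"
proof -
  have f: "fctr f" and g: "fctr g" using h by (simp_all add: hiso_def)
  have "cyc B (fob f X) (fob g X) (r X [])" if f: "fctr f" and g: "fctr g" and r: "cyc W f g r" for f g r
  proof -
    have rc: "r \<in> carrier (T f g (- 1))" and r0: "b1 W f g (- 1) r = \<zero>\<^bsub>T f g 0\<^esub>" using r by (simp_all add: cyc_def)
    show ?thesis
      unfolding cyc_iff[OF B functor_ob[OF f X] functor_ob[OF g X]]
      using ev_b1[OF f g rc X] ev_closed[OF f g rc X] rv_zero[OF f g, of X "[]" 0] X r0 by (simp add: rv_eq)
  qed
  note c = this
  have m: "hlg R B (fob f X) (fob f X) (mu B (fob f X) (fob g X) (fob f X) (r X []) (q X [])) (mu W f g f r q X [])"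
    if f: "fctr f" and g: "fctr g" and r: "cyc W f g r" and q: "cyc W g f q" for f g r q
  proof -
    have rq: "r \<in> carrier (T f g (- 1))" "q \<in> carrier (T g f (- 1))" using r q by (simp_all add: cyc_def)
    note o = functor_ob[OF f X] functor_ob[OF g X]
    show ?thesis
      unfolding ev_mu[OF f g f rq X]
      by (rule hlg_refl[OF B o(1,1) mu_closed[OF B o o(1) ev_closed[OF f g rq(1) X] ev_closed[OF g f rq(2) X]]])
  qed
  show ?thesis
    by (rule hiso_map[where ob = "\<lambda>f. fob f X" and m = "\<lambda>f g r. r X []", OF B h])
      (use f g X in \<open>auto simp: functor_ob intro: c m ev_hlg ev_unit[OF U]\<close>)
qed

end

text \<open>The point is that postcomposition preserves units. The image of a unit \<open>i\<close>
  is idempotent by \<open>functor_idem\<close>, its component at \<open>X\<close> is the image under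
  the first component of \<open>\<psi>\<close> of a unit of \<open>B\<close>, hence a unit of
  \<open>C\<close>, and \<open>unit_criterion\<close> concludes.\<close>

lemma hiso_post:
  assumes A: "ainf_category R A" and psi: "unital_functor R B C \<psi>" and h: "hiso R (fun_cat R A B) f g"
  shows "hiso R (fun_cat R A C) (comp_fun A C f \<psi>) (comp_fun A C g \<psi>)"
proof -
  have p: "ainf_functor R B C \<psi>" "preserves_units R B C \<psi>" and U: "unital_category R B" "unital_category R C"
    using psi by (simp_all add: unital_functor_iff)
  note c = AB[OF p(1)]
  interpret B: transf R A B by (rule transf.intro[OF A c(1)])
  interpret C: transf R A C by (rule transf.intro[OF A c(2)])
  let ?P = "post_fun R A B C \<psi>"
  note P = post_functor[OF A p(1)]
  have ob: "fob ?P f = comp_fun A C f \<psi>" if "ainf_functor R A B f" for f using that by (simp add: post_fun_def)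
  have "preserves_units R B.W C.W ?P"
    unfolding preserves_units_def
  proof (intro ballI allI impI)
    fix f i assume fW: "f \<in> Obj B.W" and i: "is_unit_elt R B.W f i"
    have f: "ainf_functor R A B f" using fW by simp
    have ic: "i \<in> carrier (B.T f f (- 1))" using i by (simp add: is_unit_elt_def)
    let ?j = "fmp ?P f [(f, - 1, i)]"
    obtain w where w: "idem C.W (fob ?P f) ?j w" by (rule functor_idem[OF P fW i])
    show "is_unit_elt R C.W (fob ?P f) ?j"
    proof (rule C.unit_criterion[OF w])
      fix X assume X: "X \<in> Obj A"
      have rs: "is_word B.W f [(f, - 1, i)]" and X0: "is_word A X []" and f0: "is_word B.W f []" using f ic X by simp_all
      note Y = functor_ob[OF f X]
      have cf: "ainf_functor R A C (comp_fun A C f \<psi>)" by (rule comp_functor[OF f p(1)])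
      have jc: "?j \<in> carrier (C.T (comp_fun A C f \<psi>) (comp_fun A C f \<psi>) (- 1))"
        using functor1_closed[OF P fW fW, of i "- 1"] ic f by (simp add: ob)
      have obX: "fob (comp_fun A C f \<psi>) X = fob \<psi> (fob f X)" by (rule comp_ob[OF A p(1) X])
      have "rv R C (comp_fun A C f \<psi>) (comp_fun A C f \<psi>) (- 1) ?j X [] = fv R C \<psi> (fob f X) [rletter f (- 1) i X []]"
        using rv_post[OF A p(1) rs _ X0] B.th_fil[OF f ic _ f0 X0 _ lin_fv[OF p(1)], of 0] by (simp add: B.fil_def)
      then have "?j X [] = fmp \<psi> (fob f X) [(fob f X, - 1, i X [])]"
        using C.ev_closed[OF cf cf jc X] functor1_closed[OF p(1) Y Y B.ev_closed[OF f f ic X]] functor_ob[OF p(1) Y]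
        by (intro em_eqI[OF c(2)]) (simp_all add: rv_eq fv_eq rletter_def obX)
      then show "is_unit_elt R C (fob (fob ?P f) X) (?j X [])"
        using p(2) B.ev_unit[OF U(1) f i X] Y by (simp add: ob[OF f] obX preserves_units_def)
    qed
  qed
  moreover have "ainf_functor R A B f" "ainf_functor R A B g" using h by (simp_all add: hiso_def)
  ultimately show ?thesis using hiso_functor[OF P _ h] by (simp add: ob)
qed

section \<open>Isomorphic functors and equivalences\<close>

lemma unital_ufun_cat:
  assumes A: "ainf_category R A" and U: "unital_category R B"
  shows "unital_category R (fun_cat R A B)" "unital_category R (ufun_cat R A B)"
proof -
  interpret transf R A B using A U by (intro transf.intro) (simp_all add: unital_category_def)
  show "unital_category R (fun_cat R A B)" by (rule fun_cat_unital[OF U])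
  then show "unital_category R (ufun_cat R A B)"
    unfolding ufun_cat_def by (rule full_sub_unital) (auto simp: unital_functor_iff)
qed

lemma isomorphic_functors_iff:
  assumes A: "ainf_category R A" and B: "unital_category R B"
  shows "isomorphic_functors R A B f g \<longleftrightarrow>
    unital_functor R A B f \<and> unital_functor R A B g \<and> hiso R (fun_cat R A B) f g"
proof -
  have S: "{f. unital_functor R A B f} \<subseteq> Obj (fun_cat R A B)" by (auto simp: unital_functor_iff)
  have "isomorphic_functors R A B f g \<longleftrightarrow> hiso R (ufun_cat R A B) f g"
    unfolding isomorphic_functors_def by (rule h0_isomorphic_iff[OF unital_ufun_cat(2)[OF A B]])
  also have "\<dots> \<longleftrightarrow> unital_functor R A B f \<and> unital_functor R A B g \<and> hiso R (fun_cat R A B) f g"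
    unfolding ufun_cat_def
    using full_sub_hiso[OF unital_ufun_cat(1)[OF A B] S, of f g] hiso_def[of R "full_sub (fun_cat R A B) {f. unital_functor R A B f}" f g]
    by auto
  finally show ?thesis .
qed

lemma isomorphic_eval:
  assumes "isomorphic_functors R A B f g" "unital_category R A" "unital_category R B" "X \<in> Obj A"
  shows "hiso R B (fob f X) (fob g X)"
  using assms transf.hiso_eval[OF transf.intro, of R A B f g X]
  by (simp add: isomorphic_functors_iff unital_category_def)

text \<open>An isomorphism between the composite \<open>GF\<close> and the identity functor is
  evaluated at \<open>Y\<close>; the preimage is \<open>G\<close> applied to
  \<open>Y\<close>.\<close>

lemma equivalence_surjective:
  assumes e: "ainf_equivalence R U V F" and Y: "Y \<in> Obj V"
  obtains X where "X \<in> Obj U" "hiso R V (fob F X) Y"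
proof -
  obtain G where G: "unital_functor R V U G" and i: "isomorphic_functors R V V (comp_fun V V G F) (id_fun V)"
    and F: "unital_functor R U V F"
    using e by (auto simp: ainf_equivalence_def)
  have V: "unital_category R V" and g: "ainf_functor R V U G" and f: "ainf_functor R U V F"
    using G F by (simp_all add: unital_functor_iff)
  have "hiso R V (fob F (fob G Y)) Y"
    using isomorphic_eval[OF i V V Y] comp_ob[OF AB(1)[OF g] f Y] Y by (simp add: id_fun_def)
  then show thesis using that functor_ob[OF g Y] by blast
qed

text \<open>With a quasi-inverse \<open>G\<close> of \<open>F\<close>, the object \<open>X\<close>
  is isomorphic to its image under \<open>F\<close> and then \<open>G\<close>, likewise for
  \<open>Y\<close>, and the unital functor \<open>G\<close> carries the given isomorphism between
  the images.\<close>

lemma equivalence_reflects: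
  assumes e: "ainf_equivalence R U V F" and X: "X \<in> Obj U" and Y: "Y \<in> Obj U" and h: "hiso R V (fob F X) (fob F Y)"
  shows "hiso R U X Y"
proof -
  obtain G where G: "unital_functor R V U G" and i: "isomorphic_functors R U U (comp_fun U U F G) (id_fun U)"
    and F: "unital_functor R U V F"
    using e by (auto simp: ainf_equivalence_def)
  have U: "unital_category R U" and g: "ainf_functor R V U G" "preserves_units R V U G" and f: "ainf_functor R U V F"
    using G F by (simp_all add: unital_functor_iff)
  have *: "hiso R U (fob G (fob F Z)) Z" if Z: "Z \<in> Obj U" for Z
    using isomorphic_eval[OF i U U Z] comp_ob[OF AB(1)[OF f] g(1) Z] Z by (simp add: id_fun_def)
  note t = hiso_trans[OF AB(1)[OF f]]
  show ?thesis by (rule t[OF t[OF hiso_sym[OF *[OF X]] hiso_functor[OF g h]] *[OF Y]])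
qed

text \<open>The conditions of unitality and contractibility select full subcategories, so
  isomorphism can be decided among all functors, where \<open>hiso_post\<close> lives.\<close>

lemma ufun_cat_mod_hiso_iff:
  assumes C: "unital_category R C" and A: "unital_category R A"
    and o: "f \<in> Obj (ufun_cat_mod R C S A)" "g \<in> Obj (ufun_cat_mod R C S A)"
  shows "hiso R (ufun_cat_mod R C S A) f g \<longleftrightarrow> hiso R (fun_cat R C A) f g"
proof -
  have c: "ainf_category R C" using C by (simp add: unital_category_def)
  note U = unital_ufun_cat[OF c A]
  have "f \<in> {f. unital_functor R C A f}" "g \<in> {f. unital_functor R C A f}" using o by (simp_all add: ufun_cat_mod_def)
  moreover have "{f. unital_functor R C A f} \<subseteq> Obj (fun_cat R C A)" by (auto simp: unital_functor_iff)
  ultimately have "hiso R (ufun_cat R C A) f g \<longleftrightarrow> hiso R (fun_cat R C A) f g"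
    unfolding ufun_cat_def by (intro full_sub_hiso[OF U(1)])
  then show ?thesis
    using o full_sub_hiso[OF U(2), of "{f. unital_functor R C A f \<and> contractible_fun R (full_sub C S) A (restrict_fun C S A f)}" f g]
    by (auto simp: ufun_cat_mod_def ufun_cat_def)
qed

lemma ufun_cat_mod_hiso:
  assumes "unital_category R C" "unital_category R A" "hiso R (ufun_cat_mod R C S A) f g"
  shows "hiso R (fun_cat R C A) f g"
  using assms(3) ufun_cat_mod_hiso_iff[OF assms(1,2), of f S g] by (simp add: hiso_def[of R "ufun_cat_mod R C S A"])

text \<open>The functor \<open>e'\<close> is itself an object of the target of the equivalence: its
  restriction to the subcategory is contractible because it belongs to a quotient. The roles of the
  two quotients can be exchanged.\<close>

lemma quotient_factor:
  assumes C: "unital_category R C" and q: "is_quotient R C S D e" and q': "is_quotient R C S D' e'"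
  obtains \<phi> where "unital_functor R D D' \<phi>" "hiso R (fun_cat R C D') (comp_fun C D' e \<phi>) e'"
proof -
  let ?V = "ufun_cat_mod R C S D'" and ?F = "precomp_fun R C D D' e"
  have D': "unital_category R D'" and e: "ainf_equivalence R (ufun_cat R D D') ?V ?F"
    using q q' by (simp_all add: is_quotient_def)
  have "e' \<in> Obj ?V" using q' by (simp add: is_quotient_def ufun_cat_mod_def)
  then obtain \<phi> where p: "\<phi> \<in> Obj (ufun_cat R D D')" and h: "hiso R ?V (fob ?F \<phi>) e'"
    by (rule equivalence_surjective[OF e])
  have "hiso R (fun_cat R C D') (fob ?F \<phi>) e'" using h by (rule ufun_cat_mod_hiso[OF C D'])
  then show thesis using that[of \<phi>] p by (simp add: precomp_fun_def ufun_cat_def)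
qed

lemma quotient_endo:
  assumes C: "unital_category R C" and q: "is_quotient R C S D e"
    and chi: "unital_functor R D D \<chi>" and h: "hiso R (fun_cat R C D) (comp_fun C D e \<chi>) e"
  shows "isomorphic_functors R D D \<chi> (id_fun D)"
proof -
  let ?V = "ufun_cat_mod R C S D" and ?U = "ufun_cat R D D" and ?F = "precomp_fun R C D D e"
  have D: "unital_category R D" and eq: "ainf_equivalence R ?U ?V ?F" and e: "ainf_functor R C D e"
    using q by (simp_all add: is_quotient_def unital_functor_iff)
  have o: "\<chi> \<in> Obj ?U" "id_fun D \<in> Obj ?U" using chi unital_id[OF D] by (simp_all add: ufun_cat_def)
  have F: "ainf_functor R ?U ?V ?F" using eq by (simp add: ainf_equivalence_def unital_functor_iff)
  \<comment> \<open>Both sides of the assumed isomorphism are recognised as values of precomposition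
    with \<open>e\<close>, the right one at the identity functor.\<close>
  have "fob ?F \<chi> = comp_fun C D e \<chi>" "fob ?F (id_fun D) = e" using o by (simp_all add: precomp_fun_def comp_id[OF e])
  then have "hiso R ?V (fob ?F \<chi>) (fob ?F (id_fun D))"
    using h ufun_cat_mod_hiso_iff[OF C D functor_ob[OF F o(1)] functor_ob[OF F o(2)]] by simp
  from equivalence_reflects[OF eq o this] have "hiso R ?U \<chi> (id_fun D)" .
  then show ?thesis
    unfolding isomorphic_functors_def h0_isomorphic_iff[OF unital_ufun_cat(2)[OF AB(2)[OF e] D]] .
qed

theorem corollary1p6:
  fixes R :: "'k ring"
    and C D D' :: "('k, 'o, 'm) ainf_cat"
    and S :: "'o set"
    and e e' :: "('o, 'm, 'o, 'm) ainf_fun"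
  assumes "cring R"
    and "unital_category R C"
    and "S \<subseteq> Obj C"
    and "is_quotient R C S D e"
    and "is_quotient R C S D' e'"
  shows "\<exists>\<phi>. ainf_equivalence R D D' \<phi> \<and>
             isomorphic_functors R C D' (comp_fun C D' e \<phi>) e'"
proof -
  note C = assms(2) and q = assms(4) and q' = assms(5)
  obtain \<phi> where phi: "unital_functor R D D' \<phi>" "hiso R (fun_cat R C D') (comp_fun C D' e \<phi>) e'"
    by (rule quotient_factor[OF C q q'])
  obtain \<psi> where psi: "unital_functor R D' D \<psi>" "hiso R (fun_cat R C D) (comp_fun C D e' \<psi>) e"
    by (rule quotient_factor[OF C q' q])
  have e: "unital_functor R C D e" and e': "unital_functor R C D' e'" using q q' by (simp_all add: is_quotient_def)
  note f = e[unfolded unital_functor_iff] e'[unfolded unital_functor_iff] phi(1)[unfolded unital_functor_iff] psi(1)[unfolded unital_functor_iff]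
  have fe: "ainf_functor R C D e" "ainf_functor R C D' e'" "ainf_functor R D D' \<phi>" "ainf_functor R D' D \<psi>"
    and U: "unital_category R D'" using f by simp_all
  note cats = AB(1)[OF fe(1)] AB(2)[OF fe(1)] AB(2)[OF fe(2)]
  have W: "ainf_category R (fun_cat R C D)" "ainf_category R (fun_cat R C D')"
    using fun_cat_ainf cats by blast+
  have "hiso R (fun_cat R C D) (comp_fun C D e (comp_fun D D \<phi> \<psi>)) e"
    unfolding comp_assoc[OF fe(1,3,4)]
    by (rule hiso_trans[OF W(1) hiso_post[OF cats(1) psi(1) phi(2)] psi(2)])
  then have 1: "isomorphic_functors R D D (comp_fun D D \<phi> \<psi>) (id_fun D)"
    by (rule quotient_endo[OF C q unital_comp[OF phi(1) psi(1)]])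
  have "hiso R (fun_cat R C D') (comp_fun C D' e' (comp_fun D' D' \<psi> \<phi>)) e'"
    unfolding comp_assoc[OF fe(2,4,3)]
    by (rule hiso_trans[OF W(2) hiso_post[OF cats(1) phi(1) psi(2)] phi(2)])
  then have 2: "isomorphic_functors R D' D' (comp_fun D' D' \<psi> \<phi>) (id_fun D')"
    by (rule quotient_endo[OF C q' unital_comp[OF psi(1) phi(1)]])
  have "ainf_equivalence R D D' \<phi>" unfolding ainf_equivalence_def using phi(1) psi(1) 1 2 by blast
  moreover have "isomorphic_functors R C D' (comp_fun C D' e \<phi>) e'"
    unfolding isomorphic_functors_iff[OF cats(1) U] using phi(2) e' unital_comp[OF e phi(1)] by blast
  ultimately show ?thesis by blast
qed

end
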